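(* Let $m>0$, $p>1$, $\lambda:=m(p-1)$, and let $u$ be a nonnegative, locally bounded, local weak solution in $\Omega_T$ (as defined in the context) to $u_t-\operatorname{div}\mathbf{A}(x,t,u,Du)=0$ with $\mathbf A$ satisfying the structure conditions in the context. Assume that $\lambda>1$ and $p<2$. Then there exists a constant $\gamma>0$, depending only on $N,m,p,K_1,K_2$, such that for every cylinder $Q_{2r,t-s}(y,t)=B_{2r}(y)\times(s,t)\subset\Omega_T$ and every number $\mu^+$ with $u\le\mu^+$ in $Q_{2r,t-s}(y,t)$, $$\sup_{s\le\tau\le t}\ \frac{1}{|B_r(y)|}\int_{B_r(y)}(\mu^+-u(x,\tau))\,dx\le\gamma\inf_{s\le\tau\le t}\ \frac{1}{|B_{2r}(y)|}\int_{B_{2r}(y)}(\mu^+-u(x,\tau))\,dx+\gamma\,[\mu^+]^{\frac{(m-1)(p-1)}{2-p}}\Big(\frac{t-s}{r^p}\Big)^{\frac1{2-p}}.$$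
   Context: Let $\Omega$ be a domain in $\mathbb{R}^N$, $T>0$, $\Omega_T:=\Omega\times(0,T)$. Let $m>0$, $p>1$, $m^-:=\min(1,m)$. Notation: $B_r(x_0):=\{x\in\mathbb{R}^N:|x-x_0|<r\}$ and $Q_{r,\eta}(x_0,t_0):=B_r(x_0)\times(t_0-\eta,t_0)$. The function $\mathbf{A}=(A_1,\dots,A_N):\Omega_T\times\mathbb{R}_+\times\mathbb{R}^N\to\mathbb{R}^N$ is Carathéodory, i.e. $\mathbf{A}(\cdot,\cdot,u,\xi)$ is Lebesgue measurable for all $u\in\mathbb{R}_+$, $\xi\in\mathbb{R}^N$, and $\mathbf{A}(x,t,\cdot,\cdot)$ is continuous for almost all $(x,t)\in\Omega_T$. The structure conditions are $$\mathbf{A}(x,t,u,Du)\cdot Du^{m^-}\ge K_1\,u^{(m-m^-)(p-1)}|Du^{m^-}|^p,\qquad |\mathbf{A}(x,t,u,Du)|\le K_2\,u^{(m-m^-)(p-1)}|Du^{m^-}|^{p-1},$$ with positive constants $K_1,K_2$. A function $u$ is a nonnegative, locally bounded, local weak subsolution (supersolution) to $u_t-\operatorname{div}\mathbf{A}(x,t,u,Du)=0$ in $\Omega_T$ if $0\le u\in C_{\rm loc}(0,T;L^{1+m^-}_{\rm loc}(\Omega))$, $u^{m^-}\in L^p_{\rm loc}(0,T;W^{1,p}_{\rm loc}(\Omega))$, $u\in L^\infty_{\rm loc}(\Omega_T)$, and for every compact $E\subset\Omega$ and every $[t_1,t_2]\subset(0,T]$ $$\int_E u\zeta\,dx\Big|_{t_1}^{t_2}+\int_{t_1}^{t_2}\int_E\{-u\zeta_\tau+\mathbf{A}(x,\tau,u,Du)\cdot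 D\zeta\}\,dx\,d\tau\le(\ge)\,0$$ for all $\zeta\ge0$ with $\zeta\in W^{1,1+\frac1{m^-}}(0,T;L^{1+\frac1{m^-}}(E))\cap L^p(0,T;W^{1,p}_0(E))$. A solution is a function that is both a subsolution and a supersolution. *)

theory Defs
  imports "HOL-Analysis.Analysis"
begin

text \<open>
  Points of space-time are pairs \<open>(x, t)\<close>. A function on space-time is a total function on
  pairs; its values outside the set under consideration are irrelevant.
\<close>

definition cylinder :: "'a set \<Rightarrow> real \<Rightarrow> ('a \<times> real) set" where
  "cylinder \<Omega> T = \<Omega> \<times> {0<..<T}"

definition domain :: "'a::euclidean_space set \<Rightarrow> bool" where
  "domain \<Omega> \<longleftrightarrow> open \<Omega> \<and> connected \<Omega> \<and> \<Omega> \<noteq> {}"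

definition average :: "'a::euclidean_space set \<Rightarrow> ('a \<Rightarrow> real) \<Rightarrow> real" where
  "average B f = (LINT x:B|lebesgue. f x) / measure lebesgue B"

text \<open>Real powers with \<open>v\<^sup>0 = 1\<close> also for \<open>v = 0\<close>; in the library, \<open>0 powr 0 = 0\<close>.\<close>

definition rpow :: "real \<Rightarrow> real \<Rightarrow> real" where
  "rpow v a = (if a = 0 then 1 else v powr a)"


section \<open>Lebesgue and Sobolev spaces\<close>

definition Lp_on :: "real \<Rightarrow> 'a::euclidean_space set \<Rightarrow> ('a \<Rightarrow> 'b::euclidean_space) \<Rightarrow> bool" where
  "Lp_on p S f \<longleftrightarrow>
     set_borel_measurable lebesgue S f \<and> set_integrable lebesgue S (\<lambda>x. norm (f x) powr p)"

definition Lp_loc :: "real \<Rightarrow> 'a::euclidean_space set \<Rightarrow> ('a \<Rightarrow> 'b::euclidean_space) \<Rightarrow> bool" where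
  "Lp_loc p U f \<longleftrightarrow> (\<forall>K. compact K \<and> K \<subseteq> U \<longrightarrow> Lp_on p K f)"

definition Linf_loc :: "'a::euclidean_space set \<Rightarrow> ('a \<Rightarrow> real) \<Rightarrow> bool" where
  "Linf_loc U f \<longleftrightarrow> (\<forall>K. compact K \<and> K \<subseteq> U \<longrightarrow>
     set_borel_measurable lebesgue K f \<and> (\<exists>M. AE x in lebesgue. x \<in> K \<longrightarrow> \<bar>f x\<bar> \<le> M))"

definition locally_integrable ::
  "'a::euclidean_space set \<Rightarrow> ('a \<Rightarrow> 'b::euclidean_space) \<Rightarrow> bool" where
  "locally_integrable U f \<longleftrightarrow> (\<forall>K. compact K \<and> K \<subseteq> U \<longrightarrow> set_integrable lebesgue K f)"

primrec Ck :: "nat \<Rightarrow> ('a::euclidean_space \<Rightarrow> real) \<Rightarrow> bool" where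
  "Ck 0 f \<longleftrightarrow> continuous_on UNIV f"
| "Ck (Suc k) f \<longleftrightarrow> (\<forall>x. f differentiable (at x)) \<and>
     (\<forall>i\<in>Basis. Ck k (\<lambda>x. frechet_derivative f (at x) i))"

definition test_functions :: "'a::euclidean_space set \<Rightarrow> ('a \<Rightarrow> real) set" where
  "test_functions U = {\<phi>. (\<forall>k. Ck k \<phi>) \<and>
     compact (closure {x. \<phi> x \<noteq> 0}) \<and> closure {x. \<phi> x \<noteq> 0} \<subseteq> U}"

definition grad :: "('a::euclidean_space \<Rightarrow> real) \<Rightarrow> 'a \<Rightarrow> 'a" where
  "grad \<phi> x = (\<Sum>i\<in>Basis. frechet_derivative \<phi> (at x) i *\<^sub>R i)"

definition has_weak_gradient ::
  "'a::euclidean_space set \<Rightarrow> ('a \<Rightarrow> real) \<Rightarrow> ('a \<Rightarrow> 'a) \<Rightarrow> bool" where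
  "has_weak_gradient U f G \<longleftrightarrow> locally_integrable U f \<and> locally_integrable U G \<and>
     (\<forall>\<phi>\<in>test_functions U. \<forall>i\<in>Basis.
        (LINT x:U|lebesgue. f x * (grad \<phi> x \<bullet> i)) = - (LINT x:U|lebesgue. (G x \<bullet> i) * \<phi> x))"

text \<open>
  \<open>f \<in> W\<^sub>0\<^sup>1\<^sup>,\<^sup>p(E)\<close> with gradient \<open>G\<close>: the pair is the limit in \<open>L\<^sup>p(E)\<close> of smooth functions with
  compact support in the interior of \<open>E\<close> and their gradients.
\<close>

definition W01p :: "real \<Rightarrow> 'a::euclidean_space set \<Rightarrow> ('a \<Rightarrow> real) \<Rightarrow> ('a \<Rightarrow> 'a) \<Rightarrow> bool" where
  "W01p p E f G \<longleftrightarrow> Lp_on p E f \<and> Lp_on p E G \<and>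
     (\<exists>\<phi>::nat \<Rightarrow> 'a \<Rightarrow> real. (\<forall>k. \<phi> k \<in> test_functions (interior E)) \<and>
        (\<lambda>k. LINT x:E|lebesgue. \<bar>\<phi> k x - f x\<bar> powr p) \<longlonglongrightarrow> 0 \<and>
        (\<lambda>k. LINT x:E|lebesgue. norm (grad (\<phi> k) x - G x) powr p) \<longlonglongrightarrow> 0)"


section \<open>Functions of time with values in function spaces\<close>

definition continuous_into_Lp ::
  "real set \<Rightarrow> real \<Rightarrow> 'a::euclidean_space set \<Rightarrow> ('a \<times> real \<Rightarrow> real) \<Rightarrow> bool" where
  "continuous_into_Lp I q E f \<longleftrightarrow> (\<forall>t\<in>I. Lp_on q E (\<lambda>x. f (x, t))) \<and>
     (\<forall>t\<in>I. ((\<lambda>\<tau>. LINT x:E|lebesgue. \<bar>f (x, \<tau>) - f (x, t)\<bar> powr q) \<longlongrightarrow> 0) (at t within I))"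

definition C_loc_Lp_loc ::
  "real \<Rightarrow> 'a::euclidean_space set \<Rightarrow> real \<Rightarrow> ('a \<times> real \<Rightarrow> real) \<Rightarrow> bool" where
  "C_loc_Lp_loc q \<Omega> T f \<longleftrightarrow>
     (\<forall>E. compact E \<and> E \<subseteq> \<Omega> \<longrightarrow> continuous_into_Lp {0<..<T} q E f)"

definition has_spatial_gradient ::
  "'a::euclidean_space set \<Rightarrow> real \<Rightarrow> ('a \<times> real \<Rightarrow> real) \<Rightarrow> ('a \<times> real \<Rightarrow> 'a) \<Rightarrow> bool" where
  "has_spatial_gradient \<Omega> T f V \<longleftrightarrow> locally_integrable (cylinder \<Omega> T) V \<and>
     (AE t in lebesgue. 0 < t \<and> t < T \<longrightarrow>
        has_weak_gradient \<Omega> (\<lambda>x. f (x, t)) (\<lambda>x. V (x, t)))"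

text \<open>The spatial gradient is unique up to a null set, so the choice is immaterial.\<close>

definition spatial_gradient ::
  "'a::euclidean_space set \<Rightarrow> real \<Rightarrow> ('a \<times> real \<Rightarrow> real) \<Rightarrow> ('a \<times> real \<Rightarrow> 'a)" where
  "spatial_gradient \<Omega> T f = (SOME V. has_spatial_gradient \<Omega> T f V)"

text \<open>\<open>f \<in> L\<^sup>p\<^sub>l\<^sub>o\<^sub>c(0, T; W\<^sup>1\<^sup>,\<^sup>p\<^sub>l\<^sub>o\<^sub>c(\<Omega>))\<close>\<close>

definition Lp_loc_W1p_loc ::
  "real \<Rightarrow> 'a::euclidean_space set \<Rightarrow> real \<Rightarrow> ('a \<times> real \<Rightarrow> real) \<Rightarrow> bool" where
  "Lp_loc_W1p_loc p \<Omega> T f \<longleftrightarrow> Lp_loc p (cylinder \<Omega> T) f \<and>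
     (\<exists>V. has_spatial_gradient \<Omega> T f V \<and> Lp_loc p (cylinder \<Omega> T) V)"

text \<open>
  \<open>\<zeta> \<in> W\<^sup>1\<^sup>,\<^sup>q(0, T; L\<^sup>q(E))\<close> with weak time derivative \<open>Z\<close>. As the traces \<open>\<zeta>(\<cdot>, t)\<close> are used,
  \<open>\<zeta>\<close> is required to be the representative in \<open>C([0, T]; L\<^sup>q(E))\<close>.
\<close>

definition W1q_Lq ::
  "real \<Rightarrow> real \<Rightarrow> 'a::euclidean_space set \<Rightarrow> ('a \<times> real \<Rightarrow> real) \<Rightarrow> ('a \<times> real \<Rightarrow> real) \<Rightarrow> bool" where
  "W1q_Lq q T E \<zeta> Z \<longleftrightarrow>
     Lp_on q (cylinder E T) \<zeta> \<and> Lp_on q (cylinder E T) Z \<and>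
     (\<forall>\<phi>\<in>test_functions {0<..<T}. AE x in lebesgue. x \<in> E \<longrightarrow>
        (LINT t:{0<..<T}|lebesgue. \<zeta> (x, t) * deriv \<phi> t)
        = - (LINT t:{0<..<T}|lebesgue. Z (x, t) * \<phi> t)) \<and>
     continuous_into_Lp {0..T} q E \<zeta>"

text \<open>\<open>\<zeta> \<in> L\<^sup>p(0, T; W\<^sub>0\<^sup>1\<^sup>,\<^sup>p(E))\<close> with spatial gradient \<open>G\<close>\<close>

definition Lp_W01p ::
  "real \<Rightarrow> real \<Rightarrow> 'a::euclidean_space set \<Rightarrow> ('a \<times> real \<Rightarrow> real) \<Rightarrow> ('a \<times> real \<Rightarrow> 'a) \<Rightarrow> bool" where
  "Lp_W01p p T E \<zeta> G \<longleftrightarrow>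
     Lp_on p (cylinder E T) \<zeta> \<and> Lp_on p (cylinder E T) G \<and>
     (AE t in lebesgue. 0 < t \<and> t < T \<longrightarrow> W01p p E (\<lambda>x. \<zeta> (x, t)) (\<lambda>x. G (x, t)))"


section \<open>The doubly nonlinear equation\<close>

definition m_minus :: "real \<Rightarrow> real" where
  "m_minus m = min 1 m"

definition caratheodory ::
  "'a::euclidean_space set \<Rightarrow> real \<Rightarrow> ('a \<times> real \<Rightarrow> real \<Rightarrow> 'a \<Rightarrow> 'a) \<Rightarrow> bool" where
  "caratheodory \<Omega> T A \<longleftrightarrow>
     (\<forall>v\<ge>0. \<forall>\<xi>. set_borel_measurable lebesgue (cylinder \<Omega> T) (\<lambda>z. A z v \<xi>)) \<and>
     (AE z in lebesgue. z \<in> cylinder \<Omega> T \<longrightarrow>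
        continuous_on ({0..} \<times> UNIV) (\<lambda>(v, \<xi>). A z v \<xi>))"

definition u_pow :: "real \<Rightarrow> ('a \<times> real \<Rightarrow> real) \<Rightarrow> 'a \<times> real \<Rightarrow> real" where
  "u_pow m u z = rpow (u z) (m_minus m)"

definition D_u_pow ::
  "'a::euclidean_space set \<Rightarrow> real \<Rightarrow> real \<Rightarrow> ('a \<times> real \<Rightarrow> real) \<Rightarrow> 'a \<times> real \<Rightarrow> 'a" where
  "D_u_pow \<Omega> T m u = spatial_gradient \<Omega> T (u_pow m u)"

text \<open>
  Write \<open>k = min 1 m\<close>. For \<open>m < 1\<close> the function \<open>u\<close> itself need not be weakly differentiable,
  and \<open>Du\<close> is defined by the chain rule \<open>D(u powr k) = k * u powr (k - 1) * Du\<close>, with \<open>Du = 0\<close>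
  where \<open>u = 0\<close>. For \<open>m \<ge> 1\<close>, \<open>k = 1\<close> and this is the weak gradient of \<open>u\<close>.
\<close>

definition D_u ::
  "'a::euclidean_space set \<Rightarrow> real \<Rightarrow> real \<Rightarrow> ('a \<times> real \<Rightarrow> real) \<Rightarrow> 'a \<times> real \<Rightarrow> 'a" where
  "D_u \<Omega> T m u z = (rpow (u z) (1 - m_minus m) / m_minus m) *\<^sub>R D_u_pow \<Omega> T m u z"

text \<open>
  The conditions are imposed along \<open>u\<close>, exactly as they are written. They follow from the
  corresponding bounds for all \<open>(v, \<xi>)\<close> in place of \<open>(u, Du)\<close>.
\<close>

definition structure_conditions ::
  "'a::euclidean_space set \<Rightarrow> real \<Rightarrow> real \<Rightarrow> real \<Rightarrow> real \<Rightarrow> real \<Rightarrow>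
     ('a \<times> real \<Rightarrow> real \<Rightarrow> 'a \<Rightarrow> 'a) \<Rightarrow> ('a \<times> real \<Rightarrow> real) \<Rightarrow> bool" where
  "structure_conditions \<Omega> T m p K1 K2 A u \<longleftrightarrow>
     (AE z in lebesgue. z \<in> cylinder \<Omega> T \<longrightarrow>
        A z (u z) (D_u \<Omega> T m u z) \<bullet> D_u_pow \<Omega> T m u z
          \<ge> K1 * rpow (u z) ((m - m_minus m) * (p - 1)) * norm (D_u_pow \<Omega> T m u z) powr p \<and>
        norm (A z (u z) (D_u \<Omega> T m u z))
          \<le> K2 * rpow (u z) ((m - m_minus m) * (p - 1)) * norm (D_u_pow \<Omega> T m u z) powr (p - 1))"

definition solution_space ::
  "'a::euclidean_space set \<Rightarrow> real \<Rightarrow> real \<Rightarrow> real \<Rightarrow> ('a \<times> real \<Rightarrow> real) \<Rightarrow> bool" where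
  "solution_space \<Omega> T m p u \<longleftrightarrow>
     (AE z in lebesgue. z \<in> cylinder \<Omega> T \<longrightarrow> 0 \<le> u z) \<and>
     C_loc_Lp_loc (1 + m_minus m) \<Omega> T u \<and>
     Lp_loc_W1p_loc p \<Omega> T (u_pow m u) \<and>
     Linf_loc (cylinder \<Omega> T) u"

definition admissible_test ::
  "real \<Rightarrow> real \<Rightarrow> real \<Rightarrow> 'a::euclidean_space set \<Rightarrow>
     ('a \<times> real \<Rightarrow> real) \<Rightarrow> ('a \<times> real \<Rightarrow> real) \<Rightarrow> ('a \<times> real \<Rightarrow> 'a) \<Rightarrow> bool" where
  "admissible_test m p T E \<zeta> Z G \<longleftrightarrow>
     W1q_Lq (1 + 1 / m_minus m) T E \<zeta> Z \<and> Lp_W01p p T E \<zeta> G \<and>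
     (AE z in lebesgue. z \<in> cylinder E T \<longrightarrow> 0 \<le> \<zeta> z)"

definition weak_integrand ::
  "'a::euclidean_space set \<Rightarrow> real \<Rightarrow> real \<Rightarrow> ('a \<times> real \<Rightarrow> real \<Rightarrow> 'a \<Rightarrow> 'a) \<Rightarrow>
     ('a \<times> real \<Rightarrow> real) \<Rightarrow> ('a \<times> real \<Rightarrow> real) \<Rightarrow> ('a \<times> real \<Rightarrow> 'a) \<Rightarrow> 'a \<times> real \<Rightarrow> real" where
  "weak_integrand \<Omega> T m A u Z G z = - (u z * Z z) + A z (u z) (D_u \<Omega> T m u z) \<bullet> G z"

definition weak_form ::
  "'a::euclidean_space set \<Rightarrow> real \<Rightarrow> real \<Rightarrow> ('a \<times> real \<Rightarrow> real \<Rightarrow> 'a \<Rightarrow> 'a) \<Rightarrow>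
     ('a \<times> real \<Rightarrow> real) \<Rightarrow> 'a set \<Rightarrow> real \<Rightarrow> real \<Rightarrow>
     ('a \<times> real \<Rightarrow> real) \<Rightarrow> ('a \<times> real \<Rightarrow> real) \<Rightarrow> ('a \<times> real \<Rightarrow> 'a) \<Rightarrow> real" where
  "weak_form \<Omega> T m A u E t1 t2 \<zeta> Z G =
     (LINT x:E|lebesgue. u (x, t2) * \<zeta> (x, t2)) - (LINT x:E|lebesgue. u (x, t1) * \<zeta> (x, t1))
     + (LINT z:E \<times> {t1..t2}|lebesgue. weak_integrand \<Omega> T m A u Z G z)"

text \<open>
  The integrals exist automatically if the structure conditions hold and \<open>t2 < T\<close>. For \<open>t2 = T\<close>,
  where the local function spaces give no information, their existence is part of the meaning
  of the weak formulation; without it the library's integral would be \<open>0\<close> by convention.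
\<close>

definition weak_form_defined ::
  "'a::euclidean_space set \<Rightarrow> real \<Rightarrow> real \<Rightarrow> ('a \<times> real \<Rightarrow> real \<Rightarrow> 'a \<Rightarrow> 'a) \<Rightarrow>
     ('a \<times> real \<Rightarrow> real) \<Rightarrow> 'a set \<Rightarrow> real \<Rightarrow> real \<Rightarrow>
     ('a \<times> real \<Rightarrow> real) \<Rightarrow> ('a \<times> real \<Rightarrow> real) \<Rightarrow> ('a \<times> real \<Rightarrow> 'a) \<Rightarrow> bool" where
  "weak_form_defined \<Omega> T m A u E t1 t2 \<zeta> Z G \<longleftrightarrow>
     set_integrable lebesgue E (\<lambda>x. u (x, t1) * \<zeta> (x, t1)) \<and>
     set_integrable lebesgue E (\<lambda>x. u (x, t2) * \<zeta> (x, t2)) \<and>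
     set_integrable lebesgue (E \<times> {t1..t2}) (weak_integrand \<Omega> T m A u Z G)"

definition weak_subsolution ::
  "'a::euclidean_space set \<Rightarrow> real \<Rightarrow> real \<Rightarrow> real \<Rightarrow>
     ('a \<times> real \<Rightarrow> real \<Rightarrow> 'a \<Rightarrow> 'a) \<Rightarrow> ('a \<times> real \<Rightarrow> real) \<Rightarrow> bool" where
  "weak_subsolution \<Omega> T m p A u \<longleftrightarrow> solution_space \<Omega> T m p u \<and>
     (\<forall>E t1 t2 \<zeta> Z G. compact E \<and> E \<subseteq> \<Omega> \<and> 0 < t1 \<and> t1 < t2 \<and> t2 \<le> T \<and>
        admissible_test m p T E \<zeta> Z G \<longrightarrow>
        weak_form_defined \<Omega> T m A u E t1 t2 \<zeta> Z G \<and>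
        weak_form \<Omega> T m A u E t1 t2 \<zeta> Z G \<le> 0)"

definition weak_supersolution ::
  "'a::euclidean_space set \<Rightarrow> real \<Rightarrow> real \<Rightarrow> real \<Rightarrow>
     ('a \<times> real \<Rightarrow> real \<Rightarrow> 'a \<Rightarrow> 'a) \<Rightarrow> ('a \<times> real \<Rightarrow> real) \<Rightarrow> bool" where
  "weak_supersolution \<Omega> T m p A u \<longleftrightarrow> solution_space \<Omega> T m p u \<and>
     (\<forall>E t1 t2 \<zeta> Z G. compact E \<and> E \<subseteq> \<Omega> \<and> 0 < t1 \<and> t1 < t2 \<and> t2 \<le> T \<and>
        admissible_test m p T E \<zeta> Z G \<longrightarrow>
        weak_form_defined \<Omega> T m A u E t1 t2 \<zeta> Z G \<and>
        weak_form \<Omega> T m A u E t1 t2 \<zeta> Z G \<ge> 0)"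

definition weak_solution ::
  "'a::euclidean_space set \<Rightarrow> real \<Rightarrow> real \<Rightarrow> real \<Rightarrow>
     ('a \<times> real \<Rightarrow> real \<Rightarrow> 'a \<Rightarrow> 'a) \<Rightarrow> ('a \<times> real \<Rightarrow> real) \<Rightarrow> bool" where
  "weak_solution \<Omega> T m p A u \<longleftrightarrow> weak_subsolution \<Omega> T m p A u \<and> weak_supersolution \<Omega> T m p A u"

text \<open>
  The times in \<open>[s, t]\<close> at which a local solution in \<open>\<Omega> \<times> (0, T)\<close> has a value. The weak formulation
  involves \<open>u(\<cdot>, \<tau>)\<close> for \<open>0 < \<tau> \<le> T\<close> only; \<open>u(\<cdot>, 0)\<close> is not defined. For \<open>0 < s\<close> and \<open>t \<le> T\<close>
  this is \<open>[s, t]\<close>.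
\<close>

definition solution_times :: "real \<Rightarrow> real \<Rightarrow> real \<Rightarrow> real set" where
  "solution_times T s t = {s..t} \<inter> {0<..T}"

end

theory Submission
  imports Defs
begin

text \<open>
  Since \<open>\<lambda> > 1\<close> and \<open>p < 2\<close> force \<open>m > 1\<close>, the weak gradient of \<open>u\<close> itself exists and the flux \<open>A\<close> is
  bounded by \<open>u\<^sup>q |Du|\<^sup>p\<^sup>-\<^sup>1\<close> with \<open>q = (m - 1)(p - 1) > 0\<close>. Put \<open>v = \<mu> - u \<ge> 0\<close> and let \<open>\<zeta>\<close> be a cutoff
  between \<open>B\<^sub>r\<close> and \<open>B\<^sub>2\<^sub>r\<close>. Testing with the time-independent function \<open>\<zeta>\<^sup>k\<close>, the increment of
  \<open>\<integral> v \<zeta>\<^sup>k dx\<close> between two times is at most the space-time integral of \<open>|A| |D\<zeta>\<^sup>k|\<close>.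

  To bound that flux, test with \<open>(v + \<nu>)\<^sup>-\<^sup>\<alpha> \<zeta>\<^sup>k\<close>, where \<open>\<alpha>\<close> is small, \<open>k\<close> is large and
  \<open>\<nu> = (\<mu>\<^sup>q (t - s) / r\<^sup>p)\<close> to the power \<open>1 / (2 - p)\<close>. The solution has no time derivative, but by concavity
  of \<open>x\<^sup>1\<^sup>-\<^sup>\<alpha>\<close> it suffices to freeze the test function at time \<open>\<tau>\<close>, to use it on \<open>[\<tau> - h, \<tau>]\<close>, and to let
  \<open>h \<rightarrow> 0\<close>. This bounds \<open>\<integral>\<integral> u\<^sup>q (v + \<nu>)\<^sup>-\<^sup>\<alpha>\<^sup>-\<^sup>1 |Du|\<^sup>p \<zeta>\<^sup>k\<close>. With \<open>S\<close> the supremum over the times of the mean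
  value of \<open>v \<zeta>\<^sup>k\<close>, Young's inequality then bounds the flux by \<open>|B| ((S + \<nu>) / 2 + C \<nu>)\<close>, so that
  \<open>S\<close> is at most twice the mean value at any one time plus \<open>C' \<nu>\<close>.
\<close>

section \<open>Translations in \<open>L\<^sup>p\<close>\<close>

text \<open>The flux carries |Du|^(p-1), the energy |Du|^p weighted by a negative power of v +
  \<nu>. Young's inequality between them leaves the power (\<alpha> + 1)(p - 1) of v + \<nu>, which
  the mean of v controls only if that exponent is below 1. As p < 2 there is room for a small
  \<alpha> > 0, and the same gap 2 - p produces the exponent in \<nu>. The shift by \<nu> keeps the
  negative power away from its singularity at u = \<mu>.

  The obstacle is admissibility. A function frozen in time has time derivative 0, so only its slice
  must lie in W_0^{1,p}; this is proved by mollification, for a smooth function of a bounded Sobolev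
  slice times a cutoff. Moreover u, its gradient and the flux are given only up to null sets, and
  the gradient is picked by choice, hence the Borel versions and the uniqueness result. The supremum
  and infimum run over every time, also T, where no bound on u is assumed; weak continuity in time
  carries the bounds there. Finally, absorbing half of S requires S to be finite, which v \<le>
  \<mu> provides.\<close>

lemma nonneg_squeeze:
  fixes a b :: "nat \<Rightarrow> real"
  assumes "\<And>n. 0 \<le> a n" "\<And>n. a n \<le> b n" "b \<longlonglongrightarrow> 0"
  shows "a \<longlonglongrightarrow> 0"
  by (rule tendsto_sandwich[OF _ _ tendsto_const assms(3)]) (simp_all add: assms)

lemma lborel_translate:
  fixes f :: "'a::euclidean_space \<Rightarrow> 'b::{banach, second_countable_topology}" and a :: 'a
  assumes f: "f \<in> borel_measurable borel"
  shows "(LINT x|lborel. f (x + a)) = (LINT x|lborel. f x)"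
    and "integrable lborel (\<lambda>x. f (x + a)) \<longleftrightarrow> integrable lborel f"
proof -
  have *: "lborel = distr lborel borel ((+) a)" by (simp add: lborel_distr_plus)
  have "(LINT x|lborel. f x) = (LINT x|distr lborel borel ((+) a). f x)"
    by (simp add: lborel_distr_plus)
  also have "\<dots> = (LINT x|lborel. f (a + x))" using f by (intro integral_distr) auto
  finally show "(LINT x|lborel. f (x + a)) = (LINT x|lborel. f x)" by (simp add: add.commute)
  have "integrable (distr lborel borel ((+) a)) f \<longleftrightarrow> integrable lborel (\<lambda>x. f (a + x))"
    using f by (intro integrable_distr_eq) auto
  then show "integrable lborel (\<lambda>x. f (x + a)) \<longleftrightarrow> integrable lborel f"
    by (simp add: lborel_distr_plus add.commute)
qed

lemma lborel_translate_integrable: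
  fixes f :: "'a::euclidean_space \<Rightarrow> 'b::{banach, second_countable_topology}"
  assumes "integrable lborel f"
  shows "integrable lborel (\<lambda>x. f (x + a))"
  using assms lborel_translate(2)[of f a] by (simp add: borel_measurable_integrable[simplified])

text \<open>Since both indicators have the same integral, it suffices to bound the positive part of the
  difference, for which openness gives pointwise convergence.\<close>

lemma translation_L1_open:
  fixes U :: "'a::euclidean_space set"
  assumes U: "open U" "emeasure lborel U < \<infinity>" and X: "X \<longlonglongrightarrow> 0"
  shows "(\<lambda>n. LINT x|lborel. \<bar>indicator U (x + X n) - indicator U x :: real\<bar>) \<longlonglongrightarrow> 0"
proof -
  let ?f = "indicator U :: 'a \<Rightarrow> real"
  have [measurable]: "U \<in> sets borel" using U by auto
  have int: "integrable lborel ?f" using U by (intro integrable_real_indicator) auto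
  have intn: "integrable lborel (\<lambda>x. ?f (x + a))" for a
    by (rule lborel_translate_integrable[OF int])
  have lim: "(\<lambda>n. LINT x|lborel. max 0 (?f x - ?f (x + X n))) \<longlonglongrightarrow> (LINT x|(lborel :: 'a measure). (0::real))"
  proof (rule integral_dominated_convergence[where w="?f"])
    show "AE x in lborel. (\<lambda>n. max 0 (?f x - ?f (x + X n))) \<longlonglongrightarrow> 0"
    proof (rule AE_I2)
      fix x
      show "(\<lambda>n. max 0 (?f x - ?f (x + X n))) \<longlonglongrightarrow> 0"
      proof (cases "x \<in> U")
        case True
        have "(\<lambda>n. x + X n) \<longlonglongrightarrow> x + 0" by (intro tendsto_intros X)
        then have "\<forall>\<^sub>F n in sequentially. x + X n \<in> U"
          using U True by (auto intro: topological_tendstoD)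
        then have "\<forall>\<^sub>F n in sequentially. max 0 (?f x - ?f (x + X n)) = 0"
          by eventually_elim (use True in simp)
        then show ?thesis by (rule tendsto_eventually)
      next
        case False
        then have "max 0 (?f x - ?f (x + X n)) = 0" for n by (simp add: indicator_def)
        then show ?thesis by simp
      qed
    qed
    show "AE x in lborel. norm (max 0 (?f x - ?f (x + X n))) \<le> ?f x" for n
      by (auto simp: indicator_def)
  qed (use int in auto)
  have eq: "(LINT x|lborel. \<bar>?f (x + a) - ?f x\<bar>) = 2 * (LINT x|lborel. max 0 (?f x - ?f (x + a)))" for a
  proof -
    have "(LINT x|lborel. \<bar>?f (x + a) - ?f x\<bar>)
        = (LINT x|lborel. 2 * max 0 (?f x - ?f (x + a)) + (?f (x + a) - ?f x))"
      by (intro Bochner_Integration.integral_cong) (auto simp: indicator_def)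
    also have "\<dots> = 2 * (LINT x|lborel. max 0 (?f x - ?f (x + a)))
        + ((LINT x|lborel. ?f (x + a)) - (LINT x|lborel. ?f x))"
      using int intn by (subst Bochner_Integration.integral_add) (auto simp: Bochner_Integration.integral_diff)
    finally show ?thesis by (simp add: lborel_translate)
  qed
  show ?thesis using tendsto_mult_left[OF lim, of 2] by (simp add: eq)
qed

text \<open>Translations are isometries of L^1, so replacing f by a close g costs the same small
  amount before and after the shift. This closes the class of functions with continuous translations
  under L^1 limits.\<close>

lemma translation_L1_approx:
  fixes f :: "'a::euclidean_space \<Rightarrow> real"
  assumes f: "integrable lborel f" and X: "X \<longlonglongrightarrow> 0"
    and ap: "\<And>e. e > 0 \<Longrightarrow> \<exists>g. integrable lborel g \<and> (LINT x|lborel. \<bar>g x - f x\<bar>) < e \<and>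
       (\<lambda>n. LINT x|lborel. \<bar>g (x + X n) - g x\<bar>) \<longlonglongrightarrow> 0"
  shows "(\<lambda>n. LINT x|lborel. \<bar>f (x + X n) - f x\<bar>) \<longlonglongrightarrow> 0"
proof (rule LIMSEQ_I)
  fix r :: real assume "r > 0"
  then obtain g where g: "integrable lborel g" "(LINT x|lborel. \<bar>g x - f x\<bar>) < r / 3"
    "(\<lambda>n. LINT x|lborel. \<bar>g (x + X n) - g x\<bar>) \<longlonglongrightarrow> 0" using ap[of "r/3"] by auto
  from LIMSEQ_D[OF g(3), of "r/3"] \<open>r > 0\<close> obtain N
    where N: "\<And>n. n \<ge> N \<Longrightarrow> norm ((LINT x|lborel. \<bar>g (x + X n) - g x\<bar>) - 0) < r / 3" by auto
  have "norm ((LINT x|lborel. \<bar>f (x + X n) - f x\<bar>) - 0) < r" if "n \<ge> N" for n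
  proof -
    note t = lborel_translate_integrable[of _ "X n"]
    have i1: "integrable lborel (\<lambda>x. \<bar>g x - f x\<bar>)" using f g by auto
    have i2: "integrable lborel (\<lambda>x. \<bar>g (x + X n) - f (x + X n)\<bar>)" using t[OF i1] .
    have i3: "integrable lborel (\<lambda>x. \<bar>g (x + X n) - g x\<bar>)"
      by (intro integrable_abs Bochner_Integration.integrable_diff g t[OF g(1)])
    have m: "(\<lambda>x. \<bar>g x - f x\<bar>) \<in> borel_measurable borel" using i1 by (auto dest: borel_measurable_integrable)
    have "(LINT x|lborel. \<bar>f (x + X n) - f x\<bar>)
      \<le> (LINT x|lborel. (\<bar>g (x + X n) - f (x + X n)\<bar> + \<bar>g (x + X n) - g x\<bar>) + \<bar>g x - f x\<bar>)"
      by (intro integral_mono Bochner_Integration.integrable_add i1 i2 i3 integrable_abs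
        Bochner_Integration.integrable_diff f t[OF f]) linarith
    also have "\<dots> = (LINT x|lborel. \<bar>g (x + X n) - f (x + X n)\<bar>) + (LINT x|lborel. \<bar>g (x + X n) - g x\<bar>)
         + (LINT x|lborel. \<bar>g x - f x\<bar>)"
      using i2 i3 i1 by (simp only: Bochner_Integration.integral_add Bochner_Integration.integrable_add)
    also have "(LINT x|lborel. \<bar>g (x + X n) - f (x + X n)\<bar>) = (LINT x|lborel. \<bar>g x - f x\<bar>)"
      using lborel_translate(1)[OF m] by simp
    finally show ?thesis using N[OF that] g(2) by (simp add: Bochner_Integration.integral_nonneg)
  qed
  then show "\<exists>N. \<forall>n\<ge>N. norm ((LINT x|lborel. \<bar>f (x + X n) - f x\<bar>) - 0) < r" by blast
qed

text \<open>Induction over integrable functions: outer regularity replaces a Borel set of finite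
  measure by a slightly larger open set, sums obey the triangle inequality, and limits fall under
  \<open>translation_L1_approx\<close>.\<close>

lemma translation_L1:
  fixes f :: "'a::euclidean_space \<Rightarrow> real"
  assumes "integrable lborel f" and X: "X \<longlonglongrightarrow> 0"
  shows "(\<lambda>n. LINT x|lborel. \<bar>f (x + X n) - f x\<bar>) \<longlonglongrightarrow> 0"
  using assms(1)
proof (induct rule: integrable_induct)
  case (base A c)
  have [measurable]: "A \<in> sets borel" and Afin: "emeasure lborel A < \<infinity>" using base by auto
  have intA: "integrable lborel (indicator A :: 'a \<Rightarrow> real)"
    using Afin by (intro integrable_real_indicator) auto
  have *: "(\<lambda>n. LINT x|lborel. \<bar>indicator A (x + X n) - indicator A x :: real\<bar>) \<longlonglongrightarrow> 0"
  proof (rule translation_L1_approx[OF intA X])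
    fix e :: real assume "e > 0"
    obtain U where U: "open U" "A \<subseteq> U" "emeasure lborel (U - A) < e"
      by (rule outer_regular_lborel[OF \<open>A \<in> sets borel\<close> \<open>e > 0\<close>])
    have [measurable]: "U \<in> sets borel" using U by auto
    have "emeasure lborel U \<le> emeasure lborel A + emeasure lborel (U - A)"
      using U by (subst plus_emeasure) (auto intro!: emeasure_mono)
    also have "\<dots> < \<infinity>" using Afin order.strict_trans[OF U(3) ennreal_less_top] by (simp add: ennreal_add_less_top)
    finally have Ufin: "emeasure lborel U < \<infinity>" .
    have intU: "integrable lborel (indicator U :: 'a \<Rightarrow> real)"
      using Ufin by (intro integrable_real_indicator) auto
    have "(LINT x|lborel. \<bar>indicator U x - indicator A x :: real\<bar>) = (LINT x|lborel. indicator (U - A) x)"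
      using U by (intro Bochner_Integration.integral_cong) (auto simp: indicator_def)
    also have "\<dots> = measure lborel (U - A)" by simp
    also have "\<dots> < e"
    proof -
      have "emeasure lborel (U - A) = ennreal (measure lborel (U - A))"
        using order.strict_trans[OF U(3) ennreal_less_top] by (intro emeasure_eq_ennreal_measure) auto
      then show ?thesis using U(3) \<open>e > 0\<close> by (simp add: ennreal_less_iff)
    qed
    finally show "\<exists>g. integrable lborel g \<and> (LINT x|lborel. \<bar>g x - indicator A x\<bar>) < e \<and>
       (\<lambda>n. LINT x|lborel. \<bar>g (x + X n) - g x\<bar>) \<longlonglongrightarrow> 0"
      by (intro exI[of _ "indicator U"] conjI intU translation_L1_open[OF U(1) Ufin X])
  qed
  have "\<bar>indicator A (x + X n) *\<^sub>R c - indicator A x *\<^sub>R c\<bar>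
     = \<bar>c\<bar> * \<bar>indicator A (x + X n) - indicator A x\<bar>" for x n
    by (auto simp: indicator_def)
  then show ?case using tendsto_mult_left[OF *, of "\<bar>c\<bar>"] by simp
next
  case (add f g)
  note t = lborel_translate_integrable
  have le: "(LINT x|lborel. \<bar>f (x + X n) + g (x + X n) - (f x + g x)\<bar>)
     \<le> (LINT x|lborel. \<bar>f (x + X n) - f x\<bar>) + (LINT x|lborel. \<bar>g (x + X n) - g x\<bar>)" for n
  proof -
    have i: "integrable lborel (\<lambda>x. \<bar>f (x + X n) - f x\<bar>)" "integrable lborel (\<lambda>x. \<bar>g (x + X n) - g x\<bar>)"
      "integrable lborel (\<lambda>x. \<bar>f (x + X n) + g (x + X n) - (f x + g x)\<bar>)"
      using add t[of _ "X n", OF add(1)] t[of _ "X n", OF add(3)] by auto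
    show ?thesis
      unfolding Bochner_Integration.integral_add[OF i(1,2), symmetric]
      using i by (intro integral_mono) auto
  qed
  show ?case
  proof (rule tendsto_sandwich[OF _ _ tendsto_const])
    show "\<forall>\<^sub>F n in sequentially. 0 \<le> (LINT x|lborel. \<bar>f (x + X n) + g (x + X n) - (f x + g x)\<bar>)"
      by (intro always_eventually allI Bochner_Integration.integral_nonneg) simp
    show "(\<lambda>n. (LINT x|lborel. \<bar>f (x + X n) - f x\<bar>) + (LINT x|lborel. \<bar>g (x + X n) - g x\<bar>)) \<longlonglongrightarrow> 0"
      using tendsto_add[OF add(2) add(4)] by simp
  qed (intro always_eventually allI le)
next
  case (lim f s)
  show ?case
  proof (rule translation_L1_approx[OF lim(5) X])
    fix e :: real assume e: "e > 0"
    \<comment> \<open>The induction principle supplies |s i x| \<le> 2 |f x|, hence the dominating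
      function 3 |f|.\<close>
    have "(\<lambda>i. LINT x|lborel. \<bar>s i x - f x\<bar>) \<longlonglongrightarrow> (LINT x|(lborel :: 'a measure). (0::real))"
    proof (rule integral_dominated_convergence[where w="\<lambda>x. 3 * norm (f x)"])
      show "AE x in lborel. (\<lambda>i. \<bar>s i x - f x\<bar>) \<longlonglongrightarrow> 0"
        using lim(3) by (auto intro!: tendsto_rabs_zero LIM_zero)
      show "AE x in lborel. norm \<bar>s i x - f x\<bar> \<le> 3 * norm (f x)" for i
      proof (rule AE_I2)
        fix x show "norm \<bar>s i x - f x\<bar> \<le> 3 * norm (f x)"
          using lim(4)[of x i] by simp
      qed
      show "(\<lambda>x. \<bar>s i x - f x\<bar>) \<in> borel_measurable lborel" for i
        by (intro borel_measurable_integrable integrable_abs Bochner_Integration.integrable_diff lim)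
    qed (intro integrable_mult_right integrable_norm lim borel_measurable_const)+
    from LIMSEQ_D[OF this e] obtain i where "norm ((LINT x|lborel. \<bar>s i x - f x\<bar>) - 0) < e" by auto
    then have "(LINT x|lborel. \<bar>s i x - f x\<bar>) < e" by simp
    then show "\<exists>g. integrable lborel g \<and> (LINT x|lborel. \<bar>g x - f x\<bar>) < e \<and>
       (\<lambda>n. LINT x|lborel. \<bar>g (x + X n) - g x\<bar>) \<longlonglongrightarrow> 0"
      by (intro exI[of _ "s i"] conjI lim)
  qed
qed

text \<open>Splitting off one factor, x^p = x x^(p-1), leaves powers with nonnegative exponent,
  which only grow when their base is enlarged to a + b.\<close>

lemma powr_superadd:
  fixes a b p :: real
  assumes "a \<ge> 0" "b \<ge> 0" "p \<ge> 1"
  shows "a powr p + b powr p \<le> (a + b) powr p"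
proof (cases "a = 0 \<or> b = 0")
  case False
  then have pos: "a > 0" "b > 0" using assms by auto
  have s: "x powr p = x * x powr (p - 1)" if "x > 0" for x :: real
    using that powr_add[of x 1 "p - 1"] by simp
  have "a * a powr (p - 1) \<le> a * (a + b) powr (p - 1)" "b * b powr (p - 1) \<le> b * (a + b) powr (p - 1)"
    using pos assms by (auto intro!: mult_left_mono powr_mono2)
  from add_mono[OF this] show ?thesis using pos by (simp only: s distrib_right add_pos_pos)
qed (use assms in auto)

lemma powr_add_le:
  fixes a b p :: real
  assumes "a \<ge> 0" "b \<ge> 0" "p \<ge> 0"
  shows "(a + b) powr p \<le> 2 powr p * (a powr p + b powr p)"
proof -
  have "(a + b) powr p \<le> (2 * max a b) powr p" using assms by (intro powr_mono2) auto
  also have "\<dots> = 2 powr p * max a b powr p" by (simp add: powr_mult)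
  also have "max a b powr p \<le> a powr p + b powr p" by (auto simp: max_def)
  finally show ?thesis by simp
qed

text \<open>The signed power sgn a |a|^p maps L^p functions to L^1 functions, and this bound brings
  L^1 convergence of the images back to L^p convergence. For equal signs it rests on
  superadditivity, for opposite signs on \<open>powr_add_le\<close>.\<close>

lemma abs_diff_powr_le:
  fixes a b p :: real
  assumes "p \<ge> 1"
  shows "\<bar>a - b\<bar> powr p \<le> 2 powr p * \<bar>sgn a * \<bar>a\<bar> powr p - sgn b * \<bar>b\<bar> powr p\<bar>"
proof -
  have one: "1 \<le> (2::real) powr p" using assms by (intro ge_one_powr_ge_zero) auto
  have *: "(x - y) powr p \<le> 2 powr p * (x powr p - y powr p)" if "x \<ge> y" "y \<ge> 0" for x y :: real
  proof -
    have le: "(x - y) powr p \<le> x powr p - y powr p"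
      using powr_superadd[of "x - y" y p] that assms by simp
    moreover have "0 \<le> x powr p - y powr p" using that assms by (simp add: powr_mono2)
    ultimately show ?thesis using mult_right_mono[OF one, of "x powr p - y powr p"] by (metis mult_1 order_trans)
  qed
  have **: "(x + y) powr p \<le> 2 powr p * (x powr p + y powr p)" if "x \<ge> 0" "y \<ge> 0" for x y :: real
    using powr_add_le[of x y p] that assms by auto
  have m: "x powr p \<le> y powr p" if "0 \<le> x" "x \<le> y" for x y :: real
    using that assms by (intro powr_mono2) auto
  consider "a \<ge> 0" "b \<ge> 0" "a \<ge> b" | "a \<ge> 0" "b \<ge> 0" "a < b" | "a \<ge> 0" "b < 0" | "a < 0" "b \<ge> 0"
     | "a < 0" "b < 0" "a \<ge> b" | "a < 0" "b < 0" "a < b" by linarith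
  then show ?thesis
  proof cases
    case 1
    then have "\<bar>a - b\<bar> powr p \<le> 2 powr p * (a powr p - b powr p)" using *[of b a] by simp
    then show ?thesis using 1 m[of b a] by (auto simp: sgn_real_def split: if_splits)
  next
    case 2
    then have "\<bar>a - b\<bar> powr p \<le> 2 powr p * (b powr p - a powr p)" using *[of a b] by simp
    then show ?thesis using 2 m[of a b] by (auto simp: sgn_real_def abs_if split: if_splits)
  next
    case 3
    then show ?thesis using **[of a "-b"] by (auto simp: sgn_real_def)
  next
    case 4
    have "\<bar>sgn a * \<bar>a\<bar> powr p - sgn b * \<bar>b\<bar> powr p\<bar> = b powr p + (-a) powr p"
    proof -
      have "sgn a * \<bar>a\<bar> powr p - sgn b * \<bar>b\<bar> powr p = - (b powr p + (-a) powr p)"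
        using 4 by (cases "b = 0") (auto simp: sgn_real_def)
      moreover have "0 \<le> b powr p + (-a) powr p" by simp
      ultimately show ?thesis by linarith
    qed
    then show ?thesis using 4 **[of b "-a"] by simp
  next
    case 5
    then have "\<bar>a - b\<bar> powr p \<le> 2 powr p * ((-b) powr p - (-a) powr p)" using *[of "-a" "-b"] by simp
    then show ?thesis using 5 m[of "-a" "-b"] by (auto simp: sgn_real_def abs_if split: if_splits)
  next
    case 6
    then have "\<bar>a - b\<bar> powr p \<le> 2 powr p * ((-a) powr p - (-b) powr p)" using *[of "-b" "-a"] by simp
    then show ?thesis using 6 m[of "-b" "-a"] by (auto simp: sgn_real_def abs_if split: if_splits)
  qed
qed

lemma integrable_powr_translate_diff:
  fixes f :: "'a::euclidean_space \<Rightarrow> real"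
  assumes [measurable]: "f \<in> borel_measurable borel" and f: "integrable lborel (\<lambda>x. \<bar>f x\<bar> powr p)"
    and p: "p \<ge> 1"
  shows "integrable lborel (\<lambda>x. \<bar>f (x + a) - f x\<bar> powr p)"
proof (rule Bochner_Integration.integrable_bound[where f="\<lambda>x. 2 powr p * (\<bar>f (x + a)\<bar> powr p + \<bar>f x\<bar> powr p)"])
  show "integrable lborel (\<lambda>x. 2 powr p * (\<bar>f (x + a)\<bar> powr p + \<bar>f x\<bar> powr p))"
    using f lborel_translate_integrable[OF f, of a] by auto
  show "AE x in lborel. norm (\<bar>f (x + a) - f x\<bar> powr p) \<le> norm (2 powr p * (\<bar>f (x + a)\<bar> powr p + \<bar>f x\<bar> powr p))"
  proof (rule AE_I2)
    fix x
    have "\<bar>f (x + a) - f x\<bar> powr p \<le> (\<bar>f (x + a)\<bar> + \<bar>f x\<bar>) powr p" using p by (intro powr_mono2) auto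
    also have "\<dots> \<le> 2 powr p * (\<bar>f (x + a)\<bar> powr p + \<bar>f x\<bar> powr p)" using p by (intro powr_add_le) auto
    finally show "norm (\<bar>f (x + a) - f x\<bar> powr p) \<le> norm (2 powr p * (\<bar>f (x + a)\<bar> powr p + \<bar>f x\<bar> powr p))" by simp
  qed
qed measurable

text \<open>The signed power g of f is integrable, and continuity of its translations in L^1 returns
  to f through \<open>abs_diff_powr_le\<close>.\<close>

lemma translation_Lp:
  fixes f :: "'a::euclidean_space \<Rightarrow> real"
  assumes m[measurable]: "f \<in> borel_measurable borel" and f: "integrable lborel (\<lambda>x. \<bar>f x\<bar> powr p)"
    and p: "p \<ge> 1" and X: "X \<longlonglongrightarrow> 0"
  shows "(\<lambda>n. LINT x|lborel. \<bar>f (x + X n) - f x\<bar> powr p) \<longlonglongrightarrow> 0"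
proof -
  define g where "g x = sgn (f x) * \<bar>f x\<bar> powr p" for x
  have [measurable]: "g \<in> borel_measurable borel" unfolding g_def by measurable
  have g: "integrable lborel g"
  proof (rule Bochner_Integration.integrable_bound[OF f])
    show "AE x in lborel. norm (g x) \<le> norm (\<bar>f x\<bar> powr p)"
      by (rule AE_I2) (simp add: g_def abs_mult sgn_real_def)
  qed simp
  have le: "(LINT x|lborel. \<bar>f (x + X n) - f x\<bar> powr p) \<le> 2 powr p * (LINT x|lborel. \<bar>g (x + X n) - g x\<bar>)" for n
    unfolding integral_mult_right_zero[symmetric]
  proof (rule integral_mono)
    show "integrable lborel (\<lambda>x. 2 powr p * \<bar>g (x + X n) - g x\<bar>)"
      by (intro integrable_mult_right integrable_abs Bochner_Integration.integrable_diff
        lborel_translate_integrable g)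
    show "\<bar>f (x + X n) - f x\<bar> powr p \<le> 2 powr p * \<bar>g (x + X n) - g x\<bar>" for x
      using abs_diff_powr_le[OF p] by (simp only: g_def)
  qed (rule integrable_powr_translate_diff[OF m f p])
  have "(\<lambda>n. 2 powr p * (LINT x|lborel. \<bar>g (x + X n) - g x\<bar>)) \<longlonglongrightarrow> 0"
    using tendsto_mult_left[OF translation_L1[OF g X], of "2 powr p"] by simp
  from nonneg_squeeze[OF _ le this] show ?thesis by simp
qed

text \<open>Sequential continuity at 0 becomes a modulus valid on a whole ball of shifts.
  Mollification needs this form, as there h ranges over the support of the kernel.\<close>

lemma translation_Lp_ex:
  fixes f :: "'a::euclidean_space \<Rightarrow> real"
  assumes m: "f \<in> borel_measurable borel" and f: "integrable lborel (\<lambda>x. \<bar>f x\<bar> powr p)"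
    and p: "p \<ge> 1" and e: "e > 0"
  shows "\<exists>d>0. \<forall>h. norm h < d \<longrightarrow> (LINT x|lborel. \<bar>f (x + h) - f x\<bar> powr p) < e"
proof -
  let ?J = "\<lambda>h. LINT x|lborel. \<bar>f (x + h) - f x\<bar> powr p"
  have "isCont ?J 0" unfolding continuous_at_sequentially
    using translation_Lp[OF m f p] by (simp add: o_def)
  then have "\<forall>e>0. \<exists>d>0. \<forall>h. dist h 0 < d \<longrightarrow> dist (?J h) (?J 0) < e"
    unfolding continuous_at_eps_delta .
  then have "\<exists>d>0. \<forall>h. dist h 0 < d \<longrightarrow> dist (?J h) (?J 0) < e"
    using e by simp
  then obtain d where d: "d > 0" "\<forall>h. dist h 0 < d \<longrightarrow> dist (?J h) (?J 0) < e" by (elim exE conjE)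
  have "?J h < e" if "norm h < d" for h
    using d(2)[rule_format, of h] that by (simp add: dist_norm)
  with d(1) show ?thesis by (intro exI[of _ d]) simp
qed

section \<open>Mollification\<close>

text \<open>The family \<open>s\<^sup>-\<^sup>j exp (-1/s)\<close> (extended by 0 to \<open>s \<le> 0\<close>) is closed under differentiation up to
  linear combinations.\<close>

definition flat :: "nat \<Rightarrow> real \<Rightarrow> real" where
  "flat j s = (if s > 0 then exp (- (1 / s)) / s ^ j else 0)"

lemma flat_nonneg: "flat j s \<ge> 0"
  by (simp add: flat_def)

lemma power_div_fact_le_exp:
  fixes x :: real
  assumes "x \<ge> 0"
  shows "x ^ n / fact n \<le> exp x"
proof -
  have "(\<Sum>k\<in>{n}. x ^ k /\<^sub>R fact k) \<le> (\<Sum>k. x ^ k /\<^sub>R fact k)"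
    using assms by (intro sum_le_suminf summable_exp_generic) auto
  then show ?thesis by (simp add: exp_def divide_inverse mult.commute)
qed

text \<open>The term of index j + 2 of the exponential series at 1/s beats the pole of order j and
  leaves a factor s^2, which makes the difference quotient at 0 vanish.\<close>

lemma flat_le:
  assumes s: "s > 0"
    and c_def: "c = fact (j + 2)"
  shows "flat j s \<le> c * s ^ 2"
proof -
  have c: "c > 0" by (simp add: c_def del: fact_Suc)
  have "(1 / s) ^ (j + 2) / c \<le> exp (1 / s)"
    unfolding c_def using s by (intro power_div_fact_le_exp) simp
  then have "(1 / s) ^ (j + 2) \<le> c * exp (1 / s)"
    by (simp only: pos_divide_le_eq[OF c] mult.commute)
  then have "1 \<le> c * exp (1 / s) * s ^ (j + 2)" using s
    by (simp add: power_divide divide_le_eq)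
  then have "exp (- (1 / s)) * 1 \<le> exp (- (1 / s)) * (c * exp (1 / s) * s ^ (j + 2))"
    by (intro mult_left_mono) auto
  also have "\<dots> = (exp (- (1 / s)) * exp (1 / s)) * c * s ^ (j + 2)" by (simp only: mult_ac)
  also have "\<dots> = c * s ^ 2 * s ^ j" by (simp add: exp_minus power_add power2_eq_square)
  finally show ?thesis using s by (simp add: flat_def divide_le_eq)
qed

lemma flat_has_derivative:
  "(flat j has_real_derivative (flat (j + 2) s - real j * flat (j + 1) s)) (at s)"
proof -
  consider "s > 0" | "s < 0" | "s = 0" by linarith
  then show ?thesis
  proof cases
    case 1
    \<comment> \<open>The exponent j - 1 is a truncated subtraction; the factor j makes the identity
      true also for j = 0.\<close>
    have Q: "real j * s ^ (j - 1) = real j * s ^ j / s" using 1 by (cases j) auto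
    have "((\<lambda>s. exp (- (1 / s)) / s ^ j) has_real_derivative
        (exp (- (1 / s)) * (1 / s\<^sup>2) * s ^ j - exp (- (1 / s)) * (real j * s ^ (j - 1))) / (s ^ j * s ^ j)) (at s)"
      using 1 by (auto intro!: derivative_eq_intros simp: power2_eq_square)
    also have "(exp (- (1 / s)) * (1 / s\<^sup>2) * s ^ j - exp (- (1 / s)) * (real j * s ^ (j - 1))) / (s ^ j * s ^ j)
        = flat (j + 2) s - real j * flat (j + 1) s"
      unfolding Q using 1 by (simp add: flat_def field_simps power_add power2_eq_square)
    finally have "((\<lambda>s. exp (- (1 / s)) / s ^ j) has_real_derivative (flat (j + 2) s - real j * flat (j + 1) s)) (at s)" .
    then show ?thesis
      by (rule DERIV_cong_ev[THEN iffD1, rotated -1, OF _ refl _ refl])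
        (use 1 in \<open>auto simp: flat_def eventually_nhds intro!: exI[of _ "{0<..}"]\<close>)
  next
    case 2
    have "((\<lambda>s. 0) has_real_derivative (flat (j + 2) s - real j * flat (j + 1) s)) (at s)"
      using 2 by (auto simp: flat_def)
    then show ?thesis
      by (rule DERIV_cong_ev[THEN iffD1, rotated -1, OF _ refl _ refl])
        (use 2 in \<open>auto simp: flat_def eventually_nhds intro!: exI[of _ "{..<0}"]\<close>)
  next
    case 3
    obtain c :: real where c: "c = fact (j + 2)" by blast
    then have c0: "c > 0" by (simp del: fact_Suc)
    \<comment> \<open>The difference quotient at 0 is 0 on the left and at most c h on the right by
      \<open>flat_le\<close>.\<close>
    have "((\<lambda>h. (flat j (0 + h) - flat j 0) / h) \<longlongrightarrow> 0) (at 0)"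
    proof (rule Lim_null_comparison)
      show "\<forall>\<^sub>F h in at 0. norm ((flat j (0 + h) - flat j 0) / h) \<le> c * \<bar>h\<bar>"
      proof (intro always_eventually allI)
        fix h :: real
        show "norm ((flat j (0 + h) - flat j 0) / h) \<le> c * \<bar>h\<bar>"
        proof (cases "h > 0")
          case True
          then show ?thesis using flat_le[OF True c] flat_nonneg[of j h]
            by (simp add: flat_def[of _ 0] divide_simps power2_eq_square mult.assoc)
        next
          case False
          then show ?thesis using c0 by (auto simp: flat_def not_less mult_le_0_iff)
        qed
      qed
      show "((\<lambda>h. c * \<bar>h\<bar>) \<longlongrightarrow> 0) (at 0)"
        by (intro tendsto_mult_right_zero tendsto_rabs_zero tendsto_ident_at)
    qed
    then show ?thesis using 3 by (simp add: DERIV_def flat_def)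
  qed
qed

text \<open>This algebra is closed under partial derivatives, so membership alone gives smoothness
  of every order. The bump \<open>flat 0 (e\<^sup>2 - x \<bullet> x)\<close> lies in it.\<close>

inductive smooth_gen :: "('a::euclidean_space \<Rightarrow> real) \<Rightarrow> bool" where
  const: "smooth_gen (\<lambda>x. c)"
| coord: "smooth_gen (\<lambda>x. x \<bullet> i)"
| flat: "smooth_gen (\<lambda>x. flat j (d - x \<bullet> x))"
| add: "smooth_gen f \<Longrightarrow> smooth_gen g \<Longrightarrow> smooth_gen (\<lambda>x. f x + g x)"
| mult: "smooth_gen f \<Longrightarrow> smooth_gen g \<Longrightarrow> smooth_gen (\<lambda>x. f x * g x)"

lemma smooth_gen_deriv:
  assumes "smooth_gen f"
  shows "\<exists>f'. (\<forall>x. (f has_derivative f' x) (at x)) \<and> (\<forall>i. smooth_gen (\<lambda>x. f' x i))"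
  using assms
proof induct
  case (const c)
  show ?case by (intro exI[of _ "\<lambda>x i. 0"]) (auto intro: smooth_gen.intros)
next
  case (coord i)
  show ?case by (intro exI[of _ "\<lambda>x h. h \<bullet> i"]) (auto intro!: smooth_gen.intros derivative_eq_intros)
next
  case (flat j d)
  have "((\<lambda>x::'a. flat j (d - x \<bullet> x)) has_derivative
     (\<lambda>h. (flat (j + 2) (d - x \<bullet> x) + (- real j) * flat (j + 1) (d - x \<bullet> x)) * ((-2) * (x \<bullet> h)))) (at x)" for x
  proof -
    have "((\<lambda>x::'a. d - x \<bullet> x) has_derivative (\<lambda>h. (-2) * (x \<bullet> h))) (at x)"
      by (auto intro!: derivative_eq_intros simp: inner_commute)
    from DERIV_compose_FDERIV[OF flat_has_derivative this, of j]
    show ?thesis by (simp add: mult_ac)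
  qed
  moreover have "smooth_gen (\<lambda>x::'a. (flat (j + 2) (d - x \<bullet> x) + (- real j) * flat (j + 1) (d - x \<bullet> x)) * ((-2) * (x \<bullet> i)))" for i
    by (intro smooth_gen.intros)
  ultimately show ?case
    by (intro exI[of _ "\<lambda>x h. (flat (j + 2) (d - x \<bullet> x) + (- real j) * flat (j + 1) (d - x \<bullet> x)) * ((-2) * (x \<bullet> h))"])
      simp
next
  case (add f g)
  then obtain f' g' where "\<And>x. (f has_derivative f' x) (at x)" "\<And>x. (g has_derivative g' x) (at x)"
    "\<And>i. smooth_gen (\<lambda>x. f' x i)" "\<And>i. smooth_gen (\<lambda>x. g' x i)" by blast
  then show ?case
    by (intro exI[of _ "\<lambda>x h. f' x h + g' x h"]) (auto intro!: smooth_gen.intros has_derivative_add)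
next
  case (mult f g)
  then obtain f' g' where "\<And>x. (f has_derivative f' x) (at x)" "\<And>x. (g has_derivative g' x) (at x)"
    "\<And>i. smooth_gen (\<lambda>x. f' x i)" "\<And>i. smooth_gen (\<lambda>x. g' x i)" by blast
  with mult show ?case
    by (intro exI[of _ "\<lambda>x h. f x * g' x h + f' x h * g x"]) (auto intro!: smooth_gen.intros has_derivative_mult)
qed

lemma smooth_gen_Ck: "smooth_gen f \<Longrightarrow> Ck k f"
proof (induct k arbitrary: f)
  case 0
  from smooth_gen_deriv[OF 0] obtain f' where "\<And>x. (f has_derivative f' x) (at x)" by blast
  then show ?case
    by (auto intro!: has_derivative_continuous_on[of _ f f'] intro: has_derivative_at_withinI)
next
  case (Suc k)
  from smooth_gen_deriv[OF Suc(2)] obtain f' where d: "\<And>x. (f has_derivative f' x) (at x)"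
    and g: "\<And>i. smooth_gen (\<lambda>x. f' x i)" by blast
  have "frechet_derivative f (at x) = f' x" for x using frechet_derivative_at[OF d] by simp
  then show ?case using d g Suc(1) by (auto intro: differentiableI)
qed

section \<open>Mollifiers and convolution\<close>

definition mollifier :: "real \<Rightarrow> ('a::euclidean_space \<Rightarrow> real) \<Rightarrow> bool" where
  "mollifier e \<rho> \<longleftrightarrow> (\<forall>k. Ck k \<rho>) \<and> (\<forall>x. \<rho> x \<ge> 0) \<and> (\<forall>x. norm x > e \<longrightarrow> \<rho> x = 0) \<and>
     integrable lborel \<rho> \<and> (LINT x|lborel. \<rho> x) = 1"

lemma bounded_support_integrable:
  fixes f :: "'a::euclidean_space \<Rightarrow> 'b::euclidean_space"
  assumes "continuous_on UNIV f" "\<And>x. norm x > R \<Longrightarrow> f x = 0"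
  shows "integrable lborel f"
proof -
  have "integrable lborel (\<lambda>x. indicator (cball 0 R) x *\<^sub>R f x)"
    by (intro borel_integrable_compact continuous_on_subset[OF assms(1)]) auto
  also have "(\<lambda>x. indicator (cball 0 R) x *\<^sub>R f x) = f"
    using assms(2) by (force simp: indicator_def)
  finally show ?thesis .
qed

lemma mollifier_exists:
  assumes e: "e > 0"
  shows "\<exists>\<rho>::'a::euclidean_space \<Rightarrow> real. mollifier e \<rho>"
proof -
  define f :: "'a \<Rightarrow> real" where "f x = flat 0 (e\<^sup>2 - x \<bullet> x)" for x
  have sg: "smooth_gen f" unfolding f_def by (rule smooth_gen.flat)
  have cont: "continuous_on UNIV f" using smooth_gen_Ck[OF sg, of 0] by simp
  have supp: "f x = 0" if "norm x > e" for x
  proof -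
    have "e\<^sup>2 < (norm x)\<^sup>2" using that e by (intro power_strict_mono) auto
    then show ?thesis by (simp add: f_def flat_def power2_norm_eq_inner)
  qed
  have int: "integrable lborel f" by (rule bounded_support_integrable[OF cont supp])
  have nn: "f x \<ge> 0" for x by (simp add: f_def flat_nonneg)
  \<comment> \<open>A continuous function that vanishes almost everywhere vanishes everywhere, but f
    is positive at 0.\<close>
  have "(LINT x|lborel. f x) \<noteq> 0"
  proof
    assume "(LINT x|lborel. f x) = 0"
    then have "AE x in lborel. f x = 0"
      using integral_nonneg_eq_0_iff_AE[OF int] nn by auto
    then have "AE x in lebesgue. x \<in> {x. f x = 0}" by (auto intro: AE_completion)
    moreover have "closed {x. f x = 0}" by (intro closed_Collect_eq cont continuous_on_const)
    ultimately have "0 \<in> {x. f x = 0}" by (intro mem_closed_if_AE_lebesgue)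
    then show False using e by (simp add: f_def flat_def)
  qed
  moreover have "(LINT x|lborel. f x) \<ge> 0" using nn by (intro Bochner_Integration.integral_nonneg) auto
  ultimately have pos: "(LINT x|lborel. f x) > 0" by linarith
  define c where "c = (LINT x|lborel. f x)"
  have "smooth_gen (\<lambda>x. (1 / c) * f x)" by (intro smooth_gen.intros sg)
  then have "mollifier e (\<lambda>x. (1 / c) * f x)"
    using nn pos supp int smooth_gen_Ck unfolding mollifier_def by (auto simp: c_def)
  then show ?thesis by blast
qed

lemma frechet_derivative_linear_basis:
  fixes f :: "'a::euclidean_space \<Rightarrow> real"
  assumes "f differentiable (at x)"
  shows "(f has_derivative (\<lambda>h. grad f x \<bullet> h)) (at x)"
proof -
  have d: "(f has_derivative frechet_derivative f (at x)) (at x)" using assms by (simp add: frechet_derivative_works)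
  have "frechet_derivative f (at x) h = grad f x \<bullet> h" for h
  proof -
    have lin: "linear (frechet_derivative f (at x))" using d by (rule has_derivative_linear)
    have "frechet_derivative f (at x) h = frechet_derivative f (at x) (\<Sum>i\<in>Basis. (h \<bullet> i) *\<^sub>R i)"
      by (simp add: euclidean_representation)
    also have "\<dots> = (\<Sum>i\<in>Basis. (h \<bullet> i) * frechet_derivative f (at x) i)"
      using lin by (simp add: linear_sum linear_cmul)
    also have "\<dots> = grad f x \<bullet> h"
      by (simp add: grad_def inner_sum_left inner_sum_right inner_commute mult.commute)
    finally show ?thesis .
  qed
  then show ?thesis using d by (metis (no_types, lifting) ext)
qed

lemma grad_eqI:
  fixes f :: "'a::euclidean_space \<Rightarrow> real"
  assumes "(f has_derivative (\<lambda>h. G \<bullet> h)) (at x)"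
  shows "grad f x = G"
proof -
  have "frechet_derivative f (at x) = (\<lambda>h. G \<bullet> h)" using frechet_derivative_at[OF assms] by simp
  then show ?thesis by (simp add: grad_def euclidean_representation)
qed

lemma grad_inner_Basis:
  "i \<in> Basis \<Longrightarrow> grad f x \<bullet> i = frechet_derivative f (at x) i"
  by (simp add: grad_def inner_sum_left_Basis)

lemma Ck_imp:
  assumes "\<And>k. Ck k f"
  shows Ck_has_derivative: "(f has_derivative (\<lambda>h. grad f x \<bullet> h)) (at x)"
    and Ck_continuous: "continuous_on UNIV f"
    and Ck_grad_continuous: "continuous_on UNIV (grad f)"
    and Ck_partial: "i \<in> Basis \<Longrightarrow> Ck k (\<lambda>x. grad f x \<bullet> i)"
proof -
  show "(f has_derivative (\<lambda>h. grad f x \<bullet> h)) (at x)"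
    using assms[of "Suc 0"] by (intro frechet_derivative_linear_basis) simp
  show "continuous_on UNIV f" using assms[of 0] by simp
  have *: "Ck k (\<lambda>x. grad f x \<bullet> i)" if "i \<in> Basis" for i k
    using assms[of "Suc k"] that by (simp add: grad_inner_Basis)
  then show "i \<in> Basis \<Longrightarrow> Ck k (\<lambda>x. grad f x \<bullet> i)" .
  show "continuous_on UNIV (grad f)"
    using *[of _ 0] by (intro continuous_on_componentwise[THEN iffD2]) auto
qed

lemma derivative_zero_off_closed:
  fixes \<psi> :: "'a::euclidean_space \<Rightarrow> real" and G :: "'a \<Rightarrow> 'a"
  assumes d: "\<And>x. (\<psi> has_derivative (\<lambda>h. G x \<bullet> h)) (at x)"
    and K: "closed K" "\<And>x. x \<notin> K \<Longrightarrow> \<psi> x = 0" and x: "x \<notin> K"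
  shows "G x = 0"
proof -
  have x': "x \<in> - K" using x by simp
  have "((\<lambda>x. 0) has_derivative (\<lambda>h. G x \<bullet> h)) (at x)"
  proof (rule has_derivative_transform_within_open[OF d _ x'])
    show "open (- K)" using K(1) by (rule open_Compl)
    show "\<psi> v = 0" if "v \<in> - K" for v using that by (intro K(2)) (rule ComplD)
  qed
  from has_derivative_unique[OF this has_derivative_const] have "G x \<bullet> G x = 0" by metis
  then show ?thesis by simp
qed

lemma derivative_zero_outside:
  fixes \<psi> :: "'a::euclidean_space \<Rightarrow> real" and G :: "'a \<Rightarrow> 'a"
  assumes d: "\<And>x. (\<psi> has_derivative (\<lambda>h. G x \<bullet> h)) (at x)"
    and supp: "\<And>x. norm x > R \<Longrightarrow> \<psi> x = 0" and that: "norm x > R"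
  shows "G x = 0"
  by (rule derivative_zero_off_closed[OF d closed_cball[of 0 R]]) (use supp that in auto)

text \<open>Differentiation under the integral: G is uniformly continuous, so the linearization
  error of \<psi> is at most |z - x| e' at every base point simultaneously, and this bound
  integrates against |g|.\<close>

lemma convolution_has_derivative:
  fixes g \<psi> :: "'a::euclidean_space \<Rightarrow> real" and G :: "'a \<Rightarrow> 'a"
  assumes g: "integrable lborel g"
    and d: "\<And>x. (\<psi> has_derivative (\<lambda>h. G x \<bullet> h)) (at x)"
    and cG: "continuous_on UNIV G" and supp: "\<And>x. norm x > R \<Longrightarrow> \<psi> x = 0"
  shows "((\<lambda>x. LINT y|lborel. g y * \<psi> (x - y)) has_derivative
      (\<lambda>h. (LINT y|lborel. g y *\<^sub>R G (x - y)) \<bullet> h)) (at x)"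
    and "integrable lborel (\<lambda>y. g y * \<psi> (x - y))"
    and "integrable lborel (\<lambda>y. g y *\<^sub>R G (x - y))"
proof -
  have suppG: "G x = 0" if "norm x > R" for x
    by (rule derivative_zero_outside[where R=R, OF d supp that])
  have c\<psi>: "continuous_on UNIV \<psi>"
    using d by (intro has_derivative_continuous_on) (auto intro: has_derivative_at_withinI)
  have bd: "\<exists>B. \<forall>x. norm (F x) \<le> B" if "continuous_on UNIV F" "\<And>x. norm x > R \<Longrightarrow> F x = 0"
    for F :: "'a \<Rightarrow> 'b::euclidean_space"
  proof -
    have "compact (F ` cball 0 R)" by (intro compact_continuous_image continuous_on_subset[OF that(1)]) auto
    then have "bounded (F ` cball 0 R)" by (rule compact_imp_bounded)
    then obtain B where B: "\<And>x. x \<in> cball 0 R \<Longrightarrow> norm (F x) \<le> B"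
      unfolding bounded_iff by blast
    show ?thesis
    proof (intro exI[of _ "max B 0"] allI)
      fix x show "norm (F x) \<le> max B 0" using B[of x] that(2)[of x] by (cases "norm x > R") auto
    qed
  qed
  obtain B1 where B1: "\<And>x. norm (\<psi> x) \<le> B1" using bd[OF c\<psi> supp] by blast
  obtain B2 where B2: "\<And>x. norm (G x) \<le> B2" using bd[OF cG suppG] by blast
  have [measurable]: "\<psi> \<in> borel_measurable borel" "G \<in> borel_measurable borel"
    using c\<psi> cG by (auto intro: borel_measurable_continuous_onI)
  have [measurable]: "g \<in> borel_measurable borel" using g by (auto dest: borel_measurable_integrable)
  show i1: "integrable lborel (\<lambda>y. g y * \<psi> (x - y))" for x
  proof (rule Bochner_Integration.integrable_bound[OF integrable_mult_left[of B1, OF g]])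
    have "\<bar>\<psi> (x - y)\<bar> \<le> \<bar>B1\<bar>" for y using B1[of "x - y"] by simp
    then show "AE y in lborel. norm (g y * \<psi> (x - y)) \<le> norm (g y * B1)"
      by (intro AE_I2) (simp add: abs_mult mult_left_mono)
  qed measurable
  show i2: "integrable lborel (\<lambda>y. g y *\<^sub>R G (x - y))" for x
  proof (rule Bochner_Integration.integrable_bound[OF integrable_mult_left[of B2, OF g]])
    have "norm (G (x - y)) \<le> \<bar>B2\<bar>" for y using B2[of "x - y"] by simp
    then show "AE y in lborel. norm (g y *\<^sub>R G (x - y)) \<le> norm (g y * B2)"
      by (intro AE_I2) (simp add: abs_mult mult_left_mono)
  qed measurable
  define I where "I = (LINT y|lborel. \<bar>g y\<bar>)"
  have I0: "I \<ge> 0" unfolding I_def by (intro Bochner_Integration.integral_nonneg) auto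
  have uc: "uniformly_continuous_on UNIV G"
  proof -
    have "uniformly_continuous_on (cball 0 (R + 1)) G"
      by (intro compact_uniformly_continuous continuous_on_subset[OF cG]) auto
    show ?thesis unfolding uniformly_continuous_on_def
    proof safe
      fix e :: real assume "e > 0"
      then obtain d where d: "d > 0"
        "\<And>x x'. x \<in> cball 0 (R+1) \<Longrightarrow> x' \<in> cball 0 (R+1) \<Longrightarrow> dist x' x < d \<Longrightarrow> dist (G x') (G x) < e"
        using uniformly_continuous_onE[OF \<open>uniformly_continuous_on (cball 0 (R + 1)) G\<close>] by metis
      show "\<exists>d>0. \<forall>x\<in>UNIV. \<forall>x'\<in>UNIV. dist x' x < d \<longrightarrow> dist (G x') (G x) < e"
      proof (intro exI[of _ "min d 1"] conjI ballI impI)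
        fix x x' :: 'a assume dd: "dist x' x < min d 1"
        show "dist (G x') (G x) < e"
        \<comment> \<open>Two points at distance below 1 either both lie in the ball of radius R +
          1, or both lie outside the support.\<close>
        proof (cases "norm x \<le> R \<or> norm x' \<le> R")
          case True
          have "norm x' \<le> norm x + 1" "norm x \<le> norm x' + 1"
            using dd norm_triangle_ineq2[of x' x] norm_triangle_ineq2[of x x']
            by (auto simp: dist_norm norm_minus_commute)
          then show ?thesis using True dd by (intro d(2)) auto
        next
          case False
          then show ?thesis using suppG \<open>e > 0\<close> by simp
        qed
      qed (use d in auto)
    qed
  qed
  show "((\<lambda>x. LINT y|lborel. g y * \<psi> (x - y)) has_derivative
      (\<lambda>h. (LINT y|lborel. g y *\<^sub>R G (x - y)) \<bullet> h)) (at x)"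
    unfolding has_derivative_at_alt
  proof (intro conjI allI impI)
    show "bounded_linear (\<lambda>h. (LINT y|lborel. g y *\<^sub>R G (x - y)) \<bullet> h)" by (rule bounded_linear_inner_right)
    fix e :: real assume e: "e > 0"
    define e' where "e' = e / (I + 1)"
    have e': "e' > 0" using e I0 by (simp add: e'_def)
    obtain \<delta> where \<delta>: "\<delta> > 0" "\<And>x x'. dist x' x < \<delta> \<Longrightarrow> dist (G x') (G x) < e'"
      using uniformly_continuous_onE[OF uc e'] UNIV_I by metis
    have lin: "norm (\<psi> b - \<psi> a - G a \<bullet> (b - a)) \<le> norm (b - a) * e'" if ab: "norm (b - a) < \<delta>" for a b
    proof (rule differentiable_bound_linearization[where S="ball a \<delta>" and f'="\<lambda>x h. G x \<bullet> h"])
      show "a + t *\<^sub>R (b - a) \<in> ball a \<delta>" if "t \<in> {0..1}" for t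
      proof -
        have "\<bar>t\<bar> * norm (b - a) \<le> 1 * norm (b - a)" using that by (intro mult_right_mono) auto
        then show ?thesis using ab by (simp add: dist_norm)
      qed
      show "onorm ((\<lambda>h. G z \<bullet> h) - (\<lambda>h. G a \<bullet> h)) \<le> e'" if "z \<in> ball a \<delta>" for z
      proof -
        have "onorm (\<lambda>h. (G z - G a) \<bullet> h) \<le> norm (G z - G a)"
        proof (rule onorm_bound)
          show "norm ((G z - G a) \<bullet> h) \<le> norm (G z - G a) * norm h" for h
            using Cauchy_Schwarz_ineq2 by auto
        qed simp
        also have "\<dots> \<le> e'" using \<delta>(2)[of z a] that by (simp add: dist_norm norm_minus_commute)
        finally show ?thesis by (simp add: inner_diff_left fun_diff_def)
      qed
      show "(\<psi> has_derivative (\<lambda>h. G z \<bullet> h)) (at z within ball a \<delta>)" for z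
        by (rule has_derivative_at_withinI[OF d])
      show "a \<in> ball a \<delta>" using \<delta>(1) by simp
    qed
    show "\<exists>d>0. \<forall>z. norm (z - x) < d \<longrightarrow>
       norm ((LINT y|lborel. g y * \<psi> (z - y)) - (LINT y|lborel. g y * \<psi> (x - y)) -
         (LINT y|lborel. g y *\<^sub>R G (x - y)) \<bullet> (z - x)) \<le> e * norm (z - x)"
    proof (intro exI[of _ \<delta>] conjI allI impI)
      fix z assume z: "norm (z - x) < \<delta>"
      have i3: "integrable lborel (\<lambda>y. (g y *\<^sub>R G (x - y)) \<bullet> (z - x))"
        by (rule integrable_inner_left[OF i2])
      have eq3: "(LINT y|lborel. g y *\<^sub>R G (x - y)) \<bullet> (z - x) = (LINT y|lborel. (g y *\<^sub>R G (x - y)) \<bullet> (z - x))"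
        by (rule integral_inner_left[symmetric, OF i2])
      have "(LINT y|lborel. g y * \<psi> (z - y)) - (LINT y|lborel. g y * \<psi> (x - y)) -
         (LINT y|lborel. g y *\<^sub>R G (x - y)) \<bullet> (z - x)
        = (LINT y|lborel. g y * \<psi> (z - y) - g y * \<psi> (x - y) - (g y *\<^sub>R G (x - y)) \<bullet> (z - x))"
        unfolding eq3 using i1 i3 by (simp only: Bochner_Integration.integral_diff Bochner_Integration.integrable_diff)
      also have "norm \<dots> \<le> (LINT y|lborel. \<bar>g y\<bar> * (norm (z - x) * e'))"
      proof (rule Bochner_Integration.integral_norm_bound_integral)
        show "norm (g y * \<psi> (z - y) - g y * \<psi> (x - y) - (g y *\<^sub>R G (x - y)) \<bullet> (z - x)) \<le> \<bar>g y\<bar> * (norm (z - x) * e')" for y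
        proof -
          have "g y * \<psi> (z - y) - g y * \<psi> (x - y) - (g y *\<^sub>R G (x - y)) \<bullet> (z - x)
            = g y * (\<psi> (z - y) - \<psi> (x - y) - G (x - y) \<bullet> ((z - y) - (x - y)))"
            by (simp add: algebra_simps)
          also have "norm \<dots> \<le> \<bar>g y\<bar> * (norm ((z - y) - (x - y)) * e')"
            unfolding norm_mult using z by (intro mult_mono lin) auto
          finally show ?thesis by simp
        qed
      qed (intro Bochner_Integration.integrable_diff i1 i3 integrable_mult_left integrable_abs g)+
      also have "\<dots> = I * (norm (z - x) * e')" by (simp add: I_def)
      also have "\<dots> \<le> e * norm (z - x)"
      proof -
        have "I * e' \<le> e" using I0 e by (simp add: e'_def field_simps)
        then show ?thesis using mult_right_mono[of "I * e'" e "norm (z - x)"] by (simp add: mult.assoc mult.commute mult.left_commute)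
      qed
      finally show "norm ((LINT y|lborel. g y * \<psi> (z - y)) - (LINT y|lborel. g y * \<psi> (x - y)) -
         (LINT y|lborel. g y *\<^sub>R G (x - y)) \<bullet> (z - x)) \<le> e * norm (z - x)" .
    qed (use \<delta> in auto)
  qed
qed

text \<open>All derivatives fall on the kernel, whose partial derivatives are again smooth with the
  same support bound; hence the induction on k generalises over \<rho>.\<close>

lemma convolution_Ck:
  fixes g :: "'a::euclidean_space \<Rightarrow> real"
  assumes g: "integrable lborel g"
  shows "(\<And>k. Ck k \<rho>) \<Longrightarrow> (\<And>x. norm x > R \<Longrightarrow> \<rho> x = 0) \<Longrightarrow> Ck k (\<lambda>x. LINT y|lborel. g y * \<rho> (x - y))"
proof (induct k arbitrary: \<rho>)
  case 0
  note D = convolution_has_derivative[where R=R, OF g Ck_has_derivative[OF 0(1)] Ck_grad_continuous[OF 0(1)] 0(2)]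
  show ?case
    using has_derivative_continuous_on[OF has_derivative_at_withinI[OF D(1)], of UNIV] by simp
next
  case (Suc k)
  note D = convolution_has_derivative[where R=R, OF g Ck_has_derivative[OF Suc(2)] Ck_grad_continuous[OF Suc(2)] Suc(3)]
  have "frechet_derivative (\<lambda>x. LINT y|lborel. g y * \<rho> (x - y)) (at x) i
     = (LINT y|lborel. g y * (grad \<rho> (x - y) \<bullet> i))" for x i
  proof -
    have "frechet_derivative (\<lambda>x. LINT y|lborel. g y * \<rho> (x - y)) (at x) i
       = (LINT y|lborel. g y *\<^sub>R grad \<rho> (x - y)) \<bullet> i"
      using frechet_derivative_at[OF D(1)[of x]] by metis
    also have "\<dots> = (LINT y|lborel. (g y *\<^sub>R grad \<rho> (x - y)) \<bullet> i)"
      by (rule integral_inner_left[symmetric, OF D(3)])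
    finally show ?thesis by simp
  qed
  moreover have "Ck k (\<lambda>x. LINT y|lborel. g y * (grad \<rho> (x - y) \<bullet> i))" if "i \<in> Basis" for i
    using derivative_zero_outside[where R=R, OF Ck_has_derivative[OF Suc(2)] Suc(3)]
    by (intro Suc(1) Ck_partial Suc(2) that) auto
  moreover have "(\<lambda>x. LINT y|lborel. g y * \<rho> (x - y)) differentiable at x" for x
    using D(1)[of x] by (rule differentiableI)
  ultimately show ?case by simp
qed

lemma Ck_uminus: "Ck k f \<Longrightarrow> Ck k (\<lambda>x. - f x)"
proof (induct k arbitrary: f)
  case (Suc k)
  have "frechet_derivative (\<lambda>x. - f x) (at x) = (\<lambda>h. - frechet_derivative f (at x) h)" for x
    using Suc(2) by (intro frechet_derivative_at[symmetric] has_derivative_minus) (simp add: frechet_derivative_works)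
  then show ?case using Suc by (auto intro: differentiable_minus)
qed (auto intro: continuous_intros)

lemma Ck_reflect: "Ck k f \<Longrightarrow> Ck k (\<lambda>y. f (x - y))"
proof (induct k arbitrary: f)
  case 0
  then show ?case by (auto intro!: continuous_on_compose2[of UNIV f] continuous_intros)
next
  case (Suc k)
  have d: "((\<lambda>y. f (x - y)) has_derivative (\<lambda>h. - frechet_derivative f (at (x - y)) h)) (at y)" for y
  proof -
    have f: "(f has_derivative frechet_derivative f (at (x - y))) (at (x - y))"
      using Suc(2) by (simp add: frechet_derivative_works)
    have "((\<lambda>y. x - y) has_derivative (\<lambda>h. - h)) (at y)" by (auto intro!: derivative_eq_intros)
    from has_derivative_compose[OF this f]
    show ?thesis using linear_neg[OF has_derivative_linear[OF f]] by simp
  qed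
  then have "frechet_derivative (\<lambda>y. f (x - y)) (at y) = (\<lambda>h. - frechet_derivative f (at (x - y)) h)" for y
    by (metis frechet_derivative_at)
  moreover have "Ck k (\<lambda>y. - frechet_derivative f (at (x - y)) i)" if "i \<in> Basis" for i
    using Suc(1)[OF Ck_uminus, of "\<lambda>z. frechet_derivative f (at z) i"] Suc(2) that by simp
  ultimately show ?case using d by (auto intro: differentiableI)
qed

lemma test_functionsI:
  assumes "\<And>k. Ck k \<phi>" "compact K" "K \<subseteq> U" "\<And>x. x \<notin> K \<Longrightarrow> \<phi> x = 0"
  shows "\<phi> \<in> test_functions U"
proof -
  have "{x. \<phi> x \<noteq> 0} \<subseteq> K" using assms(4) by auto
  then have sub: "closure {x. \<phi> x \<noteq> 0} \<subseteq> K"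
    using assms(2) by (intro closure_minimal compact_imp_closed)
  then have "compact (closure {x. \<phi> x \<noteq> 0})"
    by (metis assms(2) closed_closure compact_Int_closed inf.absorb2)
  then show ?thesis using assms sub by (auto simp: test_functions_def)
qed

section \<open>Convergence of mollifications in L^p\<close>

lemma lborel_reflect:
  fixes f :: "'a::euclidean_space \<Rightarrow> 'b::{banach, second_countable_topology}" and a :: 'a
  assumes f: "f \<in> borel_measurable borel"
  shows "(LINT x|lborel. f (a - x)) = (LINT x|lborel. f x)"
    and "integrable lborel (\<lambda>x. f (a - x)) \<longleftrightarrow> integrable lborel f"
proof -
  have *: "distr lborel borel (\<lambda>x. a - x) = lborel"
    using lborel_affine[of "-1" a] by (simp add: density_1 one_ennreal_def[symmetric])
  have "(LINT x|lborel. f x) = (LINT x|distr lborel borel (\<lambda>x. a - x). f x)"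
    by (simp add: *)
  also have "\<dots> = (LINT x|lborel. f (a - x))" using f by (intro integral_distr) auto
  finally show "(LINT x|lborel. f (a - x)) = (LINT x|lborel. f x)" by simp
  have "integrable (distr lborel borel (\<lambda>x. a - x)) f \<longleftrightarrow> integrable lborel (\<lambda>x. f (a - x))"
    using f by (intro integrable_distr_eq) auto
  then show "integrable lborel (\<lambda>x. f (a - x)) \<longleftrightarrow> integrable lborel f" by (simp add: *)
qed

text \<open>Either t is at most h, or t^(1-p) is at most h^(1-p). As h can be chosen afterwards,
  this is the source of the Jensen-type bound below.\<close>

lemma le_add_powr:
  fixes t h p :: real
  assumes "t \<ge> 0" "h > 0" "p \<ge> 1"
  shows "t \<le> h + t powr p * h powr (1 - p)"
proof (cases "t \<le> h")
  case False
  then have "t powr p * t powr (1 - p) \<le> t powr p * h powr (1 - p)"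
    using assms by (intro mult_left_mono powr_mono2') auto
  moreover have "t powr p * t powr (1 - p) = t" using False assms by (simp add: powr_add[symmetric])
  ultimately show ?thesis using assms by linarith
qed (use assms in \<open>simp add: add_increasing2\<close>)

text \<open>Jensen's inequality for the probability density w, up to the factor 2 powr p. Bounding
  |g| by \<open>le_add_powr\<close> with h equal to half the absolute mean allows h to be absorbed.
  The right side is an extended integral, so it may be infinite.\<close>

lemma powr_integral_le:
  fixes w g :: "'a \<Rightarrow> real"
  assumes w: "integrable M w" "(LINT x|M. w x) = 1" "\<And>x. w x \<ge> 0"
    and g: "integrable M (\<lambda>x. w x * g x)" and p: "p \<ge> 1"
    and gm: "g \<in> borel_measurable M"
  shows "ennreal (\<bar>LINT x|M. w x * g x\<bar> powr p) \<le> 2 powr p * (\<integral>\<^sup>+x. ennreal (w x * \<bar>g x\<bar> powr p) \<partial>M)"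
proof (cases "(\<integral>\<^sup>+x. ennreal (w x * \<bar>g x\<bar> powr p) \<partial>M) = \<infinity> \<or> (LINT x|M. w x * g x) = 0")
  case True
  then show ?thesis by (auto simp: ennreal_mult_top)
next
  case False
  note [measurable] = gm borel_measurable_integrable[OF w(1)]
  have fin: "integrable M (\<lambda>x. w x * \<bar>g x\<bar> powr p)"
    using False w(3) by (intro integrableI_nonneg) (auto simp: top.not_eq_extremum)
  define h where "h = \<bar>LINT x|M. w x * g x\<bar> / 2"
  have h: "h > 0" using False by (simp add: h_def)
  have "2 * h \<le> (LINT x|M. w x * h + (w x * \<bar>g x\<bar> powr p) * h powr (1 - p))"
  proof -
    have "2 * h \<le> (LINT x|M. \<bar>w x * g x\<bar>)" unfolding h_def using integral_abs_bound by simp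
    also have "\<dots> \<le> (LINT x|M. w x * h + (w x * \<bar>g x\<bar> powr p) * h powr (1 - p))"
    proof (rule integral_mono)
      fix x
      have "w x * \<bar>g x\<bar> \<le> w x * (h + \<bar>g x\<bar> powr p * h powr (1 - p))"
        using h p w(3) by (intro mult_left_mono le_add_powr) auto
      then show "\<bar>w x * g x\<bar> \<le> w x * h + (w x * \<bar>g x\<bar> powr p) * h powr (1 - p)"
        using w(3)[of x] by (simp add: abs_mult algebra_simps)
    qed (use g w fin in auto)
    finally show ?thesis .
  qed
  also have "\<dots> = h + (LINT x|M. w x * \<bar>g x\<bar> powr p) * h powr (1 - p)"
    using w fin by simp
  finally have "h \<le> (LINT x|M. w x * \<bar>g x\<bar> powr p) * h powr (1 - p)" by simp
  then have "h * h powr (p - 1) \<le> (LINT x|M. w x * \<bar>g x\<bar> powr p) * h powr (1 - p) * h powr (p - 1)"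
    by (intro mult_right_mono) auto
  also have "\<dots> = (LINT x|M. w x * \<bar>g x\<bar> powr p)" using h by (simp add: mult.assoc powr_add[symmetric])
  also have "h * h powr (p - 1) = h powr p" using h powr_add[of h 1 "p - 1"] by simp
  finally have "h powr p \<le> (LINT x|M. w x * \<bar>g x\<bar> powr p)" .
  moreover have "\<bar>LINT x|M. w x * g x\<bar> powr p = 2 powr p * h powr p"
    by (simp add: h_def powr_mult[symmetric])
  ultimately have "\<bar>LINT x|M. w x * g x\<bar> powr p \<le> 2 powr p * (LINT x|M. w x * \<bar>g x\<bar> powr p)" by simp
  then have "ennreal (\<bar>LINT x|M. w x * g x\<bar> powr p) \<le> ennreal (2 powr p) * ennreal (LINT x|M. w x * \<bar>g x\<bar> powr p)"
    by (simp add: ennreal_mult''[symmetric] w(3) Bochner_Integration.integral_nonneg ennreal_leI)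
  also have "ennreal (LINT x|M. w x * \<bar>g x\<bar> powr p) = (\<integral>\<^sup>+x. ennreal (w x * \<bar>g x\<bar> powr p) \<partial>M)"
    using fin w(3) by (intro nn_integral_eq_integral[symmetric]) auto
  finally show ?thesis .
qed

lemma mollifierD:
  assumes "mollifier e \<rho>"
  shows "\<And>k. Ck k \<rho>" "\<And>x. \<rho> x \<ge> 0" "\<And>x. norm x > e \<Longrightarrow> \<rho> x = 0"
    "integrable lborel \<rho>" "(LINT x|lborel. \<rho> x) = 1" "\<rho> \<in> borel_measurable borel"
  using assms by (auto simp: mollifier_def intro!: borel_measurable_continuous_onI Ck_continuous)

text \<open>Since \<rho> has integral 1, c x - f x is the \<rho>-average of f (x - z) - f x.
  \<open>powr_integral_le\<close> and Tonelli's theorem reduce its L^p size to that of translations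
  by at most e.\<close>

lemma mollify_Lp_bound:
  fixes f \<rho> :: "'a::euclidean_space \<Rightarrow> real"
  assumes f: "integrable lborel f" and fp: "integrable lborel (\<lambda>x. \<bar>f x\<bar> powr p)" and p: "p \<ge> 1"
    and m: "mollifier e \<rho>" and B: "\<And>h. norm h \<le> e \<Longrightarrow> (LINT x|lborel. \<bar>f (x + h) - f x\<bar> powr p) \<le> B"
  defines "c \<equiv> \<lambda>x. LINT y|lborel. f y * \<rho> (x - y)"
  shows "integrable lborel (\<lambda>x. \<bar>c x - f x\<bar> powr p)"
    and "(LINT x|lborel. \<bar>c x - f x\<bar> powr p) \<le> 2 powr p * B"
    and "c \<in> borel_measurable borel"
proof -
  note M = mollifierD[OF m]
  note [measurable] = M(6)
  have fm[measurable]: "f \<in> borel_measurable borel" using f by (auto dest: borel_measurable_integrable)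
  note D = convolution_has_derivative[where R=e, OF f Ck_has_derivative[OF M(1)] Ck_grad_continuous[OF M(1)] M(3)]
  show cm[measurable]: "c \<in> borel_measurable borel"
    using has_derivative_continuous_on[OF has_derivative_at_withinI[OF D(1)], of UNIV]
    unfolding c_def by (intro borel_measurable_continuous_onI) simp
  have eq: "c x - f x = (LINT z|lborel. \<rho> z * (f (x - z) - f x))"
    and int: "integrable lborel (\<lambda>z. \<rho> z * (f (x - z) - f x))" for x
  proof -
    have i1: "integrable lborel (\<lambda>z. f (x - z) * \<rho> z)"
      using lborel_reflect(2)[of "\<lambda>y. f y * \<rho> (x - y)" x] D(2)[of x] by simp
    have "c x = (LINT z|lborel. f (x - z) * \<rho> z)"
      unfolding c_def using lborel_reflect(1)[of "\<lambda>y. f y * \<rho> (x - y)" x] by simp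
    moreover have "f x = (LINT z|lborel. \<rho> z * f x)" using M by simp
    ultimately have "c x - f x = (LINT z|lborel. f (x - z) * \<rho> z) - (LINT z|lborel. \<rho> z * f x)" by linarith
    also have "\<dots> = (LINT z|lborel. f (x - z) * \<rho> z - \<rho> z * f x)"
      by (intro Bochner_Integration.integral_diff[symmetric] i1 integrable_mult_left M)
    finally show "c x - f x = (LINT z|lborel. \<rho> z * (f (x - z) - f x))" by (simp add: algebra_simps)
    show "integrable lborel (\<lambda>z. \<rho> z * (f (x - z) - f x))"
      using Bochner_Integration.integrable_diff[OF i1 integrable_mult_left[OF M(4), of "f x"]]
      by (simp add: algebra_simps)
  qed
  have "(\<integral>\<^sup>+x. ennreal (\<bar>c x - f x\<bar> powr p) \<partial>lborel)
     \<le> (\<integral>\<^sup>+x. 2 powr p * (\<integral>\<^sup>+z. ennreal (\<rho> z * \<bar>f (x - z) - f x\<bar> powr p) \<partial>lborel) \<partial>lborel)"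
    unfolding eq by (intro nn_integral_mono powr_integral_le M int p) simp
  also have "\<dots> = 2 powr p * (\<integral>\<^sup>+x. (\<integral>\<^sup>+z. ennreal (\<rho> z * \<bar>f (x - z) - f x\<bar> powr p) \<partial>lborel) \<partial>lborel)"
    by (intro nn_integral_cmult) measurable
  also have "(\<integral>\<^sup>+x. (\<integral>\<^sup>+z. ennreal (\<rho> z * \<bar>f (x - z) - f x\<bar> powr p) \<partial>lborel) \<partial>lborel)
     = (\<integral>\<^sup>+z. (\<integral>\<^sup>+x. ennreal (\<rho> z * \<bar>f (x - z) - f x\<bar> powr p) \<partial>lborel) \<partial>lborel)"
    by (intro lborel_pair.Fubini'[symmetric]) measurable
  also have "\<dots> \<le> (\<integral>\<^sup>+z. ennreal (\<rho> z * B) \<partial>lborel)"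
  proof (intro nn_integral_mono)
    fix z
    show "(\<integral>\<^sup>+x. ennreal (\<rho> z * \<bar>f (x - z) - f x\<bar> powr p) \<partial>lborel) \<le> ennreal (\<rho> z * B)"
    proof (cases "norm z > e")
      case False
      have i: "integrable lborel (\<lambda>x. \<rho> z * \<bar>f (x - z) - f x\<bar> powr p)"
        using integrable_powr_translate_diff[OF fm fp p, of "-z"] by simp
      have "(\<integral>\<^sup>+x. ennreal (\<rho> z * \<bar>f (x - z) - f x\<bar> powr p) \<partial>lborel)
         = ennreal (LINT x|lborel. \<rho> z * \<bar>f (x - z) - f x\<bar> powr p)"
        using i M(2) by (intro nn_integral_eq_integral) auto
      also have "\<dots> \<le> ennreal (\<rho> z * B)"
        using B[of "-z"] False M(2)[of z] by (intro ennreal_leI) (auto intro!: mult_left_mono)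
      finally show ?thesis .
    qed (simp add: M(3))
  qed
  also have "\<dots> = ennreal (LINT z|lborel. \<rho> z * B)"
  proof (intro nn_integral_eq_integral)
    have "0 \<le> (LINT x|lborel. \<bar>f (x + 0) - f x\<bar> powr p)" by simp
    show "AE z in lborel. 0 \<le> \<rho> z * B"
    proof (rule AE_I2)
      fix z show "0 \<le> \<rho> z * B"
      proof (cases "norm z > e")
        case False
        have "0 \<le> (LINT x|lborel. \<bar>f (x + z) - f x\<bar> powr p)" by (intro Bochner_Integration.integral_nonneg) simp
        also have "\<dots> \<le> B" using False by (intro B) simp
        finally show ?thesis using M(2)[of z] by simp
      qed (simp add: M(3))
    qed
  qed (use M in auto)
  also have "(LINT z|lborel. \<rho> z * B) = B" using M by simp
  finally have le: "(\<integral>\<^sup>+x. ennreal (\<bar>c x - f x\<bar> powr p) \<partial>lborel) \<le> 2 powr p * ennreal B"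
    by (simp add: mult_left_mono)
  show i: "integrable lborel (\<lambda>x. \<bar>c x - f x\<bar> powr p)"
    using le by (intro integrableI_nonneg) (auto simp: ennreal_mult_less_top intro: le_less_trans)
  have "0 \<le> (LINT x|lborel. \<bar>f (x + 0) - f x\<bar> powr p)" by simp
  have B0: "0 \<le> B"
  proof -
    \<comment> \<open>The kernel has integral 1, so it is not identically 0 and some z has norm at
      most e; at that shift B dominates a nonnegative integral.\<close>
    have "\<exists>z::'a. \<not> norm z > e"
    proof (rule ccontr)
      assume "\<not> ?thesis"
      then have "\<rho> = (\<lambda>z. 0)" using M(3) by (intro ext) blast
      then show False using M(5) by simp
    qed
    then obtain z :: 'a where "norm z \<le> e" using not_less by blast
    have "0 \<le> (LINT x|lborel. \<bar>f (x + z) - f x\<bar> powr p)" by (intro Bochner_Integration.integral_nonneg) simp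
    also have "\<dots> \<le> B" using \<open>norm z \<le> e\<close> by (intro B)
    finally show ?thesis .
  qed
  have "ennreal (LINT x|lborel. \<bar>c x - f x\<bar> powr p) = (\<integral>\<^sup>+x. ennreal (\<bar>c x - f x\<bar> powr p) \<partial>lborel)"
    using i by (intro nn_integral_eq_integral[symmetric]) auto
  also have "\<dots> \<le> ennreal (2 powr p * B)" using le B0 by (simp add: ennreal_mult)
  finally show "(LINT x|lborel. \<bar>c x - f x\<bar> powr p) \<le> 2 powr p * B"
    using B0 by (subst (asm) ennreal_le_iff) auto
qed

definition mollifiers :: "(nat \<Rightarrow> 'a::euclidean_space \<Rightarrow> real) \<Rightarrow> bool" where
  "mollifiers \<rho> \<longleftrightarrow> (\<forall>n. mollifier (inverse (real (Suc n))) (\<rho> n))"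

lemma mollifiers_exist: "\<exists>\<rho>::nat \<Rightarrow> 'a::euclidean_space \<Rightarrow> real. mollifiers \<rho>"
proof -
  have "\<forall>n. \<exists>\<rho>::'a \<Rightarrow> real. mollifier (inverse (real (Suc n))) \<rho>"
    by (intro allI mollifier_exists) simp
  then show ?thesis unfolding mollifiers_def by (rule choice)
qed

lemma mollify_Lp:
  fixes f :: "'a::euclidean_space \<Rightarrow> real"
  assumes f: "integrable lborel f" and fp: "integrable lborel (\<lambda>x. \<bar>f x\<bar> powr p)" and p: "p \<ge> 1"
    and m: "mollifiers \<rho>"
  shows "integrable lborel (\<lambda>x. \<bar>(LINT y|lborel. f y * \<rho> n (x - y)) - f x\<bar> powr p)"
    and "(\<lambda>n. LINT x|lborel. \<bar>(LINT y|lborel. f y * \<rho> n (x - y)) - f x\<bar> powr p) \<longlonglongrightarrow> 0"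
proof -
  let ?c = "\<lambda>n x. LINT y|lborel. f y * \<rho> n (x - y)"
  have m': "mollifier (inverse (real (Suc n))) (\<rho> n)" for n using m by (simp add: mollifiers_def)
  have fm: "f \<in> borel_measurable borel" using f by (auto dest: borel_measurable_integrable)
  \<comment> \<open>This crude bound on all translations serves the integrability claim; the
    convergence below uses the modulus from \<open>translation_Lp_ex\<close>.\<close>
  define B where "B = 2 powr p * (2 * (LINT x|lborel. \<bar>f x\<bar> powr p))"
  have B: "(LINT x|lborel. \<bar>f (x + h) - f x\<bar> powr p) \<le> B" for h
  proof -
    have fph: "integrable lborel (\<lambda>x. \<bar>f (x + h)\<bar> powr p)" by (rule lborel_translate_integrable[OF fp])
    have eqh: "(LINT x|lborel. \<bar>f (x + h)\<bar> powr p) = (LINT x|lborel. \<bar>f x\<bar> powr p)"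
      using lborel_translate(1)[of "\<lambda>x. \<bar>f x\<bar> powr p" h] fm by simp
    have "(LINT x|lborel. \<bar>f (x + h) - f x\<bar> powr p)
      \<le> (LINT x|lborel. 2 powr p * (\<bar>f (x + h)\<bar> powr p + \<bar>f x\<bar> powr p))"
    proof (rule integral_mono[OF integrable_powr_translate_diff[OF fm fp p]])
      fix x
      have "\<bar>f (x + h) - f x\<bar> powr p \<le> (\<bar>f (x + h)\<bar> + \<bar>f x\<bar>) powr p" using p by (intro powr_mono2) auto
      also have "\<dots> \<le> 2 powr p * (\<bar>f (x + h)\<bar> powr p + \<bar>f x\<bar> powr p)" using p by (intro powr_add_le) auto
      finally show "\<bar>f (x + h) - f x\<bar> powr p \<le> 2 powr p * (\<bar>f (x + h)\<bar> powr p + \<bar>f x\<bar> powr p)" .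
    qed (use fp fph in auto)
    also have "\<dots> = B" using fp fph eqh by (simp add: B_def)
    finally show ?thesis .
  qed
  show "integrable lborel (\<lambda>x. \<bar>?c n x - f x\<bar> powr p)"
    using mollify_Lp_bound(1)[OF f fp p m' B] .
  show "(\<lambda>n. LINT x|lborel. \<bar>?c n x - f x\<bar> powr p) \<longlonglongrightarrow> 0"
  proof (rule LIMSEQ_I)
    fix r :: real assume r: "r > 0"
    define e where "e = r / (2 * 2 powr p)"
    have e: "e > 0" using r by (simp add: e_def)
    obtain d where d: "d > 0" "\<And>h. norm h < d \<Longrightarrow> (LINT x|lborel. \<bar>f (x + h) - f x\<bar> powr p) < e"
      using translation_Lp_ex[OF fm fp p e] by blast
    obtain N where N: "inverse (real (Suc N)) < d" using reals_Archimedean[OF d(1)] by blast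
    have "norm ((LINT x|lborel. \<bar>?c n x - f x\<bar> powr p) - 0) < r" if "n \<ge> N" for n
    proof -
      have "inverse (real (Suc n)) \<le> inverse (real (Suc N))" using that by (intro le_imp_inverse_le) auto
      then have "(LINT x|lborel. \<bar>?c n x - f x\<bar> powr p) \<le> 2 powr p * e"
        using N by (intro mollify_Lp_bound(2)[OF f fp p m'] less_imp_le d) linarith
      also have "\<dots> < r" using r by (simp add: e_def)
      moreover have "0 \<le> (LINT x|lborel. \<bar>?c n x - f x\<bar> powr p)" by (intro Bochner_Integration.integral_nonneg) simp
      ultimately show ?thesis by simp
    qed
    then show "\<exists>N. \<forall>n\<ge>N. norm ((LINT x|lborel. \<bar>?c n x - f x\<bar> powr p) - 0) < r" by blast
  qed
qed

lemma mollifier_test: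
  assumes m: "mollifier e \<rho>" and sub: "cball x e \<subseteq> U"
  shows "(\<lambda>y. \<rho> (x - y)) \<in> test_functions U"
proof (rule test_functionsI[OF _ _ sub])
  show "Ck k (\<lambda>y. \<rho> (x - y))" for k by (intro Ck_reflect mollifierD[OF m])
  show "\<rho> (x - y) = 0" if "y \<notin> cball x e" for y
    using that by (intro mollifierD(3)[OF m]) (simp add: dist_norm)
qed simp

text \<open>The mollification of g at x is the pairing of g with a kernel centred at x, a test
  function in U as soon as its radius is small. L^1 convergence gives convergence almost everywhere
  along a subsequence, and signs survive the limit.\<close>

lemma AE_nonneg_if_test_nonneg:
  fixes g :: "'a::euclidean_space \<Rightarrow> real"
  assumes g: "integrable lborel g" and U: "open U"
    and t: "\<And>\<phi>. \<phi> \<in> test_functions U \<Longrightarrow> (\<And>x. \<phi> x \<ge> 0) \<Longrightarrow> (LINT x|lborel. g x * \<phi> x) \<ge> 0"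
  shows "AE x in lborel. x \<in> U \<longrightarrow> g x \<ge> 0"
proof -
  obtain \<rho> :: "nat \<Rightarrow> 'a \<Rightarrow> real" where m: "mollifiers \<rho>" using mollifiers_exist by blast
  then have m': "mollifier (inverse (real (Suc n))) (\<rho> n)" for n by (simp add: mollifiers_def)
  let ?c = "\<lambda>n x. LINT y|lborel. g y * \<rho> n (x - y)"
  have gm[measurable]: "g \<in> borel_measurable borel" using g by (auto dest: borel_measurable_integrable)
  have gp: "integrable lborel (\<lambda>x. \<bar>g x\<bar> powr 1)" using g by simp
  note L = mollify_Lp[OF g gp _ m]
  have cm[measurable]: "?c n \<in> borel_measurable borel" for n
    using convolution_Ck[where k=0 and R="inverse (real (Suc n))", OF g mollifierD(1)[OF m'] mollifierD(3)[OF m']]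
    by (intro borel_measurable_continuous_onI) simp
  have "integrable lborel (\<lambda>x. ?c n x - g x)" for n
    by (rule Bochner_Integration.integrable_bound[OF L(1)[of n]]) auto
  moreover have "(\<lambda>n. LINT x|lborel. norm (?c n x - g x)) \<longlonglongrightarrow> 0" using L(2) by simp
  ultimately obtain r :: "nat \<Rightarrow> nat" where r: "strict_mono r" and
    ae: "AE x in lborel. (\<lambda>n. ?c (r n) x - g x) \<longlonglongrightarrow> 0"
    using tendsto_L1_AE_subseq[of lborel "\<lambda>n x. ?c n x - g x"] by blast
  show ?thesis using ae
  proof eventually_elim
    case (elim x)
    show ?case
    proof
      assume "x \<in> U"
      then obtain e where e: "e > 0" "cball x e \<subseteq> U" using U open_contains_cball by blast
      obtain N where N: "inverse (real (Suc N)) < e" using reals_Archimedean[OF e(1)] by blast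
      have "0 \<le> ?c (r n) x" if "n \<ge> N" for n
      proof (rule t)
        have "n \<le> r n" using r by (rule seq_suble)
        then have "inverse (real (Suc (r n))) \<le> inverse (real (Suc N))" using that by (intro le_imp_inverse_le) auto
        then have "cball x (inverse (real (Suc (r n)))) \<subseteq> cball x e" using N by (intro subset_cball) linarith
        then show "(\<lambda>y. \<rho> (r n) (x - y)) \<in> test_functions U"
          using e(2) by (intro mollifier_test[OF m']) auto
      qed (rule mollifierD(2)[OF m'])
      moreover have "(\<lambda>n. ?c (r n) x) \<longlonglongrightarrow> g x" using elim by (rule LIM_zero_cancel)
      ultimately show "0 \<le> g x" by (intro LIMSEQ_le_const) auto
    qed
  qed
qed

lemma norm_powr_le_sum:
  fixes v :: "'a::euclidean_space"
  assumes p: "p \<ge> 1"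
  shows "norm v powr p \<le> real DIM('a) powr p * (\<Sum>i\<in>Basis. \<bar>v \<bullet> i\<bar> powr p)"
proof -
  let ?m = "Max ((\<lambda>i. \<bar>v \<bullet> i\<bar>) ` Basis)"
  have "?m \<in> (\<lambda>i. \<bar>v \<bullet> i\<bar>) ` Basis" by (intro Max_in) auto
  then obtain j where j: "j \<in> Basis" "?m = \<bar>v \<bullet> j\<bar>" by blast
  have "norm v \<le> (\<Sum>i\<in>Basis. \<bar>v \<bullet> i\<bar>)" by (rule norm_le_l1)
  also have "\<dots> \<le> (\<Sum>i\<in>(Basis::'a set). ?m)" by (intro sum_mono) auto
  also have "\<dots> = real DIM('a) * \<bar>v \<bullet> j\<bar>" using j by simp
  finally have "norm v powr p \<le> (real DIM('a) * \<bar>v \<bullet> j\<bar>) powr p" using p by (intro powr_mono2) auto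
  also have "\<dots> = real DIM('a) powr p * \<bar>v \<bullet> j\<bar> powr p" by (simp add: powr_mult)
  also have "\<bar>v \<bullet> j\<bar> powr p \<le> (\<Sum>i\<in>Basis. \<bar>v \<bullet> i\<bar> powr p)"
    using j by (intro member_le_sum) auto
  finally show ?thesis by (simp add: mult_left_mono)
qed

lemma norm_add_powr_le:
  fixes a b :: "'a::real_normed_vector"
  assumes "p \<ge> 0"
  shows "norm (a + b) powr p \<le> 2 powr p * (norm a powr p + norm b powr p)"
proof -
  have "norm (a + b) powr p \<le> (norm a + norm b) powr p"
    using assms by (intro powr_mono2 norm_triangle_ineq) auto
  also have "\<dots> \<le> 2 powr p * (norm a powr p + norm b powr p)" using assms by (intro powr_add_le) auto
  finally show ?thesis .
qed

lemma mollify_Lp_vector: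
  fixes V :: "'a::euclidean_space \<Rightarrow> 'b::euclidean_space"
  assumes V: "integrable lborel V" and Vp: "integrable lborel (\<lambda>x. norm (V x) powr p)" and p: "p \<ge> 1"
    and m: "mollifiers \<rho>"
  defines "c \<equiv> \<lambda>n x. LINT y|lborel. \<rho> n (x - y) *\<^sub>R V y"
  shows "integrable lborel (\<lambda>x. norm (c n x - V x) powr p)"
    and "(\<lambda>n. LINT x|lborel. norm (c n x - V x) powr p) \<longlonglongrightarrow> 0"
    and "integrable lborel (\<lambda>y. \<rho> n (x - y) *\<^sub>R V y)"
proof -
  have m': "mollifier (inverse (real (Suc n))) (\<rho> n)" for n using m by (simp add: mollifiers_def)
  note M = mollifierD[OF m']
  have [measurable]: "\<rho> n \<in> borel_measurable borel" for n by (rule M)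
  have [measurable]: "V \<in> borel_measurable borel" using V by (auto dest: borel_measurable_integrable)
  have Vi: "integrable lborel (\<lambda>x. V x \<bullet> i)" for i by (rule integrable_inner_left[OF V])
  have Vpi: "integrable lborel (\<lambda>x. \<bar>V x \<bullet> i\<bar> powr p)" if "i \<in> Basis" for i
  proof (rule Bochner_Integration.integrable_bound[OF Vp])
    show "AE x in lborel. norm (\<bar>V x \<bullet> i\<bar> powr p) \<le> norm (norm (V x) powr p)"
      using that p by (intro AE_I2) (auto intro!: powr_mono2 Basis_le_norm)
  qed measurable
  show int: "integrable lborel (\<lambda>y. \<rho> n (x - y) *\<^sub>R V y)" for n x
  proof -
    have "continuous_on UNIV (\<rho> n)" by (rule Ck_continuous[OF M(1)])
    have "compact (\<rho> n ` cball 0 1)"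
      by (intro compact_continuous_image continuous_on_subset[OF Ck_continuous[OF M(1)]]) auto
    then have "bounded (\<rho> n ` cball 0 1)" by (rule compact_imp_bounded)
    then obtain B where B: "\<And>x. x \<in> cball 0 1 \<Longrightarrow> norm (\<rho> n x) \<le> B"
      unfolding bounded_iff by blast
    have "\<bar>\<rho> n z\<bar> \<le> \<bar>B\<bar>" for z
    proof (cases "norm z > 1")
      case True
      then have "norm z > inverse (real (Suc n))" by (simp add: field_simps) (smt (verit) mult_nonneg_nonneg of_nat_0_le_iff)
      then show ?thesis using M(3)[of n z] by simp
    qed (use B[of z] in auto)
    then show ?thesis
      by (intro Bochner_Integration.integrable_bound[OF integrable_scaleR_right[of "\<bar>B\<bar>", OF V]] AE_I2)
        (auto intro!: mult_right_mono)
  qed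
  have ci: "c n x \<bullet> i = (LINT y|lborel. (V y \<bullet> i) * \<rho> n (x - y))" for n x i
    unfolding c_def integral_inner_left[OF int, symmetric] by (simp add: mult.commute)
  note L = mollify_Lp[OF Vi Vpi p m]
  let ?D = "\<lambda>n x. \<Sum>i\<in>Basis. \<bar>(LINT y|lborel. (V y \<bullet> i) * \<rho> n (x - y)) - V x \<bullet> i\<bar> powr p"
  have le: "norm (c n x - V x) powr p \<le> real DIM('b) powr p * ?D n x" for n x
    using norm_powr_le_sum[OF p, of "c n x - V x"] by (simp add: inner_diff_left ci)
  have [measurable]: "c n \<in> borel_measurable borel" for n unfolding c_def by measurable
  have intD: "integrable lborel (\<lambda>x. real DIM('b) powr p * ?D n x)" for n
    using L(1) by (intro integrable_mult_right Bochner_Integration.integrable_sum) auto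
  show i: "integrable lborel (\<lambda>x. norm (c n x - V x) powr p)" for n
  proof (rule Bochner_Integration.integrable_bound[OF intD[of n]])
    show "AE x in lborel. norm (norm (c n x - V x) powr p) \<le> norm (real DIM('b) powr p * ?D n x)"
      using le[of n] by (intro AE_I2) (auto intro: order_trans[OF _ abs_ge_self])
  qed measurable
  have lim: "(\<lambda>n. real DIM('b) powr p * (\<Sum>i\<in>Basis. LINT x|lborel. \<bar>(LINT y|lborel. (V y \<bullet> i) * \<rho> n (x - y)) - V x \<bullet> i\<bar> powr p)) \<longlonglongrightarrow> 0"
    by (intro tendsto_mult_right_zero tendsto_null_sum L(2))
  have le2: "(LINT x|lborel. norm (c n x - V x) powr p)
    \<le> real DIM('b) powr p * (\<Sum>i\<in>Basis. LINT x|lborel. \<bar>(LINT y|lborel. (V y \<bullet> i) * \<rho> n (x - y)) - V x \<bullet> i\<bar> powr p)" for n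
  proof -
    have "(LINT x|lborel. norm (c n x - V x) powr p) \<le> (LINT x|lborel. real DIM('b) powr p * ?D n x)"
      by (rule integral_mono[OF i intD le])
    also have "\<dots> = real DIM('b) powr p * (\<Sum>i\<in>Basis. LINT x|lborel. \<bar>(LINT y|lborel. (V y \<bullet> i) * \<rho> n (x - y)) - V x \<bullet> i\<bar> powr p)"
      using L(1) by (subst integral_mult_right_zero, subst Bochner_Integration.integral_sum) auto
    finally show ?thesis .
  qed
  show "(\<lambda>n. LINT x|lborel. norm (c n x - V x) powr p) \<longlonglongrightarrow> 0"
    by (rule nonneg_squeeze[OF _ le2 lim]) (simp add: Bochner_Integration.integral_nonneg)
qed

section \<open>Approximation in \<open>W\<^sub>0\<^sup>1\<^sup>,\<^sup>p\<close> and the chain rule\<close>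

text \<open>
  Unlike \<^const>\<open>W01p\<close> this refers to functions on the whole space and to \<^const>\<open>lborel\<close>, so that integrals
  can be translated and convolved.
\<close>

definition W01p_approx :: "real \<Rightarrow> 'a::euclidean_space set \<Rightarrow> ('a \<Rightarrow> real) \<Rightarrow> ('a \<Rightarrow> 'a) \<Rightarrow> bool" where
  "W01p_approx p U f G \<longleftrightarrow> f \<in> borel_measurable borel \<and> G \<in> borel_measurable borel \<and>
     integrable lborel (\<lambda>x. \<bar>f x\<bar> powr p) \<and> integrable lborel (\<lambda>x. norm (G x) powr p) \<and>
     (\<forall>e>0. \<exists>\<phi>\<in>test_functions U. (LINT x|lborel. \<bar>\<phi> x - f x\<bar> powr p) < e \<and>
        (LINT x|lborel. norm (grad \<phi> x - G x) powr p) < e)"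

lemma test_functionsD:
  assumes "\<phi> \<in> test_functions U"
  shows "\<And>k. Ck k \<phi>" "\<And>x. x \<notin> U \<Longrightarrow> \<phi> x = 0" "\<exists>R. \<forall>x. norm x > R \<longrightarrow> \<phi> x = 0"
    "\<And>x. x \<notin> U \<Longrightarrow> grad \<phi> x = 0" "\<exists>R. \<forall>x. norm x > R \<longrightarrow> grad \<phi> x = 0"
proof -
  let ?S = "closure {x. \<phi> x \<noteq> 0}"
  show C: "\<And>k. Ck k \<phi>" using assms by (simp add: test_functions_def)
  have S: "compact ?S" "?S \<subseteq> U" using assms by (simp_all add: test_functions_def)
  have z: "\<phi> x = 0" if "x \<notin> ?S" for x
  proof (rule ccontr)
    assume "\<phi> x \<noteq> 0"
    then have "x \<in> ?S" by (intro subsetD[OF closure_subset]) simp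
    with that show False by contradiction
  qed
  show "\<phi> x = 0" if "x \<notin> U" for x
    by (rule z) (metis that subsetD[OF S(2)])
  obtain R where "\<forall>x\<in>?S. norm x \<le> R"
    using compact_imp_bounded[OF S(1)] unfolding bounded_iff by (elim exE)
  then have R: "norm x \<le> R" if "x \<in> ?S" for x using that by (rule bspec)
  have R2: "\<phi> x = 0" if "norm x > R" for x
    by (rule z) (metis R that not_le)
  then show "\<exists>R. \<forall>x. norm x > R \<longrightarrow> \<phi> x = 0" by (intro exI[of _ R]) simp
  have "grad \<phi> x = 0" if "norm x > R" for x
    by (rule derivative_zero_outside[where R=R, OF Ck_has_derivative[OF C] R2 that])
  then show "\<exists>R. \<forall>x. norm x > R \<longrightarrow> grad \<phi> x = 0" by (intro exI[of _ R]) simp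
  show "grad \<phi> x = 0" if "x \<notin> U" for x
  proof -
    have x: "x \<in> - ?S" by (rule ComplI) (metis that subsetD[OF S(2)])
    have "((\<lambda>x. 0) has_derivative (\<lambda>h. grad \<phi> x \<bullet> h)) (at x)"
    proof (rule has_derivative_transform_within_open[OF Ck_has_derivative[OF C] _ x])
      show "open (- ?S)" by (intro open_Compl closed_closure)
      show "\<phi> v = 0" if "v \<in> - ?S" for v using that by (intro z) (rule ComplD)
    qed
    from has_derivative_unique[OF this has_derivative_const] have "grad \<phi> x \<bullet> grad \<phi> x = 0" by metis
    then show ?thesis by simp
  qed
qed

lemma continuous_bounded_support:
  fixes f :: "'a::euclidean_space \<Rightarrow> 'b::euclidean_space"
  assumes "continuous_on UNIV f" "\<And>x. norm x > R \<Longrightarrow> f x = 0"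
  shows "\<exists>B\<ge>0. \<forall>x. norm (f x) \<le> B"
proof -
  have "compact (f ` cball 0 R)" by (intro compact_continuous_image continuous_on_subset[OF assms(1)]) auto
  then have "bounded (f ` cball 0 R)" by (rule compact_imp_bounded)
  then obtain B where B: "\<And>x. x \<in> cball 0 R \<Longrightarrow> norm (f x) \<le> B" unfolding bounded_iff by blast
  have "norm (f x) \<le> \<bar>B\<bar>" for x using B[of x] assms(2)[of x] by (cases "norm x > R") auto
  then show ?thesis by (intro exI[of _ "\<bar>B\<bar>"]) auto
qed

lemma continuous_support_powr_integrable:
  fixes f :: "'a::euclidean_space \<Rightarrow> 'b::euclidean_space"
  assumes "continuous_on UNIV f" "\<And>x. norm x > R \<Longrightarrow> f x = 0" "p > 0"
  shows "integrable lborel (\<lambda>x. norm (f x) powr p)"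
proof (rule bounded_support_integrable)
  show "continuous_on UNIV (\<lambda>x. norm (f x) powr p)"
    using assms by (intro continuous_on_powr' continuous_intros) auto
qed (use assms in auto)

lemma set_integral_lebesgue_lborel:
  fixes h :: "'a::euclidean_space \<Rightarrow> 'b::{banach, second_countable_topology}"
  assumes "h \<in> borel_measurable borel" "\<And>x. x \<notin> E \<Longrightarrow> h x = 0"
  shows "(LINT x:E|lebesgue. h x) = (LINT x|lborel. h x)"
    and "set_integrable lebesgue E h \<longleftrightarrow> integrable lborel h"
    and "set_borel_measurable lebesgue E h"
proof -
  have eq: "(\<lambda>x. indicator E x *\<^sub>R h x) = h" using assms(2) by (force simp: indicator_def)
  show "(LINT x:E|lebesgue. h x) = (LINT x|lborel. h x)"
    unfolding set_lebesgue_integral_def eq using assms(1) by (simp add: integral_completion)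
  show "set_integrable lebesgue E h \<longleftrightarrow> integrable lborel h"
    unfolding set_integrable_def eq using assms(1) by (simp add: integrable_completion)
  show "set_borel_measurable lebesgue E h"
    unfolding set_borel_measurable_def eq using assms(1) by (simp add: measurable_completion)
qed

lemma W01p_approx_W01p:
  assumes W: "W01p_approx p (interior E) f G" and p: "p > 0"
    and z: "\<And>x. x \<notin> E \<Longrightarrow> f x = 0" "\<And>x. x \<notin> E \<Longrightarrow> G x = 0"
  shows "W01p p E f G"
proof -
  have [measurable]: "f \<in> borel_measurable borel" "G \<in> borel_measurable borel"
    and i: "integrable lborel (\<lambda>x. \<bar>f x\<bar> powr p)" "integrable lborel (\<lambda>x. norm (G x) powr p)"
    using W by (auto simp: W01p_approx_def)
  have "\<forall>n. \<exists>\<phi>. \<phi> \<in> test_functions (interior E) \<and> (LINT x|lborel. \<bar>\<phi> x - f x\<bar> powr p) < inverse (real (Suc n)) \<and>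
        (LINT x|lborel. norm (grad \<phi> x - G x) powr p) < inverse (real (Suc n))"
    using W unfolding W01p_approx_def Bex_def by simp
  from choice[OF this] obtain \<phi> where \<phi>: "\<And>n. \<phi> n \<in> test_functions (interior E)"
    "\<And>n. (LINT x|lborel. \<bar>\<phi> n x - f x\<bar> powr p) < inverse (real (Suc n))"
    "\<And>n. (LINT x|lborel. norm (grad (\<phi> n) x - G x) powr p) < inverse (real (Suc n))" by blast
  note T = test_functionsD[OF \<phi>(1)]
  have z': "\<phi> n x = 0" "grad (\<phi> n) x = 0" if "x \<notin> E" for n x
    using T(2)[of x n] T(4)[of x n] that interior_subset[of E] by auto
  have [measurable]: "\<phi> n \<in> borel_measurable borel" "grad (\<phi> n) \<in> borel_measurable borel" for n
    by (auto intro!: borel_measurable_continuous_onI Ck_continuous Ck_grad_continuous T(1))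
  have eq1: "(LINT x:E|lebesgue. \<bar>\<phi> n x - f x\<bar> powr p) = (LINT x|lborel. \<bar>\<phi> n x - f x\<bar> powr p)" for n
    using z z' by (intro set_integral_lebesgue_lborel) auto
  have eq2: "(LINT x:E|lebesgue. norm (grad (\<phi> n) x - G x) powr p) = (LINT x|lborel. norm (grad (\<phi> n) x - G x) powr p)" for n
    using z z' by (intro set_integral_lebesgue_lborel) auto
  have l1: "(\<lambda>n. LINT x|lborel. \<bar>\<phi> n x - f x\<bar> powr p) \<longlonglongrightarrow> 0"
    by (rule nonneg_squeeze[OF _ less_imp_le[OF \<phi>(2)] LIMSEQ_inverse_real_of_nat]) (simp add: Bochner_Integration.integral_nonneg)
  have l2: "(\<lambda>n. LINT x|lborel. norm (grad (\<phi> n) x - G x) powr p) \<longlonglongrightarrow> 0"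
    by (rule nonneg_squeeze[OF _ less_imp_le[OF \<phi>(3)] LIMSEQ_inverse_real_of_nat]) (simp add: Bochner_Integration.integral_nonneg)
  have m1: "set_borel_measurable lebesgue E f" "set_borel_measurable lebesgue E G"
    using z by (auto intro!: set_integral_lebesgue_lborel(3))
  have m2: "set_integrable lebesgue E (\<lambda>x. \<bar>f x\<bar> powr p)" "set_integrable lebesgue E (\<lambda>x. norm (G x) powr p)"
    using set_integral_lebesgue_lborel(2)[of "\<lambda>x. \<bar>f x\<bar> powr p" E] set_integral_lebesgue_lborel(2)[of "\<lambda>x. norm (G x) powr p" E] z i
    by auto
  show ?thesis
    unfolding W01p_def Lp_on_def
    using m1 m2 l1 l2 \<phi>(1) by (auto simp: eq1 eq2 intro!: exI[of _ \<phi>])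
qed

text \<open>Mollification keeps the support inside the larger ball once the radius is below half of
  the gap b - a, and it commutes with the gradient, so the function and its gradient both converge
  in L^p.\<close>

lemma W01p_approx_C1:
  fixes \<psi> :: "'a::euclidean_space \<Rightarrow> real"
  assumes d: "\<And>x. (\<psi> has_derivative (\<lambda>h. G x \<bullet> h)) (at x)" and cG: "continuous_on UNIV G"
    and supp: "\<And>x. x \<notin> cball y a \<Longrightarrow> \<psi> x = 0" and ab: "a < b" and p: "p \<ge> 1"
  shows "W01p_approx p (ball y b) \<psi> G"
proof -
  obtain \<rho> :: "nat \<Rightarrow> 'a \<Rightarrow> real" where m: "mollifiers \<rho>" using mollifiers_exist by blast
  then have m': "mollifier (inverse (real (Suc n))) (\<rho> n)" for n by (simp add: mollifiers_def)
  note M = mollifierD[OF m']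
  have supp0: "\<psi> x = 0" if "norm x > norm y + a" for x
  proof (rule supp)
    have "norm x \<le> norm y + dist y x" by (metis dist_norm norm_minus_commute norm_triangle_sub)
    then show "x \<notin> cball y a" using that by simp
  qed
  have suppG: "G x = 0" if "norm x > norm y + a" for x
    by (rule derivative_zero_outside[where R="norm y + a", OF d supp0 that])
  have c\<psi>: "continuous_on UNIV \<psi>"
    using d by (intro has_derivative_continuous_on) (auto intro: has_derivative_at_withinI)
  have [measurable]: "\<psi> \<in> borel_measurable borel" "G \<in> borel_measurable borel"
    using c\<psi> cG by (auto intro: borel_measurable_continuous_onI)
  have [measurable]: "\<rho> n \<in> borel_measurable borel" for n by (rule M)
  have i\<psi>: "integrable lborel \<psi>" "integrable lborel (\<lambda>x. \<bar>\<psi> x\<bar> powr p)"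
    using bounded_support_integrable[OF c\<psi> supp0] continuous_support_powr_integrable[OF c\<psi> supp0] p by auto
  have iG: "integrable lborel G" "integrable lborel (\<lambda>x. norm (G x) powr p)"
    using bounded_support_integrable[OF cG suppG] continuous_support_powr_integrable[OF cG suppG] p by auto
  define \<phi> where "\<phi> n x = (LINT z|lborel. \<psi> z * \<rho> n (x - z))" for n x
  have Ck\<phi>: "Ck k (\<phi> n)" for k n
    unfolding \<phi>_def by (rule convolution_Ck[OF i\<psi>(1) M(1) M(3)])
  have grad\<phi>: "grad (\<phi> n) x = (LINT z|lborel. \<rho> n (x - z) *\<^sub>R G z)" for n x
  proof -
    have "\<phi> n = (\<lambda>x. LINT z|lborel. \<rho> n z * \<psi> (x - z))"
    proof
      fix x
      show "\<phi> n x = (LINT z|lborel. \<rho> n z * \<psi> (x - z))"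
        using lborel_reflect(1)[of "\<lambda>z. \<psi> z * \<rho> n (x - z)" x] by (simp add: \<phi>_def mult.commute)
    qed
    then have "(\<phi> n has_derivative (\<lambda>h. (LINT z|lborel. \<rho> n z *\<^sub>R G (x - z)) \<bullet> h)) (at x)"
      using convolution_has_derivative(1)[where R="norm y + a", OF M(4) d cG supp0] by simp
    from grad_eqI[OF this] show ?thesis
      using lborel_reflect(1)[of "\<lambda>z. \<rho> n z *\<^sub>R G (x - z)" x] by simp
  qed
  have l1: "(\<lambda>n. LINT x|lborel. \<bar>\<phi> n x - \<psi> x\<bar> powr p) \<longlonglongrightarrow> 0"
    unfolding \<phi>_def by (rule mollify_Lp(2)[OF i\<psi> p m])
  have l2: "(\<lambda>n. LINT x|lborel. norm (grad (\<phi> n) x - G x) powr p) \<longlonglongrightarrow> 0"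
    unfolding grad\<phi> by (rule mollify_Lp_vector(2)[OF iG p m])
  obtain N where N: "inverse (real (Suc N)) < (b - a) / 2" using reals_Archimedean[of "(b-a)/2"] ab by auto
  have test: "\<phi> n \<in> test_functions (ball y b)" if "n \<ge> N" for n
  proof (rule test_functionsI[of _ "cball y ((a + b) / 2)"])
    show "\<phi> n x = 0" if x: "x \<notin> cball y ((a + b) / 2)" for x
    proof -
      have 0: "\<psi> z * \<rho> n (x - z) = 0" for z
      proof (cases "z \<in> cball y a")
        case True
        have "dist y x \<le> dist y z + norm (x - z)" by (metis dist_norm dist_triangle dist_commute)
        then have "norm (x - z) > (b - a) / 2" using True x by (simp add: field_simps)
        moreover have "inverse (real (Suc n)) \<le> inverse (real (Suc N))" using \<open>n \<ge> N\<close> by (intro le_imp_inverse_le) auto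
        ultimately have "\<rho> n (x - z) = 0" using N by (intro M(3)) linarith
        then show ?thesis by simp
      qed (simp add: supp)
      show ?thesis unfolding \<phi>_def 0 by simp
    qed
    show "cball y ((a + b) / 2) \<subseteq> ball y b" using ab by (intro cball_subset_ball_iff[THEN iffD2]) auto
  qed (auto intro: Ck\<phi>)
  have "\<exists>\<phi>\<in>test_functions (ball y b). (LINT x|lborel. \<bar>\<phi> x - \<psi> x\<bar> powr p) < e \<and>
        (LINT x|lborel. norm (grad \<phi> x - G x) powr p) < e" if e: "e > 0" for e
  proof -
    from l1 e have "\<forall>\<^sub>F n in sequentially. (LINT x|lborel. \<bar>\<phi> n x - \<psi> x\<bar> powr p) < e" by (rule order_tendstoD)
    moreover from l2 e have "\<forall>\<^sub>F n in sequentially. (LINT x|lborel. norm (grad (\<phi> n) x - G x) powr p) < e" by (rule order_tendstoD)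
    moreover have "\<forall>\<^sub>F n in sequentially. n \<ge> N" by (rule eventually_ge_at_top)
    ultimately have "\<forall>\<^sub>F n in sequentially. \<phi> n \<in> test_functions (ball y b) \<and> (LINT x|lborel. \<bar>\<phi> n x - \<psi> x\<bar> powr p) < e \<and>
        (LINT x|lborel. norm (grad (\<phi> n) x - G x) powr p) < e"
      by eventually_elim (use test in blast)
    from eventually_happens[OF this] show ?thesis by (auto simp: Bex_def)
  qed
  then show ?thesis unfolding W01p_approx_def using i\<psi> iG by simp
qed

section \<open>The chain rule for bounded Sobolev functions with a cutoff\<close>

lemma integrable_cball_const: "integrable lborel (\<lambda>x::'a::euclidean_space. indicator (cball y a) x * (c::real))"
proof -
  have "emeasure lborel (cball y a) < \<infinity>" by (rule emeasure_compact_finite) simp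
  then show ?thesis by (intro integrable_mult_left integrable_real_indicator) simp_all
qed

lemma integrable_of_powr_support:
  fixes V :: "'a::euclidean_space \<Rightarrow> 'b::euclidean_space"
  assumes [measurable]: "V \<in> borel_measurable borel" and Vp: "integrable lborel (\<lambda>x. norm (V x) powr p)"
    and p: "p \<ge> 1" and supp: "\<And>x. x \<notin> cball y b \<Longrightarrow> V x = 0"
  shows "integrable lborel V"
proof (rule Bochner_Integration.integrable_bound)
  show "integrable lborel (\<lambda>x. indicator (cball y b) x * 1 + norm (V x) powr p)"
    by (intro Bochner_Integration.integrable_add integrable_cball_const Vp)
  show "AE x in lborel. norm (V x) \<le> norm (indicator (cball y b) x * 1 + norm (V x) powr p)"
  proof (rule AE_I2)
    fix x
    show "norm (V x) \<le> norm (indicator (cball y b) x * 1 + norm (V x) powr p)"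
      using le_add_powr[of "norm (V x)" 1 p] p supp[of x] by (cases "x \<in> cball y b") auto
  qed
qed measurable

text \<open>Mollify f to g n. Then \<open>F (g n x) * w x\<close> is C^1 with compact support, and
  its gradient converges in L^p: the mollified V in norm, the coefficients boundedly and almost
  everywhere along a subsequence. The cutoff w confines everything to radius a, which leaves room
  for the kernel inside radius b.\<close>

lemma W01p_approx_comp:
  fixes f :: "'a::euclidean_space \<Rightarrow> real" and V :: "'a \<Rightarrow> 'a"
  assumes fm[measurable]: "f \<in> borel_measurable borel" and fb: "\<And>x. 0 \<le> f x" "\<And>x. f x \<le> \<mu>"
    and fs: "\<And>x. x \<notin> cball y b \<Longrightarrow> f x = 0"
    and Vm[measurable]: "V \<in> borel_measurable borel" and Vp: "integrable lborel (\<lambda>x. norm (V x) powr p)"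
    and Vs: "\<And>x. x \<notin> cball y b \<Longrightarrow> V x = 0" and p: "p \<ge> 1"
    and weak: "\<And>\<phi> i. \<phi> \<in> test_functions (ball y b) \<Longrightarrow> i \<in> Basis \<Longrightarrow>
       (LINT x|lborel. f x * (grad \<phi> x \<bullet> i)) = - (LINT x|lborel. (V x \<bullet> i) * \<phi> x)"
    and F: "\<And>s. 0 \<le> s \<Longrightarrow> s \<le> \<mu> \<Longrightarrow> (F has_real_derivative F' s) (at s)"
    and F': "continuous_on {0..\<mu>} F'"
    and Fm[measurable]: "F \<in> borel_measurable borel" "F' \<in> borel_measurable borel"
    and w: "\<And>x. (w has_derivative (\<lambda>h. Dw x \<bullet> h)) (at x)" and cDw: "continuous_on UNIV Dw"
    and ws: "\<And>x. x \<notin> cball y a \<Longrightarrow> w x = 0" and ab: "a < b"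
  shows "W01p_approx p (ball y b) (\<lambda>x. F (f x) * w x) (\<lambda>x. (F' (f x) * w x) *\<^sub>R V x + F (f x) *\<^sub>R Dw x)"
proof -
  obtain \<rho> :: "nat \<Rightarrow> 'a \<Rightarrow> real" where m: "mollifiers \<rho>" using mollifiers_exist by blast
  then have m': "mollifier (inverse (real (Suc n))) (\<rho> n)" for n by (simp add: mollifiers_def)
  note M = mollifierD[OF m']
  have [measurable]: "\<rho> n \<in> borel_measurable borel" for n by (rule M)
  have \<mu>0: "0 \<le> \<mu>" using fb[of y] by linarith

  have ws0: "w x = 0" if "norm x > norm y + a" for x
  proof (rule ws)
    have "norm x \<le> norm y + dist y x" by (metis dist_norm norm_minus_commute norm_triangle_sub)
    then show "x \<notin> cball y a" using that by simp
  qed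
  have Dws0: "Dw x = 0" if "norm x > norm y + a" for x
    by (rule derivative_zero_outside[where R="norm y + a", OF w ws0 that])
  have Dws: "Dw x = 0" if "x \<notin> cball y a" for x
  proof -
    have x: "x \<in> - cball y a" using that by simp
    have "((\<lambda>x. 0) has_derivative (\<lambda>h. Dw x \<bullet> h)) (at x)"
      by (rule has_derivative_transform_within_open[OF w _ x]) (use ws in auto)
    from has_derivative_unique[OF this has_derivative_const] have "Dw x \<bullet> Dw x = 0" by metis
    then show ?thesis by simp
  qed
  have cw: "continuous_on UNIV w"
    by (rule has_derivative_continuous_on[OF has_derivative_at_withinI[OF w]])
  have [measurable]: "w \<in> borel_measurable borel" "Dw \<in> borel_measurable borel"
    by (rule borel_measurable_continuous_onI[OF cw], rule borel_measurable_continuous_onI[OF cDw])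
  obtain Bw where Bw: "Bw \<ge> 0" "\<And>x. norm (w x) \<le> Bw" using continuous_bounded_support[OF cw ws0] by blast
  obtain Bd where Bd: "Bd \<ge> 0" "\<And>x. norm (Dw x) \<le> Bd" using continuous_bounded_support[OF cDw Dws0] by blast

  have cF: "continuous_on {0..\<mu>} F"
    by (intro continuous_at_imp_continuous_on ballI DERIV_isCont[OF F]) auto
  obtain BF where "\<And>v. v \<in> F ` {0..\<mu>} \<Longrightarrow> norm v \<le> BF"
    using compact_imp_bounded[OF compact_continuous_image[OF cF compact_Icc]] unfolding bounded_iff by blast
  then have BF: "\<bar>F s\<bar> \<le> BF" if "s \<in> {0..\<mu>}" for s using that by simp
  obtain BF' where "\<And>v. v \<in> F' ` {0..\<mu>} \<Longrightarrow> norm v \<le> BF'"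
    using compact_imp_bounded[OF compact_continuous_image[OF F' compact_Icc]] unfolding bounded_iff by blast
  then have BF': "\<bar>F' s\<bar> \<le> BF'" if "s \<in> {0..\<mu>}" for s using that by simp
  have BF0: "BF \<ge> 0" "BF' \<ge> 0" using BF[of 0] BF'[of 0] \<mu>0 by auto

  have fi: "integrable lborel f"
  proof (rule Bochner_Integration.integrable_bound[OF integrable_cball_const[of y b \<mu>]])
    have "norm (f x) \<le> norm (indicator (cball y b) x * \<mu>)" for x
      using fb[of x] fs[of x] \<mu>0 by (cases "x \<in> cball y b") auto
    then show "AE x in lborel. norm (f x) \<le> norm (indicator (cball y b) x * \<mu>)" by (intro AE_I2)
  qed measurable
  have Vi: "integrable lborel V" by (rule integrable_of_powr_support[OF Vm Vp p Vs])

  define g where "g n x = (LINT z|lborel. f z * \<rho> n (x - z))" for n x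
  define Dg where "Dg n x = (LINT z|lborel. f z *\<^sub>R grad (\<rho> n) (x - z))" for n x
  define W where "W n x = (LINT z|lborel. \<rho> n (x - z) *\<^sub>R V z)" for n x
  note D = convolution_has_derivative[where R="inverse (real (Suc n))" for n, OF fi Ck_has_derivative[OF M(1)] Ck_grad_continuous[OF M(1)] M(3)]
  have dg: "(g n has_derivative (\<lambda>h. Dg n x \<bullet> h)) (at x)" for n x
    unfolding g_def Dg_def by (rule D(1))
  have g0: "0 \<le> g n x" for n x
    unfolding g_def by (intro Bochner_Integration.integral_nonneg) (simp add: fb M(2))
  \<comment> \<open>An average of values in [0, \<mu>] stays there, so F is evaluated only where it
    is known to be differentiable.\<close>
  have g1: "g n x \<le> \<mu>" for n x
  proof -
    have i: "integrable lborel (\<lambda>z. \<rho> n (x - z))" using lborel_reflect(2)[of "\<rho> n" x] M(4) by simp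
    have "g n x \<le> (LINT z|lborel. \<mu> * \<rho> n (x - z))"
      unfolding g_def by (intro integral_mono D(2) integrable_mult_right i mult_right_mono fb M(2))
    also have "\<dots> = \<mu> * (LINT z|lborel. \<rho> n (x - z))" by simp
    also have "(LINT z|lborel. \<rho> n (x - z)) = 1" using lborel_reflect(1)[of "\<rho> n" x] M(5) by simp
    finally show ?thesis by simp
  qed
  have gm[measurable]: "g n \<in> borel_measurable borel" for n unfolding g_def by measurable
  have cDg: "continuous_on UNIV (Dg n)" for n
  proof -
    have "Ck (Suc 0) (g n)" unfolding g_def by (rule convolution_Ck[OF fi M(1) M(3)])
    then have "continuous_on UNIV (\<lambda>x. frechet_derivative (g n) (at x) i)" if "i \<in> Basis" for i
      using that by simp
    moreover have "frechet_derivative (g n) (at x) i = Dg n x \<bullet> i" for x i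
      using frechet_derivative_at[OF dg[of n x]] by metis
    ultimately show ?thesis
      by (intro continuous_on_componentwise[THEN iffD2]) simp
  qed

  obtain N where N: "inverse (real (Suc N)) < b - a" using reals_Archimedean[of "b - a"] ab by auto
  \<comment> \<open>On the smaller ball the kernel centred at x is a test function in
    \<open>ball y b\<close>, so the weak gradient identity turns the derivative of the mollification
    into the mollification of V.\<close>
  have DgW: "Dg n x = W n x" if n: "n \<ge> N" and x: "x \<in> cball y a" for n x
  proof (rule euclidean_eqI)
    fix i :: 'a assume i: "i \<in> Basis"
    have "inverse (real (Suc n)) \<le> inverse (real (Suc N))" using n by (intro le_imp_inverse_le) auto
    then have "inverse (real (Suc n)) < b - a" using N by linarith
    have "z \<in> ball y b" if "z \<in> cball x (inverse (real (Suc n)))" for z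
      using dist_triangle[of y z x] x that \<open>inverse (real (Suc n)) < b - a\<close> unfolding mem_cball mem_ball by linarith
    then have "cball x (inverse (real (Suc n))) \<subseteq> ball y b" by (rule subsetI)
    then have t: "(\<lambda>z. \<rho> n (x - z)) \<in> test_functions (ball y b)" by (rule mollifier_test[OF m'])
    have gr: "grad (\<lambda>z. \<rho> n (x - z)) z = - grad (\<rho> n) (x - z)" for z
    proof (rule grad_eqI)
      have "((\<lambda>z. x - z) has_derivative (\<lambda>h. - h)) (at z)" by (auto intro!: derivative_eq_intros)
      from has_derivative_compose[OF this Ck_has_derivative[OF M(1)]]
      show "((\<lambda>z. \<rho> n (x - z)) has_derivative (\<lambda>h. - grad (\<rho> n) (x - z) \<bullet> h)) (at z)" by simp
    qed
    have "Dg n x \<bullet> i = (LINT z|lborel. (f z *\<^sub>R grad (\<rho> n) (x - z)) \<bullet> i)"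
      unfolding Dg_def by (rule integral_inner_left[symmetric, OF D(3)])
    also have "\<dots> = - (LINT z|lborel. f z * (grad (\<lambda>z. \<rho> n (x - z)) z \<bullet> i))"
      by (simp add: gr)
    also have "\<dots> = (LINT z|lborel. (V z \<bullet> i) * \<rho> n (x - z))" using weak[OF t i] by simp
    also have "\<dots> = (LINT z|lborel. (\<rho> n (x - z) *\<^sub>R V z) \<bullet> i)" by (simp add: mult.commute)
    also have "\<dots> = W n x \<bullet> i"
      unfolding W_def by (rule integral_inner_left[OF mollify_Lp_vector(3)[OF Vi Vp p m]])
    finally show "Dg n x \<bullet> i = W n x \<bullet> i" .
  qed

  define \<psi> where "\<psi> n x = F (g n x) * w x" for n x
  define G where "G n x = (F' (g n x) * w x) *\<^sub>R Dg n x + F (g n x) *\<^sub>R Dw x" for n x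
  let ?\<psi> = "\<lambda>x. F (f x) * w x" and ?G = "\<lambda>x. (F' (f x) * w x) *\<^sub>R V x + F (f x) *\<^sub>R Dw x"
  have approx: "W01p_approx p (ball y b) (\<psi> n) (G n)" for n
  proof (rule W01p_approx_C1[OF _ _ _ ab p])
    show "(\<psi> n has_derivative (\<lambda>h. G n x \<bullet> h)) (at x)" for x
    proof -
      have "((\<lambda>x. F (g n x)) has_derivative (\<lambda>h. (Dg n x \<bullet> h) * F' (g n x))) (at x)"
        by (rule DERIV_compose_FDERIV[OF F[OF g0 g1] dg])
      from has_derivative_mult[OF this w]
      show ?thesis unfolding \<psi>_def G_def
        by (rule has_derivative_eq_rhs) (simp add: inner_add_left algebra_simps)
    qed
    have cg: "continuous_on UNIV (g n)"
      by (rule has_derivative_continuous_on[OF has_derivative_at_withinI[OF dg]])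
    have "continuous_on UNIV (\<lambda>x. F (g n x))" "continuous_on UNIV (\<lambda>x. F' (g n x))"
      using g0 g1 by (auto intro!: continuous_on_compose2[OF cF cg] continuous_on_compose2[OF F' cg])
    then show "continuous_on UNIV (G n)"
      unfolding G_def by (intro continuous_intros cw cDw cDg)
  qed (simp add: \<psi>_def ws)

  have "integrable lborel (\<lambda>x. g n x - f x)" "(\<lambda>n. LINT x|lborel. norm (g n x - f x)) \<longlonglongrightarrow> 0" for n
  proof -
    have f1: "integrable lborel (\<lambda>x. \<bar>f x\<bar> powr 1)" using fi by simp
    note L = mollify_Lp[OF fi f1 _ m]
    show "integrable lborel (\<lambda>x. g n x - f x)"
      by (rule Bochner_Integration.integrable_bound[OF L(1)[of n]]) (simp_all add: g_def[symmetric])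
    show "(\<lambda>n. LINT x|lborel. norm (g n x - f x)) \<longlonglongrightarrow> 0" using L(2) by (simp add: g_def)
  qed
  then obtain r :: "nat \<Rightarrow> nat" where r: "strict_mono r" and
    ae: "AE x in lborel. (\<lambda>n. g (r n) x - f x) \<longlonglongrightarrow> 0"
    using tendsto_L1_AE_subseq[of lborel "\<lambda>n x. g n x - f x"] by blast
  have ae': "AE x in lborel. (\<lambda>n. F (g (r n) x)) \<longlonglongrightarrow> F (f x) \<and> (\<lambda>n. F' (g (r n) x)) \<longlonglongrightarrow> F' (f x)"
    using ae
  proof eventually_elim
    case (elim x)
    then have l: "(\<lambda>n. g (r n) x) \<longlonglongrightarrow> f x" by (rule LIM_zero_cancel)
    have "(\<lambda>n. F (g (r n) x)) \<longlonglongrightarrow> F (f x)"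
      by (rule continuous_on_tendsto_compose[OF cF l]) (simp_all add: fb g0 g1)
    moreover have "(\<lambda>n. F' (g (r n) x)) \<longlonglongrightarrow> F' (f x)"
      by (rule continuous_on_tendsto_compose[OF F' l]) (simp_all add: fb g0 g1)
    ultimately show ?case ..
  qed
  have BFd: "\<bar>F (g n x) - F (f x)\<bar> \<le> 2 * BF" "\<bar>F' (g n x) - F' (f x)\<bar> \<le> 2 * BF'" for n x
    using BF[of "g n x"] BF[of "f x"] BF'[of "g n x"] BF'[of "f x"] fb[of x] g0[of n x] g1[of n x] by auto

  have int\<psi>: "integrable lborel (\<lambda>x. \<bar>?\<psi> x\<bar> powr p)"
  proof (rule Bochner_Integration.integrable_bound[OF integrable_cball_const[of y a "(BF * Bw) powr p"]])
    have "norm (\<bar>?\<psi> x\<bar> powr p) \<le> norm (indicator (cball y a) x * (BF * Bw) powr p)" for x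
    proof (cases "x \<in> cball y a")
      case True
      have "\<bar>?\<psi> x\<bar> \<le> BF * Bw" using BF[of "f x"] fb[of x] Bw(2)[of x] BF0 by (auto simp: abs_mult intro!: mult_mono)
      then show ?thesis using True p by (simp add: powr_mono2)
    qed (use p in \<open>simp add: ws\<close>)
    then show "AE x in lborel. norm (\<bar>?\<psi> x\<bar> powr p) \<le> norm (indicator (cball y a) x * (BF * Bw) powr p)" by (intro AE_I2)
  qed measurable

  \<comment> \<open>H and K are the errors of the two coefficients. The error of the gradient is
    then F'(g) w (W - V) + H V + K Dw, and each summand tends to 0 in L^p.\<close>
  define H where "H n x = (F' (g n x) - F' (f x)) * w x" for n x
  define K where "K n x = (F (g n x) - F (f x))" for n x
  have Hb: "\<bar>H n x\<bar> \<le> 2 * BF' * Bw" for n x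
    unfolding H_def abs_mult using BFd[of n x] Bw(2)[of x] BF0 by (intro mult_mono) auto
  have Kb: "\<bar>K n x\<bar> \<le> 2 * BF" for n x
    unfolding K_def using BFd[of n x] by simp
  have limH: "(\<lambda>n. LINT x|lborel. norm (H (r n) x *\<^sub>R V x) powr p) \<longlonglongrightarrow> (LINT x|(lborel::'a measure). (0::real))"
  proof (rule integral_dominated_convergence[where w="\<lambda>x. (2 * BF' * Bw) powr p * norm (V x) powr p"])
    show "AE x in lborel. (\<lambda>n. norm (H (r n) x *\<^sub>R V x) powr p) \<longlonglongrightarrow> 0"
      using ae'
    proof eventually_elim
      case (elim x)
      have "(\<lambda>n. H (r n) x *\<^sub>R V x) \<longlonglongrightarrow> ((F' (f x) - F' (f x)) * w x) *\<^sub>R V x"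
        unfolding H_def using elim by (intro tendsto_intros) auto
      then have "(\<lambda>n. norm (H (r n) x *\<^sub>R V x)) \<longlonglongrightarrow> 0" by (intro tendsto_norm_zero) simp
      then show ?case using p by (intro tendsto_zero_powrI[where b=p]) auto
    qed
    show "AE x in lborel. norm (norm (H (r n) x *\<^sub>R V x) powr p) \<le> (2 * BF' * Bw) powr p * norm (V x) powr p" for n
    proof (rule AE_I2)
      fix x
      have "norm (H (r n) x *\<^sub>R V x) powr p \<le> (2 * BF' * Bw * norm (V x)) powr p"
        using Hb[of "r n" x] p by (intro powr_mono2) (auto intro!: mult_right_mono)
      then show "norm (norm (H (r n) x *\<^sub>R V x) powr p) \<le> (2 * BF' * Bw) powr p * norm (V x) powr p"
        by (simp add: powr_mult)
    qed
    show "integrable lborel (\<lambda>x. (2 * BF' * Bw) powr p * norm (V x) powr p)" by (intro integrable_mult_right Vp)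
    show "(\<lambda>x. norm (H (r n) x *\<^sub>R V x) powr p) \<in> borel_measurable lborel" for n unfolding H_def by measurable
  qed measurable
  have cball_bd: "norm (norm (k *\<^sub>R v) powr p) \<le> indicator (cball y a) x * (c * B) powr p"
    if "\<bar>k\<bar> \<le> c" "norm v \<le> B" "x \<notin> cball y a \<Longrightarrow> v = 0" for k c B x and v :: "'b::real_normed_vector"
  proof (cases "x \<in> cball y a")
    case True
    have "norm (k *\<^sub>R v) powr p \<le> (c * B) powr p"
      using that p by (intro powr_mono2) (auto intro!: mult_mono intro: order_trans[OF abs_ge_zero])
    then show ?thesis using True by simp
  qed (use that p in simp)
  have limK: "(\<lambda>n. LINT x|lborel. norm (K (r n) x *\<^sub>R Q x) powr p) \<longlonglongrightarrow> (LINT x|(lborel::'a measure). (0::real))"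
    if [measurable]: "Q \<in> borel_measurable borel" and Q: "\<And>x. norm (Q x) \<le> B" "\<And>x. x \<notin> cball y a \<Longrightarrow> Q x = 0"
    for Q :: "'a \<Rightarrow> 'b::euclidean_space" and B
  proof (rule integral_dominated_convergence[where w="\<lambda>x. indicator (cball y a) x * (2 * BF * B) powr p"])
    show "AE x in lborel. (\<lambda>n. norm (K (r n) x *\<^sub>R Q x) powr p) \<longlonglongrightarrow> 0"
      using ae'
    proof eventually_elim
      case (elim x)
      have "(\<lambda>n. K (r n) x *\<^sub>R Q x) \<longlonglongrightarrow> (F (f x) - F (f x)) *\<^sub>R Q x"
        unfolding K_def using elim by (intro tendsto_intros) auto
      then have "(\<lambda>n. norm (K (r n) x *\<^sub>R Q x)) \<longlonglongrightarrow> 0" by (intro tendsto_norm_zero) simp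
      then show ?case using p by (intro tendsto_zero_powrI[where b=p]) auto
    qed
    show "AE x in lborel. norm (norm (K (r n) x *\<^sub>R Q x) powr p) \<le> indicator (cball y a) x * (2 * BF * B) powr p" for n
      by (intro AE_I2 cball_bd Kb Q)
    show "(\<lambda>x. norm (K (r n) x *\<^sub>R Q x) powr p) \<in> borel_measurable lborel" for n unfolding K_def by measurable
  qed (measurable, rule integrable_cball_const)
  have intH: "integrable lborel (\<lambda>x. norm (H n x *\<^sub>R V x) powr p)" for n
  proof (rule Bochner_Integration.integrable_bound[OF integrable_mult_right[OF Vp, of "(2 * BF' * Bw) powr p"]])
    show "AE x in lborel. norm (norm (H n x *\<^sub>R V x) powr p) \<le> norm ((2 * BF' * Bw) powr p * norm (V x) powr p)"
    proof (rule AE_I2)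
      fix x
      have "norm (H n x *\<^sub>R V x) powr p \<le> (2 * BF' * Bw * norm (V x)) powr p"
        using Hb[of n x] p by (intro powr_mono2) (auto intro!: mult_right_mono)
      then show "norm (norm (H n x *\<^sub>R V x) powr p) \<le> norm ((2 * BF' * Bw) powr p * norm (V x) powr p)"
        by (simp add: powr_mult)
    qed
    show "(\<lambda>x. norm (H n x *\<^sub>R V x) powr p) \<in> borel_measurable lborel" unfolding H_def by measurable
  qed
  have intK: "integrable lborel (\<lambda>x. norm (K n x *\<^sub>R Q x) powr p)"
    if [measurable]: "Q \<in> borel_measurable borel" and Q: "\<And>x. norm (Q x) \<le> B" "\<And>x. x \<notin> cball y a \<Longrightarrow> Q x = 0"
    for Q :: "'a \<Rightarrow> 'b::euclidean_space" and B n
  proof (rule Bochner_Integration.integrable_bound[OF integrable_cball_const[of y a "(2 * BF * B) powr p"]])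
    show "AE x in lborel. norm (norm (K n x *\<^sub>R Q x) powr p) \<le> norm (indicator (cball y a) x * (2 * BF * B) powr p)"
    proof (rule AE_I2)
      fix x
      have "norm (norm (K n x *\<^sub>R Q x) powr p) \<le> indicator (cball y a) x * (2 * BF * B) powr p"
        by (intro cball_bd Kb Q)
      then show "norm (norm (K n x *\<^sub>R Q x) powr p) \<le> norm (indicator (cball y a) x * (2 * BF * B) powr p)"
        by simp
    qed
    show "(\<lambda>x. norm (K n x *\<^sub>R Q x) powr p) \<in> borel_measurable lborel" unfolding K_def by measurable
  qed

  have lim\<psi>: "(\<lambda>n. LINT x|lborel. \<bar>\<psi> (r n) x - ?\<psi> x\<bar> powr p) \<longlonglongrightarrow> 0"
  proof -
    have "\<bar>\<psi> n x - ?\<psi> x\<bar> = norm (K n x *\<^sub>R w x)" for n x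
      by (simp add: \<psi>_def K_def left_diff_distrib[symmetric])
    then show ?thesis using limK[OF _ Bw(2) ws] by simp
  qed
  have int\<psi>d: "integrable lborel (\<lambda>x. \<bar>\<psi> n x - ?\<psi> x\<bar> powr p)" for n
  proof -
    have "\<bar>\<psi> n x - ?\<psi> x\<bar> = norm (K n x *\<^sub>R w x)" for x
      by (simp add: \<psi>_def K_def left_diff_distrib[symmetric])
    then show ?thesis using intK[OF _ Bw(2) ws] by simp
  qed

  define J where "J n x = 2 powr p * ((BF' * Bw) powr p * norm (W n x - V x) powr p
     + 2 powr p * (norm (H n x *\<^sub>R V x) powr p + norm (K n x *\<^sub>R Dw x) powr p))" for n x
  have Gd: "norm (G n x - ?G x) powr p \<le> J n x" if n: "n \<ge> N" for n x
  proof -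
    have eq: "G n x - ?G x = (F' (g n x) * w x) *\<^sub>R (W n x - V x) + (H n x *\<^sub>R V x + K n x *\<^sub>R Dw x)"
    proof (cases "x \<in> cball y a")
      case True
      then show ?thesis by (simp add: G_def H_def K_def DgW[OF n] algebra_simps)
    qed (simp add: G_def H_def K_def ws Dws)
    have "norm ((F' (g n x) * w x) *\<^sub>R (W n x - V x)) powr p \<le> (BF' * Bw * norm (W n x - V x)) powr p"
      using BF'[of "g n x"] Bw(2)[of x] g0[of n x] g1[of n x] BF0 p
      by (intro powr_mono2) (auto simp: abs_mult intro!: mult_right_mono mult_mono)
    also have "\<dots> = (BF' * Bw) powr p * norm (W n x - V x) powr p" by (simp add: powr_mult)
    finally have 1: "norm ((F' (g n x) * w x) *\<^sub>R (W n x - V x)) powr p \<le> (BF' * Bw) powr p * norm (W n x - V x) powr p" .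
    have 2: "norm (H n x *\<^sub>R V x + K n x *\<^sub>R Dw x) powr p
       \<le> 2 powr p * (norm (H n x *\<^sub>R V x) powr p + norm (K n x *\<^sub>R Dw x) powr p)"
      using p by (intro norm_add_powr_le) simp
    have "norm (G n x - ?G x) powr p \<le> 2 powr p * (norm ((F' (g n x) * w x) *\<^sub>R (W n x - V x)) powr p
       + norm (H n x *\<^sub>R V x + K n x *\<^sub>R Dw x) powr p)"
      unfolding eq using p by (intro norm_add_powr_le) simp
    also have "\<dots> \<le> J n x" unfolding J_def by (intro mult_left_mono add_mono 1 2) simp
    finally show ?thesis .
  qed
  have W: "integrable lborel (\<lambda>x. norm (W n x - V x) powr p)" "(\<lambda>n. LINT x|lborel. norm (W n x - V x) powr p) \<longlonglongrightarrow> 0" for n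
    unfolding W_def by (rule mollify_Lp_vector[OF Vi Vp p m])+
  note iKD = intK[OF _ Bd(2) Dws] and lKD = limK[OF _ Bd(2) Dws]
  have intJ: "integrable lborel (J n)" for n
    unfolding J_def
    by (intro integrable_mult_right Bochner_Integration.integrable_add W intH iKD) measurable
  have eqJ: "(LINT x|lborel. J n x) = 2 powr p * ((BF' * Bw) powr p * (LINT x|lborel. norm (W n x - V x) powr p)
     + 2 powr p * ((LINT x|lborel. norm (H n x *\<^sub>R V x) powr p) + (LINT x|lborel. norm (K n x *\<^sub>R Dw x) powr p)))" for n
  proof -
    have a: "integrable lborel (\<lambda>x. norm (K n x *\<^sub>R Dw x) powr p)" by (rule iKD) measurable
    show ?thesis
      unfolding J_def
      by (simp only: integral_mult_right_zero Bochner_Integration.integral_add Bochner_Integration.integrable_add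
        integrable_mult_right W(1) intH a)
  qed
  have limJ: "(\<lambda>n. LINT x|lborel. J (r n) x) \<longlonglongrightarrow> 0"
  proof -
    have a: "(\<lambda>n. LINT x|lborel. norm (K (r n) x *\<^sub>R Dw x) powr p) \<longlonglongrightarrow> 0" using lKD by simp
    have b: "(\<lambda>n. LINT x|lborel. norm (H (r n) x *\<^sub>R V x) powr p) \<longlonglongrightarrow> 0" using limH by simp
    have c: "(\<lambda>n. LINT x|lborel. norm (W (r n) x - V x) powr p) \<longlonglongrightarrow> 0"
      using LIMSEQ_subseq_LIMSEQ[OF W(2) r] by (simp add: o_def)
    show ?thesis unfolding eqJ
      using tendsto_mult_right_zero[OF tendsto_add_zero[OF tendsto_mult_right_zero[OF c] tendsto_mult_right_zero[OF tendsto_add_zero[OF b a]]]]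
      by blast
  qed
  have [measurable]: "Dg n \<in> borel_measurable borel" for n by (rule borel_measurable_continuous_onI[OF cDg])
  have Gm[measurable]: "G n \<in> borel_measurable borel" for n unfolding G_def by measurable
  have intGd: "integrable lborel (\<lambda>x. norm (G n x - ?G x) powr p)" if "n \<ge> N" for n
  proof (rule Bochner_Integration.integrable_bound[OF intJ[of n]])
    show "AE x in lborel. norm (norm (G n x - ?G x) powr p) \<le> norm (J n x)"
      using Gd[OF that] by (intro AE_I2) (simp add: order_trans[OF _ abs_ge_self])
  qed measurable
  have intG: "integrable lborel (\<lambda>x. norm (?G x) powr p)"
  proof (rule Bochner_Integration.integrable_bound)
    have GN: "integrable lborel (\<lambda>x. norm (G N x) powr p)" using approx[of N] by (simp add: W01p_approx_def)
    show "integrable lborel (\<lambda>x. 2 powr p * (norm (G N x) powr p + norm (?G x - G N x) powr p))"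
      using intGd[of N] by (intro integrable_mult_right Bochner_Integration.integrable_add GN) (simp add: norm_minus_commute)
    have "norm (?G x) powr p \<le> 2 powr p * (norm (G N x) powr p + norm (?G x - G N x) powr p)" for x
      using norm_add_powr_le[of p "G N x" "?G x - G N x"] p by simp
    then show "AE x in lborel. norm (norm (?G x) powr p) \<le> norm (2 powr p * (norm (G N x) powr p + norm (?G x - G N x) powr p))"
      by (intro AE_I2) (simp add: order_trans[OF _ abs_ge_self])
  qed measurable

  have "\<exists>\<phi>\<in>test_functions (ball y b). (LINT x|lborel. \<bar>\<phi> x - ?\<psi> x\<bar> powr p) < e \<and>
        (LINT x|lborel. norm (grad \<phi> x - ?G x) powr p) < e" if e: "e > 0" for e
  proof -
    \<comment> \<open>Two errors enter a triangle inequality that costs the factor 2 powr p.\<close>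
    define e' where "e' = e / (2 * 2 powr p)"
    have e': "e' > 0" using e by (simp add: e'_def)
    have "\<forall>\<^sub>F n in sequentially. (LINT x|lborel. \<bar>\<psi> (r n) x - ?\<psi> x\<bar> powr p) < e'"
      by (rule order_tendstoD(2)[OF lim\<psi> e'])
    moreover have "\<forall>\<^sub>F n in sequentially. (LINT x|lborel. J (r n) x) < e'"
      by (rule order_tendstoD(2)[OF limJ e'])
    moreover have "\<forall>\<^sub>F n in sequentially. n \<ge> N" by (rule eventually_ge_at_top)
    ultimately have "\<forall>\<^sub>F n in sequentially. (LINT x|lborel. \<bar>\<psi> (r n) x - ?\<psi> x\<bar> powr p) < e' \<and>
      (LINT x|lborel. J (r n) x) < e' \<and> n \<ge> N" by eventually_elim simp
    from eventually_happens[OF this] obtain j where j: "(LINT x|lborel. \<bar>\<psi> (r j) x - ?\<psi> x\<bar> powr p) < e'"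
      "(LINT x|lborel. J (r j) x) < e'" "j \<ge> N" by auto
    define n where "n = r j"
    have n: "n \<ge> N" using seq_suble[OF r, of j] j(3) by (simp add: n_def)
    have G': "(LINT x|lborel. norm (G n x - ?G x) powr p) < e'"
      using integral_mono[OF intGd[OF n] intJ Gd[OF n]] j(2) by (simp add: n_def)
    obtain \<phi> where \<phi>: "\<phi> \<in> test_functions (ball y b)" "(LINT x|lborel. \<bar>\<phi> x - \<psi> n x\<bar> powr p) < e'"
      "(LINT x|lborel. norm (grad \<phi> x - G n x) powr p) < e'"
      using approx[of n] e' unfolding W01p_approx_def by blast
    note T = test_functionsD[OF \<phi>(1)]
    have [measurable]: "\<phi> \<in> borel_measurable borel" "grad \<phi> \<in> borel_measurable borel"
      by (auto intro!: borel_measurable_continuous_onI Ck_continuous Ck_grad_continuous T(1))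
    have tri: "(LINT x|lborel. norm (a x - c x) powr p) < e"
      if [measurable]: "a \<in> borel_measurable borel" "b \<in> borel_measurable borel" "c \<in> borel_measurable borel"
      and "(LINT x|lborel. norm (a x - b x) powr p) < e'" "(LINT x|lborel. norm (b x - c x) powr p) < e'"
      and "integrable lborel (\<lambda>x. norm (a x) powr p)" "integrable lborel (\<lambda>x. norm (b x) powr p)" "integrable lborel (\<lambda>x. norm (b x - c x) powr p)"
      for a b c :: "'a \<Rightarrow> 'b::euclidean_space"
    proof -
      have ab: "integrable lborel (\<lambda>x. norm (a x - b x) powr p)"
      proof (rule Bochner_Integration.integrable_bound)
        show "integrable lborel (\<lambda>x. 2 powr p * (norm (a x) powr p + norm (b x) powr p))"
          using that by (intro integrable_mult_right Bochner_Integration.integrable_add)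
        show "AE x in lborel. norm (norm (a x - b x) powr p) \<le> norm (2 powr p * (norm (a x) powr p + norm (b x) powr p))"
        proof (rule AE_I2)
          fix x
          show "norm (norm (a x - b x) powr p) \<le> norm (2 powr p * (norm (a x) powr p + norm (b x) powr p))"
            using norm_add_powr_le[of p "a x" "- b x"] p by simp
        qed
      qed measurable
      have i: "integrable lborel (\<lambda>x. 2 powr p * (norm (a x - b x) powr p + norm (b x - c x) powr p))"
        using that ab by (intro integrable_mult_right Bochner_Integration.integrable_add)
      have le: "norm (a x - c x) powr p \<le> 2 powr p * (norm (a x - b x) powr p + norm (b x - c x) powr p)" for x
        using norm_add_powr_le[of p "a x - b x" "b x - c x"] p by simp
      have ac: "integrable lborel (\<lambda>x. norm (a x - c x) powr p)"
      proof (rule Bochner_Integration.integrable_bound[OF i])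
        show "AE x in lborel. norm (norm (a x - c x) powr p) \<le> norm (2 powr p * (norm (a x - b x) powr p + norm (b x - c x) powr p))"
          using le by (intro AE_I2) (simp add: order_trans[OF _ abs_ge_self])
      qed measurable
      have "(LINT x|lborel. norm (a x - c x) powr p) \<le> (LINT x|lborel. 2 powr p * (norm (a x - b x) powr p + norm (b x - c x) powr p))"
        by (rule integral_mono[OF ac i le])
      also have "\<dots> = 2 powr p * ((LINT x|lborel. norm (a x - b x) powr p) + (LINT x|lborel. norm (b x - c x) powr p))"
        using ab that by simp
      also have "\<dots> < 2 powr p * (e' + e')" using that by (intro mult_strict_left_mono add_strict_mono) auto
      also have "\<dots> = e" by (simp add: e'_def)
      finally show ?thesis .
    qed
    obtain R where R: "\<And>x. norm x > R \<Longrightarrow> \<phi> x = 0" using T(3) by blast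
    obtain R' where R': "\<And>x. norm x > R' \<Longrightarrow> grad \<phi> x = 0" using T(5) by blast
    have p0: "p > 0" using p by simp
    have an: "\<psi> n \<in> borel_measurable borel" "G n \<in> borel_measurable borel"
      "integrable lborel (\<lambda>x. norm (\<psi> n x) powr p)" "integrable lborel (\<lambda>x. norm (G n x) powr p)"
      using approx[of n] by (simp_all add: W01p_approx_def)
    have "(LINT x|lborel. norm (\<phi> x - ?\<psi> x) powr p) < e"
      using an \<phi>(2) j(1) int\<psi>d[of n] continuous_support_powr_integrable[OF Ck_continuous[OF T(1)] R p0]
      by (intro tri[of \<phi> "\<psi> n"]) (simp_all add: n_def)
    moreover have "(LINT x|lborel. norm (grad \<phi> x - ?G x) powr p) < e"
      using an \<phi>(3) G' intGd[OF n] continuous_support_powr_integrable[OF Ck_grad_continuous[OF T(1)] R' p0]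
      by (intro tri[of "grad \<phi>" "G n"]) simp_all
    ultimately show ?thesis using \<phi>(1) by auto
  qed
  moreover have "?\<psi> \<in> borel_measurable borel" "?G \<in> borel_measurable borel" by measurable
  ultimately show ?thesis unfolding W01p_approx_def using int\<psi> intG by blast
qed

section \<open>Time-independent test functions\<close>

text \<open>The completed measure on space-time is not itself a product measure, so the exceptional
  set is first covered by a Borel null set, to which Fubini's theorem applies with time as the outer
  variable.\<close>

lemma AE_time_slice:
  fixes P :: "'a::euclidean_space \<times> real \<Rightarrow> bool"
  assumes "AE z in lebesgue. P z"
  shows "AE t in lborel. AE x in lborel. P (x, t)"
proof -
  have "AE z in lborel. P z" using assms by (simp add: AE_completion_iff)
  then obtain N where N: "N \<in> null_sets lborel" "{z. \<not> P z} \<subseteq> N"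
    unfolding eventually_ae_filter by auto
  have Nm[measurable]: "N \<in> sets (borel :: ('a \<times> real) measure)" using N(1) by (auto simp: null_sets_def)
  have "AE z in lborel \<Otimes>\<^sub>M lborel. z \<notin> N"
    unfolding lborel_prod by (rule AE_not_in[OF N(1)])
  then have 1: "AE x in lborel. AE t in lborel. (x, t) \<notin> N" by (rule lborel_pair.AE_pair)
  have "{z \<in> space (lborel \<Otimes>\<^sub>M lborel). (fst z, snd z) \<notin> N} \<in> sets (lborel \<Otimes>\<^sub>M lborel)"
    using Nm unfolding lborel_prod by (simp add: Compl_eq[symmetric] Compl_in_sets_lebesgue)
  then have "AE t in lborel. AE x in lborel. (x, t) \<notin> N"
    using lborel_pair.AE_commute[of "\<lambda>x t. (x, t) \<notin> N"] 1 by blast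
  then show ?thesis
  proof eventually_elim
    case (elim t)
    then show ?case by eventually_elim (use N(2) in blast)
  qed
qed

text \<open>Null slices alone do not make a set measurable; for Borel sets Tonelli's theorem gives
  this converse of \<open>AE_time_slice\<close>.\<close>

lemma AE_from_time_slice:
  fixes P :: "'a::euclidean_space \<times> real \<Rightarrow> bool"
  assumes m: "{z. P z} \<in> sets borel" and ae: "AE t in lborel. AE x in lborel. P (x, t)"
  shows "AE z in lebesgue. P z"
proof -
  have m': "{z \<in> space (lborel \<Otimes>\<^sub>M lborel). P z} \<in> sets (lborel \<Otimes>\<^sub>M lborel)"
    using m unfolding lborel_prod by simp
  then have m'': "{z \<in> space (lborel \<Otimes>\<^sub>M lborel). P (fst z, snd z)} \<in> sets (lborel \<Otimes>\<^sub>M lborel)" by simp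
  have "AE x in lborel. AE t in lborel. P (x, t)"
    using lborel_pair.AE_commute[of "\<lambda>x t. P (x, t)", OF m''] ae by blast
  from lborel_pair.AE_pair_measure[OF m' this] show ?thesis
    unfolding lborel_prod by (rule AE_completion)
qed

lemma measurable_fst_snd_borel [measurable]:
  "fst \<in> borel_measurable (borel :: ('a::second_countable_topology \<times> 'b::second_countable_topology) measure)"
  "snd \<in> borel_measurable (borel :: ('a::second_countable_topology \<times> 'b::second_countable_topology) measure)"
  by (intro borel_measurable_continuous_onI continuous_intros)+

lemma integrable_time_const:
  fixes h :: "'a::euclidean_space \<Rightarrow> 'b::euclidean_space"
  assumes h: "integrable lborel h" and I: "I \<in> sets borel" "emeasure lborel I < \<infinity>"
  shows "integrable lborel (\<lambda>z::'a \<times> real. indicator I (snd z) *\<^sub>R h (fst z))"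
proof -
  have [measurable]: "h \<in> borel_measurable borel" "I \<in> sets borel"
    using h I by (auto dest: borel_measurable_integrable)
  have iI: "integrable lborel (indicator I :: real \<Rightarrow> real)" using I by (intro integrable_real_indicator) auto
  have "integrable (lborel \<Otimes>\<^sub>M lborel) (\<lambda>z::'a \<times> real. indicator I (snd z) *\<^sub>R h (fst z))"
  proof (rule lborel_pair.Fubini_integrable)
    have "(\<lambda>x. LINT t|lborel. norm (indicator I (snd (x, t)) *\<^sub>R h (fst (x, t))))
       = (\<lambda>x. measure lborel I * norm (h x))" by simp
    then show "integrable lborel (\<lambda>x. LINT t|lborel. norm (indicator I (snd (x, t)) *\<^sub>R h (fst (x, t))))"
      using h by simp
    show "AE x in lborel. integrable lborel (\<lambda>t. indicator I (snd (x, t)) *\<^sub>R h (fst (x, t)))"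
      using iI by (intro AE_I2) (simp add: integrable_scaleR_left)
  qed measurable
  then show ?thesis unfolding lborel_prod .
qed

lemma Lp_on_time_const:
  fixes h :: "'a::euclidean_space \<Rightarrow> 'b::euclidean_space"
  assumes [measurable]: "h \<in> borel_measurable borel" and hq: "integrable lborel (\<lambda>x. norm (h x) powr q)"
    and z: "\<And>x. x \<notin> E \<Longrightarrow> h x = 0"
  shows "Lp_on q (cylinder E T) (\<lambda>z. h (fst z))"
proof -
  have i: "integrable lborel (\<lambda>z::'a \<times> real. indicator {0<..<T} (snd z) *\<^sub>R (norm (h (fst z)) powr q))"
    by (rule integrable_time_const[OF hq _ emeasure_bounded_finite]) simp_all
  have eq1: "(\<lambda>z. indicator (cylinder E T) z *\<^sub>R (norm (h (fst z)) powr q))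
     = (\<lambda>z::'a \<times> real. indicator {0<..<T} (snd z) *\<^sub>R (norm (h (fst z)) powr q))"
    using z by (auto simp: cylinder_def indicator_def fun_eq_iff)
  have eq2: "(\<lambda>z. indicator (cylinder E T) z *\<^sub>R h (fst z))
     = (\<lambda>z::'a \<times> real. indicator {0<..<T} (snd z) *\<^sub>R h (fst z))"
    using z by (auto simp: cylinder_def indicator_def fun_eq_iff)
  have "(\<lambda>z::'a \<times> real. indicator {0<..<T} (snd z) *\<^sub>R h (fst z)) \<in> borel_measurable borel" by measurable
  moreover have "(\<lambda>z::'a \<times> real. indicator {0<..<T} (snd z) *\<^sub>R (norm (h (fst z)) powr q)) \<in> borel_measurable borel" by measurable
  ultimately show ?thesis
    unfolding Lp_on_def set_borel_measurable_def set_integrable_def eq1 eq2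
    using i by (simp add: measurable_completion integrable_completion)
qed

text \<open>A test function vanishes at both endpoints. Multiplied by a constant in t, this says
  that a time-independent function has weak time derivative 0.\<close>

lemma integral_deriv_test_function:
  assumes \<phi>: "\<phi> \<in> test_functions {0<..<T}" and T: "T > 0"
  shows "(LINT t:{0<..<T}|lebesgue. deriv \<phi> t) = 0"
proof -
  note D = test_functionsD[OF \<phi>]
  have d: "(\<phi> has_field_derivative grad \<phi> t) (at t)" for t
    using Ck_has_derivative[OF D(1), of t] by (simp add: has_field_derivative_def mult_commute_abs)
  have D4: "grad \<phi> t = 0" if "t \<le> 0 \<or> t \<ge> T" for t using D(4)[of t] that by auto
  have de: "deriv \<phi> t = grad \<phi> t" for t using d by (rule DERIV_imp_deriv)
  have "(LINT t:{0<..<T}|lebesgue. deriv \<phi> t) = (LINT t|lborel. grad \<phi> t)"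
    unfolding de using D(4) Ck_grad_continuous[OF D(1)]
    by (intro set_integral_lebesgue_lborel borel_measurable_continuous_onI) auto
  also have "\<dots> = (LINT t|lborel. indicator {0..T} t *\<^sub>R grad \<phi> t)"
  proof (intro Bochner_Integration.integral_cong refl)
    fix t
    show "grad \<phi> t = indicator {0..T} t *\<^sub>R grad \<phi> t"
      using D4[of t] by (cases "t \<in> {0..T}") auto
  qed
  also have "\<dots> = \<phi> T - \<phi> 0"
    using T d
    by (intro integral_FTC_atLeastAtMost)
      (auto simp: has_real_derivative_iff_has_vector_derivative[symmetric] intro: has_field_derivative_at_within
        continuous_on_subset[OF Ck_grad_continuous[OF D(1)]])
  also have "\<dots> = 0" using D(2) by simp
  finally show ?thesis .
qed

text \<open>With \<open>m_minus m = 1\<close> the exponent of the time derivative space is 2, and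
  boundedness with compact support supplies the L^2 bounds. Freezing in time thus reduces
  admissibility to membership of one slice in W_0^{1,p}.\<close>

lemma admissible_static:
  fixes \<psi> :: "'a::euclidean_space \<Rightarrow> real"
  assumes W: "W01p_approx p (ball y b) \<psi> G" and m: "m_minus m = 1" and p: "p > 1" and T: "T > 0"
    and z: "\<And>x. x \<notin> cball y b \<Longrightarrow> \<psi> x = 0" "\<And>x. x \<notin> cball y b \<Longrightarrow> G x = 0"
    and B: "\<And>x. 0 \<le> \<psi> x" "\<And>x. \<psi> x \<le> B"
  shows "admissible_test m p T (cball y b) (\<lambda>z. \<psi> (fst z)) (\<lambda>z. 0) (\<lambda>z. G (fst z))"
proof -
  have [measurable]: "\<psi> \<in> borel_measurable borel" "G \<in> borel_measurable borel"
    and i: "integrable lborel (\<lambda>x. norm (\<psi> x) powr p)" "integrable lborel (\<lambda>x. norm (G x) powr p)"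
    using W by (auto simp: W01p_approx_def)
  have W0: "W01p p (cball y b) \<psi> G"
    using W p z by (intro W01p_approx_W01p) auto
  have i2: "integrable lborel (\<lambda>x. norm (\<psi> x) powr 2)"
  proof (rule Bochner_Integration.integrable_bound[OF integrable_cball_const[of y b "B powr 2"]])
    have "norm (norm (\<psi> x) powr 2) \<le> norm (indicator (cball y b) x * B powr 2)" for x
      using B[of x] z(1)[of x] by (cases "x \<in> cball y b") (auto intro!: powr_mono2)
    then show "AE x in lborel. norm (norm (\<psi> x) powr 2) \<le> norm (indicator (cball y b) x * B powr 2)" by (intro AE_I2)
  qed measurable
  have 0: "Lp_on 2 (cylinder (cball y b) T) (\<lambda>z. 0::real)"
    using Lp_on_time_const[of "\<lambda>x::'a. 0::real" 2 "cball y b" T] by simp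
  have L2: "Lp_on 2 (cball y b) \<psi>"
    using i2 z(1) set_integral_lebesgue_lborel(2)[of "\<lambda>x. norm (\<psi> x) powr 2" "cball y b"]
    unfolding Lp_on_def by (auto intro!: set_integral_lebesgue_lborel(3))
  have "W1q_Lq 2 T (cball y b) (\<lambda>z. \<psi> (fst z)) (\<lambda>z. 0)"
    unfolding W1q_Lq_def
  proof (intro conjI ballI)
    show "Lp_on 2 (cylinder (cball y b) T) (\<lambda>z. \<psi> (fst z))"
      by (intro Lp_on_time_const i2 z) measurable
    show "continuous_into_Lp {0..T} 2 (cball y b) (\<lambda>z. \<psi> (fst z))"
      unfolding continuous_into_Lp_def using L2 by simp
    fix \<phi> assume "\<phi> \<in> test_functions {0<..<T}"
    from integral_deriv_test_function[OF this T]
    show "AE x in lebesgue. x \<in> cball y b \<longrightarrow> (LINT t:{0<..<T}|lebesgue. \<psi> (fst (x, t)) * deriv \<phi> t)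
        = - (LINT t:{0<..<T}|lebesgue. 0 * \<phi> t)" by simp
  qed (rule 0)
  moreover have "Lp_W01p p T (cball y b) (\<lambda>z. \<psi> (fst z)) (\<lambda>z. G (fst z))"
    unfolding Lp_W01p_def using W0 i z by (auto intro!: Lp_on_time_const)
  ultimately show ?thesis unfolding admissible_test_def using m B by simp
qed

text \<open>The sub- and supersolution inequalities hold for the same nonnegative test function, so
  the weak form is 0, and its term with the time derivative is absent. The time t2 = T is
  included.\<close>

lemma weak_identity:
  fixes \<psi> :: "'a::euclidean_space \<Rightarrow> real"
  assumes sol: "weak_solution \<Omega> T m p A u" and sub: "cball y b \<subseteq> \<Omega>"
    and W: "W01p_approx p (ball y b) \<psi> G" and m: "m_minus m = 1" and p: "p > 1"
    and z: "\<And>x. x \<notin> cball y b \<Longrightarrow> \<psi> x = 0" "\<And>x. x \<notin> cball y b \<Longrightarrow> G x = 0"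
    and B: "\<And>x. 0 \<le> \<psi> x" "\<And>x. \<psi> x \<le> B" and t: "0 < t1" "t1 < t2" "t2 \<le> T"
  shows "set_integrable lebesgue (cball y b) (\<lambda>x. u (x, t1) * \<psi> x)"
    "set_integrable lebesgue (cball y b) (\<lambda>x. u (x, t2) * \<psi> x)"
    "set_integrable lebesgue (cball y b \<times> {t1..t2}) (\<lambda>z. A z (u z) (D_u \<Omega> T m u z) \<bullet> G (fst z))"
    "(LINT x:cball y b|lebesgue. u (x, t2) * \<psi> x) - (LINT x:cball y b|lebesgue. u (x, t1) * \<psi> x)
      = - (LINT z:cball y b \<times> {t1..t2}|lebesgue. A z (u z) (D_u \<Omega> T m u z) \<bullet> G (fst z))"
proof -
  have T: "T > 0" using t by linarith
  note ad = admissible_static[OF W m p T z B]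
  have c: "compact (cball y b) \<and> cball y b \<subseteq> \<Omega> \<and> 0 < t1 \<and> t1 < t2 \<and> t2 \<le> T \<and>
      admissible_test m p T (cball y b) (\<lambda>z. \<psi> (fst z)) (\<lambda>z. 0) (\<lambda>z. G (fst z))"
    using ad t sub by simp
  have wi: "weak_integrand \<Omega> T m A u (\<lambda>z. 0) (\<lambda>z. G (fst z)) = (\<lambda>z. A z (u z) (D_u \<Omega> T m u z) \<bullet> G (fst z))"
    by (simp add: weak_integrand_def fun_eq_iff)
  have "weak_form_defined \<Omega> T m A u (cball y b) t1 t2 (\<lambda>z. \<psi> (fst z)) (\<lambda>z. 0) (\<lambda>z. G (fst z))"
    "weak_form \<Omega> T m A u (cball y b) t1 t2 (\<lambda>z. \<psi> (fst z)) (\<lambda>z. 0) (\<lambda>z. G (fst z)) \<le> 0"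
    using sol c unfolding weak_solution_def weak_subsolution_def by blast+
  moreover have "weak_form \<Omega> T m A u (cball y b) t1 t2 (\<lambda>z. \<psi> (fst z)) (\<lambda>z. 0) (\<lambda>z. G (fst z)) \<ge> 0"
    using sol c unfolding weak_solution_def weak_supersolution_def by blast
  ultimately show "set_integrable lebesgue (cball y b) (\<lambda>x. u (x, t1) * \<psi> x)"
    "set_integrable lebesgue (cball y b) (\<lambda>x. u (x, t2) * \<psi> x)"
    "set_integrable lebesgue (cball y b \<times> {t1..t2}) (\<lambda>z. A z (u z) (D_u \<Omega> T m u z) \<bullet> G (fst z))"
    "(LINT x:cball y b|lebesgue. u (x, t2) * \<psi> x) - (LINT x:cball y b|lebesgue. u (x, t1) * \<psi> x)
      = - (LINT z:cball y b \<times> {t1..t2}|lebesgue. A z (u z) (D_u \<Omega> T m u z) \<bullet> G (fst z))"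
    unfolding weak_form_defined_def weak_form_def wi fst_conv by auto
qed

lemma AE_snd_neq:
  "AE z in (lebesgue :: ('a::euclidean_space \<times> real) measure). snd z \<noteq> c"
proof -
  have "negligible {z::'a \<times> real. z \<bullet> (0, 1) = c}"
    by (rule negligible_standard_hyperplane) (auto simp: Basis_prod_def)
  then have "{z::'a \<times> real. snd z = c} \<in> null_sets lebesgue"
    by (simp add: negligible_iff_null_sets inner_prod_def)
  from AE_not_in[OF this] show ?thesis by simp
qed

text \<open>Between two times the pairing changes by the integral of one fixed integrable function
  over a slab; as the times merge, the slab shrinks to a hyperplane of measure zero. This reaches
  \<tau>' = T, about which the local continuity of u in time says nothing.\<close>

lemma weak_identity_continuous:
  fixes \<psi> :: "'a::euclidean_space \<Rightarrow> real"
  assumes sol: "weak_solution \<Omega> T m p A u" and sub: "cball y b \<subseteq> \<Omega>"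
    and W: "W01p_approx p (ball y b) \<psi> G" and m: "m_minus m = 1" and p: "p > 1"
    and z: "\<And>x. x \<notin> cball y b \<Longrightarrow> \<psi> x = 0" "\<And>x. x \<notin> cball y b \<Longrightarrow> G x = 0"
    and B: "\<And>x. 0 \<le> \<psi> x" "\<And>x. \<psi> x \<le> B"
    and \<tau>: "\<And>n. \<tau> n \<in> {0<..T}" "\<tau>' \<in> {0<..T}" "\<tau> \<longlonglongrightarrow> \<tau>'"
  shows "(\<lambda>n. LINT x:cball y b|lebesgue. u (x, \<tau> n) * \<psi> x) \<longlonglongrightarrow> (LINT x:cball y b|lebesgue. u (x, \<tau>') * \<psi> x)"
proof -
  let ?g = "\<lambda>\<tau>. LINT x:cball y b|lebesgue. u (x, \<tau>) * \<psi> x"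
  let ?a = "\<lambda>z. A z (u z) (D_u \<Omega> T m u z) \<bullet> G (fst z)"
  note WI = weak_identity[OF sol sub W m p z B]
  \<comment> \<open>Half of \<tau>' bounds the times away from 0, which gives an integrable majorant
    on a slab reaching up to T.\<close>
  define c where "c = \<tau>' / 2"
  have c: "0 < c" "c < \<tau>'" "c < T" using \<tau>(2) by (auto simp: c_def)
  have "\<forall>\<^sub>F n in sequentially. \<tau> n > c" using order_tendstoD(1)[OF \<tau>(3) c(2)] .
  then obtain N where N: "\<And>n. n \<ge> N \<Longrightarrow> \<tau> n > c" unfolding eventually_sequentially by blast
  have int: "set_integrable lebesgue (cball y b \<times> {c..T}) ?a" using WI(3) c by simp
  define S where "S n = cball y b \<times> {min (\<tau> (n + N)) \<tau>'..max (\<tau> (n + N)) \<tau>'}" for n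
  have Sm[measurable]: "S n \<in> sets lebesgue" for n
  proof -
    have "closed (S n)" unfolding S_def by (intro closed_Times) auto
    then show ?thesis by (intro sets_completionI_sets) simp
  qed
  have Ssub: "S n \<subseteq> cball y b \<times> {c..T}" for n
    using N[of "n + N"] c \<tau>(1)[of "n+N"] \<tau>(2) by (auto simp: S_def)
  have eq: "\<bar>?g (\<tau> (n + N)) - ?g \<tau>'\<bar> = \<bar>LINT z:S n|lebesgue. ?a z\<bar>" for n
  proof -
    consider "\<tau> (n + N) = \<tau>'" | "\<tau> (n + N) < \<tau>'" | "\<tau>' < \<tau> (n + N)" by linarith
    then show ?thesis
    proof cases
      case 1
      \<comment> \<open>The weak identity needs two distinct times; for equal ones the slab is
        itself a null set.\<close>
      have "AE z in lebesgue. indicator (S n) z *\<^sub>R ?a z = 0"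
        using AE_snd_neq[of \<tau>'] by eventually_elim (auto simp: S_def 1 indicator_def)
      then have "(LINT z:S n|lebesgue. ?a z) = 0"
        unfolding set_lebesgue_integral_def by (rule integral_eq_zero_AE)
      then show ?thesis using 1 by simp
    next
      case 2
      then show ?thesis using WI(4)[of "\<tau> (n + N)" \<tau>'] \<tau>(1)[of "n+N"] \<tau>(2) by (simp add: S_def min_def max_def)
    next
      case 3
      then show ?thesis using WI(4)[of \<tau>' "\<tau> (n + N)"] \<tau>(1)[of "n+N"] \<tau>(2) by (simp add: S_def min_def max_def)
    qed
  qed
  have "(\<lambda>n. LINT z|lebesgue. indicator (S n) z *\<^sub>R ?a z) \<longlonglongrightarrow> (LINT z|(lebesgue :: ('a \<times> real) measure). (0::real))"
  proof (rule integral_dominated_convergence[where w="\<lambda>z. norm (indicator (cball y b \<times> {c..T}) z *\<^sub>R ?a z)"])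
    show "integrable lebesgue (\<lambda>z. norm (indicator (cball y b \<times> {c..T}) z *\<^sub>R ?a z))"
      using int unfolding set_integrable_def by (rule integrable_norm)
    show "(\<lambda>z. indicator (S n) z *\<^sub>R ?a z) \<in> borel_measurable lebesgue" for n
      using set_integrable_subset[OF int Sm Ssub] unfolding set_integrable_def by (rule borel_measurable_integrable)
    show "AE z in lebesgue. norm (indicator (S n) z *\<^sub>R ?a z) \<le> norm (indicator (cball y b \<times> {c..T}) z *\<^sub>R ?a z)" for n
      using Ssub[of n] by (intro AE_I2) (auto simp: indicator_def)
    show "AE z in lebesgue. (\<lambda>n. indicator (S n) z *\<^sub>R ?a z) \<longlonglongrightarrow> 0"
      using AE_snd_neq[of \<tau>']
    proof eventually_elim
      case (elim z)
      have "(\<lambda>n. \<tau> (n + N)) \<longlonglongrightarrow> \<tau>'" using \<tau>(3) by (rule LIMSEQ_ignore_initial_segment)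
      then have "\<forall>\<^sub>F n in sequentially. dist (\<tau> (n + N)) \<tau>' < \<bar>snd z - \<tau>'\<bar>"
        using elim by (intro tendstoD) auto
      then have "\<forall>\<^sub>F n in sequentially. indicator (S n) z *\<^sub>R ?a z = 0"
        by eventually_elim (auto simp: S_def indicator_def dist_real_def mem_Times_iff)
      then show ?case by (rule tendsto_eventually)
    qed
  qed simp
  then have "(\<lambda>n. \<bar>LINT z:S n|lebesgue. ?a z\<bar>) \<longlonglongrightarrow> 0"
    unfolding set_lebesgue_integral_def by (simp add: tendsto_rabs_zero)
  then have "(\<lambda>n. ?g (\<tau> (n + N)) - ?g \<tau>') \<longlonglongrightarrow> 0" unfolding eq[symmetric] by (rule tendsto_rabs_zero_cancel)
  then have "(\<lambda>n. ?g (\<tau> (n + N))) \<longlonglongrightarrow> ?g \<tau>'" by (rule LIM_zero_cancel)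
  then show ?thesis by (rule LIMSEQ_offset)
qed

section \<open>The vanishing time step\<close>

lemma translation_Lp_vector_ex:
  fixes V :: "'a::euclidean_space \<Rightarrow> 'b::euclidean_space"
  assumes [measurable]: "V \<in> borel_measurable borel" and Vp: "integrable lborel (\<lambda>x. norm (V x) powr p)"
    and p: "p \<ge> 1" and e: "e > 0"
  shows "\<exists>d>0. \<forall>h. norm h < d \<longrightarrow> (LINT x|lborel. norm (V (x + h) - V x) powr p) < e"
    and "integrable lborel (\<lambda>x. norm (V (x + h) - V x) powr p)"
proof -
  have Vpi: "integrable lborel (\<lambda>x. \<bar>V x \<bullet> i\<bar> powr p)" if "i \<in> Basis" for i
  proof (rule Bochner_Integration.integrable_bound[OF Vp])
    show "AE x in lborel. norm (\<bar>V x \<bullet> i\<bar> powr p) \<le> norm (norm (V x) powr p)"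
      using that p by (intro AE_I2) (auto intro!: powr_mono2 Basis_le_norm)
  qed measurable
  define c where "c = real DIM('b) powr p"
  have c: "c > 0" by (simp add: c_def)
  let ?S = "\<lambda>h x. c * (\<Sum>i\<in>Basis. \<bar>V (x + h) \<bullet> i - V x \<bullet> i\<bar> powr p)"
  have mi: "(\<lambda>x. V x \<bullet> i) \<in> borel_measurable borel" for i by measurable
  have i1: "integrable lborel (\<lambda>x. \<bar>V (x + h) \<bullet> i - V x \<bullet> i\<bar> powr p)" if "i \<in> Basis" for i h
    by (rule integrable_powr_translate_diff[OF mi Vpi[OF that] p])
  have iS: "integrable lborel (?S h)" for h
    by (intro integrable_mult_right Bochner_Integration.integrable_sum i1)
  have le: "norm (V (x + h) - V x) powr p \<le> ?S h x" for x h
    using norm_powr_le_sum[OF p, of "V (x + h) - V x"] by (simp add: inner_diff_left c_def)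
  have iV: "integrable lborel (\<lambda>x. norm (V (x + h) - V x) powr p)" for h
  proof (rule Bochner_Integration.integrable_bound[OF iS[of h]])
    show "AE x in lborel. norm (norm (V (x + h) - V x) powr p) \<le> norm (?S h x)"
    proof (rule AE_I2)
      fix x show "norm (norm (V (x + h) - V x) powr p) \<le> norm (?S h x)"
        using le[of x h] by simp
    qed
  qed measurable
  then show "integrable lborel (\<lambda>x. norm (V (x + h) - V x) powr p)" .
  define e' where "e' = e / (c * real DIM('b))"
  have e': "e' > 0" using e c by (simp add: e'_def)
  have "\<exists>d. \<forall>i\<in>Basis. d i > 0 \<and> (\<forall>h. norm h < d i \<longrightarrow> (LINT x|lborel. \<bar>V (x + h) \<bullet> i - V x \<bullet> i\<bar> powr p) < e')"
    using translation_Lp_ex[OF mi Vpi p e'] by (intro bchoice) blast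
  then obtain d where d: "\<And>i. i \<in> Basis \<Longrightarrow> d i > 0"
    "\<And>i h. i \<in> Basis \<Longrightarrow> norm h < d i \<Longrightarrow> (LINT x|lborel. \<bar>V (x + h) \<bullet> i - V x \<bullet> i\<bar> powr p) < e'" by blast
  show "\<exists>d>0. \<forall>h. norm h < d \<longrightarrow> (LINT x|lborel. norm (V (x + h) - V x) powr p) < e"
  proof (intro exI[of _ "Min (d ` Basis)"] conjI allI impI)
    show "0 < Min (d ` Basis)" using d(1) by (subst Min_gr_iff) auto
    fix h :: 'a assume h: "norm h < Min (d ` Basis)"
    have "(LINT x|lborel. norm (V (x + h) - V x) powr p) \<le> (LINT x|lborel. ?S h x)"
      by (rule integral_mono[OF iV iS le])
    also have "\<dots> = c * (\<Sum>i\<in>Basis. LINT x|lborel. \<bar>V (x + h) \<bullet> i - V x \<bullet> i\<bar> powr p)"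
      using i1 by (subst integral_mult_right_zero, subst Bochner_Integration.integral_sum) auto
    also have "\<dots> < c * (\<Sum>i\<in>(Basis::'b set). e')"
      using h c by (intro mult_strict_left_mono sum_strict_mono d(2)) auto
    also have "\<dots> = e" using c by (simp add: e'_def)
    finally show "(LINT x|lborel. norm (V (x + h) - V x) powr p) < e" .
  qed
qed

text \<open>Young's inequality without optimal constants: estimating by the larger of b and \<eta> *
  a leaves one of the two terms on the right.\<close>

lemma young_dichotomy:
  fixes a b \<eta> p :: real
  assumes "a \<ge> 0" "b \<ge> 0" "\<eta> > 0" "p > 1"
  shows "a powr (p - 1) * b \<le> \<eta> * a powr p + \<eta> powr (1 - p) * b powr p"
proof (cases "b \<le> \<eta> * a")
  case True
  have "a powr (p - 1) * b \<le> a powr (p - 1) * (\<eta> * a)" using True by (intro mult_left_mono) auto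
  also have "\<dots> = \<eta> * a powr p"
    using assms powr_add[of a "p - 1" 1] by (cases "a = 0") auto
  finally show ?thesis by (simp add: add_increasing2)
next
  case False
  then have b: "b > 0" using assms by (metis mult_nonneg_nonneg less_le not_le order_trans)
  have "a \<le> b / \<eta>" using False assms by (simp add: field_simps)
  then have "a powr (p - 1) \<le> (b / \<eta>) powr (p - 1)" using assms by (intro powr_mono2) auto
  then have "a powr (p - 1) * b \<le> (b / \<eta>) powr (p - 1) * b" using b by (intro mult_right_mono) auto
  also have "(b / \<eta>) powr (p - 1) = b powr (p - 1) * \<eta> powr (1 - p)"
  proof -
    have "\<eta> powr (1 - p) = inverse (\<eta> powr (p - 1))" using powr_minus[of \<eta> "p - 1"] by simp
    then show ?thesis unfolding powr_divide by (simp add: divide_inverse)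
  qed
  also have "b powr (p - 1) * \<eta> powr (1 - p) * b = \<eta> powr (1 - p) * b powr p"
    using b powr_add[of b "p - 1" 1] by simp
  finally show ?thesis using assms by (simp add: add_increasing)
qed

text \<open>Passage to the limit in the time-discrete energy inequality: shifting \<open>\<Psi>\<close> in time by at most
  \<open>h\<close> changes the pairing with \<open>G\<close> by a quantity that vanishes as \<open>h \<rightarrow> 0\<close>.\<close>

lemma energy_limit:
  fixes G \<Psi> :: "'a::euclidean_space \<times> real \<Rightarrow> 'a" and Y :: "real \<Rightarrow> real"
  assumes Gm[measurable]: "G \<in> borel_measurable borel" and \<Psi>m[measurable]: "\<Psi> \<in> borel_measurable borel"
    and Ym[measurable]: "Y \<in> borel_measurable borel" and p: "p > 1"
    and Gq: "integrable lborel (\<lambda>z. norm (G z) powr (p / (p - 1)))"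
    and \<Psi>p: "integrable lborel (\<lambda>z. norm (\<Psi> z) powr p)"
    and t: "t0 < t1" "t1 < t2"
    and \<Psi>z: "\<And>z. snd z \<notin> {t1..t2} \<Longrightarrow> \<Psi> z = 0"
    and Y: "\<And>\<tau>. 0 \<le> Y \<tau>" "\<And>\<tau>. Y \<tau> \<le> C"
    and step: "\<And>h. 0 < h \<Longrightarrow> h < t1 - t0 \<Longrightarrow> AE \<tau> in lborel. \<tau> \<in> {t1..t2} \<longrightarrow>
      (LINT z|lborel. indicator {\<tau> - h..\<tau>} (snd z) * (G z \<bullet> \<Psi> (fst z, \<tau>))) \<le> Y \<tau> - Y (\<tau> - h)"
  shows "(LINT z|lborel. G z \<bullet> \<Psi> z) \<le> C"
    and "integrable lborel (\<lambda>z. G z \<bullet> \<Psi> z)"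
proof -
  \<comment> \<open>Writing |G| as a power with exponent p - 1 lets \<open>young_dichotomy\<close>
    pair the exponents p / (p - 1) and p.\<close>
  have GA: "norm (G z) = (norm (G z) powr (1 / (p - 1))) powr (p - 1)" for z
    using p by (simp add: powr_powr)
  have GB: "(norm (G z) powr (1 / (p - 1))) powr p = norm (G z) powr (p / (p - 1))" for z
    by (simp add: powr_powr)
  have young: "norm (G z) * norm v \<le> \<eta> * norm (G z) powr (p / (p - 1)) + \<eta> powr (1 - p) * norm v powr p"
    if "\<eta> > 0" for z \<eta> and v :: 'a
    using young_dichotomy[of "norm (G z) powr (1 / (p - 1))" "norm v" \<eta> p] that p
    unfolding GA[symmetric] GB by simp
  show iP: "integrable lborel (\<lambda>z. G z \<bullet> \<Psi> z)"
  proof (rule Bochner_Integration.integrable_bound)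
    show "integrable lborel (\<lambda>z. 1 * norm (G z) powr (p / (p - 1)) + 1 powr (1 - p) * norm (\<Psi> z) powr p)"
      using Gq \<Psi>p by (intro Bochner_Integration.integrable_add integrable_mult_right)
    have "norm (G z \<bullet> \<Psi> z) \<le> norm (1 * norm (G z) powr (p / (p - 1)) + 1 powr (1 - p) * norm (\<Psi> z) powr p)" for z
      using young[of 1 z "\<Psi> z"] Cauchy_Schwarz_ineq2[of "G z" "\<Psi> z"] by simp
    then show "AE z in lborel. norm (G z \<bullet> \<Psi> z) \<le> norm (1 * norm (G z) powr (p / (p - 1)) + 1 powr (1 - p) * norm (\<Psi> z) powr p)"
      by (intro AE_I2)
  qed measurable
  define IG where "IG = (LINT z|lborel. norm (G z) powr (p / (p - 1)))"
  have IG: "IG \<ge> 0" unfolding IG_def by (intro Bochner_Integration.integral_nonneg) simp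
  have key: "(LINT z|lborel. G z \<bullet> \<Psi> z) \<le> C + e" if e: "e > 0" for e
  proof -
    \<comment> \<open>With this \<eta> the G part of Young's inequality is at most e / 2; \<kappa>
      is the translation error of \<Psi> that may contribute the other half.\<close>
    define \<eta> where "\<eta> = e / (2 * (IG + 1))"
    have \<eta>: "\<eta> > 0" using e IG by (simp add: \<eta>_def)
    have \<eta>IG: "\<eta> * IG \<le> e / 2" using e IG by (simp add: \<eta>_def field_simps)
    define \<kappa> where "\<kappa> = e / (2 * \<eta> powr (1 - p))"
    have \<kappa>: "\<kappa> > 0" using e \<eta> by (simp add: \<kappa>_def)
    obtain d where d: "d > 0" "\<And>h. norm h < d \<Longrightarrow> (LINT z|lborel. norm (\<Psi> (z + h) - \<Psi> z) powr p) < \<kappa>"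
      using translation_Lp_vector_ex(1)[OF \<Psi>m \<Psi>p _ \<kappa>] p by auto
    note i\<Delta> = translation_Lp_vector_ex(2)[OF \<Psi>m \<Psi>p less_imp_le[OF p] \<kappa>]
    define h where "h = min d (t1 - t0) / 2"
    have h: "0 < h" "h < t1 - t0" "h < d" using d(1) t by (auto simp: h_def min_def field_simps)
    have shift: "(\<integral>\<^sup>+z. ennreal (norm (G z) * norm (\<Psi> (z + (0, s)) - \<Psi> z)) \<partial>lborel) \<le> ennreal e"
      if s: "0 \<le> s" "s \<le> h" for s
    proof -
      have i: "integrable lborel (\<lambda>z. \<eta> * norm (G z) powr (p / (p - 1)) + \<eta> powr (1 - p) * norm (\<Psi> (z + (0, s)) - \<Psi> z) powr p)"
        using Gq i\<Delta> by (intro Bochner_Integration.integrable_add integrable_mult_right)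
      have "(\<integral>\<^sup>+z. ennreal (norm (G z) * norm (\<Psi> (z + (0, s)) - \<Psi> z)) \<partial>lborel)
        \<le> (\<integral>\<^sup>+z. ennreal (\<eta> * norm (G z) powr (p / (p - 1)) + \<eta> powr (1 - p) * norm (\<Psi> (z + (0, s)) - \<Psi> z) powr p) \<partial>lborel)"
        by (intro nn_integral_mono ennreal_leI young \<eta>)
      also have "\<dots> = ennreal (LINT z|lborel. \<eta> * norm (G z) powr (p / (p - 1)) + \<eta> powr (1 - p) * norm (\<Psi> (z + (0, s)) - \<Psi> z) powr p)"
        using \<eta> by (intro nn_integral_eq_integral i AE_I2) (simp add: less_imp_le)
      also have "(LINT z|lborel. \<eta> * norm (G z) powr (p / (p - 1)) + \<eta> powr (1 - p) * norm (\<Psi> (z + (0, s)) - \<Psi> z) powr p)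
        = \<eta> * IG + \<eta> powr (1 - p) * (LINT z|lborel. norm (\<Psi> (z + (0, s)) - \<Psi> z) powr p)"
        unfolding IG_def using Gq i\<Delta> by (simp add: Bochner_Integration.integral_add)
      also have "\<dots> \<le> e / 2 + \<eta> powr (1 - p) * \<kappa>"
        using d(2)[of "(0, s)"] s h(3) \<eta>IG by (intro add_mono mult_left_mono) (auto simp: norm_Pair)
      also have "\<dots> = e" using \<eta> by (simp add: \<kappa>_def)
      finally show ?thesis by (simp add: ennreal_leI)
    qed
    define I where "I \<tau> z = (indicator {\<tau> - h..\<tau>} (snd z) :: real)" for \<tau> and z :: "'a \<times> real"
    have I_alt: "I \<tau> z = indicator {0..h} (\<tau> - snd z)" for \<tau> z by (auto simp: I_def indicator_def)
    have Im[measurable]: "(\<lambda>w::real \<times> ('a \<times> real). I (fst w) (snd w)) \<in> borel_measurable borel"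
      unfolding I_alt by measurable
    define Q where "Q w = I (fst w) (snd w) * (G (snd w) \<bullet> (\<Psi> (fst (snd w), fst w) - \<Psi> (snd w)))" for w :: "real \<times> ('a \<times> real)"
    define P where "P w = I (fst w) (snd w) * (G (snd w) \<bullet> \<Psi> (snd w))" for w :: "real \<times> ('a \<times> real)"
    have pairm: "(\<lambda>w::real \<times> ('a \<times> real). (fst (snd w), fst w)) \<in> borel_measurable borel"
      by (intro borel_measurable_continuous_onI continuous_intros)
    have \<Psi>'[measurable]: "(\<lambda>w::real \<times> ('a \<times> real). \<Psi> (fst (snd w), fst w)) \<in> borel_measurable borel"
      using measurable_compose[OF pairm \<Psi>m] by simp
    have Qm[measurable]: "Q \<in> borel_measurable (lborel \<Otimes>\<^sub>M lborel)" unfolding Q_def lborel_prod by measurable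
    have Pm[measurable]: "P \<in> borel_measurable (lborel \<Otimes>\<^sub>M lborel)" unfolding P_def lborel_prod by measurable
    \<comment> \<open>A fixed point lies in the window [\<tau> - h, \<tau>] for a set of \<tau> of
      length h. Integrating over \<tau> produces the factor h that divides out at the end.\<close>
    have nnI: "(\<integral>\<^sup>+\<tau>. ennreal (I \<tau> z) * c \<partial>lborel) = ennreal h * c" for z and c :: ennreal
    proof -
      have "(\<lambda>\<tau>. ennreal (I \<tau> z) * c) = (\<lambda>\<tau>. c * indicator {snd z..snd z + h} \<tau>)"
        by (auto simp: I_def indicator_def fun_eq_iff)
      then show ?thesis using h by (simp add: nn_integral_cmult_indicator mult.commute)
    qed
    have nnP: "(\<integral>\<^sup>+w. ennreal (norm (P w)) \<partial>(lborel \<Otimes>\<^sub>M lborel)) < \<infinity>"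
    proof -
      have "(\<integral>\<^sup>+w. ennreal (norm (P w)) \<partial>(lborel \<Otimes>\<^sub>M lborel)) = (\<integral>\<^sup>+z. \<integral>\<^sup>+\<tau>. ennreal (norm (P (\<tau>, z))) \<partial>lborel \<partial>lborel)"
        by (rule lborel_pair.nn_integral_snd[symmetric]) measurable
      also have "\<dots> = (\<integral>\<^sup>+z. ennreal h * ennreal (norm (G z \<bullet> \<Psi> z)) \<partial>lborel)"
        using nnI by (intro nn_integral_cong) (simp add: P_def abs_mult ennreal_mult I_def)
      also have "\<dots> = ennreal h * (\<integral>\<^sup>+z. ennreal (norm (G z \<bullet> \<Psi> z)) \<partial>lborel)"
        by (rule nn_integral_cmult) measurable
      also have "\<dots> < \<infinity>" using iP by (simp add: integrable_iff_bounded ennreal_mult_less_top)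
      finally show ?thesis .
    qed
    have intP: "integrable (lborel \<Otimes>\<^sub>M lborel) P" using nnP by (intro integrableI_bounded) measurable
    have nnQ: "(\<integral>\<^sup>+w. ennreal (norm (Q w)) \<partial>(lborel \<Otimes>\<^sub>M lborel)) \<le> ennreal (h * e)"
    proof -
      have "(\<integral>\<^sup>+w. ennreal (norm (Q w)) \<partial>(lborel \<Otimes>\<^sub>M lborel)) = (\<integral>\<^sup>+z. \<integral>\<^sup>+\<tau>. ennreal (norm (Q (\<tau>, z))) \<partial>lborel \<partial>lborel)"
        by (rule lborel_pair.nn_integral_snd[symmetric]) measurable
      also have "\<dots> \<le> (\<integral>\<^sup>+z. \<integral>\<^sup>+s. indicator {0..h} s * ennreal (norm (G z) * norm (\<Psi> (z + (0, s)) - \<Psi> z)) \<partial>lborel \<partial>lborel)"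
      proof (rule nn_integral_mono)
        fix z :: "'a \<times> real"
        have zm[measurable]: "(\<lambda>\<tau>. \<Psi> (fst z, \<tau>)) \<in> borel_measurable borel"
        proof -
          have "(\<lambda>\<tau>. (fst z, \<tau>)) \<in> borel_measurable borel" by (intro borel_measurable_continuous_onI continuous_intros)
          from measurable_compose[OF this \<Psi>m] show ?thesis .
        qed
        let ?f = "\<lambda>\<tau>. indicator {0..h} (\<tau> - snd z) * ennreal (norm (G z) * norm (\<Psi> (fst z, \<tau>) - \<Psi> z))"
        have "(\<integral>\<^sup>+\<tau>. ennreal (norm (Q (\<tau>, z))) \<partial>lborel) \<le> (\<integral>\<^sup>+\<tau>. ?f \<tau> \<partial>lborel)"
        proof (rule nn_integral_mono)
          fix \<tau>
          show "ennreal (norm (Q (\<tau>, z))) \<le> ?f \<tau>"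
            using Cauchy_Schwarz_ineq2[of "G z" "\<Psi> (fst z, \<tau>) - \<Psi> z"]
            by (auto simp: Q_def I_alt indicator_def intro!: ennreal_leI)
        qed
        also have "\<dots> = (\<integral>\<^sup>+\<tau>. ?f \<tau> \<partial>(distr lborel borel ((+) (snd z))))" by (simp add: lborel_distr_plus)
        also have "\<dots> = (\<integral>\<^sup>+s. ?f (snd z + s) \<partial>lborel)" by (rule nn_integral_distr) measurable
        also have "\<dots> = (\<integral>\<^sup>+s. indicator {0..h} s * ennreal (norm (G z) * norm (\<Psi> (z + (0, s)) - \<Psi> z)) \<partial>lborel)"
          by (intro nn_integral_cong) (cases z; simp)
        finally show "(\<integral>\<^sup>+\<tau>. ennreal (norm (Q (\<tau>, z))) \<partial>lborel)
          \<le> (\<integral>\<^sup>+s. indicator {0..h} s * ennreal (norm (G z) * norm (\<Psi> (z + (0, s)) - \<Psi> z)) \<partial>lborel)" .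
      qed
      also have "\<dots> = (\<integral>\<^sup>+s. \<integral>\<^sup>+z. indicator {0..h} s * ennreal (norm (G z) * norm (\<Psi> (z + (0, s)) - \<Psi> z)) \<partial>lborel \<partial>lborel)"
      proof (rule lborel_pair.Fubini')
        have "(\<lambda>w::real \<times> ('a \<times> real). snd w + (0, fst w)) \<in> borel_measurable borel"
          by (intro borel_measurable_continuous_onI continuous_intros)
        from measurable_compose[OF this \<Psi>m]
        have [measurable]: "(\<lambda>w::real \<times> ('a \<times> real). \<Psi> (snd w + (0, fst w))) \<in> borel_measurable borel" .
        show "(\<lambda>(s, z). indicator {0..h} s * ennreal (norm (G z) * norm (\<Psi> (z + (0, s)) - \<Psi> z))) \<in> borel_measurable (lborel \<Otimes>\<^sub>M lborel)"
          unfolding lborel_prod case_prod_beta by measurable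
      qed
      also have "\<dots> \<le> (\<integral>\<^sup>+s. ennreal e * indicator {0..h} s \<partial>lborel)"
      proof (rule nn_integral_mono)
        fix s
        show "(\<integral>\<^sup>+z. indicator {0..h} s * ennreal (norm (G z) * norm (\<Psi> (z + (0, s)) - \<Psi> z)) \<partial>lborel) \<le> ennreal e * indicator {0..h} s"
          using shift[of s] by (cases "s \<in> {0..h}") auto
      qed
      also have "\<dots> = ennreal (h * e)" using h e by (simp add: nn_integral_cmult_indicator ennreal_mult' mult.commute)
      finally show ?thesis .
    qed
    have intQ: "integrable (lborel \<Otimes>\<^sub>M lborel) Q"
      using nnQ by (intro integrableI_bounded) (auto intro: le_less_trans)
    have Qle: "\<bar>integral\<^sup>L (lborel \<Otimes>\<^sub>M lborel) Q\<bar> \<le> h * e"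
    proof -
      have "ennreal \<bar>integral\<^sup>L (lborel \<Otimes>\<^sub>M lborel) Q\<bar> \<le> ennreal (h * e)"
        using integral_norm_bound_ennreal[OF intQ] nnQ by simp
      then show ?thesis using h e by (subst (asm) ennreal_le_iff) auto
    qed
    have Pval: "integral\<^sup>L (lborel \<Otimes>\<^sub>M lborel) P = h * (LINT z|lborel. G z \<bullet> \<Psi> z)"
    proof -
      have PP: "integrable (lborel \<Otimes>\<^sub>M lborel) (\<lambda>(\<tau>, z). P (\<tau>, z))" using intP by simp
      have "integral\<^sup>L (lborel \<Otimes>\<^sub>M lborel) P = (LINT z|lborel. LINT \<tau>|lborel. P (\<tau>, z))"
        using lborel_pair.integral_snd[OF PP] by simp
      also have "\<dots> = (LINT z|lborel. h * (G z \<bullet> \<Psi> z))"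
      proof (rule Bochner_Integration.integral_cong[OF refl])
        fix z :: "'a \<times> real"
        have "(LINT \<tau>|lborel. P (\<tau>, z)) = (LINT \<tau>|lborel. indicator {snd z..snd z + h} \<tau> * (G z \<bullet> \<Psi> z))"
          by (intro Bochner_Integration.integral_cong) (auto simp: P_def I_def indicator_def)
        then show "(LINT \<tau>|lborel. P (\<tau>, z)) = h * (G z \<bullet> \<Psi> z)" using h by simp
      qed
      finally show ?thesis by simp
    qed
    have intPQ: "integrable (lborel \<Otimes>\<^sub>M lborel) (\<lambda>w. P w + Q w)" using intP intQ by simp
    have PQ: "P (\<tau>, z) + Q (\<tau>, z) = indicator {\<tau> - h..\<tau>} (snd z) * (G z \<bullet> \<Psi> (fst z, \<tau>))" for \<tau> z
      by (simp add: P_def Q_def I_def inner_diff_right algebra_simps)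
    have intY: "integrable lborel (\<lambda>\<tau>. indicator {a..b} \<tau> * Y \<tau>)" for a b
    proof (rule Bochner_Integration.integrable_bound)
      show "integrable lborel (\<lambda>\<tau>. indicator {a..b} \<tau> * C)"
        by (intro integrable_mult_left integrable_real_indicator) (auto simp: emeasure_lborel_Icc_eq)
      show "AE \<tau> in lborel. norm (indicator {a..b} \<tau> * Y \<tau>) \<le> norm (indicator {a..b} \<tau> * C)"
        using Y by (intro AE_I2) (auto simp: indicator_def intro: order_trans[OF _ abs_ge_self])
    qed measurable
    have intY': "integrable lborel (\<lambda>\<tau>. indicator {t1..t2} \<tau> * Y (\<tau> - h))"
      and eqY': "(LINT \<tau>|lborel. indicator {t1..t2} \<tau> * Y (\<tau> - h)) = (LINT \<tau>|lborel. indicator {t1-h..t2-h} \<tau> * Y \<tau>)"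
    proof -
      have eq: "(\<lambda>\<tau>. indicator {t1..t2} \<tau> * Y (\<tau> - h)) = (\<lambda>\<tau>. (\<lambda>\<tau>. indicator {t1-h..t2-h} \<tau> * Y \<tau>) (\<tau> + (-h)))"
        by (auto simp: indicator_def fun_eq_iff)
      show "integrable lborel (\<lambda>\<tau>. indicator {t1..t2} \<tau> * Y (\<tau> - h))"
        unfolding eq by (rule lborel_translate_integrable[OF intY])
      have m: "(\<lambda>\<tau>. indicator {t1-h..t2-h} \<tau> * Y \<tau>) \<in> borel_measurable borel" by measurable
      show "(LINT \<tau>|lborel. indicator {t1..t2} \<tau> * Y (\<tau> - h)) = (LINT \<tau>|lborel. indicator {t1-h..t2-h} \<tau> * Y \<tau>)"
        unfolding eq by (rule lborel_translate(1)[OF m])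
    qed
    have "h * (LINT z|lborel. G z \<bullet> \<Psi> z) + integral\<^sup>L (lborel \<Otimes>\<^sub>M lborel) Q = integral\<^sup>L (lborel \<Otimes>\<^sub>M lborel) (\<lambda>w. P w + Q w)"
      using intP intQ Pval by simp
    also have "\<dots> = (LINT \<tau>|lborel. LINT z|lborel. P (\<tau>, z) + Q (\<tau>, z))"
      using lborel_pair.integral_fst'[OF intPQ] by simp
    also have "\<dots> \<le> (LINT \<tau>|lborel. indicator {t1..t2} \<tau> * Y \<tau> - indicator {t1..t2} \<tau> * Y (\<tau> - h))"
    proof (rule integral_mono_AE)
      show "integrable lborel (\<lambda>\<tau>. LINT z|lborel. P (\<tau>, z) + Q (\<tau>, z))"
        using lborel_pair.integrable_fst'[OF intPQ] by simp
      show "integrable lborel (\<lambda>\<tau>. indicator {t1..t2} \<tau> * Y \<tau> - indicator {t1..t2} \<tau> * Y (\<tau> - h))"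
        using intY intY' by simp
      show "AE \<tau> in lborel. (LINT z|lborel. P (\<tau>, z) + Q (\<tau>, z)) \<le> indicator {t1..t2} \<tau> * Y \<tau> - indicator {t1..t2} \<tau> * Y (\<tau> - h)"
        using step[OF h(1,2)]
      proof eventually_elim
        case (elim \<tau>)
        show ?case
        proof (cases "\<tau> \<in> {t1..t2}")
          case True
          then show ?thesis using elim unfolding PQ by simp
        next
          case False
          then show ?thesis unfolding PQ using \<Psi>z by simp
        qed
      qed
    qed
    also have "\<dots> = (LINT \<tau>|lborel. indicator {t1..t2} \<tau> * Y \<tau>) - (LINT \<tau>|lborel. indicator {t1-h..t2-h} \<tau> * Y \<tau>)"
      using intY intY' eqY' by simp
    also have "\<dots> = (LINT \<tau>|lborel. indicator {t1..t2} \<tau> * Y \<tau> - indicator {t1-h..t2-h} \<tau> * Y \<tau>)"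
      using intY by simp
    \<comment> \<open>The positive part of the difference of the two indicators lies in the last
      window of length h, where Y is at most C; the negative part is dropped because Y is
      nonnegative.\<close>
    also have "\<dots> \<le> (LINT \<tau>|lborel. indicator {t2-h..t2} \<tau> * C)"
    proof (rule integral_mono)
      show "integrable lborel (\<lambda>\<tau>. indicator {t1..t2} \<tau> * Y \<tau> - indicator {t1-h..t2-h} \<tau> * Y \<tau>)" using intY by simp
      show "integrable lborel (\<lambda>\<tau>. indicator {t2-h..t2} \<tau> * C)"
        by (intro integrable_mult_left integrable_real_indicator) (auto simp: emeasure_lborel_Icc_eq)
      fix \<tau>
      show "indicator {t1..t2} \<tau> * Y \<tau> - indicator {t1-h..t2-h} \<tau> * Y \<tau> \<le> indicator {t2-h..t2} \<tau> * C"
        using Y[of \<tau>] h by (auto simp: indicator_def)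
    qed
    also have "\<dots> = h * C" using h by simp
    finally have "h * (LINT z|lborel. G z \<bullet> \<Psi> z) \<le> h * C + h * e" using Qle by linarith
    then have "h * (LINT z|lborel. G z \<bullet> \<Psi> z) \<le> h * (C + e)" by (simp add: distrib_left)
    then show ?thesis using h(1) by simp
  qed
  then show "(LINT z|lborel. G z \<bullet> \<Psi> z) \<le> C" by (rule field_le_epsilon)
qed

section \<open>Cutoff functions and interpolation\<close>

text \<open>A polynomial cutoff: it has a kink on the sphere, but its powers from the second on are
  C^1, and the gradient of the k-th power is bounded by a multiple of the (k - 1)-th, the form that
  Young's inequality needs.\<close>

definition bump :: "'a::euclidean_space \<Rightarrow> real \<Rightarrow> 'a \<Rightarrow> real" where
  "bump y a x = max 0 (1 - (norm (x - y))\<^sup>2 / a\<^sup>2)"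

text \<open>The gradient of the k-th power of \<open>bump\<close>, as shown in
  \<open>bump_power_has_derivative\<close>.\<close>

definition grad_bump :: "nat \<Rightarrow> 'a::euclidean_space \<Rightarrow> real \<Rightarrow> 'a \<Rightarrow> 'a" where
  "grad_bump k y a x = (- (2 * real k / a\<^sup>2) * bump y a x ^ (k - 1)) *\<^sub>R (x - y)"

lemma bump_bounds: "0 \<le> bump y a x" "bump y a x \<le> 1"
  by (auto simp: bump_def)

lemma bump_pos: 
  assumes "a > 0"
  shows "0 < bump y a x \<longleftrightarrow> x \<in> ball y a"
proof -
  have "(norm (x - y))\<^sup>2 < a\<^sup>2 \<longleftrightarrow> norm (x - y) < a" using assms power_mono_iff[of a "norm (x - y)" 2] by (simp add: not_le[symmetric])
  then show ?thesis using assms by (auto simp: bump_def dist_norm norm_minus_commute)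
qed

lemma bump_zero: "a > 0 \<Longrightarrow> x \<notin> ball y a \<Longrightarrow> bump y a x = 0"
  using bump_pos[of a y x] bump_bounds(1)[of y a x] by linarith

text \<open>The radius 2a/3 is r for the later choice a = 3r/2, and 5/9 = 1 - (2/3)^2. This is the
  source of the constant (9/5)^k.\<close>

lemma bump_lower:
  assumes "a > 0" "x \<in> ball y (2 * a / 3)"
  shows "5 / 9 \<le> bump y a x"
proof -
  have "norm (x - y) \<le> 2 * a / 3" using assms by (simp add: dist_norm norm_minus_commute)
  then have "(norm (x - y))\<^sup>2 \<le> (2 * a / 3)\<^sup>2" by (intro power_mono) auto
  then have "(norm (x - y))\<^sup>2 / a\<^sup>2 \<le> 4 / 9" using assms by (simp add: field_simps power2_eq_square)
  then have "5 / 9 \<le> 1 - (norm (x - y))\<^sup>2 / a\<^sup>2" by linarith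
  then show ?thesis unfolding bump_def by (rule max.coboundedI2)
qed

lemma max_power_has_derivative:
  assumes "k \<ge> 2"
  shows "((\<lambda>s::real. max 0 s ^ k) has_real_derivative real k * max 0 s ^ (k - 1)) (at s)"
proof -
  have k: "(0::real) ^ (k - 1) = 0" "(0::real) ^ k = 0" using assms by (auto simp: power_0_left)
  consider "s > 0" | "s < 0" | "s = 0" by linarith
  then show ?thesis
  proof cases
    case 1
    have "((\<lambda>s::real. s ^ k) has_real_derivative real k * max 0 s ^ (k - 1)) (at s)"
      using 1 by (auto intro!: derivative_eq_intros)
    then show ?thesis
      by (rule has_field_derivative_transform_within_open[of _ _ _ "{0<..}"]) (use 1 in auto)
  next
    case 2
    have "((\<lambda>s::real. 0) has_real_derivative real k * max 0 s ^ (k - 1)) (at s)"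
      using 2 by (simp add: k del: One_nat_def)
    then show ?thesis
      by (rule has_field_derivative_transform_within_open[of _ _ _ "{..<0}"]) (use 2 assms in auto)
  next
    case 3
    have "((\<lambda>h::real. (max 0 (0 + h) ^ k - max 0 0 ^ k) / h) \<longlongrightarrow> 0) (at 0)"
    proof (rule Lim_null_comparison)
      have "\<forall>\<^sub>F h in at (0::real). dist h 0 < 1" by (rule eventually_at_ball[of 1 0 UNIV, simplified, unfolded dist_commute[of 0]]) 
      then show "\<forall>\<^sub>F h in at (0::real). norm ((max 0 (0 + h) ^ k - max 0 0 ^ k) / h) \<le> \<bar>h\<bar>"
      proof eventually_elim
        case (elim h)
        show ?case
        proof (cases "h > 0")
          case True
          have "h ^ k \<le> h ^ 2" using True elim assms by (intro power_decreasing) auto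
          then show ?thesis using True by (simp add: k field_simps power2_eq_square)
        qed (simp add: k)
      qed
    qed (intro tendsto_rabs_zero tendsto_ident_at)
    then show ?thesis using 3 by (simp add: k DERIV_def del: One_nat_def)
  qed
qed

lemma bump_power_has_derivative:
  assumes "k \<ge> 2"
  shows "((\<lambda>x. bump y a x ^ k) has_derivative (\<lambda>h. grad_bump k y a x \<bullet> h)) (at x)"
proof -
  have "((\<lambda>x. 1 - ((x - y) \<bullet> (x - y)) / a\<^sup>2) has_derivative (\<lambda>h. - (2 * ((x - y) \<bullet> h)) / a\<^sup>2)) (at x)"
    by (auto intro!: derivative_eq_intros simp: inner_commute divide_inverse)
  from DERIV_compose_FDERIV[OF max_power_has_derivative[OF assms] this]
  show ?thesis
    unfolding bump_def grad_bump_def power2_norm_eq_inner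
    by (rule has_derivative_eq_rhs) (simp add: fun_eq_iff mult_ac)
qed

lemma continuous_bump: "continuous_on UNIV (bump y a)"
  unfolding bump_def divide_inverse by (intro continuous_intros)

lemma continuous_grad_bump: "continuous_on UNIV (grad_bump k y a)"
  unfolding grad_bump_def by (intro continuous_intros continuous_bump)

lemma bump_measurable [measurable]:
  "bump y a \<in> borel_measurable borel" "grad_bump k y a \<in> borel_measurable borel"
  by (intro borel_measurable_continuous_onI continuous_bump continuous_grad_bump)+

lemma norm_grad_bump_le:
  assumes a: "a > 0" and k: "k \<ge> 2"
  shows "norm (grad_bump k y a x) \<le> 2 * real k / a * bump y a x ^ (k - 1)"
proof (cases "x \<in> ball y a")
  case True
  then have "norm (x - y) \<le> a" by (simp add: dist_norm norm_minus_commute)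
  then have "2 * real k / a\<^sup>2 * bump y a x ^ (k - 1) * norm (x - y) \<le> 2 * real k / a\<^sup>2 * bump y a x ^ (k - 1) * a"
    using bump_bounds(1)[of y a x] by (intro mult_left_mono) auto
  also have "\<dots> = 2 * real k / a * bump y a x ^ (k - 1)" using a by (simp add: power2_eq_square)
  finally show ?thesis using bump_bounds(1)[of y a x] by (simp add: grad_bump_def)
next
  case False
  have 0: "(0::real) ^ (k - 1) = 0" using k by (auto simp: power_0_left)
  show ?thesis using bump_zero[OF a False] by (simp add: 0 grad_bump_def del: One_nat_def)
qed

text \<open>Normalise by W = S + \<nu>: with X = (f + \<nu>) b^k / W one has X^\<theta> \<le> 1 + X.
  The condition \<open>real k * \<theta> + p \<le> real k\<close> allows b^(k-p) to be replaced by
  the larger b^(k \<theta>), which is the power of the cutoff contained in X^\<theta>.\<close>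

lemma weighted_power_integral:
  fixes f :: "'a::euclidean_space \<Rightarrow> real"
  assumes [measurable]: "f \<in> borel_measurable borel" and f: "\<And>x. 0 \<le> f x" "\<And>x. f x \<le> \<mu>"
    and a: "a > 0" and \<theta>: "0 \<le> \<theta>" "\<theta> \<le> 1" "real k * \<theta> + p \<le> real k" and p: "p > 0" and \<nu>: "\<nu> > 0" and S: "S \<ge> 0"
    and fS: "(LINT x|lborel. f x * bump y a x ^ k) \<le> measure lborel (ball y a) * S"
  shows "integrable lborel (\<lambda>x. (f x + \<nu>) powr \<theta> * bump y a x powr (real k - p))"
    and "(LINT x|lborel. (f x + \<nu>) powr \<theta> * bump y a x powr (real k - p))
      \<le> 3 * measure lborel (ball y a) * (S + \<nu>) powr \<theta>"
proof -
  let ?b = "bump y a" and ?\<Lambda> = "measure lborel (ball y a)"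
  define W where "W = S + \<nu>"
  have W: "W > 0" using S \<nu> by (simp add: W_def)
  have k: "k > 0"
  proof (rule ccontr)
    assume "\<not> k > 0"
    then show False using \<theta> p by simp
  qed
  have ib: "integrable lborel (indicator (ball y a) :: 'a \<Rightarrow> real)"
    using emeasure_bounded_finite[of "ball y a"] by (intro integrable_real_indicator) auto
  have ifw: "integrable lborel (\<lambda>x. f x * ?b x ^ k)"
  proof (rule Bochner_Integration.integrable_bound[OF integrable_mult_right[OF ib, of \<mu>]])
    have "norm (f x * ?b x ^ k) \<le> norm (\<mu> * indicator (ball y a) x)" for x
    proof (cases "x \<in> ball y a")
      case True
      have "f x * ?b x ^ k \<le> f x * 1" using f(1)[of x] bump_bounds[of y a x] by (intro mult_left_mono power_le_one) auto
      then show ?thesis using True f(1)[of x] f(2)[of x] bump_bounds(1)[of y a x] by simp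
    next
      case False
      then show ?thesis using bump_zero[OF a False] k by simp
    qed
    then show "AE x in lborel. norm (f x * ?b x ^ k) \<le> norm (\<mu> * indicator (ball y a) x)" by (intro AE_I2)
  qed measurable
  \<comment> \<open>The 2 collects the 1 from X^\<theta> \<le> 1 + X and the \<nu> part of X, which
    is at most 1; the f part integrates to at most the measure of the ball. Together they give the
    factor 3.\<close>
  define R where "R x = W powr \<theta> * (2 * indicator (ball y a) x + f x * ?b x ^ k / W)" for x
  have iR: "integrable lborel R" unfolding R_def
    using ib ifw by (intro integrable_mult_right Bochner_Integration.integrable_add integrable_divide)
  have le: "(f x + \<nu>) powr \<theta> * ?b x powr (real k - p) \<le> R x" for x
  proof (cases "x \<in> ball y a")
    case True
    then have b: "0 < ?b x" "?b x \<le> 1" using bump_pos[OF a] bump_bounds(2)[of y a x] by auto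
    have fp: "0 < f x + \<nu>" using f(1)[of x] \<nu> by linarith
    define X where "X = (f x + \<nu>) * ?b x ^ k / W"
    have X: "X \<ge> 0" using fp b W by (simp add: X_def)
    have "?b x powr (real k - p) \<le> ?b x powr (real k * \<theta>)" using b \<theta> by (intro powr_mono') auto
    also have "\<dots> = (?b x ^ k) powr \<theta>" using b by (simp add: powr_realpow[symmetric] powr_powr)
    finally have "(f x + \<nu>) powr \<theta> * ?b x powr (real k - p) \<le> (f x + \<nu>) powr \<theta> * (?b x ^ k) powr \<theta>"
      by (intro mult_left_mono) auto
    also have "\<dots> = W powr \<theta> * X powr \<theta>" using W by (simp add: X_def powr_mult[symmetric])
    also have "X powr \<theta> \<le> 1 + X"
    proof (cases "X \<le> 1")
      case True
      then show ?thesis using X \<theta> by (intro order_trans[OF powr_le1]) auto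
    next
      case False
      then have "X powr \<theta> \<le> X powr 1" using \<theta> by (intro powr_mono) auto
      then show ?thesis using X by simp
    qed
    also have "1 + X \<le> 2 + f x * ?b x ^ k / W"
    proof -
      have "\<nu> * ?b x ^ k \<le> W * 1" using \<nu> S b by (intro mult_mono power_le_one) (auto simp: W_def)
      then have "\<nu> * ?b x ^ k / W \<le> 1" using W by (simp add: divide_le_eq)
      then show ?thesis by (simp add: X_def distrib_right add_divide_distrib)
    qed
    finally show ?thesis using True by (simp add: R_def mult_left_mono)
  next
    case False
    have 0: "(0::real) ^ k = 0" using k by (simp add: power_0_left)
    show ?thesis using bump_zero[OF a False] by (simp add: R_def False 0)
  qed
  show i: "integrable lborel (\<lambda>x. (f x + \<nu>) powr \<theta> * ?b x powr (real k - p))"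
  proof (rule Bochner_Integration.integrable_bound[OF iR])
    have "norm ((f x + \<nu>) powr \<theta> * ?b x powr (real k - p)) \<le> norm (R x)" for x
      using le[of x] by simp
    then show "AE x in lborel. norm ((f x + \<nu>) powr \<theta> * ?b x powr (real k - p)) \<le> norm (R x)" by (intro AE_I2)
  qed measurable
  have "(LINT x|lborel. (f x + \<nu>) powr \<theta> * ?b x powr (real k - p)) \<le> (LINT x|lborel. R x)"
    by (rule integral_mono[OF i iR le])
  also have "\<dots> = W powr \<theta> * (2 * ?\<Lambda> + (LINT x|lborel. f x * ?b x ^ k) / W)"
    unfolding R_def using ib ifw by simp
  also have "\<dots> \<le> W powr \<theta> * (2 * ?\<Lambda> + ?\<Lambda>)"
  proof (intro mult_left_mono add_left_mono)
    have "(LINT x|lborel. f x * ?b x ^ k) \<le> ?\<Lambda> * W"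
      using fS \<nu> by (auto simp: W_def distrib_left intro: order_trans add_increasing2)
    then show "(LINT x|lborel. f x * ?b x ^ k) / W \<le> ?\<Lambda>" using W by (simp add: divide_le_eq)
  qed simp
  finally show "(LINT x|lborel. (f x + \<nu>) powr \<theta> * ?b x powr (real k - p)) \<le> 3 * ?\<Lambda> * (S + \<nu>) powr \<theta>"
    by (simp add: W_def mult_ac)
qed

text \<open>The left side is factored as A^(p-1) B, with the powers of P and b distributed so that
  A^p is the energy density. This fixes what remains in B^p: the power (\<alpha> + 1)(p - 1) +
  \<sigma> p of P and the power k - p of b.\<close>

lemma pointwise_young:
  fixes P b V L \<eta> p \<alpha> \<sigma> :: real
  assumes P: "P > 0" and b: "b > 0" and V: "V \<ge> 0" and L: "L \<ge> 0" and \<eta>: "\<eta> > 0" and p: "p > 1" and k: "k > 0"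
  shows "P powr \<sigma> * (V powr (p - 1) * (L * b ^ (k - 1)))
    \<le> \<eta> * (P powr (- \<alpha> - 1) * V powr p * b ^ k)
      + \<eta> powr (1 - p) * (P powr ((\<alpha> + 1) * (p - 1) + \<sigma> * p) * b powr (real k - p) * L powr p)"
proof -
  define \<beta> where "\<beta> = (\<alpha> + 1) / p"
  have \<beta>: "\<beta> * p = \<alpha> + 1" using p by (simp add: \<beta>_def)
  define A where "A = V * b powr (real k / p) * P powr (- \<beta>)"
  define B where "B = L * b powr ((real k - p) / p) * P powr (\<beta> * (p - 1) + \<sigma>)"
  have e1: "- \<beta> * p = - \<alpha> - 1" using \<beta> by simp
  have e2: "(\<beta> * (p - 1) + \<sigma>) * p = (\<alpha> + 1) * (p - 1) + \<sigma> * p"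
    unfolding \<beta>[symmetric] by (simp add: algebra_simps)
  have e3: "real k / p * p = real k" "(real k - p) / p * p = real k - p" using p by auto
  have bk: "b ^ j = b powr real j" for j using b by (simp add: powr_realpow)
  have A0: "A \<ge> 0" "B \<ge> 0" using V L by (simp_all add: A_def B_def)
  have Ap: "A powr p = P powr (- \<alpha> - 1) * V powr p * b ^ k"
    unfolding A_def powr_mult powr_powr bk e1 e3 by (simp add: mult_ac)
  have Bp: "B powr p = P powr ((\<alpha> + 1) * (p - 1) + \<sigma> * p) * b powr (real k - p) * L powr p"
    unfolding B_def powr_mult powr_powr e2 e3 by (simp add: mult_ac)
  have "A powr (p - 1) * B = V powr (p - 1) * L * (b powr (real k / p * (p - 1)) * b powr ((real k - p) / p))
     * (P powr (- \<beta> * (p - 1)) * P powr (\<beta> * (p - 1) + \<sigma>))"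
    unfolding A_def B_def powr_mult powr_powr by (simp only: mult_ac)
  also have "b powr (real k / p * (p - 1)) * b powr ((real k - p) / p) = b powr (real k - 1)"
  proof -
    have "real k / p * (p - 1) + (real k - p) / p = real k - 1" using p by (simp add: field_simps)
    then show ?thesis by (simp add: powr_add[symmetric])
  qed
  also have "P powr (- \<beta> * (p - 1)) * P powr (\<beta> * (p - 1) + \<sigma>) = P powr \<sigma>"
  proof -
    have "- \<beta> * (p - 1) + (\<beta> * (p - 1) + \<sigma>) = \<sigma>" by simp
    then show ?thesis by (simp only: powr_add[symmetric])
  qed
  also have "b powr (real k - 1) = b ^ (k - 1)" using k by (simp add: bk of_nat_diff Suc_le_eq)
  finally have eq: "A powr (p - 1) * B = P powr \<sigma> * (V powr (p - 1) * (L * b ^ (k - 1)))" by (simp add: mult_ac)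
  show ?thesis using young_dichotomy[OF A0 \<eta> p] unfolding Ap Bp eq .
qed

text \<open>Young's inequality with exponents 1/(p-1) and 1/(2-p), by comparing \<nu> with \<kappa>
  * W. For small \<kappa> the multiple of W can be absorbed, and only a multiple of \<nu>
  remains.\<close>

lemma powr_interpolation:
  fixes W \<nu> \<kappa> p :: real
  assumes "W > 0" "\<nu> > 0" "\<kappa> > 0" "1 < p" "p < 2"
  shows "W powr (p - 1) * \<nu> powr (2 - p) \<le> \<kappa> powr (2 - p) * W + \<kappa> powr (1 - p) * \<nu>"
proof (cases "\<nu> \<le> \<kappa> * W")
  case True
  have "W powr (p - 1) * \<nu> powr (2 - p) \<le> W powr (p - 1) * (\<kappa> * W) powr (2 - p)"
    using True assms by (intro mult_left_mono powr_mono2) auto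
  also have "\<dots> = \<kappa> powr (2 - p) * (W powr (p - 1) * W powr (2 - p))" by (simp add: powr_mult mult_ac)
  also have "W powr (p - 1) * W powr (2 - p) = W" using assms by (simp add: powr_add[symmetric])
  finally show ?thesis using assms by (simp add: add_increasing2)
next
  case False
  then have "W \<le> \<nu> * \<kappa> powr (-1)" using assms by (simp add: powr_minus_divide field_simps)
  then have "W powr (p - 1) * \<nu> powr (2 - p) \<le> (\<nu> * \<kappa> powr (-1)) powr (p - 1) * \<nu> powr (2 - p)"
    using assms by (intro mult_right_mono powr_mono2) auto
  also have "\<dots> = \<kappa> powr (1 - p) * (\<nu> powr (p - 1) * \<nu> powr (2 - p))"
  proof -
    have "-1 * (p - 1) = 1 - p" by simp
    then show ?thesis unfolding powr_mult powr_powr by (simp only: mult_ac)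
  qed
  also have "\<nu> powr (p - 1) * \<nu> powr (2 - p) = \<nu>" using assms by (simp add: powr_add[symmetric])
  finally show ?thesis using assms by (simp add: add_increasing)
qed

section \<open>The flux estimate\<close>

text \<open>The factor 2 / (\<alpha> K1) divides by the half of the coercive term that survives
  absorption; 3 / (1 - \<alpha>) comes from the energy of a slice, and the last summand is the price
  of Young's inequality with \<eta> = \<alpha> K1 / (2 K2), as in
  \<open>energy_bound\<close>.\<close>

definition energy_const :: "real \<Rightarrow> real \<Rightarrow> nat \<Rightarrow> real \<Rightarrow> real \<Rightarrow> real" where
  "energy_const p \<alpha> k K1 K2 =
     2 / (\<alpha> * K1) * (3 / (1 - \<alpha>) + 3 * K2 * (\<alpha> * K1 / (2 * K2)) powr (1 - p) * (2 * real k) powr p)"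

text \<open>\<epsilon> makes the contribution of the energy to the flux W / 4, and \<kappa> solves D
  \<kappa>^(2-p) = 1/4, so that interpolation adds another W / 4. The value is the coefficient of
  \<nu> that is left.\<close>

definition flux_const :: "real \<Rightarrow> real \<Rightarrow> nat \<Rightarrow> real \<Rightarrow> real \<Rightarrow> real" where
  "flux_const p \<alpha> k K1 K2 =
     (let \<epsilon> = 1 / (4 * K2 * energy_const p \<alpha> k K1 K2);
          D = 3 * K2 * (2 * real k) powr p * \<epsilon> powr (1 - p);
          \<kappa> = (1 / (4 * D)) powr (1 / (2 - p))
      in D * \<kappa> powr (1 - p))"

text \<open>
  \<open>U\<close>, \<open>V\<close>, \<open>G\<close> stand for \<open>u\<close>, \<open>Du\<close> and \<open>A(x, t, u, Du)\<close>, and \<open>S\<close> bounds the mean values of \<open>(\<mu> - u) \<zeta>\<^sup>k\<close>.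
  The condition \<open>small\<close> is what the choice of \<open>\<nu>\<close> guarantees; the conditions \<open>\<theta>\<close> make the exponents of
  \<open>\<zeta>\<close> that remain after Young's inequality large enough.
\<close>

locale flux_estimate =
  fixes p \<alpha> K1 K2 :: real and k :: nat and y :: "'a::euclidean_space" and a q \<mu> \<nu> S t1 t2 :: real
    and U :: "'a \<times> real \<Rightarrow> real" and V G :: "'a \<times> real \<Rightarrow> 'a"
  assumes p: "1 < p" "p < 2" and K: "K1 > 0" "K2 > 0" and \<alpha>: "0 < \<alpha>" "\<alpha> < 1" "\<alpha> \<le> p - 1"
    and k2: "k \<ge> 2"
    and \<theta>: "real k * (1 - \<alpha>) + p \<le> real k" "real k * ((\<alpha> + 1) * (p - 1)) + p \<le> real k"
    and a: "a > 0" and q: "q > 0" and \<nu>: "\<nu> > 0" and S: "S \<ge> 0" and t: "t1 < t2"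
    and Um: "U \<in> borel_measurable borel" and Vm: "V \<in> borel_measurable borel" and Gm: "G \<in> borel_measurable borel"
    and U: "\<And>z. 0 \<le> U z" "\<And>z. U z \<le> \<mu>"
    and Vp: "integrable lborel (\<lambda>z. norm (V z) powr p)"
    and str: "AE z in lborel. fst z \<in> ball y a \<longrightarrow> snd z \<in> {t1..t2} \<longrightarrow>
       K1 * U z powr q * norm (V z) powr p \<le> G z \<bullet> V z \<and>
       norm (G z) \<le> K2 * U z powr q * norm (V z) powr (p - 1)"
    and slice: "AE \<tau> in lborel. \<tau> \<in> {t1..t2} \<longrightarrow>
       (LINT x|lborel. (\<mu> - U (x, \<tau>)) * bump y a x ^ k) \<le> measure lborel (ball y a) * S"
    and small: "\<mu> powr q * (t2 - t1) \<le> a powr p * \<nu> powr (2 - p)"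
begin

lemmas meas [measurable] = Um Vm Gm

abbreviation "J z \<equiv> (indicator {t1..t2} (snd z) :: real)"
abbreviation "P z \<equiv> \<mu> - U z + \<nu>"
abbreviation "\<Lambda> \<equiv> measure lborel (ball y a)"
abbreviation "W \<equiv> S + \<nu>"

text \<open>The spatial gradient of \<open>P z powr (- \<alpha>)\<close> times the k-th power of the
  cutoff, restricted to [t1, t2]. The first coefficient is positive because P decreases as U
  grows.\<close>

definition test_grad :: "'a \<times> real \<Rightarrow> 'a" where
  "test_grad z = J z *\<^sub>R ((\<alpha> * P z powr (- \<alpha> - 1) * bump y a (fst z) ^ k) *\<^sub>R V z
      + P z powr (- \<alpha>) *\<^sub>R grad_bump k y a (fst z))"

text \<open>The coercive quantity: \<alpha> K1 times it bounds from below the part of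
  \<open>G z \<bullet> test_grad z\<close> that contains V.\<close>

definition density :: "'a \<times> real \<Rightarrow> real" where
  "density z = J z * (U z powr q * (P z powr (- \<alpha> - 1) * norm (V z) powr p * bump y a (fst z) ^ k))"

text \<open>What Young's inequality leaves of the cutoff terms, in the shape treated by
  \<open>weighted_power_integral\<close>.\<close>

definition weight :: "real \<Rightarrow> 'a \<times> real \<Rightarrow> real" where
  "weight \<theta> z = J z * (P z powr \<theta> * bump y a (fst z) powr (real k - p))"

lemma P_pos: "P z > 0" and W_pos: "W > 0" and U_powr_le: "U z powr q \<le> \<mu> powr q"
  using U[of z] \<nu> S q by (auto intro!: powr_mono2)

lemma kp: "real k > p"
proof -
  have "real k * (1 - \<alpha>) > 0" using k2 \<alpha> by (intro mult_pos_pos) auto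
  then show ?thesis using \<theta> by linarith
qed

lemma weight_integral:
  assumes th: "0 \<le> \<theta>" "\<theta> \<le> 1" "real k * \<theta> + p \<le> real k"
  shows "integrable lborel (weight \<theta>)" and "(LINT z|lborel. weight \<theta> z) \<le> (t2 - t1) * (3 * \<Lambda> * W powr \<theta>)"
proof -
  have wm[measurable]: "weight \<theta> \<in> borel_measurable borel" unfolding weight_def by measurable
  have ib: "integrable lborel (\<lambda>x. indicator (ball y a) x * (\<mu> + \<nu>) powr \<theta>)"
    using emeasure_bounded_finite[of "ball y a"] by (intro integrable_mult_left integrable_real_indicator) auto
  have ibt: "integrable lborel (\<lambda>z::'a \<times> real. indicator {t1..t2} (snd z) *\<^sub>R (indicator (ball y a) (fst z) * (\<mu> + \<nu>) powr \<theta>))"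
    by (rule integrable_time_const[OF ib _ emeasure_bounded_finite]) auto
  show i: "integrable lborel (weight \<theta>)"
  proof (rule Bochner_Integration.integrable_bound[OF ibt])
    have "norm (weight \<theta> z) \<le> norm (indicator {t1..t2} (snd z) *\<^sub>R (indicator (ball y a) (fst z) * (\<mu> + \<nu>) powr \<theta>))" for z
    proof (cases "fst z \<in> ball y a")
      case True
      have "P z powr \<theta> * bump y a (fst z) powr (real k - p) \<le> (\<mu> + \<nu>) powr \<theta> * 1"
        using U[of z] P_pos[of z] th kp bump_bounds[of y a "fst z"] by (intro mult_mono powr_mono2 powr_le1) auto
      then show ?thesis using True by (simp add: weight_def indicator_def)
    qed (simp add: weight_def bump_zero[OF a])
    then show "AE z in lborel. norm (weight \<theta> z) \<le> norm (indicator {t1..t2} (snd z) *\<^sub>R (indicator (ball y a) (fst z) * (\<mu> + \<nu>) powr \<theta>))"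
      by (intro AE_I2)
  qed measurable
  have i': "integrable (lborel \<Otimes>\<^sub>M lborel) (\<lambda>(x, \<tau>). weight \<theta> (x, \<tau>))" using i by (simp add: lborel_prod)
  have "(LINT z|lborel. weight \<theta> z) = (LINT \<tau>|lborel. LINT x|lborel. weight \<theta> (x, \<tau>))"
    using lborel_pair.integral_snd[OF i'] by (simp add: lborel_prod)
  also have "\<dots> \<le> (LINT \<tau>|lborel. indicator {t1..t2} \<tau> * (3 * \<Lambda> * W powr \<theta>))"
  proof (rule integral_mono_AE)
    show "integrable lborel (\<lambda>\<tau>. LINT x|lborel. weight \<theta> (x, \<tau>))" by (rule lborel_pair.integrable_snd[OF i'])
    show "integrable lborel (\<lambda>\<tau>. indicator {t1..t2} \<tau> * (3 * \<Lambda> * W powr \<theta>))"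
      by (intro integrable_mult_left integrable_real_indicator) (auto simp: emeasure_lborel_Icc_eq)
    show "AE \<tau> in lborel. (LINT x|lborel. weight \<theta> (x, \<tau>)) \<le> indicator {t1..t2} \<tau> * (3 * \<Lambda> * W powr \<theta>)"
      using slice
    proof eventually_elim
      case (elim \<tau>)
      show ?case
      proof (cases "\<tau> \<in> {t1..t2}")
        case True
        have "(\<lambda>x. (x, \<tau>)) \<in> borel_measurable borel" by (intro borel_measurable_continuous_onI continuous_intros)
        from measurable_compose[OF this Um] have [measurable]: "(\<lambda>x. U (x, \<tau>)) \<in> borel_measurable borel" .
        have "(LINT x|lborel. ((\<mu> - U (x, \<tau>)) + \<nu>) powr \<theta> * bump y a x powr (real k - p)) \<le> 3 * \<Lambda> * (S + \<nu>) powr \<theta>"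
          using U elim True p by (intro weighted_power_integral(2)[where \<mu>=\<mu>] a th \<nu> S) auto
        then show ?thesis using True by (simp add: weight_def)
      next
        case False
        then show ?thesis by (simp add: weight_def)
      qed
    qed
  qed
  also have "\<dots> = (t2 - t1) * (3 * \<Lambda> * W powr \<theta>)" using t by simp
  finally show "(LINT z|lborel. weight \<theta> z) \<le> (t2 - t1) * (3 * \<Lambda> * W powr \<theta>)" .
qed

text \<open>The lower bound P \<ge> \<nu> tames the negative power, so the density is at most a
  constant times |V|^p. Finiteness is what allows half of it to be absorbed.\<close>

lemma density_integrable: "integrable lborel density"
proof (rule Bochner_Integration.integrable_bound)
  show "integrable lborel (\<lambda>z. (\<mu> powr q * \<nu> powr (- \<alpha> - 1)) * norm (V z) powr p)"
    by (intro integrable_mult_right Vp)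
  show "density \<in> borel_measurable lborel" unfolding density_def by measurable
  have "norm (density z) \<le> norm ((\<mu> powr q * \<nu> powr (- \<alpha> - 1)) * norm (V z) powr p)" for z
  proof -
    have "P z powr (- \<alpha> - 1) \<le> \<nu> powr (- \<alpha> - 1)" using U[of z] \<nu> \<alpha> by (intro powr_mono2') auto
    then have "U z powr q * (P z powr (- \<alpha> - 1) * norm (V z) powr p * bump y a (fst z) ^ k)
      \<le> \<mu> powr q * (\<nu> powr (- \<alpha> - 1) * norm (V z) powr p * 1)"
      using bump_bounds[of y a "fst z"] by (intro mult_mono U_powr_le power_le_one) auto
    then show ?thesis using bump_bounds(1)[of y a "fst z"] by (simp add: density_def indicator_def mult_ac)
  qed
  then show "AE z in lborel. norm (density z) \<le> norm ((\<mu> powr q * \<nu> powr (- \<alpha> - 1)) * norm (V z) powr p)"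
    by (intro AE_I2)
qed

lemma density_nonneg: "density z \<ge> 0"
  using bump_bounds(1)[of y a "fst z"] by (simp add: density_def)

text \<open>Two instances serve: \<sigma> = - \<alpha> for the cutoff term in the energy inequality,
  \<sigma> = 0 for the flux itself.\<close>

lemma cross_term:
  assumes "fst z \<in> ball y a" "snd z \<in> {t1..t2}" and \<eta>: "\<eta> > 0"
    and G: "norm (G z) \<le> K2 * U z powr q * norm (V z) powr (p - 1)"
  shows "P z powr \<sigma> * (norm (G z) * norm (grad_bump k y a (fst z)))
    \<le> K2 * \<eta> * density z + K2 * \<eta> powr (1 - p) * \<mu> powr q * (2 * real k / a) powr p * weight ((\<alpha> + 1) * (p - 1) + \<sigma> * p) z"
proof -
  have b: "bump y a (fst z) > 0" using assms(1) by (simp only: bump_pos[OF a])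
  let ?b = "bump y a (fst z)" and ?L = "2 * real k / a"
  have J: "J z = 1" using assms(2) by simp
  have "P z powr \<sigma> * (norm (G z) * norm (grad_bump k y a (fst z)))
    \<le> P z powr \<sigma> * ((K2 * U z powr q * norm (V z) powr (p - 1)) * (?L * ?b ^ (k - 1)))"
    using G norm_grad_bump_le[OF a k2, of y "fst z"] K by (intro mult_left_mono mult_mono) auto
  also have "\<dots> = K2 * U z powr q * (P z powr \<sigma> * (norm (V z) powr (p - 1) * (?L * ?b ^ (k - 1))))"
    by (simp only: mult_ac)
  also have "\<dots> \<le> K2 * U z powr q * (\<eta> * (P z powr (- \<alpha> - 1) * norm (V z) powr p * ?b ^ k)
      + \<eta> powr (1 - p) * (P z powr ((\<alpha> + 1) * (p - 1) + \<sigma> * p) * ?b powr (real k - p) * ?L powr p))"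
    using K a k2 p by (intro mult_left_mono pointwise_young P_pos b \<eta>) auto
  also have "\<dots> = K2 * \<eta> * density z + K2 * \<eta> powr (1 - p) * U z powr q * ?L powr p * weight ((\<alpha> + 1) * (p - 1) + \<sigma> * p) z"
    unfolding density_def weight_def J by (simp add: distrib_left mult_ac)
  also have "\<dots> \<le> K2 * \<eta> * density z + K2 * \<eta> powr (1 - p) * \<mu> powr q * ?L powr p * weight ((\<alpha> + 1) * (p - 1) + \<sigma> * p) z"
  proof -
    have w0: "0 \<le> weight ((\<alpha> + 1) * (p - 1) + \<sigma> * p) z" by (simp add: weight_def)
    show ?thesis
      using K by (intro add_left_mono mult_right_mono mult_left_mono U_powr_le w0) auto
  qed
  finally show ?thesis .
qed

text \<open>The choice of \<nu> enters here: the radius from the gradient of the cutoff and the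
  length of the time interval are traded for \<nu>^(2-p).\<close>

lemma weight_const: "\<mu> powr q * (2 * real k / a) powr p * (t2 - t1) \<le> (2 * real k) powr p * \<nu> powr (2 - p)"
proof -
  have "\<mu> powr q * (2 * real k / a) powr p * (t2 - t1) = (2 * real k) powr p / a powr p * (\<mu> powr q * (t2 - t1))"
    by (simp add: powr_divide)
  also have "\<dots> \<le> (2 * real k) powr p / a powr p * (a powr p * \<nu> powr (2 - p))"
    by (intro mult_left_mono small) simp
  also have "\<dots> = (2 * real k) powr p * \<nu> powr (2 - p)" using a by simp
  finally show ?thesis .
qed

text \<open>Coercivity yields \<alpha> K1 times the density, and Young's inequality spends half of
  it on the cutoff term. The remaining weight has exponent p - 1 - \<alpha>; the factor W^(2-p) from
  \<open>weight_const\<close> lifts it to W^(1-\<alpha>), the size of the energy.\<close>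

lemma energy_bound:
  assumes en: "integrable lborel (\<lambda>z. G z \<bullet> test_grad z)"
    "(LINT z|lborel. G z \<bullet> test_grad z) \<le> 3 / (1 - \<alpha>) * \<Lambda> * W powr (1 - \<alpha>)"
  shows "(LINT z|lborel. density z) \<le> energy_const p \<alpha> k K1 K2 * \<Lambda> * W powr (1 - \<alpha>)"
proof -
  define \<eta> where "\<eta> = \<alpha> * K1 / (2 * K2)"
  have \<eta>: "\<eta> > 0" using \<alpha> K by (simp add: \<eta>_def)
  define c where "c = K2 * \<eta> powr (1 - p) * \<mu> powr q * (2 * real k / a) powr p"
  have c: "c \<ge> 0" using K by (simp add: c_def)
  \<comment> \<open>The hypothesis \<alpha> \<le> p - 1 keeps this exponent nonnegative.\<close>
  define \<theta>2 where "\<theta>2 = p - 1 - \<alpha>"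
  have \<theta>2: "(\<alpha> + 1) * (p - 1) + (- \<alpha>) * p = \<theta>2" by (simp add: \<theta>2_def algebra_simps)
  have th: "0 \<le> \<theta>2" "\<theta>2 \<le> 1" "real k * \<theta>2 + p \<le> real k"
  proof -
    show "0 \<le> \<theta>2" "\<theta>2 \<le> 1" using \<alpha> p by (auto simp: \<theta>2_def)
    have "real k * \<theta>2 \<le> real k * (1 - \<alpha>)" using p by (intro mult_left_mono) (auto simp: \<theta>2_def)
    then show "real k * \<theta>2 + p \<le> real k" using \<theta>(1) by linarith
  qed
  have "(LINT z|lborel. (\<alpha> * K1 / 2) * density z - c * weight \<theta>2 z) \<le> (LINT z|lborel. G z \<bullet> test_grad z)"
  proof (rule integral_mono_AE)
    show "integrable lborel (\<lambda>z. (\<alpha> * K1 / 2) * density z - c * weight \<theta>2 z)"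
      by (intro Bochner_Integration.integrable_diff integrable_mult_right density_integrable weight_integral th)
    show "AE z in lborel. (\<alpha> * K1 / 2) * density z - c * weight \<theta>2 z \<le> G z \<bullet> test_grad z"
      using str
    proof eventually_elim
      case (elim z)
      show ?case
      proof (cases "fst z \<in> ball y a \<and> snd z \<in> {t1..t2}")
        case True
        then have z: "fst z \<in> ball y a" "snd z \<in> {t1..t2}" by auto
        have J: "J z = 1" using z by simp
        have G: "K1 * U z powr q * norm (V z) powr p \<le> G z \<bullet> V z" "norm (G z) \<le> K2 * U z powr q * norm (V z) powr (p - 1)"
          using elim z by auto
        have 1: "P z powr (- \<alpha>) * (norm (G z) * norm (grad_bump k y a (fst z))) \<le> K2 * \<eta> * density z + c * weight \<theta>2 z"
          using cross_term[OF z \<eta> G(2), of "- \<alpha>"] unfolding \<theta>2 c_def .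
        have 2: "K2 * \<eta> = \<alpha> * K1 / 2" using K by (simp add: \<eta>_def)
        have 3: "- (norm (G z) * norm (grad_bump k y a (fst z))) \<le> G z \<bullet> grad_bump k y a (fst z)"
          using Cauchy_Schwarz_ineq2[of "G z" "grad_bump k y a (fst z)"] by linarith
        have 4: "- (P z powr (- \<alpha>) * (norm (G z) * norm (grad_bump k y a (fst z)))) \<le> P z powr (- \<alpha>) * (G z \<bullet> grad_bump k y a (fst z))"
          using mult_left_mono[OF 3, of "P z powr (- \<alpha>)"] by simp
        have "(\<alpha> * P z powr (- \<alpha> - 1) * bump y a (fst z) ^ k) * (K1 * U z powr q * norm (V z) powr p)
           \<le> (\<alpha> * P z powr (- \<alpha> - 1) * bump y a (fst z) ^ k) * (G z \<bullet> V z)"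
          using \<alpha> bump_bounds(1)[of y a "fst z"] by (intro mult_left_mono G) auto
        then have 5: "\<alpha> * K1 * density z \<le> (\<alpha> * P z powr (- \<alpha> - 1) * bump y a (fst z) ^ k) * (G z \<bullet> V z)"
          unfolding density_def J by (simp add: mult_ac)
        have "G z \<bullet> test_grad z = (\<alpha> * P z powr (- \<alpha> - 1) * bump y a (fst z) ^ k) * (G z \<bullet> V z)
           + P z powr (- \<alpha>) * (G z \<bullet> grad_bump k y a (fst z))"
          unfolding test_grad_def J by (simp add: inner_add_right)
        moreover have "N \<le> X / 2 + w \<Longrightarrow> - N \<le> T2 \<Longrightarrow> X \<le> T1 \<Longrightarrow> X / 2 - w \<le> T1 + T2" for N X w T1 T2 :: real
          by linarith
        moreover have "\<alpha> * K1 / 2 * density z = \<alpha> * K1 * density z / 2" by simp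
        ultimately show ?thesis using 1 4 5 unfolding 2 by (simp only:)
      next
        case False
        have 0: "bump y a (fst z) ^ k = 0" "grad_bump k y a (fst z) = 0" if "fst z \<notin> ball y a"
        proof -
          show "bump y a (fst z) ^ k = 0" using bump_zero[OF a that] k2 by simp
          have "k - 1 > 0" using k2 by simp
          then have "bump y a (fst z) ^ (k - 1) = 0" using bump_zero[OF a that] by simp
          then show "grad_bump k y a (fst z) = 0" unfolding grad_bump_def by simp
        qed
        show ?thesis
        proof (cases "snd z \<in> {t1..t2}")
          case True
          then have n: "fst z \<notin> ball y a" using False by simp
          have "(0::real) ^ k = 0" using k2 by (simp add: power_0_left)
          then show ?thesis by (simp only: density_def weight_def test_grad_def 0[OF n] bump_zero[OF a n]) simp
        qed (simp add: density_def weight_def test_grad_def)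
      qed
    qed
  qed (rule en)
  also have "(LINT z|lborel. (\<alpha> * K1 / 2) * density z - c * weight \<theta>2 z) = (\<alpha> * K1 / 2) * (LINT z|lborel. density z) - c * (LINT z|lborel. weight \<theta>2 z)"
    using density_integrable weight_integral(1)[OF th] by simp
  finally have A: "(\<alpha> * K1 / 2) * (LINT z|lborel. density z) \<le> 3 / (1 - \<alpha>) * \<Lambda> * W powr (1 - \<alpha>) + c * (LINT z|lborel. weight \<theta>2 z)"
    using en(2) by linarith
  have "c * (LINT z|lborel. weight \<theta>2 z) \<le> c * ((t2 - t1) * (3 * \<Lambda> * W powr \<theta>2))"
    by (intro mult_left_mono weight_integral(2) th c)
  also have "\<dots> = 3 * K2 * \<eta> powr (1 - p) * \<Lambda> * W powr \<theta>2 * (\<mu> powr q * (2 * real k / a) powr p * (t2 - t1))"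
    by (simp add: c_def)
  also have "\<dots> \<le> 3 * K2 * \<eta> powr (1 - p) * \<Lambda> * W powr \<theta>2 * ((2 * real k) powr p * W powr (2 - p))"
  proof (intro mult_left_mono)
    have "\<nu> powr (2 - p) \<le> W powr (2 - p)" using \<nu> S p by (intro powr_mono2) auto
    then have "(2 * real k) powr p * \<nu> powr (2 - p) \<le> (2 * real k) powr p * W powr (2 - p)" by (intro mult_left_mono) auto
    then show "\<mu> powr q * (2 * real k / a) powr p * (t2 - t1) \<le> (2 * real k) powr p * W powr (2 - p)" using weight_const by linarith
  qed (use K in simp)
  also have "\<dots> = (3 * K2 * \<eta> powr (1 - p) * (2 * real k) powr p) * \<Lambda> * (W powr \<theta>2 * W powr (2 - p))" by (simp only: mult_ac)
  also have "W powr \<theta>2 * W powr (2 - p) = W powr (1 - \<alpha>)" by (simp add: powr_add[symmetric] \<theta>2_def)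
  finally have B: "c * (LINT z|lborel. weight \<theta>2 z) \<le> (3 * K2 * \<eta> powr (1 - p) * (2 * real k) powr p) * \<Lambda> * W powr (1 - \<alpha>)" .
  have "(\<alpha> * K1 / 2) * (LINT z|lborel. density z) \<le> (3 / (1 - \<alpha>) + 3 * K2 * \<eta> powr (1 - p) * (2 * real k) powr p) * \<Lambda> * W powr (1 - \<alpha>)"
    using A B by (simp add: distrib_right)
  then have "2 / (\<alpha> * K1) * ((\<alpha> * K1 / 2) * (LINT z|lborel. density z))
     \<le> 2 / (\<alpha> * K1) * ((3 / (1 - \<alpha>) + 3 * K2 * \<eta> powr (1 - p) * (2 * real k) powr p) * \<Lambda> * W powr (1 - \<alpha>))"
    using \<alpha> K by (intro mult_left_mono) auto
  moreover have "2 / (\<alpha> * K1) * ((\<alpha> * K1 / 2) * (LINT z|lborel. density z)) = (LINT z|lborel. density z)"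
    using \<alpha> K by simp
  ultimately show ?thesis unfolding energy_const_def \<eta>_def by (simp only: mult.assoc)
qed

lemma energy_const_pos: "energy_const p \<alpha> k K1 K2 > 0"
  unfolding energy_const_def using \<alpha> K by (intro mult_pos_pos add_pos_nonneg) auto

text \<open>Scaling the Young parameter by W^\<alpha> compensates the energy bound W^(1-\<alpha>),
  so the first part becomes linear in W. The second part becomes a multiple of W^(p-1) \<nu>^(2-p),
  which \<open>powr_interpolation\<close> splits.\<close>

lemma flux_bound:
  assumes en: "integrable lborel (\<lambda>z. G z \<bullet> test_grad z)"
    "(LINT z|lborel. G z \<bullet> test_grad z) \<le> 3 / (1 - \<alpha>) * \<Lambda> * W powr (1 - \<alpha>)"
  shows "integrable lborel (\<lambda>z. J z * (norm (G z) * norm (grad_bump k y a (fst z))))"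
    and "(LINT z|lborel. J z * (norm (G z) * norm (grad_bump k y a (fst z)))) \<le> \<Lambda> * (W / 2 + flux_const p \<alpha> k K1 K2 * \<nu>)"
proof -
  let ?C2 = "energy_const p \<alpha> k K1 K2"
  define \<epsilon> where "\<epsilon> = 1 / (4 * K2 * ?C2)"
  have \<epsilon>: "\<epsilon> > 0" using K energy_const_pos by (simp add: \<epsilon>_def)
  define D where "D = 3 * K2 * (2 * real k) powr p * \<epsilon> powr (1 - p)"
  have D: "D > 0" using K \<epsilon> k2 by (simp add: D_def)
  define \<kappa> where "\<kappa> = (1 / (4 * D)) powr (1 / (2 - p))"
  have \<kappa>: "\<kappa> > 0" using D by (simp add: \<kappa>_def)
  have \<kappa>p: "\<kappa> powr (2 - p) = 1 / (4 * D)" using D p by (simp add: \<kappa>_def powr_powr)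
  have FC: "flux_const p \<alpha> k K1 K2 = D * \<kappa> powr (1 - p)"
    unfolding flux_const_def Let_def \<epsilon>_def[symmetric] D_def[symmetric] \<kappa>_def[symmetric] ..
  define \<eta> where "\<eta> = \<epsilon> * W powr \<alpha>"
  have \<eta>: "\<eta> > 0" using \<epsilon> W_pos by (simp add: \<eta>_def)
  define c where "c = K2 * \<eta> powr (1 - p) * \<mu> powr q * (2 * real k / a) powr p"
  have c: "c \<ge> 0" using K by (simp add: c_def)
  define \<theta>3 where "\<theta>3 = (\<alpha> + 1) * (p - 1)"
  have th: "0 \<le> \<theta>3" "\<theta>3 \<le> 1" "real k * \<theta>3 + p \<le> real k"
  proof -
    show "0 \<le> \<theta>3" using \<alpha> p by (simp add: \<theta>3_def)
    show "real k * \<theta>3 + p \<le> real k" using \<theta>(2) by (simp add: \<theta>3_def)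
    then have "real k * \<theta>3 \<le> real k * 1" using p by linarith
    then show "\<theta>3 \<le> 1" using k2 by (subst (asm) mult_le_cancel_left_pos) auto
  qed
  let ?R = "\<lambda>z. K2 * \<eta> * density z + c * weight \<theta>3 z"
  have iR: "integrable lborel ?R"
    by (intro Bochner_Integration.integrable_add integrable_mult_right density_integrable weight_integral th)
  have le: "AE z in lborel. J z * (norm (G z) * norm (grad_bump k y a (fst z))) \<le> ?R z"
    using str
  proof eventually_elim
    case (elim z)
    have R0: "0 \<le> ?R z" using K \<eta> c density_nonneg[of z] by (auto simp: weight_def intro!: add_nonneg_nonneg mult_nonneg_nonneg)
    show ?case
    proof (cases "fst z \<in> ball y a \<and> snd z \<in> {t1..t2}")
      case True
      then have z: "fst z \<in> ball y a" "snd z \<in> {t1..t2}" by auto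
      have G: "norm (G z) \<le> K2 * U z powr q * norm (V z) powr (p - 1)" using elim z by auto
      have "P z powr 0 * (norm (G z) * norm (grad_bump k y a (fst z))) \<le> ?R z"
        using cross_term[OF z \<eta> G, of 0] by (simp add: c_def \<theta>3_def)
      then show ?thesis using P_pos[of z] z by simp
    next
      case False
      have 0: "grad_bump k y a (fst z) = 0" if "fst z \<notin> ball y a"
      proof -
        have "k - 1 > 0" using k2 by simp
        then have "bump y a (fst z) ^ (k - 1) = 0" using bump_zero[OF a that] by simp
        then show "grad_bump k y a (fst z) = 0" unfolding grad_bump_def by simp
      qed
      then have Z: "J z * (norm (G z) * norm (grad_bump k y a (fst z))) = 0" using False by (cases "snd z \<in> {t1..t2}") auto
      show ?thesis unfolding Z by (rule R0)
    qed
  qed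
  show i: "integrable lborel (\<lambda>z. J z * (norm (G z) * norm (grad_bump k y a (fst z))))"
  proof (rule Bochner_Integration.integrable_bound[OF iR])
    show "AE z in lborel. norm (J z * (norm (G z) * norm (grad_bump k y a (fst z)))) \<le> norm (?R z)"
      using le by eventually_elim (simp add: order_trans[OF _ abs_ge_self])
  qed measurable
  have "(LINT z|lborel. J z * (norm (G z) * norm (grad_bump k y a (fst z)))) \<le> (LINT z|lborel. ?R z)"
    by (rule integral_mono_AE[OF i iR le])
  also have "\<dots> = K2 * \<eta> * (LINT z|lborel. density z) + c * (LINT z|lborel. weight \<theta>3 z)"
    using density_integrable weight_integral(1)[OF th] by simp
  also have "\<dots> \<le> \<Lambda> * (W / 4) + \<Lambda> * (W / 4 + D * \<kappa> powr (1 - p) * \<nu>)"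
  proof (rule add_mono)
    have "K2 * \<eta> * (LINT z|lborel. density z) \<le> K2 * \<eta> * (?C2 * \<Lambda> * W powr (1 - \<alpha>))"
      using K \<eta> by (intro mult_left_mono energy_bound en) auto
    also have "\<dots> = (K2 * ?C2 * \<epsilon>) * \<Lambda> * (W powr \<alpha> * W powr (1 - \<alpha>))" by (simp add: \<eta>_def)
    also have "W powr \<alpha> * W powr (1 - \<alpha>) = W" using W_pos by (simp add: powr_add[symmetric])
    also have "K2 * ?C2 * \<epsilon> = 1 / 4" using K energy_const_pos by (simp add: \<epsilon>_def)
    finally show "K2 * \<eta> * (LINT z|lborel. density z) \<le> \<Lambda> * (W / 4)" by simp
  next
    have "c * (LINT z|lborel. weight \<theta>3 z) \<le> c * ((t2 - t1) * (3 * \<Lambda> * W powr \<theta>3))"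
      by (intro mult_left_mono weight_integral(2) th c)
    also have "\<dots> = 3 * K2 * \<eta> powr (1 - p) * \<Lambda> * W powr \<theta>3 * (\<mu> powr q * (2 * real k / a) powr p * (t2 - t1))"
      by (simp add: c_def)
    also have "\<dots> \<le> 3 * K2 * \<eta> powr (1 - p) * \<Lambda> * W powr \<theta>3 * ((2 * real k) powr p * \<nu> powr (2 - p))"
      using K by (intro mult_left_mono weight_const) auto
    also have "\<dots> = \<Lambda> * (D * (W powr (p - 1) * \<nu> powr (2 - p)))"
    proof -
      have "\<eta> powr (1 - p) = \<epsilon> powr (1 - p) * W powr (\<alpha> * (1 - p))" by (simp add: \<eta>_def powr_mult powr_powr)
      moreover have "W powr (\<alpha> * (1 - p)) * W powr \<theta>3 = W powr (p - 1)"
        by (simp add: powr_add[symmetric] \<theta>3_def algebra_simps)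
      ultimately have "\<eta> powr (1 - p) * W powr \<theta>3 = \<epsilon> powr (1 - p) * W powr (p - 1)" by (simp only: mult.assoc)
      then show ?thesis unfolding D_def by (simp only: mult_ac)
    qed
    also have "\<dots> \<le> \<Lambda> * (D * (\<kappa> powr (2 - p) * W + \<kappa> powr (1 - p) * \<nu>))"
      using D by (intro mult_left_mono powr_interpolation W_pos \<nu> \<kappa> p) auto
    also have "\<dots> = \<Lambda> * (W / 4 + D * \<kappa> powr (1 - p) * \<nu>)"
      unfolding \<kappa>p using D by (simp add: distrib_left)
    finally show "c * (LINT z|lborel. weight \<theta>3 z) \<le> \<Lambda> * (W / 4 + D * \<kappa> powr (1 - p) * \<nu>)" .
  qed
  also have "\<dots> = \<Lambda> * (W / 2 + flux_const p \<alpha> k K1 K2 * \<nu>)" unfolding FC by (simp add: algebra_simps)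
  finally show "(LINT z|lborel. J z * (norm (G z) * norm (grad_bump k y a (fst z)))) \<le> \<Lambda> * (W / 2 + flux_const p \<alpha> k K1 K2 * \<nu>)" .
qed

end

section \<open>Borel versions and uniqueness of the weak gradient\<close>

lemma measurable_lebesgue_AE:
  fixes f g :: "'a::euclidean_space \<Rightarrow> 'b::euclidean_space"
  assumes g: "g \<in> borel_measurable borel" and ae: "AE x in lebesgue. f x = g x"
  shows "f \<in> borel_measurable lebesgue"
proof (rule measurableI)
  fix A :: "'b set" assume A: "A \<in> sets borel"
  have gA: "g -` A \<in> sets lebesgue" using measurable_sets[OF g A] by simp
  have "f -` A \<in> sets lebesgue"
  proof (rule complete_measure.in_sets_AE[OF _ _ gA])
    show "complete_measure (lebesgue :: 'a measure)" by (rule completion.complete_measure_axioms)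
    show "AE x in lebesgue. (x \<in> g -` A) = (x \<in> f -` A)" using ae by eventually_elim simp
  qed simp
  then show "f -` A \<inter> space lebesgue \<in> sets lebesgue" by simp
qed simp

lemma lebesgue_integral_AE:
  fixes f g :: "'a::euclidean_space \<Rightarrow> 'b::euclidean_space"
  assumes g: "g \<in> borel_measurable borel" and ae: "AE x in lebesgue. f x = g x"
  shows "(LINT x|lebesgue. f x) = (LINT x|lborel. g x)"
    and "integrable lebesgue f \<longleftrightarrow> integrable lborel g"
proof -
  have gm: "g \<in> borel_measurable lborel" using g by simp
  have gl: "g \<in> borel_measurable lebesgue" by (rule measurable_completion[OF gm])
  note fl = measurable_lebesgue_AE[OF g ae]
  show "(LINT x|lebesgue. f x) = (LINT x|lborel. g x)"
    using integral_cong_AE[OF fl gl ae] integral_completion[OF gm] by simp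
  show "integrable lebesgue f \<longleftrightarrow> integrable lborel g"
    using integrable_cong_AE[OF fl gl ae] integrable_completion[OF gm] by simp
qed

lemma borel_version:
  fixes f :: "'a::euclidean_space \<Rightarrow> 'b::euclidean_space"
  assumes f: "f \<in> borel_measurable lebesgue"
  shows "\<exists>g\<in>borel_measurable borel. AE x in lebesgue. f x = g x"
proof -
  have "\<exists>h. \<forall>i\<in>(Basis :: 'b set). h i \<in> borel_measurable borel \<and> (AE x in lebesgue. f x \<bullet> i = h i x)"
  proof (intro bchoice ballI)
    fix i :: 'b assume "i \<in> Basis"
    have "(\<lambda>x. f x \<bullet> i) \<in> borel_measurable lebesgue" by (intro borel_measurable_inner f borel_measurable_const)
    from completion_ex_borel_measurable_real[OF this]
    obtain g where "g \<in> borel_measurable lborel" "AE x in lborel. f x \<bullet> i = g x" by blast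
    then show "\<exists>h. h \<in> borel_measurable borel \<and> (AE x in lebesgue. f x \<bullet> i = h x)"
      by (intro exI[of _ g] conjI AE_completion) simp_all
  qed
  then obtain h where h: "\<And>i. i \<in> Basis \<Longrightarrow> h i \<in> borel_measurable borel"
    "\<And>i. i \<in> Basis \<Longrightarrow> AE x in lebesgue. f x \<bullet> i = h i x" by blast
  have "AE x in lebesgue. \<forall>i\<in>Basis. f x \<bullet> i = h i x" by (intro AE_finite_allI h(2)) simp_all
  then have "AE x in lebesgue. f x = (\<Sum>i\<in>Basis. h i x *\<^sub>R i)"
  proof eventually_elim
    case (elim x)
    have "f x = (\<Sum>i\<in>Basis. (f x \<bullet> i) *\<^sub>R i)" by (simp add: euclidean_representation)
    also have "\<dots> = (\<Sum>i\<in>Basis. h i x *\<^sub>R i)" by (intro sum.cong) (simp_all add: elim)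
    finally show ?case .
  qed
  moreover have "(\<lambda>x. \<Sum>i\<in>Basis. h i x *\<^sub>R i) \<in> borel_measurable borel"
    using h(1) by (intro borel_measurable_sum borel_measurable_scaleR) auto
  ultimately show ?thesis by (intro bexI[of _ "\<lambda>x. \<Sum>i\<in>Basis. h i x *\<^sub>R i"])
qed

lemma borel_version_on:
  fixes f :: "'a::euclidean_space \<Rightarrow> 'b::euclidean_space"
  assumes "set_borel_measurable lebesgue K f" and K: "K \<in> sets borel"
  shows "\<exists>g\<in>borel_measurable borel. (AE x in lebesgue. x \<in> K \<longrightarrow> f x = g x) \<and> (\<forall>x. x \<notin> K \<longrightarrow> g x = 0)"
proof -
  from borel_version[OF assms(1)[unfolded set_borel_measurable_def]]
  obtain g where g: "g \<in> borel_measurable borel" "AE x in lebesgue. indicator K x *\<^sub>R f x = g x" by blast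
  have "(\<lambda>x. indicator K x *\<^sub>R g x) \<in> borel_measurable borel" by (intro borel_measurable_scaleR borel_measurable_indicator g(1) K)
  moreover have "AE x in lebesgue. x \<in> K \<longrightarrow> f x = indicator K x *\<^sub>R g x"
    using g(2) by eventually_elim (auto simp: indicator_def)
  ultimately show ?thesis by (intro bexI[of _ "\<lambda>x. indicator K x *\<^sub>R g x"]) auto
qed

lemma test_functions_mono: "U \<subseteq> U' \<Longrightarrow> \<phi> \<in> test_functions U \<Longrightarrow> \<phi> \<in> test_functions U'"
  by (auto simp: test_functions_def)

lemma measurable_slice:
  fixes g :: "'a::euclidean_space \<times> real \<Rightarrow> 'b::euclidean_space"
  assumes "g \<in> borel_measurable borel"
  shows "(\<lambda>x. g (x, t)) \<in> borel_measurable borel"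
proof -
  have "(\<lambda>x::'a. (x, t)) \<in> borel_measurable borel" by (intro borel_measurable_continuous_onI continuous_intros)
  from measurable_compose[OF this assms] show ?thesis .
qed

lemma integrable_slices:
  fixes g :: "'a::euclidean_space \<times> real \<Rightarrow> 'b::euclidean_space"
  assumes "integrable lborel g"
  shows "AE t in lborel. integrable lborel (\<lambda>x. g (x, t))"
proof -
  have "integrable (lborel \<Otimes>\<^sub>M lborel) (\<lambda>(t, x). g (x, t))"
    using lborel_pair.integrable_product_swap[of g] assms by (simp add: lborel_prod case_prod_beta)
  from lborel_pair.AE_integrable_fst'[OF this] show ?thesis by simp
qed

lemma has_weak_gradientD:
  assumes "has_weak_gradient U f G" "\<phi> \<in> test_functions U" "i \<in> Basis"
  shows "(LINT x:U|lebesgue. f x * (grad \<phi> x \<bullet> i)) = - (LINT x:U|lebesgue. (G x \<bullet> i) * \<phi> x)"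
  using assms unfolding has_weak_gradient_def by (elim conjE) (drule bspec, assumption, drule bspec, assumption)

text \<open>Both gradients have the same pairing with every test function, so the components of
  their difference pair to 0; \<open>AE_nonneg_if_test_nonneg\<close> applies to w and to - w. The
  Borel function w stands in for one component of the difference.\<close>

lemma weak_gradient_slice_unique:
  fixes V1 V2 :: "'a::euclidean_space \<Rightarrow> 'a"
  assumes w1: "has_weak_gradient \<Omega> f V1" and w2: "has_weak_gradient \<Omega> f V2"
    and sub: "cball y b \<subseteq> \<Omega>" and i: "i \<in> Basis"
    and wm: "w \<in> borel_measurable borel"
    and ae: "AE x in lebesgue. x \<in> cball y b \<longrightarrow> (V1 x - V2 x) \<bullet> i = w x" and wz: "\<And>x. x \<notin> cball y b \<Longrightarrow> w x = 0"
  shows "AE x in lborel. x \<in> ball y b \<longrightarrow> w x = 0"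
proof -
  have V: "set_integrable lebesgue (cball y b) V1" "set_integrable lebesgue (cball y b) V2"
    using w1 w2 sub by (auto simp: has_weak_gradient_def locally_integrable_def)
  have Vi: "integrable lebesgue (\<lambda>x. (indicator (cball y b) x *\<^sub>R V1 x - indicator (cball y b) x *\<^sub>R V2 x) \<bullet> i)"
    using V unfolding set_integrable_def by (intro integrable_inner_left Bochner_Integration.integrable_diff)
  have eq: "AE x in lebesgue. (indicator (cball y b) x *\<^sub>R V1 x - indicator (cball y b) x *\<^sub>R V2 x) \<bullet> i = w x"
    using ae by eventually_elim (auto simp: indicator_def wz)
  have iw: "integrable lborel w" using Vi lebesgue_integral_AE(2)[OF wm eq] by blast
  have zero: "(LINT x|lborel. w x * \<phi> x) = 0" if \<phi>: "\<phi> \<in> test_functions (ball y b)" for \<phi>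
  proof -
    have \<phi>\<Omega>: "\<phi> \<in> test_functions \<Omega>"
      by (rule test_functions_mono[OF order_trans[OF ball_subset_cball sub] \<phi>])
    note T = test_functionsD[OF \<phi>]
    have cont: "continuous_on UNIV \<phi>" by (rule Ck_continuous[OF T(1)])
    have \<phi>m: "\<phi> \<in> borel_measurable borel" by (rule borel_measurable_continuous_onI[OF cont])
    have \<phi>l: "\<phi> \<in> borel_measurable lebesgue" using \<phi>m by (intro measurable_completion) simp
    obtain R where "\<And>x. norm x > R \<Longrightarrow> \<phi> x = 0" using T(3) by blast
    then obtain B where B: "B \<ge> 0" "\<And>x. norm (\<phi> x) \<le> B" using continuous_bounded_support[OF cont] by blast
    have int: "integrable lebesgue (\<lambda>x. indicator \<Omega> x *\<^sub>R ((X x \<bullet> i) * \<phi> x))"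
      if X: "set_integrable lebesgue (cball y b) X" for X :: "'a \<Rightarrow> 'a"
    proof -
      have eqX: "(\<lambda>x. indicator \<Omega> x *\<^sub>R ((X x \<bullet> i) * \<phi> x)) = (\<lambda>x. ((indicator (cball y b) x *\<^sub>R X x) \<bullet> i) * \<phi> x)"
      proof
        fix x
        show "indicator \<Omega> x *\<^sub>R ((X x \<bullet> i) * \<phi> x) = ((indicator (cball y b) x *\<^sub>R X x) \<bullet> i) * \<phi> x"
        proof (cases "x \<in> cball y b")
          case True
          then have "x \<in> \<Omega>" using sub by (rule subsetD[rotated])
          then show ?thesis using True by simp
        next
          case False
          then have "\<phi> x = 0" using T(2)[of x] by auto
          then show ?thesis by simp
        qed
      qed
      have Xi: "integrable lebesgue (\<lambda>x. (indicator (cball y b) x *\<^sub>R X x) \<bullet> i)"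
        using X unfolding set_integrable_def by (rule integrable_inner_left)
      show ?thesis unfolding eqX
      proof (rule Bochner_Integration.integrable_bound[OF integrable_mult_right[OF Xi, of B]])
        show "(\<lambda>x. ((indicator (cball y b) x *\<^sub>R X x) \<bullet> i) * \<phi> x) \<in> borel_measurable lebesgue"
          by (intro borel_measurable_times borel_measurable_integrable[OF Xi] \<phi>l)
        have "norm (c * \<phi> x) \<le> norm (B * c)" for c x
          using B(1) mult_left_mono[OF B(2)[of x], of "\<bar>c\<bar>"] by (simp add: abs_mult mult.commute)
        then show "AE x in lebesgue. norm (((indicator (cball y b) x *\<^sub>R X x) \<bullet> i) * \<phi> x) \<le> norm (B * ((indicator (cball y b) x *\<^sub>R X x) \<bullet> i))"
          by (intro AE_I2)
      qed
    qed
    have "(LINT x:\<Omega>|lebesgue. (V1 x \<bullet> i) * \<phi> x) = (LINT x:\<Omega>|lebesgue. (V2 x \<bullet> i) * \<phi> x)"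
      using has_weak_gradientD[OF w1 \<phi>\<Omega> i] has_weak_gradientD[OF w2 \<phi>\<Omega> i] by linarith
    then have "0 = (LINT x|lebesgue. indicator \<Omega> x *\<^sub>R ((V1 x \<bullet> i) * \<phi> x) - indicator \<Omega> x *\<^sub>R ((V2 x \<bullet> i) * \<phi> x))"
      unfolding Bochner_Integration.integral_diff[OF int[OF V(1)] int[OF V(2)]] set_lebesgue_integral_def by linarith
    also have "\<dots> = (LINT x|lborel. w x * \<phi> x)"
    proof (rule lebesgue_integral_AE(1))
      show "(\<lambda>x. w x * \<phi> x) \<in> borel_measurable borel" using wm \<phi>m by measurable
      show "AE x in lebesgue. indicator \<Omega> x *\<^sub>R ((V1 x \<bullet> i) * \<phi> x) - indicator \<Omega> x *\<^sub>R ((V2 x \<bullet> i) * \<phi> x) = w x * \<phi> x"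
        using ae
      proof eventually_elim
        case (elim x)
        show ?case
        proof (cases "x \<in> cball y b")
          case True
          then have "x \<in> \<Omega>" using sub by blast
          then show ?thesis using elim True by (simp add: inner_diff_left left_diff_distrib[symmetric])
        next
          case False
          then have "\<phi> x = 0" using T(2)[of x] by auto
          then show ?thesis by simp
        qed
      qed
    qed
    finally show ?thesis by simp
  qed
  have "AE x in lborel. x \<in> ball y b \<longrightarrow> w x \<ge> 0"
    using zero by (intro AE_nonneg_if_test_nonneg iw) auto
  moreover have "AE x in lborel. x \<in> ball y b \<longrightarrow> - w x \<ge> 0"
    using zero iw by (intro AE_nonneg_if_test_nonneg) auto
  ultimately show ?thesis by eventually_elim auto
qed

text \<open>The structure conditions speak of the gradient picked by choice, whereas p-integrability
  is known for a possibly different one; this identifies them. Uniqueness holds slice by slice, and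
  a Borel version of the difference lets the slices be assembled.\<close>

lemma spatial_gradient_unique:
  fixes V1 V2 :: "'a::euclidean_space \<times> real \<Rightarrow> 'a"
  assumes V1: "has_spatial_gradient \<Omega> T f V1" and V2: "has_spatial_gradient \<Omega> T f V2"
    and sub: "cball y b \<subseteq> \<Omega>" and t: "0 < t0" "t2 < T"
  shows "AE z in lebesgue. z \<in> ball y b \<times> {t0..t2} \<longrightarrow> V1 z = V2 z"
proof -
  let ?K = "cball y b \<times> {t0..t2}"
  have Kc: "compact ?K" by (intro compact_Times) auto
  have Ks: "?K \<subseteq> cylinder \<Omega> T" using sub t by (auto simp: cylinder_def)
  have Km: "?K \<in> sets borel" using Kc by (intro borel_compact)
  have comp: "AE z in lebesgue. z \<in> ball y b \<times> {t0..t2} \<longrightarrow> (V1 z - V2 z) \<bullet> i = 0" if i: "i \<in> Basis" for i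
  proof -
    have "set_integrable lebesgue ?K V1" "set_integrable lebesgue ?K V2"
      using V1 V2 Kc Ks unfolding has_spatial_gradient_def locally_integrable_def by blast+
    then have "set_borel_measurable lebesgue ?K V1" "set_borel_measurable lebesgue ?K V2"
      unfolding set_integrable_def set_borel_measurable_def by (auto dest: borel_measurable_integrable)
    then have m: "(\<lambda>z. (indicator ?K z *\<^sub>R V1 z - indicator ?K z *\<^sub>R V2 z) \<bullet> i) \<in> borel_measurable lebesgue"
      unfolding set_borel_measurable_def by (intro borel_measurable_inner borel_measurable_diff borel_measurable_const)
    have eq: "(\<lambda>z. (indicator ?K z *\<^sub>R V1 z - indicator ?K z *\<^sub>R V2 z) \<bullet> i) = (\<lambda>z. indicator ?K z *\<^sub>R ((V1 z - V2 z) \<bullet> i))"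
      by (simp add: fun_eq_iff inner_diff_left right_diff_distrib)
    have "set_borel_measurable lebesgue ?K (\<lambda>z. (V1 z - V2 z) \<bullet> i)"
      using m unfolding set_borel_measurable_def eq .
    from borel_version_on[OF this Km] obtain w where w: "w \<in> borel_measurable borel"
      "AE z in lebesgue. z \<in> ?K \<longrightarrow> (V1 z - V2 z) \<bullet> i = w z" "\<And>z. z \<notin> ?K \<Longrightarrow> w z = 0" by blast
    have "AE t in lborel. 0 < t \<and> t < T \<longrightarrow> has_weak_gradient \<Omega> (\<lambda>x. f (x, t)) (\<lambda>x. V1 (x, t))"
      "AE t in lborel. 0 < t \<and> t < T \<longrightarrow> has_weak_gradient \<Omega> (\<lambda>x. f (x, t)) (\<lambda>x. V2 (x, t))"
      using V1 V2 unfolding has_spatial_gradient_def by (auto simp: AE_completion_iff)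
    with AE_time_slice[OF w(2)]
    have "AE t in lborel. AE x in lborel. fst (x, t) \<in> ball y b \<longrightarrow> w (x, t) = 0"
    proof eventually_elim
      case (elim t)
      show ?case
      proof (cases "t \<in> {t0..t2}")
        case True
        have m: "(\<lambda>x. w (x, t)) \<in> borel_measurable borel" by (rule measurable_slice[OF w(1)])
        have "AE x in lborel. x \<in> ball y b \<longrightarrow> w (x, t) = 0"
        proof (rule weak_gradient_slice_unique[OF _ _ sub i m])
          show "has_weak_gradient \<Omega> (\<lambda>x. f (x, t)) (\<lambda>x. V1 (x, t))" using elim True assms(4,5) by auto
          show "has_weak_gradient \<Omega> (\<lambda>x. f (x, t)) (\<lambda>x. V2 (x, t))" using elim True assms(4,5) by auto
          show "AE x in lebesgue. x \<in> cball y b \<longrightarrow> (V1 (x, t) - V2 (x, t)) \<bullet> i = w (x, t)"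
            using elim(1) True by (intro AE_completion) (auto elim!: eventually_mono)
          show "w (x, t) = 0" if "x \<notin> cball y b" for x using that w(3) by auto
        qed
        then show ?thesis by simp
      next
        case False
        then show ?thesis using w(3) by (intro AE_I2) auto
      qed
    qed
    then have "AE z in lebesgue. fst z \<in> ball y b \<longrightarrow> w z = 0"
    proof (rule AE_from_time_slice[rotated])
      have [measurable]: "w \<in> borel_measurable borel" by (rule w(1))
      have "{z. fst z \<in> ball y b \<longrightarrow> w z = 0} = (- (fst -` ball y b)) \<union> (w -` {0})" by auto
      also have "\<dots> \<in> sets borel"
        using measurable_sets[OF w(1), of "{0}"] open_vimage_fst[of "ball y b"] by (intro sets.Un) (auto intro!: borel_closed closed_Compl open_vimage_fst)
      finally show "{z. fst z \<in> ball y b \<longrightarrow> w z = 0} \<in> sets borel" .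
    qed
    with w(2) show ?thesis by eventually_elim (auto simp: mem_Times_iff)
  qed
  have "AE z in lebesgue. \<forall>i\<in>Basis. z \<in> ball y b \<times> {t0..t2} \<longrightarrow> (V1 z - V2 z) \<bullet> i = 0"
    by (intro AE_finite_allI comp finite_Basis)
  then show ?thesis
  proof eventually_elim
    case (elim z)
    show ?case
    proof
      assume z: "z \<in> ball y b \<times> {t0..t2}"
      have "V1 z \<bullet> i = V2 z \<bullet> i" if "i \<in> Basis" for i
        using bspec[OF elim that] z by (simp add: inner_diff_left)
      then show "V1 z = V2 z" by (rule euclidean_eqI)
    qed
  qed
qed

section \<open>The Harnack estimate\<close>

lemma bump_power_zero:
  assumes "a > 0" "k > 0" "x \<notin> ball y a"
  shows "bump y a x ^ k = 0"
  using bump_zero[OF assms(1,3)] assms(2) by simp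

lemma grad_bump_zero:
  assumes "a > 0" "k \<ge> 2" "x \<notin> ball y a"
  shows "grad_bump k y a x = 0"
proof -
  have "k - 1 > 0" using assms by simp
  then have "bump y a x ^ (k - 1) = 0" using bump_zero[OF assms(1,3)] by simp
  then show ?thesis unfolding grad_bump_def by simp
qed

lemma bump_power_approx:
  assumes "a > 0" "k \<ge> 2" "a < b" "p \<ge> 1"
  shows "W01p_approx p (ball y b) (\<lambda>x. bump y a x ^ k) (grad_bump k y a)"
proof (rule W01p_approx_C1[OF bump_power_has_derivative continuous_grad_bump])
  show "bump y a x ^ k = 0" if "x \<notin> cball y a" for x
    using that assms by (intro bump_power_zero) auto
qed (use assms in auto)

lemma AE_shift:
  assumes "AE x in lborel. P (x::real)"
  shows "AE x in lborel. P (x - h)"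
proof -
  obtain N where N: "N \<in> null_sets lborel" "{x. \<not> P x} \<subseteq> N"
    using assms unfolding eventually_ae_filter by auto
  have [measurable]: "N \<in> sets borel" using N(1) by (auto simp: null_sets_def)
  have "AE x in lborel. x \<notin> N" by (rule AE_not_in[OF N(1)])
  then have "AE x in lborel. -h + 1 * x \<notin> N" by (intro AE_borel_affine) auto
  then show ?thesis by eventually_elim (use N(2) in auto)
qed

lemma powr_concave:
  fixes P1 P2 \<alpha> :: real
  assumes \<alpha>: "0 < \<alpha>" "\<alpha> < 1" and P: "P1 > 0" "P2 > 0"
  shows "P2 powr (- \<alpha>) * (P2 - P1) \<le> P2 powr (1 - \<alpha>) / (1 - \<alpha>) - P1 powr (1 - \<alpha>) / (1 - \<alpha>)"
proof -
  let ?f = "\<lambda>x. x powr (1 - \<alpha>) / (1 - \<alpha>)"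
  have d: "(?f has_real_derivative x powr (- \<alpha>)) (at x)" if "x > 0" for x
    using that \<alpha> by (auto intro!: derivative_eq_intros)
  consider "P1 = P2" | "P1 < P2" | "P2 < P1" by linarith
  then show ?thesis
  proof cases
    case 1
    then show ?thesis by simp
  next
    case 2
    obtain z where z: "P1 < z" "z < P2" "?f P2 - ?f P1 = (P2 - P1) * z powr (- \<alpha>)"
      using MVT2[OF 2, of ?f "\<lambda>x. x powr (- \<alpha>)"] d P by auto
    have "P2 powr (- \<alpha>) \<le> z powr (- \<alpha>)" using z P \<alpha> by (intro powr_mono2') auto
    then have "(P2 - P1) * P2 powr (- \<alpha>) \<le> (P2 - P1) * z powr (- \<alpha>)" using 2 by (intro mult_left_mono) auto
    then show ?thesis using z(3) by (simp add: mult.commute)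
  next
    case 3
    obtain z where z: "P2 < z" "z < P1" "?f P1 - ?f P2 = (P1 - P2) * z powr (- \<alpha>)"
      using MVT2[OF 3, of ?f "\<lambda>x. x powr (- \<alpha>)"] d P by auto
    have "z powr (- \<alpha>) \<le> P2 powr (- \<alpha>)" using z P \<alpha> by (intro powr_mono2') auto
    then have "(P1 - P2) * z powr (- \<alpha>) \<le> (P1 - P2) * P2 powr (- \<alpha>)" using 3 by (intro mult_left_mono) auto
    then show ?thesis using z(3) by (simp add: algebra_simps)
  qed
qed

lemma bounded_bump_integrable:
  fixes f :: "'a::euclidean_space \<Rightarrow> real"
  assumes [measurable]: "f \<in> borel_measurable borel" and f: "\<And>x. \<bar>f x\<bar> \<le> C" and a: "a > 0" and k: "k > 0"
  shows "integrable lborel (\<lambda>x. f x * bump y a x ^ k)"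
proof (rule Bochner_Integration.integrable_bound[OF integrable_cball_const[of y a C]])
  have "norm (f x * bump y a x ^ k) \<le> norm (indicator (cball y a) x * C)" for x
  proof (cases "x \<in> ball y a")
    case True
    have "\<bar>f x\<bar> * bump y a x ^ k \<le> C * 1"
      using f[of x] by (intro mult_mono power_le_one zero_le_power bump_bounds) linarith+
    then show ?thesis using True bump_bounds(1)[of y a x] f[of x] by (auto simp: abs_mult)
  next
    case False
    show ?thesis by (simp add: bump_power_zero[OF a k False])
  qed
  then show "AE x in lborel. norm (f x * bump y a x ^ k) \<le> norm (indicator (cball y a) x * C)" by (intro AE_I2)
qed measurable

lemma AE_ex_in_interval:
  assumes ae: "AE x in lborel. P (x::real)" and cd: "c < d"
  shows "\<exists>x\<in>{c<..<d}. P x"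
proof (rule ccontr)
  assume n: "\<not> (\<exists>x\<in>{c<..<d}. P x)"
  have "AE x in lebesgue. x \<in> - {c<..<d}"
    using AE_completion[OF ae] by eventually_elim (use n in auto)
  then have "(c + d) / 2 \<in> - {c<..<d}" by (intro mem_closed_if_AE_lebesgue) auto
  then show False using cd by (simp add: field_simps)
qed

lemma measure_ball_ratio:
  fixes y :: "'a::euclidean_space"
  assumes "0 < c" "0 < d"
  shows "measure lborel (ball y c) = (c / d) ^ DIM('a) * measure lborel (ball y d)"
  using assms by (simp add: content_ball power_divide)

lemma measure_ball_pos:
  fixes y :: "'a::euclidean_space"
  shows "0 < c \<Longrightarrow> 0 < measure lborel (ball y c)"
  by (simp add: content_ball unit_ball_vol_pos)

section \<open>Reduction of a local solution to Borel functions on a slab\<close>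

locale local_solution =
  fixes \<Omega> :: "'a::euclidean_space set" and T m p K1 K2 :: real
    and A :: "'a \<times> real \<Rightarrow> real \<Rightarrow> 'a \<Rightarrow> 'a" and u :: "'a \<times> real \<Rightarrow> real"
    and y :: 'a and r s t \<mu> :: real
  assumes m1: "m > 1" and p: "1 < p" "p < 2" and K: "K1 > 0" "K2 > 0"
    and str: "structure_conditions \<Omega> T m p K1 K2 A u" and sol: "weak_solution \<Omega> T m p A u"
    and r: "r > 0" and st: "s < t" and cyl: "ball y (2 * r) \<times> {s<..<t} \<subseteq> cylinder \<Omega> T"
    and ub: "AE z in lebesgue. z \<in> ball y (2 * r) \<times> {s<..<t} \<longrightarrow> u z \<le> \<mu>"
begin

abbreviation "q \<equiv> (m - 1) * (p - 1)"
abbreviation "flux z \<equiv> A z (u z) (D_u \<Omega> T m u z)"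
abbreviation "V0 \<equiv> D_u_pow \<Omega> T m u"
text \<open>Radii r < a < b < 2r: the cutoff lives on radius a, test functions on radius b. The gap
  between a and b is the room for mollification, and the closed ball of radius b is compact in
  \<Omega> although \<open>ball y (2 * r)\<close> may touch its boundary.\<close>

abbreviation "a \<equiv> 3 * r / 2"
abbreviation "b \<equiv> 7 * r / 4"

lemma mm: "m_minus m = 1" using m1 by (simp add: m_minus_def)

lemma q_pos: "q > 0" using m1 p by simp

lemma ball_sub: "ball y (2 * r) \<subseteq> \<Omega>" and s0: "0 \<le> s" and tT: "t \<le> T"
proof -
  have sub: "x \<in> \<Omega> \<and> 0 < \<tau> \<and> \<tau> < T" if "x \<in> ball y (2 * r)" "s < \<tau>" "\<tau> < t" for x \<tau>
  proof -
    have "(x, \<tau>) \<in> cylinder \<Omega> T" by (rule subsetD[OF cyl]) (use that in simp)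
    then show ?thesis by (simp add: cylinder_def)
  qed
  show "ball y (2 * r) \<subseteq> \<Omega>" using sub[of _ "(s + t) / 2"] st by (auto simp: field_simps)
  have y: "y \<in> ball y (2 * r)" using r by simp
  show "0 \<le> s"
  proof (rule ccontr)
    assume "\<not> 0 \<le> s"
    then have "s < min 0 ((s + t) / 2)" using st by simp
    then obtain \<tau> where "s < \<tau>" "\<tau> < min 0 ((s + t) / 2)" using dense by blast
    then show False using sub[OF y, of \<tau>] st by auto
  qed
  show "t \<le> T"
  proof (rule ccontr)
    assume "\<not> t \<le> T"
    then have "max T ((s + t) / 2) < t" using st by simp
    then obtain \<tau> where "max T ((s + t) / 2) < \<tau>" "\<tau> < t" using dense by blast
    then show False using sub[OF y, of \<tau>] st by auto
  qed
qed

lemma cball_sub: "c < 2 * r \<Longrightarrow> cball y c \<subseteq> \<Omega>"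
  using ball_sub by (rule order_trans[rotated]) auto

lemma sol_space: "solution_space \<Omega> T m p u"
  using sol unfolding weak_solution_def weak_subsolution_def by (elim conjE)

lemma u_bounds: "AE z in lebesgue. z \<in> ball y (2 * r) \<times> {s<..<t} \<longrightarrow> 0 \<le> u z \<and> u z \<le> \<mu>"
proof -
  have "AE z in lebesgue. z \<in> cylinder \<Omega> T \<longrightarrow> 0 \<le> u z"
    using sol_space unfolding solution_space_def by (elim conjE)
  with ub show ?thesis by eventually_elim (use cyl in blast)
qed

text \<open>Otherwise the two bounds on u would contradict each other almost everywhere on a
  nonempty open set.\<close>

lemma mu0: "0 \<le> \<mu>"
proof (rule ccontr)
  assume "\<not> 0 \<le> \<mu>"
  have "AE z in lebesgue. z \<in> - (ball y (2 * r) \<times> {s<..<t})"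
    using u_bounds
  proof eventually_elim
    case (elim z)
    then show ?case using \<open>\<not> 0 \<le> \<mu>\<close> by auto
  qed
  moreover have "closed (- (ball y (2 * r) \<times> {s<..<t}))"
    by (intro closed_Compl open_Times) auto
  ultimately have "(y, (s + t) / 2) \<in> - (ball y (2 * r) \<times> {s<..<t})"
    by (intro mem_closed_if_AE_lebesgue)
  then show False using r st by (simp add: field_simps)
qed

lemma structure_AE: "AE z in lebesgue. z \<in> ball y (2 * r) \<times> {s<..<t} \<longrightarrow>
    K1 * u z powr q * norm (V0 z) powr p \<le> flux z \<bullet> V0 z \<and>
    norm (flux z) \<le> K2 * u z powr q * norm (V0 z) powr (p - 1)"
proof -
  \<comment> \<open>As q is nonzero, \<open>rpow\<close> with this exponent is \<open>powr\<close>,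
    also where u = 0.\<close>
  have q0: "(m - m_minus m) * (p - 1) = q" "q \<noteq> 0" using m1 p by (simp_all add: mm)
  have "AE z in lebesgue. z \<in> cylinder \<Omega> T \<longrightarrow>
    K1 * u z powr q * norm (V0 z) powr p \<le> flux z \<bullet> V0 z \<and>
    norm (flux z) \<le> K2 * u z powr q * norm (V0 z) powr (p - 1)"
    using str q0(2) unfolding structure_conditions_def q0(1) rpow_def by simp
  then show ?thesis by eventually_elim (use cyl in blast)
qed

lemma V0_gradient: "has_spatial_gradient \<Omega> T (u_pow m u) V0"
proof -
  have "Lp_loc_W1p_loc p \<Omega> T (u_pow m u)"
    using sol_space unfolding solution_space_def by (elim conjE)
  then have "\<exists>V. has_spatial_gradient \<Omega> T (u_pow m u) V" unfolding Lp_loc_W1p_loc_def by blast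
  from someI_ex[OF this] show ?thesis unfolding D_u_pow_def spatial_gradient_def .
qed

text \<open>
  Measurability of the flux is read off the weak formulation: testing with the cutoff and with the
  cutoff times an affine function makes the components of the flux measurable where the cutoff is positive.
\<close>

lemma flux_measurable:
  assumes t02: "s < t0" "t0 < t2" "t2 < t"
  shows "set_borel_measurable lebesgue (ball y a \<times> {t0..t2}) flux"
proof -
  let ?K = "cball y b \<times> {t0..t2}" and ?Ka = "ball y a \<times> {t0..t2}"
  have a0: "0 < a" and ab: "a < b" and b2: "b < 2 * r" using r by auto
  have pp: "p \<ge> 1" "p > 1" using p by auto
  have tt: "0 < t0" "t2 \<le> T" using t02 s0 tT by auto
  let ?w = "\<lambda>x. bump y a x ^ 2" and ?g = "grad_bump 2 y a"
  \<comment> \<open>On the ball of radius a, (x - y) \<bullet> i has absolute value at most a, so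
    adding 2 * a makes the affine factor positive and the test function nonnegative.\<close>
  let ?l = "\<lambda>i x. (x - y) \<bullet> i + 2 * a"
  have int0: "set_integrable lebesgue ?K (\<lambda>z. flux z \<bullet> ?g (fst z))"
  proof (rule weak_identity(3)[OF sol cball_sub[OF b2] bump_power_approx[OF a0 _ ab pp(1)] mm pp(2) _ _ _ _ tt(1) t02(2) tt(2)])
    show "bump y a x ^ 2 = 0" if "x \<notin> cball y b" for x using that ab by (intro bump_power_zero[OF a0]) auto
    show "?g x = 0" if "x \<notin> cball y b" for x using that ab by (intro grad_bump_zero[OF a0]) auto
    show "bump y a x ^ 2 \<le> 1" for x using bump_bounds[of y a x] by (intro power_le_one) auto
  qed auto
  have int1: "set_integrable lebesgue ?K (\<lambda>z. flux z \<bullet> (?w (fst z) *\<^sub>R i + ?l i (fst z) *\<^sub>R ?g (fst z)))"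
    if i: "i \<in> Basis" for i
  proof (rule weak_identity(3)[OF sol cball_sub[OF b2] _ mm pp(2) _ _ _ _ tt(1) t02(2) tt(2)])
    have li: "\<bar>(x - y) \<bullet> i\<bar> \<le> a" if "x \<in> ball y a" for x
      using Basis_le_norm[OF i, of "x - y"] that by (simp add: dist_norm norm_minus_commute)
    show "W01p_approx p (ball y b) (\<lambda>x. ?w x * ?l i x) (\<lambda>x. ?w x *\<^sub>R i + ?l i x *\<^sub>R ?g x)"
    proof (rule W01p_approx_C1[OF _ _ _ ab pp(1)])
      show "((\<lambda>x. ?w x * ?l i x) has_derivative (\<lambda>h. (?w x *\<^sub>R i + ?l i x *\<^sub>R ?g x) \<bullet> h)) (at x)" for x
      proof -
        have "((\<lambda>x. ?l i x) has_derivative (\<lambda>h. h \<bullet> i)) (at x)" by (auto intro!: derivative_eq_intros)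
        from has_derivative_mult[OF bump_power_has_derivative[of 2 y a x, OF order_refl] this]
        show ?thesis by (rule has_derivative_eq_rhs) (auto simp: fun_eq_iff inner_add_left inner_commute[of _ i] algebra_simps)
      qed
      show "continuous_on UNIV (\<lambda>x. ?w x *\<^sub>R i + ?l i x *\<^sub>R ?g x)"
        by (intro continuous_intros continuous_bump continuous_grad_bump)
      show "?w x * ?l i x = 0" if "x \<notin> cball y a" for x using that by (simp add: bump_power_zero[OF a0])
    qed
    show "?w x * ?l i x = 0" "?w x *\<^sub>R i + ?l i x *\<^sub>R ?g x = 0" if "x \<notin> cball y b" for x
    proof -
      have x: "x \<notin> ball y a" using that ab by auto
      show "?w x * ?l i x = 0" "?w x *\<^sub>R i + ?l i x *\<^sub>R ?g x = 0"
        using bump_power_zero[OF a0 _ x, of 2] grad_bump_zero[OF a0 _ x, of 2] by simp_all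
    qed
    show "0 \<le> ?w x * ?l i x" for x
    proof (cases "x \<in> ball y a")
      case True
      have "0 \<le> ?l i x" using li[OF True] a0 by linarith
      then show ?thesis by (intro mult_nonneg_nonneg zero_le_power bump_bounds)
    next
      case False
      then show ?thesis using bump_power_zero[OF a0 _ False, of 2] by simp
    qed
    show "?w x * ?l i x \<le> 1 * (3 * a)" for x
    proof (cases "x \<in> ball y a")
      case True
      have "?l i x \<le> 3 * a" "0 \<le> ?l i x" using li[OF True] a0 by linarith+
      then show ?thesis by (intro mult_mono power_le_one bump_bounds) auto
    next
      case False
      then show ?thesis using bump_power_zero[OF a0 _ False, of 2] a0 by simp
    qed
  qed
  have fm: "F \<in> borel_measurable lebesgue" if "F \<in> borel_measurable borel" for F :: "'a \<times> real \<Rightarrow> real"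
    using that by (intro measurable_completion) simp
  have comp: "(\<lambda>z. indicator ?Ka z * (flux z \<bullet> i)) \<in> borel_measurable lebesgue" if i: "i \<in> Basis" for i
  proof -
    let ?X = "\<lambda>z. indicator ?K z *\<^sub>R (flux z \<bullet> (?w (fst z) *\<^sub>R i + ?l i (fst z) *\<^sub>R ?g (fst z)))"
    let ?Y = "\<lambda>z. indicator ?K z *\<^sub>R (flux z \<bullet> ?g (fst z))"
    have X: "?X \<in> borel_measurable lebesgue" using int1[OF i] unfolding set_integrable_def by (rule borel_measurable_integrable)
    have Y: "?Y \<in> borel_measurable lebesgue" using int0 unfolding set_integrable_def by (rule borel_measurable_integrable)
    have l: "(\<lambda>z::'a \<times> real. ?l i (fst z)) \<in> borel_measurable lebesgue" by (intro fm borel_measurable_continuous_onI continuous_intros)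
    have w: "(\<lambda>z::'a \<times> real. ?w (fst z)) \<in> borel_measurable lebesgue"
      by (intro fm borel_measurable_continuous_onI continuous_intros continuous_on_compose2[OF continuous_bump]) auto
    have K0: "(\<lambda>z. indicator ?Ka z :: real) \<in> borel_measurable lebesgue"
      by (intro fm borel_measurable_indicator borel_Times) auto
    \<comment> \<open>Subtracting \<open>?l\<close> times the first pairing from the second cancels
      the gradient of the cutoff and leaves \<open>?w\<close> times the i-th component of the
      flux.\<close>
    have "(\<lambda>z. indicator ?Ka z * ((?X z - ?l i (fst z) * ?Y z) / ?w (fst z))) \<in> borel_measurable lebesgue"
      by (intro borel_measurable_times borel_measurable_divide borel_measurable_diff X Y l w K0)
    also have "(\<lambda>z. indicator ?Ka z * ((?X z - ?l i (fst z) * ?Y z) / ?w (fst z))) = (\<lambda>z. indicator ?Ka z * (flux z \<bullet> i))"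
    proof
      fix z
      show "indicator ?Ka z * ((?X z - ?l i (fst z) * ?Y z) / ?w (fst z)) = indicator ?Ka z * (flux z \<bullet> i)"
      proof (cases "z \<in> ?Ka")
        case True
        then have z: "fst z \<in> ball y a" "z \<in> ?K" using ab by (auto simp: mem_Times_iff)
        have w0: "?w (fst z) > 0" using z bump_pos[OF a0, of y "fst z"] by (simp del: power2_eq_square)
        have "?X z - ?l i (fst z) * ?Y z = ?w (fst z) * (flux z \<bullet> i)"
          using z(2) by (simp add: inner_add_right)
        then show ?thesis using w0 by simp
      qed simp
    qed
    finally show ?thesis .
  qed
  have "(\<lambda>z. indicator ?Ka z *\<^sub>R flux z) = (\<lambda>z. \<Sum>i\<in>Basis. (indicator ?Ka z * (flux z \<bullet> i)) *\<^sub>R i)"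
  proof
    fix z
    have "indicator ?Ka z *\<^sub>R flux z = indicator ?Ka z *\<^sub>R (\<Sum>i\<in>Basis. (flux z \<bullet> i) *\<^sub>R i)"
      by (simp only: euclidean_representation)
    also have "\<dots> = (\<Sum>i\<in>Basis. (indicator ?Ka z * (flux z \<bullet> i)) *\<^sub>R i)"
      by (simp only: scaleR_sum_right scaleR_scaleR)
    finally show "indicator ?Ka z *\<^sub>R flux z = (\<Sum>i\<in>Basis. (indicator ?Ka z * (flux z \<bullet> i)) *\<^sub>R i)" .
  qed
  then show ?thesis
    unfolding set_borel_measurable_def
    by (simp only:) (intro borel_measurable_sum borel_measurable_scaleR comp borel_measurable_const)
qed

text \<open>
  Only Lebesgue measurability is known for \<open>u\<close>, its gradient and the flux; \<open>U\<close>, \<open>V\<close>, \<open>G\<close> are Borel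
  versions of them, cut off outside a slab that stays away from the initial and terminal times.
\<close>

definition slab :: "real \<Rightarrow> real \<Rightarrow> ('a \<times> real \<Rightarrow> real) \<Rightarrow> ('a \<times> real \<Rightarrow> 'a) \<Rightarrow> ('a \<times> real \<Rightarrow> 'a) \<Rightarrow> bool" where
  "slab t0 t2 U V G \<longleftrightarrow>
    U \<in> borel_measurable borel \<and> V \<in> borel_measurable borel \<and> G \<in> borel_measurable borel \<and>
    (\<forall>z. 0 \<le> U z \<and> U z \<le> \<mu>) \<and>
    (\<forall>z. z \<notin> ball y b \<times> {t0..t2} \<longrightarrow> U z = 0 \<and> V z = 0) \<and>
    integrable lborel (\<lambda>z. norm (V z) powr p) \<and>
    integrable lborel (\<lambda>z. norm (G z) powr (p / (p - 1))) \<and>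
    (AE z in lebesgue. z \<in> ball y b \<times> {t0..t2} \<longrightarrow> u z = U z \<and> V0 z = V z) \<and>
    (AE z in lebesgue. z \<in> ball y a \<times> {t0..t2} \<longrightarrow> flux z = G z) \<and>
    (AE z in lebesgue. z \<in> ball y a \<times> {t0..t2} \<longrightarrow>
       K1 * U z powr q * norm (V z) powr p \<le> G z \<bullet> V z \<and>
       norm (G z) \<le> K2 * U z powr q * norm (V z) powr (p - 1))"

lemma slab_exists:
  assumes t02: "s < t0" "t0 < t2" "t2 < t"
  shows "\<exists>U V G. slab t0 t2 U V G"
proof -
  let ?Kc = "cball y b \<times> {t0..t2}" and ?K = "ball y b \<times> {t0..t2}" and ?Ka = "ball y a \<times> {t0..t2}"
  have a0: "0 < a" and ab: "a < b" and b2: "b < 2 * r" using r by auto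
  have Kc: "compact ?Kc" by (intro compact_Times) auto
  have Kcm: "?Kc \<in> sets borel" by (rule borel_compact[OF Kc])
  have Km: "?K \<in> sets borel" "?Ka \<in> sets borel" by (auto intro: borel_Times)
  have Ksub: "?K \<subseteq> ball y (2 * r) \<times> {s<..<t}" using t02 b2 by auto
  have K0sub: "?Ka \<subseteq> ?K" using ab by auto
  have Kcs: "?Kc \<subseteq> cylinder \<Omega> T"
    using cball_sub[OF b2] t02 s0 tT by (auto simp: cylinder_def)
  have "Linf_loc (cylinder \<Omega> T) u" using sol_space unfolding solution_space_def by (elim conjE)
  then have "set_borel_measurable lebesgue ?Kc u" using Kc Kcs unfolding Linf_loc_def by blast
  from borel_version_on[OF this Kcm] obtain U0 where U0: "U0 \<in> borel_measurable borel"
    "AE z in lebesgue. z \<in> ?Kc \<longrightarrow> u z = U0 z" by blast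
  \<comment> \<open>Truncation makes the bounds hold at every point instead of almost everywhere,
    and on the slab it does not change the class of u.\<close>
  define U where "U z = indicator ?K z * max 0 (min \<mu> (U0 z))" for z
  have Um[measurable]: "U \<in> borel_measurable borel" unfolding U_def
    by (intro borel_measurable_times borel_measurable_indicator Km borel_measurable_max borel_measurable_min U0 borel_measurable_const)
  have U: "0 \<le> U z" "U z \<le> \<mu>" for z using mu0 by (auto simp: U_def indicator_def)
  have uU: "AE z in lebesgue. z \<in> ?K \<longrightarrow> u z = U z"
    using U0(2) u_bounds
  proof eventually_elim
    case (elim z)
    show ?case
    proof
      assume z: "z \<in> ?K"
      then have "z \<in> ?Kc" by auto
      then show "u z = U z" using elim z Ksub by (auto simp: U_def)
    qed
  qed
  \<comment> \<open>This gradient is p-integrable but need not be the chosen \<open>V0\<close>;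
    \<open>spatial_gradient_unique\<close> identifies the two below.\<close>
  obtain V1 where V1: "has_spatial_gradient \<Omega> T (u_pow m u) V1" "Lp_loc p (cylinder \<Omega> T) V1"
    using sol_space unfolding solution_space_def Lp_loc_W1p_loc_def by blast
  have V1K: "set_borel_measurable lebesgue ?Kc V1" "set_integrable lebesgue ?Kc (\<lambda>z. norm (V1 z) powr p)"
    using V1(2) Kc Kcs unfolding Lp_loc_def Lp_on_def by blast+
  from borel_version_on[OF V1K(1) Kcm] obtain V' where V': "V' \<in> borel_measurable borel"
    "AE z in lebesgue. z \<in> ?Kc \<longrightarrow> V1 z = V' z" "\<And>z. z \<notin> ?Kc \<Longrightarrow> V' z = 0" by blast
  note [measurable] = V'(1)
  define V where "V z = indicator ?K z *\<^sub>R V' z" for z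
  have Vm[measurable]: "V \<in> borel_measurable borel" unfolding V_def
    by (intro borel_measurable_scaleR borel_measurable_indicator Km V')
  have "integrable lborel (\<lambda>z. norm (V' z) powr p)"
  proof -
    have ae: "AE z in lebesgue. indicator ?Kc z *\<^sub>R (norm (V1 z) powr p) = norm (V' z) powr p"
      using V'(2)
    proof eventually_elim
      case (elim z)
      then show ?case using V'(3)[of z] p by (cases "z \<in> ?Kc") auto
    qed
    have m: "(\<lambda>z. norm (V' z) powr p) \<in> borel_measurable borel" by measurable
    show ?thesis
      using V1K(2) unfolding set_integrable_def lebesgue_integral_AE(2)[OF m ae] .
  qed
  then have Vp: "integrable lborel (\<lambda>z. norm (V z) powr p)"
  proof (rule Bochner_Integration.integrable_bound)
    have "norm (norm (V z) powr p) \<le> norm (norm (V' z) powr p)" for z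
      using p by (simp add: V_def indicator_def)
    then show "AE z in lborel. norm (norm (V z) powr p) \<le> norm (norm (V' z) powr p)" by (intro AE_I2)
  qed measurable
  have tt: "0 < t0" "t2 < T" using t02 s0 tT by auto
  have VV: "AE z in lebesgue. z \<in> ?K \<longrightarrow> V0 z = V z"
    using spatial_gradient_unique[OF V0_gradient V1(1) cball_sub[OF b2] tt] V'(2)
  proof eventually_elim
    case (elim z)
    show ?case
    proof
      assume z: "z \<in> ?K"
      then have "z \<in> ?Kc" by auto
      then show "V0 z = V z" using elim z by (simp add: V_def)
    qed
  qed
  from borel_version_on[OF flux_measurable[OF t02] Km(2)] obtain G where G: "G \<in> borel_measurable borel"
    "AE z in lebesgue. z \<in> ?Ka \<longrightarrow> flux z = G z" "\<And>z. z \<notin> ?Ka \<Longrightarrow> G z = 0" by blast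
  note [measurable] = G(1)
  have strG: "AE z in lebesgue. z \<in> ?Ka \<longrightarrow>
       K1 * U z powr q * norm (V z) powr p \<le> G z \<bullet> V z \<and>
       norm (G z) \<le> K2 * U z powr q * norm (V z) powr (p - 1)"
    using structure_AE uU VV G(2)
  proof eventually_elim
    case (elim z)
    show ?case
    proof
      assume z: "z \<in> ?Ka"
      then have "z \<in> ?K" "z \<in> ball y (2 * r) \<times> {s<..<t}" using K0sub Ksub by blast+
      then show "K1 * U z powr q * norm (V z) powr p \<le> G z \<bullet> V z \<and>
       norm (G z) \<le> K2 * U z powr q * norm (V z) powr (p - 1)" using elim z by metis
    qed
  qed
  \<comment> \<open>The growth condition bounds |G| by a multiple of |V|^(p-1), and raising to the
    power p / (p - 1) gives |V|^p.\<close>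
  have Gq: "integrable lborel (\<lambda>z. norm (G z) powr (p / (p - 1)))"
  proof (rule Bochner_Integration.integrable_bound)
    show "integrable lborel (\<lambda>z. (K2 * \<mu> powr q) powr (p / (p - 1)) * norm (V z) powr p)"
      by (intro integrable_mult_right Vp)
    have "AE z in lborel. z \<in> ?Ka \<longrightarrow> norm (G z) \<le> K2 * U z powr q * norm (V z) powr (p - 1)"
      using strG unfolding AE_completion_iff by eventually_elim auto
    then show "AE z in lborel. norm (norm (G z) powr (p / (p - 1))) \<le> norm ((K2 * \<mu> powr q) powr (p / (p - 1)) * norm (V z) powr p)"
    proof eventually_elim
      case (elim z)
      show ?case
      proof (cases "z \<in> ?Ka")
        case True
        have "norm (G z) \<le> K2 * U z powr q * norm (V z) powr (p - 1)" using elim True by blast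
        also have "\<dots> \<le> K2 * \<mu> powr q * norm (V z) powr (p - 1)"
          using K U[of z] q_pos by (intro mult_right_mono mult_left_mono powr_mono2) auto
        finally have "norm (G z) powr (p / (p - 1)) \<le> (K2 * \<mu> powr q * norm (V z) powr (p - 1)) powr (p / (p - 1))"
          using p by (intro powr_mono2) auto
        also have "\<dots> = (K2 * \<mu> powr q) powr (p / (p - 1)) * norm (V z) powr p"
        proof -
          have "(p - 1) * (p / (p - 1)) = p" using p by simp
          then show ?thesis by (simp only: powr_mult powr_powr)
        qed
        finally show ?thesis by simp
      qed (use G(3) p in simp)
    qed
  qed measurable
  have z0: "U z = 0 \<and> V z = 0" if "z \<notin> ?K" for z using that by (simp add: U_def V_def)
  have "AE z in lebesgue. z \<in> ?K \<longrightarrow> u z = U z \<and> V0 z = V z"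
    using uU VV by eventually_elim simp
  then have "slab t0 t2 U V G"
    unfolding slab_def using U z0 Um Vm G(1) Vp Gq G(2) strG by (intro conjI allI impI) auto
  then show ?thesis by (intro exI)
qed

text \<open>Times at which freezing works: U and V represent u and its gradient on the slice, and
  the slice is a Sobolev function with p-integrable gradient. Almost every time of a slab
  qualifies.\<close>

definition good :: "('a \<times> real \<Rightarrow> real) \<Rightarrow> ('a \<times> real \<Rightarrow> 'a) \<Rightarrow> real \<Rightarrow> bool" where
  "good U V \<tau> \<longleftrightarrow> (AE x in lebesgue. x \<in> ball y b \<longrightarrow> u (x, \<tau>) = U (x, \<tau>) \<and> V0 (x, \<tau>) = V (x, \<tau>)) \<and>
     has_weak_gradient \<Omega> (\<lambda>x. u_pow m u (x, \<tau>)) (\<lambda>x. V0 (x, \<tau>)) \<and>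
     integrable lborel (\<lambda>x. norm (V (x, \<tau>)) powr p)"

lemma slabD:
  assumes "slab t0 t2 U V G"
  shows "U \<in> borel_measurable borel" "V \<in> borel_measurable borel" "G \<in> borel_measurable borel"
    "\<And>z. 0 \<le> U z" "\<And>z. U z \<le> \<mu>" "\<And>z. z \<notin> ball y b \<times> {t0..t2} \<Longrightarrow> U z = 0" "\<And>z. z \<notin> ball y b \<times> {t0..t2} \<Longrightarrow> V z = 0"
    "integrable lborel (\<lambda>z. norm (V z) powr p)" "integrable lborel (\<lambda>z. norm (G z) powr (p / (p - 1)))"
    "AE z in lebesgue. z \<in> ball y b \<times> {t0..t2} \<longrightarrow> u z = U z \<and> V0 z = V z"
    "AE z in lebesgue. z \<in> ball y a \<times> {t0..t2} \<longrightarrow> flux z = G z"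
    "AE z in lebesgue. z \<in> ball y a \<times> {t0..t2} \<longrightarrow>
       K1 * U z powr q * norm (V z) powr p \<le> G z \<bullet> V z \<and>
       norm (G z) \<le> K2 * U z powr q * norm (V z) powr (p - 1)"
  using assms unfolding slab_def by blast+

lemma slab_good:
  assumes sl: "slab t0 t2 U V G" and t02: "s < t0" "t0 < t2" "t2 < t"
  shows "AE \<tau> in lborel. \<tau> \<in> {t0..t2} \<longrightarrow> good U V \<tau>"
proof -
  have "AE \<tau> in lborel. 0 < \<tau> \<and> \<tau> < T \<longrightarrow> has_weak_gradient \<Omega> (\<lambda>x. u_pow m u (x, \<tau>)) (\<lambda>x. V0 (x, \<tau>))"
    using V0_gradient unfolding has_spatial_gradient_def AE_completion_iff by (elim conjE)
  with AE_time_slice[OF slabD(10)[OF sl]] integrable_slices[OF slabD(8)[OF sl]]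
  show ?thesis
  proof eventually_elim
    case (elim \<tau>)
    show ?case
    proof
      assume \<tau>: "\<tau> \<in> {t0..t2}"
      have "AE x in lborel. x \<in> ball y b \<longrightarrow> u (x, \<tau>) = U (x, \<tau>) \<and> V0 (x, \<tau>) = V (x, \<tau>)"
        using elim(1) by eventually_elim (use \<tau> in auto)
      then show "good U V \<tau>" unfolding good_def
        using elim(2,3) \<tau> t02 s0 tT by (intro conjI AE_completion) auto
    qed
  qed
qed

lemma slice_weak_gradient:
  assumes sl: "slab t0 t2 U V G" and g: "good U V \<tau>"
    and \<phi>: "\<phi> \<in> test_functions (ball y b)" and i: "i \<in> Basis"
  shows "(LINT x|lborel. U (x, \<tau>) * (grad \<phi> x \<bullet> i)) = - (LINT x|lborel. (V (x, \<tau>) \<bullet> i) * \<phi> x)"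
proof -
  note S = slabD[OF sl]
  have b2: "b < 2 * r" using r by simp
  have sub: "ball y b \<subseteq> \<Omega>" by (rule order_trans[OF ball_subset_cball cball_sub[OF b2]])
  have \<phi>\<Omega>: "\<phi> \<in> test_functions \<Omega>" by (rule test_functions_mono[OF sub \<phi>])
  note D = test_functionsD[OF \<phi>]
  have m: "\<phi> \<in> borel_measurable borel" "grad \<phi> \<in> borel_measurable borel"
    by (intro borel_measurable_continuous_onI Ck_continuous[OF D(1)] Ck_grad_continuous[OF D(1)])+
  note [measurable] = m measurable_slice[OF S(1), of \<tau>] measurable_slice[OF S(2), of \<tau>]
  have ae: "AE x in lebesgue. x \<in> ball y b \<longrightarrow> u (x, \<tau>) = U (x, \<tau>) \<and> V0 (x, \<tau>) = V (x, \<tau>)"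
    and w: "has_weak_gradient \<Omega> (\<lambda>x. u_pow m u (x, \<tau>)) (\<lambda>x. V0 (x, \<tau>))" using g unfolding good_def by blast+
  have "(LINT x:\<Omega>|lebesgue. u_pow m u (x, \<tau>) * (grad \<phi> x \<bullet> i)) = (LINT x|lborel. U (x, \<tau>) * (grad \<phi> x \<bullet> i))"
    unfolding set_lebesgue_integral_def
  proof (rule lebesgue_integral_AE(1))
    show "(\<lambda>x. U (x, \<tau>) * (grad \<phi> x \<bullet> i)) \<in> borel_measurable borel" by measurable
    show "AE x in lebesgue. indicator \<Omega> x *\<^sub>R (u_pow m u (x, \<tau>) * (grad \<phi> x \<bullet> i)) = U (x, \<tau>) * (grad \<phi> x \<bullet> i)"
      using ae
    proof eventually_elim
      case (elim x)
      show ?case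
      proof (cases "x \<in> ball y b")
        case True
        then have "x \<in> \<Omega>" "u (x, \<tau>) = U (x, \<tau>)" using sub elim by blast+
        moreover have "U (x, \<tau>) powr 1 = U (x, \<tau>)" using S(4) by (rule powr_one)
        ultimately show ?thesis by (simp add: u_pow_def mm rpow_def)
      next
        case False
        show ?thesis by (simp add: D(4)[OF False])
      qed
    qed
  qed
  moreover have "(LINT x:\<Omega>|lebesgue. (V0 (x, \<tau>) \<bullet> i) * \<phi> x) = (LINT x|lborel. (V (x, \<tau>) \<bullet> i) * \<phi> x)"
    unfolding set_lebesgue_integral_def
  proof (rule lebesgue_integral_AE(1))
    show "(\<lambda>x. (V (x, \<tau>) \<bullet> i) * \<phi> x) \<in> borel_measurable borel" by measurable
    show "AE x in lebesgue. indicator \<Omega> x *\<^sub>R ((V0 (x, \<tau>) \<bullet> i) * \<phi> x) = (V (x, \<tau>) \<bullet> i) * \<phi> x"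
      using ae
    proof eventually_elim
      case (elim x)
      show ?case
      proof (cases "x \<in> ball y b")
        case True
        then have "x \<in> \<Omega>" "V0 (x, \<tau>) = V (x, \<tau>)" using sub elim by blast+
        then show ?thesis by simp
      next
        case False
        show ?thesis by (simp add: D(2)[OF False])
      qed
    qed
  qed
  ultimately show ?thesis using has_weak_gradientD[OF w \<phi>\<Omega> i] by linarith
qed

section \<open>The discrete energy inequality\<close>

definition slice_test :: "nat \<Rightarrow> real \<Rightarrow> real \<Rightarrow> ('a \<times> real \<Rightarrow> real) \<Rightarrow> real \<Rightarrow> 'a \<Rightarrow> real" where
  "slice_test k \<nu> \<alpha> U \<tau> x = (\<mu> + \<nu> - U (x, \<tau>)) powr (- \<alpha>) * bump y a x ^ k"

definition slice_grad ::
  "nat \<Rightarrow> real \<Rightarrow> real \<Rightarrow> ('a \<times> real \<Rightarrow> real) \<Rightarrow> ('a \<times> real \<Rightarrow> 'a) \<Rightarrow> real \<Rightarrow> 'a \<Rightarrow> 'a" where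
  "slice_grad k \<nu> \<alpha> U V \<tau> x =
     (\<alpha> * (\<mu> + \<nu> - U (x, \<tau>)) powr (- \<alpha> - 1) * bump y a x ^ k) *\<^sub>R V (x, \<tau>)
     + (\<mu> + \<nu> - U (x, \<tau>)) powr (- \<alpha>) *\<^sub>R grad_bump k y a x"

text \<open>The function (\<mu> + \<nu> - s)^(-\<alpha>) of s is smooth on [0, \<mu>] because \<nu>
  > 0, so \<open>W01p_approx_comp\<close> applies to the slice of U.\<close>

lemma slice_approx:
  assumes sl: "slab t0 t2 U V G" and g: "good U V \<tau>" and k: "k \<ge> 2" and \<nu>: "\<nu> > 0"
  shows "W01p_approx p (ball y b) (slice_test k \<nu> \<alpha> U \<tau>) (slice_grad k \<nu> \<alpha> U V \<tau>)"
proof -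
  note S = slabD[OF sl]
  have a0: "a > 0" and ab: "a < b" using r by auto
  show ?thesis
    unfolding slice_test_def slice_grad_def
  proof (rule W01p_approx_comp[where f="\<lambda>x. U (x, \<tau>)" and \<mu>=\<mu> and F="\<lambda>s. (\<mu> + \<nu> - s) powr (- \<alpha>)"
        and F'="\<lambda>s. \<alpha> * (\<mu> + \<nu> - s) powr (- \<alpha> - 1)" and a=a])
    show "(\<lambda>x. U (x, \<tau>)) \<in> borel_measurable borel" "(\<lambda>x. V (x, \<tau>)) \<in> borel_measurable borel"
      by (intro measurable_slice S)+
    show "integrable lborel (\<lambda>x. norm (V (x, \<tau>)) powr p)" using g unfolding good_def by blast
    show "((\<lambda>s. (\<mu> + \<nu> - s) powr (- \<alpha>)) has_real_derivative \<alpha> * (\<mu> + \<nu> - \<sigma>) powr (- \<alpha> - 1)) (at \<sigma>)"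
      if "0 \<le> \<sigma>" "\<sigma> \<le> \<mu>" for \<sigma>
      using that \<nu> by (auto intro!: derivative_eq_intros)
    show "continuous_on {0..\<mu>} (\<lambda>s. \<alpha> * (\<mu> + \<nu> - s) powr (- \<alpha> - 1))"
      using \<nu> by (intro continuous_intros) auto
    show "bump y a x ^ k = 0" if "x \<notin> cball y a" for x using that k by (intro bump_power_zero[OF a0]) auto
    show "(LINT x|lborel. U (x, \<tau>) * (grad \<phi> x \<bullet> i)) = - (LINT x|lborel. (V (x, \<tau>) \<bullet> i) * \<phi> x)"
      if "\<phi> \<in> test_functions (ball y b)" "i \<in> Basis" for \<phi> i
      by (rule slice_weak_gradient[OF sl g that])
    show "U (x, \<tau>) = 0" "V (x, \<tau>) = 0" if "x \<notin> cball y b" for x using that S(6,7) by auto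
    show "continuous_on UNIV (grad_bump k y a)" by (rule continuous_grad_bump)
    show "((\<lambda>x. bump y a x ^ k) has_derivative (\<lambda>h. grad_bump k y a x \<bullet> h)) (at x)" for x
      by (rule bump_power_has_derivative[OF k])
  qed (use S(4,5) p ab in auto)
qed

lemma slice_integral:
  assumes sl: "slab t0 t2 U V G" and g: "good U V \<tau>"
    and [measurable]: "\<psi> \<in> borel_measurable borel" and z: "\<And>x. x \<notin> ball y a \<Longrightarrow> \<psi> x = 0"
  shows "(LINT x:cball y b|lebesgue. u (x, \<tau>) * \<psi> x) = (LINT x|lborel. U (x, \<tau>) * \<psi> x)"
  unfolding set_lebesgue_integral_def
proof (rule lebesgue_integral_AE(1))
  note S = slabD[OF sl]
  note [measurable] = measurable_slice[OF S(1), of \<tau>]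
  show "(\<lambda>x. U (x, \<tau>) * \<psi> x) \<in> borel_measurable borel" by measurable
  have ab: "a < b" using r by simp
  have "AE x in lebesgue. x \<in> ball y b \<longrightarrow> u (x, \<tau>) = U (x, \<tau>) \<and> V0 (x, \<tau>) = V (x, \<tau>)"
    using g unfolding good_def by blast
  then show "AE x in lebesgue. indicator (cball y b) x *\<^sub>R (u (x, \<tau>) * \<psi> x) = U (x, \<tau>) * \<psi> x"
  proof eventually_elim
    case (elim x)
    show ?case
    proof (cases "x \<in> ball y a")
      case True
      then have "x \<in> ball y b" "x \<in> cball y b" using ab by auto
      then show ?thesis using elim by simp
    qed (simp add: z)
  qed
qed

lemma flux_integral:
  assumes sl: "slab t0 t2 U V G" and t: "t0 \<le> t1'" "t2' \<le> t2"
    and \<Psi>: "\<Psi> \<in> borel_measurable borel" and z: "\<And>x. x \<notin> ball y a \<Longrightarrow> \<Psi> x = 0"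
  shows "(LINT z:cball y b \<times> {t1'..t2'}|lebesgue. flux z \<bullet> \<Psi> (fst z))
     = (LINT z|lborel. indicator {t1'..t2'} (snd z) * (G z \<bullet> \<Psi> (fst z)))"
  unfolding set_lebesgue_integral_def
proof (rule lebesgue_integral_AE(1))
  note S = slabD[OF sl]
  note [measurable] = S(3) \<Psi>
  show "(\<lambda>z. indicator {t1'..t2'} (snd z) * (G z \<bullet> \<Psi> (fst z))) \<in> borel_measurable borel" by measurable
  have ab: "a < b" using r by simp
  show "AE z in lebesgue. indicator (cball y b \<times> {t1'..t2'}) z *\<^sub>R (flux z \<bullet> \<Psi> (fst z)) = indicator {t1'..t2'} (snd z) * (G z \<bullet> \<Psi> (fst z))"
    using S(11)
  proof eventually_elim
    case (elim w)
    show ?case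
    proof (cases "fst w \<in> ball y a")
      case True
      show ?thesis
      proof (cases "snd w \<in> {t1'..t2'}")
        case T2: True
        have "w \<in> ball y a \<times> {t0..t2}" "w \<in> cball y b \<times> {t1'..t2'}" using True T2 t ab by (auto simp: mem_Times_iff)
        then show ?thesis using elim T2 by simp
      next
        case False
        then have "w \<notin> cball y b \<times> {t1'..t2'}" by (simp add: mem_Times_iff)
        then show ?thesis using False by (simp only: indicator_simps mult_zero_left scaleR_zero_left if_False not_False_eq_True)
      qed
    qed (simp add: z)
  qed
qed

text \<open>The primitive of the test factor x^(-\<alpha>) is integrated; formally the time
  derivative of this integral is the pairing of - u_t with the test function.\<close>

definition slice_energy :: "nat \<Rightarrow> real \<Rightarrow> real \<Rightarrow> ('a \<times> real \<Rightarrow> real) \<Rightarrow> real \<Rightarrow> real" where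
  "slice_energy k \<nu> \<alpha> U \<tau> = (LINT x|lborel. (\<mu> + \<nu> - U (x, \<tau>)) powr (1 - \<alpha>) / (1 - \<alpha>) * bump y a x ^ k)"

text \<open>The weak identity on [\<tau> - h, \<tau>], with the test function frozen at \<tau>,
  turns the left side into the increment of - u against that function, and
  \<open>powr_concave\<close> bounds it by the increment of the energy. Both ends must be good, as U
  has to represent u at each.\<close>

lemma energy_step:
  assumes sl: "slab t0 t2 U V G" and g: "good U V \<tau>" "good U V (\<tau> - h)" and k: "k \<ge> 2" and \<nu>: "\<nu> > 0"
    and \<alpha>: "0 < \<alpha>" "\<alpha> < 1" and t: "s < t0" "t2 < t" "t0 \<le> \<tau> - h" "h > 0" "\<tau> \<le> t2"
  shows "(LINT z|lborel. indicator {\<tau> - h..\<tau>} (snd z) * (G z \<bullet> slice_grad k \<nu> \<alpha> U V \<tau> (fst z)))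
     \<le> slice_energy k \<nu> \<alpha> U \<tau> - slice_energy k \<nu> \<alpha> U (\<tau> - h)"
proof -
  note S = slabD[OF sl]
  have a0: "a > 0" and ab: "a < b" and b2: "b < 2 * r" using r by auto
  note [measurable] = measurable_slice[OF S(1), of \<tau>] measurable_slice[OF S(1), of "\<tau> - h"] measurable_slice[OF S(2), of \<tau>]
  let ?\<psi> = "slice_test k \<nu> \<alpha> U \<tau>" and ?\<Psi> = "slice_grad k \<nu> \<alpha> U V \<tau>"
  have \<psi>m: "?\<psi> \<in> borel_measurable borel" and \<Psi>m: "?\<Psi> \<in> borel_measurable borel"
    unfolding slice_test_def slice_grad_def by measurable
  have k0: "k > 0" using k by simp
  have za: "?\<psi> x = 0" "?\<Psi> x = 0" if "x \<notin> ball y a" for x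
    using bump_power_zero[OF a0 k0 that] grad_bump_zero[OF a0 k that]
    by (simp_all only: slice_test_def slice_grad_def) simp_all
  have zb: "?\<psi> x = 0" "?\<Psi> x = 0" if "x \<notin> cball y b" for x
    using that ab za by auto
  define c where "c = \<nu> powr (- \<alpha>)"
  have Pc: "0 \<le> (\<mu> + \<nu> - U z) powr (- \<alpha>)" "(\<mu> + \<nu> - U z) powr (- \<alpha>) \<le> c" for z
    using S(5)[of z] \<nu> \<alpha> by (auto simp: c_def intro!: powr_mono2')
  have \<psi>b: "0 \<le> ?\<psi> x" "?\<psi> x \<le> c" for x
  proof -
    show "0 \<le> ?\<psi> x" unfolding slice_test_def by (intro mult_nonneg_nonneg Pc zero_le_power bump_bounds)
    have "?\<psi> x \<le> c * 1" unfolding slice_test_def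
      using c_def by (intro mult_mono Pc power_le_one bump_bounds zero_le_power) auto
    then show "?\<psi> x \<le> c" by simp
  qed
  have pp: "p > 1" using p by simp
  have tt: "0 < \<tau> - h" "\<tau> - h < \<tau>" "\<tau> \<le> T" using t s0 tT by auto
  have sub: "cball y b \<subseteq> \<Omega>" by (rule cball_sub[OF b2])
  have WI: "(LINT x:cball y b|lebesgue. u (x, \<tau>) * ?\<psi> x) - (LINT x:cball y b|lebesgue. u (x, \<tau> - h) * ?\<psi> x)
      = - (LINT z:cball y b \<times> {\<tau> - h..\<tau>}|lebesgue. flux z \<bullet> ?\<Psi> (fst z))"
    by (rule weak_identity(4)[OF sol sub slice_approx[OF sl g(1) k \<nu>] mm pp _ _ _ _ tt]; (rule zb \<psi>b)?; assumption?)
  have tb: "t0 \<le> \<tau> - h" "\<tau> \<le> t2" using t by auto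
  have eq: "(LINT z|lborel. indicator {\<tau> - h..\<tau>} (snd z) * (G z \<bullet> ?\<Psi> (fst z)))
     = (LINT x|lborel. U (x, \<tau> - h) * ?\<psi> x) - (LINT x|lborel. U (x, \<tau>) * ?\<psi> x)"
  proof -
    have 1: "(LINT x:cball y b|lebesgue. u (x, \<tau>) * ?\<psi> x) = (LINT x|lborel. U (x, \<tau>) * ?\<psi> x)"
      by (rule slice_integral[OF sl g(1) \<psi>m]) (rule za)
    have 2: "(LINT x:cball y b|lebesgue. u (x, \<tau> - h) * ?\<psi> x) = (LINT x|lborel. U (x, \<tau> - h) * ?\<psi> x)"
      by (rule slice_integral[OF sl g(2) \<psi>m]) (rule za)
    have 3: "(LINT z:cball y b \<times> {\<tau> - h..\<tau>}|lebesgue. flux z \<bullet> ?\<Psi> (fst z))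
        = (LINT z|lborel. indicator {\<tau> - h..\<tau>} (snd z) * (G z \<bullet> ?\<Psi> (fst z)))"
      by (rule flux_integral[OF sl tb \<Psi>m]) (rule za)
    show ?thesis using WI unfolding 1 2 3 by linarith
  qed
  have iU: "integrable lborel (\<lambda>x. U (x, \<sigma>) * ?\<psi> x)" for \<sigma>
  proof -
    note [measurable] = measurable_slice[OF S(1), of \<sigma>]
    have "integrable lborel (\<lambda>x. (U (x, \<sigma>) * (\<mu> + \<nu> - U (x, \<tau>)) powr (- \<alpha>)) * bump y a x ^ k)"
    proof (rule bounded_bump_integrable[OF _ _ a0 k0])
      show "\<bar>U (x, \<sigma>) * (\<mu> + \<nu> - U (x, \<tau>)) powr (- \<alpha>)\<bar> \<le> \<mu> * c" for x
        using S(4,5)[of "(x, \<sigma>)"] Pc[of "(x, \<tau>)"] mu0 by (auto simp: abs_mult intro!: mult_mono)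
    qed measurable
    then show ?thesis by (simp add: slice_test_def mult.assoc)
  qed
  have iH: "integrable lborel (\<lambda>x. (\<mu> + \<nu> - U (x, \<sigma>)) powr (1 - \<alpha>) / (1 - \<alpha>) * bump y a x ^ k)" for \<sigma>
  proof (rule bounded_bump_integrable[OF _ _ a0 k0])
    note [measurable] = measurable_slice[OF S(1), of \<sigma>]
    show "(\<lambda>x. (\<mu> + \<nu> - U (x, \<sigma>)) powr (1 - \<alpha>) / (1 - \<alpha>)) \<in> borel_measurable borel" by measurable
    show "\<bar>(\<mu> + \<nu> - U (x, \<sigma>)) powr (1 - \<alpha>) / (1 - \<alpha>)\<bar> \<le> (\<mu> + \<nu>) powr (1 - \<alpha>) / (1 - \<alpha>)" for x
      using S(4,5)[of "(x, \<sigma>)"] \<nu> \<alpha> by (auto intro!: divide_right_mono powr_mono2)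
  qed
  have "(LINT x|lborel. U (x, \<tau> - h) * ?\<psi> x) - (LINT x|lborel. U (x, \<tau>) * ?\<psi> x)
    = (LINT x|lborel. U (x, \<tau> - h) * ?\<psi> x - U (x, \<tau>) * ?\<psi> x)"
    by (rule Bochner_Integration.integral_diff[symmetric, OF iU iU])
  also have "\<dots> \<le> (LINT x|lborel. (\<mu> + \<nu> - U (x, \<tau>)) powr (1 - \<alpha>) / (1 - \<alpha>) * bump y a x ^ k
      - (\<mu> + \<nu> - U (x, \<tau> - h)) powr (1 - \<alpha>) / (1 - \<alpha>) * bump y a x ^ k)"
  proof (rule integral_mono[OF Bochner_Integration.integrable_diff[OF iU iU] Bochner_Integration.integrable_diff[OF iH iH]])
    fix x
    let ?P = "\<mu> + \<nu> - U (x, \<tau>)" and ?R = "\<mu> + \<nu> - U (x, \<tau> - h)"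
    have P: "?R > 0" "?P > 0" using S(5)[of "(x, \<tau>)"] S(5)[of "(x, \<tau> - h)"] \<nu> by linarith+
    have "U (x, \<tau> - h) * ?\<psi> x - U (x, \<tau>) * ?\<psi> x = ?P powr (- \<alpha>) * (?P - ?R) * bump y a x ^ k"
      by (simp add: slice_test_def algebra_simps)
    also have "\<dots> \<le> (?P powr (1 - \<alpha>) / (1 - \<alpha>) - ?R powr (1 - \<alpha>) / (1 - \<alpha>)) * bump y a x ^ k"
      by (intro mult_right_mono powr_concave[OF \<alpha> P] zero_le_power bump_bounds)
    finally show "U (x, \<tau> - h) * ?\<psi> x - U (x, \<tau>) * ?\<psi> x \<le> ?P powr (1 - \<alpha>) / (1 - \<alpha>) * bump y a x ^ k - ?R powr (1 - \<alpha>) / (1 - \<alpha>) * bump y a x ^ k"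
      by (simp only: left_diff_distrib)
  qed
  also have "\<dots> = slice_energy k \<nu> \<alpha> U \<tau> - slice_energy k \<nu> \<alpha> U (\<tau> - h)"
    unfolding slice_energy_def by (rule Bochner_Integration.integral_diff[OF iH iH])
  finally show ?thesis unfolding eq .
qed

section \<open>Bounds for u at every time\<close>

abbreviation "I \<equiv> solution_times T s t"

lemma times_iff: "\<tau> \<in> I \<longleftrightarrow> s \<le> \<tau> \<and> \<tau> \<le> t \<and> 0 < \<tau>"
  using tT by (auto simp: solution_times_def)

text \<open>A set of full measure meets every interval; in this way facts that hold at almost every
  time reach every time of I, endpoints included.\<close>

lemma times_approx:
  assumes \<tau>: "\<tau> \<in> I" and ae: "AE \<sigma> in lborel. P \<sigma>"
  shows "\<exists>\<sigma>. (\<forall>n. \<sigma> n \<in> {s<..<t} \<and> P (\<sigma> n)) \<and> \<sigma> \<longlonglongrightarrow> \<tau>"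
proof -
  have "\<forall>n. \<exists>x. x \<in> {s<..<t} \<and> P x \<and> \<bar>x - \<tau>\<bar> \<le> inverse (real (Suc n))"
  proof
    fix n
    let ?d = "inverse (real (Suc n))"
    have d: "?d > 0" by simp
    have "max s (\<tau> - ?d) < min t (\<tau> + ?d)" using \<tau> st d unfolding times_iff by linarith
    from AE_ex_in_interval[OF ae this] obtain x where "x \<in> {max s (\<tau> - ?d)<..<min t (\<tau> + ?d)}" "P x" by blast
    then show "\<exists>x. x \<in> {s<..<t} \<and> P x \<and> \<bar>x - \<tau>\<bar> \<le> ?d" by (intro exI[of _ x]) auto
  qed
  from choice[OF this] obtain \<sigma> where \<sigma>: "\<And>n. \<sigma> n \<in> {s<..<t}" "\<And>n. P (\<sigma> n)"
    "\<And>n. \<bar>\<sigma> n - \<tau>\<bar> \<le> inverse (real (Suc n))" by blast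
  have "(\<lambda>n. \<bar>\<sigma> n - \<tau>\<bar>) \<longlonglongrightarrow> 0"
    by (rule nonneg_squeeze[OF _ \<sigma>(3) LIMSEQ_inverse_real_of_nat]) simp
  then have "\<sigma> \<longlonglongrightarrow> \<tau>" by (intro LIM_zero_cancel[of \<sigma>]) (rule tendsto_rabs_zero_cancel)
  then show ?thesis using \<sigma> by blast
qed

text \<open>At almost every time the bounds on u hold in the slice and integrate against \<psi>;
  continuity of the pairing in time carries the two inequalities to every \<tau>.\<close>

lemma pairing_bounds:
  assumes \<tau>: "\<tau> \<in> I" and c: "c < c'" "c' < 2 * r"
    and d: "\<And>x. (\<psi> has_derivative (\<lambda>h. G x \<bullet> h)) (at x)" and cG: "continuous_on UNIV G"
    and z: "\<And>x. x \<notin> cball y c \<Longrightarrow> \<psi> x = 0" and B: "\<And>x. 0 \<le> \<psi> x" "\<And>x. \<psi> x \<le> B"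
  shows "0 \<le> (LINT x:cball y c'|lebesgue. u (x, \<tau>) * \<psi> x)"
    and "(LINT x:cball y c'|lebesgue. u (x, \<tau>) * \<psi> x) \<le> \<mu> * (LINT x|lborel. \<psi> x)"
proof -
  let ?g = "\<lambda>\<tau>. LINT x:cball y c'|lebesgue. u (x, \<tau>) * \<psi> x"
  have pp: "p > 1" "p \<ge> 1" using p by auto
  have W: "W01p_approx p (ball y c') \<psi> G" by (rule W01p_approx_C1[OF d cG z c(1) pp(2)])
  have z': "\<psi> x = 0" "G x = 0" if "x \<notin> cball y c'" for x
  proof -
    have x: "x \<notin> cball y c" using that c by auto
    show "\<psi> x = 0" by (rule z[OF x])
    show "G x = 0" by (rule derivative_zero_off_closed[OF d closed_cball z x])
  qed
  have sub: "cball y c' \<subseteq> \<Omega>" by (rule cball_sub[OF c(2)])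
  have c\<psi>: "continuous_on UNIV \<psi>" by (rule has_derivative_continuous_on[OF has_derivative_at_withinI[OF d]])
  have \<psi>m[measurable]: "\<psi> \<in> borel_measurable borel" by (rule borel_measurable_continuous_onI[OF c\<psi>])
  have i\<psi>: "integrable lborel \<psi>"
  proof (rule Bochner_Integration.integrable_bound[OF integrable_cball_const[of y c' B]])
    have "norm (\<psi> x) \<le> norm (indicator (cball y c') x * B)" for x
      using B[of x] z'(1)[of x] by (cases "x \<in> cball y c'") auto
    then show "AE x in lborel. norm (\<psi> x) \<le> norm (indicator (cball y c') x * B)" by (intro AE_I2)
  qed measurable
  have i\<psi>l: "integrable lebesgue \<psi>" and eq\<psi>: "(LINT x|lebesgue. \<psi> x) = (LINT x|lborel. \<psi> x)"
    using lebesgue_integral_AE[of \<psi> \<psi>] i\<psi> by auto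
  have "AE \<sigma> in lborel. AE x in lborel. (x, \<sigma>) \<in> ball y (2 * r) \<times> {s<..<t} \<longrightarrow> 0 \<le> u (x, \<sigma>) \<and> u (x, \<sigma>) \<le> \<mu>"
    by (rule AE_time_slice[OF u_bounds])
  from times_approx[OF \<tau> this] obtain \<sigma> where \<sigma>: "\<And>n. \<sigma> n \<in> {s<..<t}"
    "\<And>n. AE x in lborel. (x, \<sigma> n) \<in> ball y (2 * r) \<times> {s<..<t} \<longrightarrow> 0 \<le> u (x, \<sigma> n) \<and> u (x, \<sigma> n) \<le> \<mu>"
    and lim: "\<sigma> \<longlonglongrightarrow> \<tau>" by blast
  have \<sigma>T: "\<sigma> n \<in> {0<..T}" for n using \<sigma>(1)[of n] s0 tT by auto
  have \<tau>T: "\<tau> \<in> {0<..T}" using \<tau> by (simp add: solution_times_def)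
  have lim': "(\<lambda>n. ?g (\<sigma> n)) \<longlonglongrightarrow> ?g \<tau>"
    by (rule weak_identity_continuous[OF sol sub W mm pp(1) _ _ _ _ \<sigma>T \<tau>T lim]) (use z' B in auto)
  have b: "0 \<le> ?g (\<sigma> n) \<and> ?g (\<sigma> n) \<le> \<mu> * (LINT x|lborel. \<psi> x)" for n
  proof -
    have tt: "0 < \<sigma> n / 2" "\<sigma> n / 2 < \<sigma> n" "\<sigma> n \<le> T" using \<sigma>T[of n] by auto
    have int: "set_integrable lebesgue (cball y c') (\<lambda>x. u (x, \<sigma> n) * \<psi> x)"
      by (rule weak_identity(2)[OF sol sub W mm pp(1) _ _ _ _ tt]) (use z' B in auto)
    have ae: "AE x in lebesgue. x \<in> cball y c' \<longrightarrow> 0 \<le> u (x, \<sigma> n) \<and> u (x, \<sigma> n) \<le> \<mu>"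
      using AE_completion[OF \<sigma>(2)[of n]]
    proof eventually_elim
      case (elim x)
      show ?case
      proof
        assume "x \<in> cball y c'"
        then have "(x, \<sigma> n) \<in> ball y (2 * r) \<times> {s<..<t}" using c \<sigma>(1)[of n] by simp
        then show "0 \<le> u (x, \<sigma> n) \<and> u (x, \<sigma> n) \<le> \<mu>" by (rule mp[OF elim])
      qed
    qed
    have "0 \<le> ?g (\<sigma> n)"
      unfolding set_lebesgue_integral_def
    proof (rule integral_nonneg_AE)
      show "AE x in lebesgue. 0 \<le> indicator (cball y c') x *\<^sub>R (u (x, \<sigma> n) * \<psi> x)"
        using ae by eventually_elim (use B in \<open>simp add: indicator_def\<close>)
    qed
    moreover have "?g (\<sigma> n) \<le> (LINT x|lebesgue. \<mu> * \<psi> x)"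
      unfolding set_lebesgue_integral_def
    proof (rule integral_mono_AE)
      show "AE x in lebesgue. indicator (cball y c') x *\<^sub>R (u (x, \<sigma> n) * \<psi> x) \<le> \<mu> * \<psi> x"
        using ae
      proof eventually_elim
        case (elim x)
        then show ?case using B(1)[of x] z'(1)[of x] by (cases "x \<in> cball y c'") (auto intro: mult_right_mono)
      qed
    qed (use int i\<psi>l in \<open>simp_all add: set_integrable_def\<close>)
    ultimately show ?thesis using eq\<psi> by simp
  qed
  show "0 \<le> ?g \<tau>" by (rule LIMSEQ_le_const[OF lim']) (use b in blast)
  show "?g \<tau> \<le> \<mu> * (LINT x|lborel. \<psi> x)" by (rule LIMSEQ_le_const2[OF lim']) (use b in blast)
qed

text \<open>
  At the endpoints of the time interval (in particular at \<open>\<tau> = T\<close>) the bounds \<open>0 \<le> u \<le> \<mu>\<close> are not given;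
  they pass to the limit because \<open>u(\<cdot>, \<tau>)\<close> tested with a fixed function is continuous in \<open>\<tau>\<close>.
\<close>

lemma slice_bounds_ball:
  assumes \<tau>: "\<tau> \<in> I" and c: "0 < c" "c < 2 * r"
  shows "\<exists>f\<in>borel_measurable borel. (\<forall>x. 0 \<le> f x \<and> f x \<le> \<mu>) \<and> (AE x in lebesgue. x \<in> ball y c \<longrightarrow> u (x, \<tau>) = f x)"
proof -
  define c' where "c' = (c + 2 * r) / 2"
  have cc: "c < c'" "c' < 2 * r" using c by (auto simp: c'_def)
  have pp: "p > 1" "p \<ge> 1" using p by auto
  have two: "(2::nat) \<ge> 2" "(2::nat) > 0" by auto
  let ?w = "\<lambda>x. bump y c x ^ 2"
  have W: "W01p_approx p (ball y c') ?w (grad_bump 2 y c)" by (rule bump_power_approx[OF c(1) two(1) cc(1) pp(2)])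
  have wz: "?w x = 0" "grad_bump 2 y c x = 0" if "x \<notin> cball y c'" for x
  proof -
    have x: "x \<notin> ball y c" using that cc by auto
    show "?w x = 0" by (rule bump_power_zero[OF c(1) two(2) x])
    show "grad_bump 2 y c x = 0" by (rule grad_bump_zero[OF c(1) two(1) x])
  qed
  have w01: "0 \<le> ?w x" "?w x \<le> 1" for x by (intro zero_le_power power_le_one bump_bounds)+
  have tt: "0 < \<tau> / 2" "\<tau> / 2 < \<tau>" "\<tau> \<le> T" using \<tau> by (auto simp: solution_times_def)
  \<comment> \<open>At \<tau> = T the weak formulation gives integrability only of u times a test
    function, so a version of u is recovered at the end by dividing by \<open>?w\<close>, which is
    positive on the ball.\<close>
  have int: "set_integrable lebesgue (cball y c') (\<lambda>x. u (x, \<tau>) * ?w x)"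
    by (rule weak_identity(2)[OF sol cball_sub[OF cc(2)] W mm pp(1) _ _ _ _ tt]) (use wz w01 in auto)
  then have m: "set_borel_measurable lebesgue (cball y c') (\<lambda>x. u (x, \<tau>) * ?w x)"
    unfolding set_integrable_def set_borel_measurable_def by (rule borel_measurable_integrable)
  have "cball y c' \<in> sets borel" by simp
  from borel_version_on[OF m this] obtain f1 where f1: "f1 \<in> borel_measurable borel"
    "AE x in lebesgue. x \<in> cball y c' \<longrightarrow> u (x, \<tau>) * ?w x = f1 x" "\<And>x. x \<notin> cball y c' \<Longrightarrow> f1 x = 0" by blast
  note [measurable] = f1(1)
  have ae1: "AE x in lebesgue. indicator (cball y c') x *\<^sub>R (u (x, \<tau>) * ?w x) = f1 x"
    using f1(2)
  proof eventually_elim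
    case (elim x)
    then show ?case using f1(3)[of x] by (cases "x \<in> cball y c'") auto
  qed
  have if1: "integrable lborel f1"
    using int unfolding set_integrable_def lebesgue_integral_AE(2)[OF f1(1) ae1] .
  have iw: "integrable lborel ?w"
    using bounded_bump_integrable[of "\<lambda>x. 1" 1 c 2 y] c by simp
  \<comment> \<open>Testing with \<open>?w\<close> times an arbitrary nonnegative \<phi> gives 0
    \<le> f1 \<le> \<mu> w in weak form, which \<open>AE_nonneg_if_test_nonneg\<close> then makes
    pointwise.\<close>
  have test: "0 \<le> (LINT x|lborel. f1 x * \<phi> x) \<and> (LINT x|lborel. f1 x * \<phi> x) \<le> \<mu> * (LINT x|lborel. ?w x * \<phi> x)"
    if \<phi>: "\<phi> \<in> test_functions (ball y c)" and \<phi>0: "\<And>x. 0 \<le> \<phi> x" for \<phi>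
  proof -
    note D = test_functionsD[OF \<phi>]
    have cont: "continuous_on UNIV \<phi>" "continuous_on UNIV (grad \<phi>)"
      by (rule Ck_continuous[OF D(1)], rule Ck_grad_continuous[OF D(1)])
    have [measurable]: "\<phi> \<in> borel_measurable borel" by (rule borel_measurable_continuous_onI[OF cont(1)])
    obtain R where "\<And>x. norm x > R \<Longrightarrow> \<phi> x = 0" using D(3) by blast
    then obtain B where B: "B \<ge> 0" "\<And>x. norm (\<phi> x) \<le> B" using continuous_bounded_support[OF cont(1)] by blast
    let ?\<psi> = "\<lambda>x. ?w x * \<phi> x" and ?G = "\<lambda>x. ?w x *\<^sub>R grad \<phi> x + \<phi> x *\<^sub>R grad_bump 2 y c x"
    have d: "(?\<psi> has_derivative (\<lambda>h. ?G x \<bullet> h)) (at x)" for x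
    proof -
      from has_derivative_mult[OF bump_power_has_derivative[of 2 y c x, OF two(1)] Ck_has_derivative[OF D(1)]]
      show ?thesis by (rule has_derivative_eq_rhs) (auto simp: fun_eq_iff inner_add_left)
    qed
    have cG: "continuous_on UNIV ?G"
      by (intro continuous_intros continuous_bump continuous_grad_bump cont)
    have z: "?\<psi> x = 0" if "x \<notin> cball y c" for x
      using D(2)[of x] that by auto
    have \<psi>b: "0 \<le> ?\<psi> x" "?\<psi> x \<le> 1 * B" for x
    proof -
      show "0 \<le> ?\<psi> x" by (intro mult_nonneg_nonneg w01 \<phi>0)
      show "?\<psi> x \<le> 1 * B" using B(2)[of x] \<phi>0[of x] by (intro mult_mono w01) auto
    qed
    have eq: "(LINT x:cball y c'|lebesgue. u (x, \<tau>) * ?\<psi> x) = (LINT x|lborel. f1 x * \<phi> x)"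
      unfolding set_lebesgue_integral_def
    proof (rule lebesgue_integral_AE(1))
      show "(\<lambda>x. f1 x * \<phi> x) \<in> borel_measurable borel" by measurable
      show "AE x in lebesgue. indicator (cball y c') x *\<^sub>R (u (x, \<tau>) * ?\<psi> x) = f1 x * \<phi> x"
        using ae1 by eventually_elim (simp add: mult.assoc[symmetric])
    qed
    show ?thesis using pairing_bounds[OF \<tau> cc d cG z \<psi>b] unfolding eq by blast
  qed
  have iwd: "integrable lborel (\<lambda>x. \<mu> * ?w x - f1 x)" using iw if1 by simp
  have pos1: "AE x in lborel. x \<in> ball y c \<longrightarrow> 0 \<le> f1 x"
    using test by (intro AE_nonneg_if_test_nonneg if1) auto
  have pos2: "AE x in lborel. x \<in> ball y c \<longrightarrow> 0 \<le> \<mu> * ?w x - f1 x"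
  proof (rule AE_nonneg_if_test_nonneg[OF iwd open_ball])
    fix \<phi> :: "'a \<Rightarrow> real" assume \<phi>: "\<phi> \<in> test_functions (ball y c)" "\<And>x. 0 \<le> \<phi> x"
    note D = test_functionsD[OF \<phi>(1)]
    have cont: "continuous_on UNIV \<phi>" by (rule Ck_continuous[OF D(1)])
    have [measurable]: "\<phi> \<in> borel_measurable borel" by (rule borel_measurable_continuous_onI[OF cont])
    obtain R where "\<And>x. norm x > R \<Longrightarrow> \<phi> x = 0" using D(3) by blast
    then obtain B where B: "B \<ge> 0" "\<And>x. norm (\<phi> x) \<le> B" using continuous_bounded_support[OF cont] by blast
    have bi: "integrable lborel (\<lambda>x. g x * \<phi> x)" if g: "integrable lborel g" for g :: "'a \<Rightarrow> real"
    proof (rule Bochner_Integration.integrable_bound[OF integrable_mult_right[OF g, of B]])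
      have "norm (g x * \<phi> x) \<le> norm (B * g x)" for x
        using B(1) mult_left_mono[OF B(2)[of x], of "\<bar>g x\<bar>"] by (simp add: abs_mult mult.commute)
      then show "AE x in lborel. norm (g x * \<phi> x) \<le> norm (B * g x)" by (intro AE_I2)
      show "(\<lambda>x. g x * \<phi> x) \<in> borel_measurable lborel"
        by (intro borel_measurable_times borel_measurable_integrable[OF g]) simp
    qed
    have "(LINT x|lborel. (\<mu> * ?w x - f1 x) * \<phi> x) = (LINT x|lborel. \<mu> * (?w x * \<phi> x) - f1 x * \<phi> x)"
      by (simp add: left_diff_distrib mult.assoc)
    also have "\<dots> = \<mu> * (LINT x|lborel. ?w x * \<phi> x) - (LINT x|lborel. f1 x * \<phi> x)"
      using bi[OF iw] bi[OF if1] by simp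
    finally show "0 \<le> (LINT x|lborel. (\<mu> * ?w x - f1 x) * \<phi> x)" using test[OF \<phi>] by simp
  qed
  define f where "f x = max 0 (min \<mu> (f1 x / ?w x))" for x
  have fm: "f \<in> borel_measurable borel" unfolding f_def by measurable
  have fb: "\<forall>x. 0 \<le> f x \<and> f x \<le> \<mu>" using mu0 by (auto simp: f_def)
  have "AE x in lebesgue. x \<in> ball y c \<longrightarrow> u (x, \<tau>) = f x"
    using ae1 AE_completion[OF pos1] AE_completion[OF pos2]
  proof eventually_elim
    case (elim x)
    show ?case
    proof
      assume x: "x \<in> ball y c"
      have wp: "?w x > 0" using x bump_pos[OF c(1), of y x] by (intro zero_less_power) simp
      have "x \<in> cball y c'" using x cc by simp
      then have "u (x, \<tau>) = f1 x / ?w x" using elim(1) wp by (simp add: field_simps)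
      moreover have "0 \<le> f1 x / ?w x" using elim(2) x wp by (intro divide_nonneg_pos) auto
      moreover have "f1 x / ?w x \<le> \<mu>" using elim(3) x wp by (simp add: pos_divide_le_eq)
      ultimately show "u (x, \<tau>) = f x" by (simp add: f_def)
    qed
  qed
  then show ?thesis using fm fb by blast
qed

text \<open>The average over \<open>ball y (2 * r)\<close> needs the whole ball, whose closure may
  leave \<Omega>. Exhausting it by balls of radius c n gives measurability as a pointwise limit, and
  each point lies in one of these balls, where the bounds are known.\<close>

lemma slice_bounds:
  assumes \<tau>: "\<tau> \<in> I"
  shows "\<exists>f\<in>borel_measurable borel. (\<forall>x. 0 \<le> f x \<and> f x \<le> \<mu>) \<and> (AE x in lebesgue. x \<in> ball y (2 * r) \<longrightarrow> u (x, \<tau>) = f x)"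
proof -
  define c where "c n = 2 * r - r * inverse (real (Suc n))" for n
  have ib: "0 < inverse (real (Suc n))" "inverse (real (Suc n)) \<le> 1" for n by (auto simp: divide_simps)
  have c: "0 < c n" "c n < 2 * r" for n
    using r ib[of n] mult_left_mono[OF ib(2)[of n], of r] by (auto simp: c_def)
  have "\<forall>n. \<exists>f. f \<in> borel_measurable borel \<and> (\<forall>x. 0 \<le> f x \<and> f x \<le> \<mu>) \<and> (AE x in lebesgue. x \<in> ball y (c n) \<longrightarrow> u (x, \<tau>) = f x)"
    using slice_bounds_ball[OF \<tau> c] by (simp add: Bex_def)
  from choice[OF this] obtain f where f: "\<And>n. f n \<in> borel_measurable borel" "\<And>n x. 0 \<le> f n x" "\<And>n x. f n x \<le> \<mu>"
    "\<And>n. AE x in lebesgue. x \<in> ball y (c n) \<longrightarrow> u (x, \<tau>) = f n x" by blast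
  have all: "AE x in lebesgue. \<forall>n. x \<in> ball y (c n) \<longrightarrow> u (x, \<tau>) = f n x"
    unfolding AE_all_countable by (intro allI f(4))
  have "c \<longlonglongrightarrow> 2 * r - r * 0"
    unfolding c_def by (intro tendsto_intros LIMSEQ_inverse_real_of_nat)
  then have clim: "c \<longlonglongrightarrow> 2 * r" by simp
  have ev: "\<forall>\<^sub>F n in sequentially. x \<in> ball y (c n)" if "x \<in> ball y (2 * r)" for x
    using order_tendstoD(1)[OF clim, of "dist y x"] that by simp
  define h where "h n x = indicator (ball y (c n)) x * u (x, \<tau>)" for n x
  have hm: "h n \<in> borel_measurable lebesgue" for n
  proof (rule measurable_lebesgue_AE)
    show "(\<lambda>x. indicator (ball y (c n)) x * f n x) \<in> borel_measurable borel"
      by (intro borel_measurable_times borel_measurable_indicator f) simp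
    show "AE x in lebesgue. h n x = indicator (ball y (c n)) x * f n x"
      using f(4)[of n]
    proof eventually_elim
      case (elim x)
      then show ?case by (cases "x \<in> ball y (c n)") (auto simp: h_def)
    qed
  qed
  have hl: "(\<lambda>n. h n x) \<longlonglongrightarrow> indicator (ball y (2 * r)) x *\<^sub>R u (x, \<tau>)" for x
  proof (cases "x \<in> ball y (2 * r)")
    case True
    have "\<forall>\<^sub>F n in sequentially. h n x = indicator (ball y (2 * r)) x *\<^sub>R u (x, \<tau>)"
      using ev[OF True] by eventually_elim (use True in \<open>simp add: h_def\<close>)
    then show ?thesis by (rule tendsto_eventually)
  next
    case False
    have "x \<notin> ball y (c n)" for n using False c(2)[of n] by simp
    then have "h n x = 0" for n by (simp add: h_def)
    then show ?thesis using False by simp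
  qed
  have "set_borel_measurable lebesgue (ball y (2 * r)) (\<lambda>x. u (x, \<tau>))"
    unfolding set_borel_measurable_def by (rule borel_measurable_LIMSEQ_real[OF hl hm])
  moreover have "ball y (2 * r) \<in> sets borel" by simp
  ultimately obtain g1 where g1: "g1 \<in> borel_measurable borel"
    "AE x in lebesgue. x \<in> ball y (2 * r) \<longrightarrow> u (x, \<tau>) = g1 x"
    using borel_version_on[of "ball y (2 * r)" "\<lambda>x. u (x, \<tau>)"] by blast
  define g where "g x = max 0 (min \<mu> (g1 x))" for x
  have gm: "g \<in> borel_measurable borel" unfolding g_def
    by (intro borel_measurable_max borel_measurable_min borel_measurable_const g1)
  have gb: "\<forall>x. 0 \<le> g x \<and> g x \<le> \<mu>" using mu0 by (simp add: g_def)
  have "AE x in lebesgue. x \<in> ball y (2 * r) \<longrightarrow> u (x, \<tau>) = g x"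
    using all g1(2)
  proof eventually_elim
    case (elim x)
    show ?case
    proof
      assume x: "x \<in> ball y (2 * r)"
      obtain n where n: "x \<in> ball y (c n)" using eventually_happens[OF ev[OF x]] by auto
      then have "u (x, \<tau>) = f n x" using elim(1) by blast
      moreover have "u (x, \<tau>) = g1 x" using elim(2) x by blast
      ultimately show "u (x, \<tau>) = g x" using f(2,3)[of n x] by (simp add: g_def)
    qed
  qed
  then show ?thesis using gm gb by blast
qed

section \<open>The deficit and its oscillation in time\<close>

definition pairing :: "nat \<Rightarrow> real \<Rightarrow> real" where
  "pairing k \<tau> = (LINT x:cball y b|lebesgue. u (x, \<tau>) * bump y a x ^ k)"

text \<open>This is the integral of \<mu> - u against the k-th power of the cutoff (see
  \<open>deficit_eq\<close>), written through \<open>pairing\<close> so that its continuity and its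
  increments in time come directly from the weak identity.\<close>

definition deficit :: "nat \<Rightarrow> real \<Rightarrow> real" where
  "deficit k \<tau> = \<mu> * (LINT x|lborel. bump y a x ^ k) - pairing k \<tau>"

lemma bump_power_integrable: "k > 0 \<Longrightarrow> integrable lborel (\<lambda>x. bump y a x ^ k)"
  using bounded_bump_integrable[of "\<lambda>x. 1" 1 a k y] r by simp

lemma deficit_eq:
  assumes k: "k > 0" and f: "f \<in> borel_measurable borel" "\<And>x. 0 \<le> f x" "\<And>x. f x \<le> \<mu>"
    and p: "(LINT x|lborel. f x * bump y a x ^ k) = pairing k \<tau>"
  shows "deficit k \<tau> = (LINT x|lborel. (\<mu> - f x) * bump y a x ^ k)"
proof -
  have a0: "a > 0" using r by simp
  have "\<bar>f x\<bar> \<le> \<mu>" for x using f(2,3)[of x] by simp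
  then have i: "integrable lborel (\<lambda>x. f x * bump y a x ^ k)"
    by (intro bounded_bump_integrable[OF f(1) _ a0 k])
  have "(LINT x|lborel. (\<mu> - f x) * bump y a x ^ k) = (LINT x|lborel. \<mu> * bump y a x ^ k - f x * bump y a x ^ k)"
    by (simp add: left_diff_distrib)
  also have "\<dots> = \<mu> * (LINT x|lborel. bump y a x ^ k) - (LINT x|lborel. f x * bump y a x ^ k)"
    using i bump_power_integrable[OF k] by simp
  finally show ?thesis unfolding deficit_def p ..
qed

lemma pairing_slice:
  assumes k: "k > 0" and f: "f \<in> borel_measurable borel"
    and ae: "AE x in lebesgue. x \<in> ball y (2 * r) \<longrightarrow> u (x, \<tau>) = f x"
  shows "(LINT x|lborel. f x * bump y a x ^ k) = pairing k \<tau>"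
  unfolding pairing_def set_lebesgue_integral_def
proof (rule lebesgue_integral_AE(1)[symmetric])
  have a0: "a > 0" and ab: "a < b" "a < 2 * r" using r by auto
  show "(\<lambda>x. f x * bump y a x ^ k) \<in> borel_measurable borel" using f by measurable
  show "AE x in lebesgue. indicator (cball y b) x *\<^sub>R (u (x, \<tau>) * bump y a x ^ k) = f x * bump y a x ^ k"
    using ae
  proof eventually_elim
    case (elim x)
    show ?case
    proof (cases "x \<in> ball y a")
      case True
      then have "x \<in> ball y (2 * r)" "x \<in> cball y b" using ab by auto
      then show ?thesis using elim by simp
    next
      case False
      show ?thesis by (simp add: bump_power_zero[OF a0 k False])
    qed
  qed
qed

lemma good_deficit:
  assumes sl: "slab t0 t2 U V G" and g: "good U V \<tau>" and k: "k > 0"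
  shows "deficit k \<tau> = (LINT x|lborel. (\<mu> - U (x, \<tau>)) * bump y a x ^ k)"
proof (rule deficit_eq[OF k measurable_slice[OF slabD(1)[OF sl]] slabD(4,5)[OF sl]])
  have a0: "a > 0" using r by simp
  show "(LINT x|lborel. U (x, \<tau>) * bump y a x ^ k) = pairing k \<tau>"
    unfolding pairing_def by (rule slice_integral[OF sl g, symmetric]) (measurable, rule bump_power_zero[OF a0 k])
qed

text \<open>The increment of the deficit is the flux paired with the gradient of the cutoff. The
  energy inequality that \<open>flux_bound\<close> requires comes from \<open>energy_limit\<close>,
  with \<open>energy_step\<close> as its discrete input.\<close>

lemma flux_small:
  fixes \<alpha> \<nu> S :: real
  assumes \<alpha>: "0 < \<alpha>" "\<alpha> < 1" "\<alpha> \<le> p - 1" and k: "k \<ge> 2"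
    and \<theta>: "real k * (1 - \<alpha>) + p \<le> real k" "real k * ((\<alpha> + 1) * (p - 1)) + p \<le> real k"
    and \<nu>: "\<nu> > 0" and S0: "S \<ge> 0" and S: "\<And>\<tau>. \<tau> \<in> I \<Longrightarrow> deficit k \<tau> \<le> measure lborel (ball y a) * S"
    and small: "\<mu> powr q * (t - s) \<le> r powr p * \<nu> powr (2 - p)"
    and t12: "s < t1" "t1 < t2" "t2 < t"
  shows "\<bar>deficit k t2 - deficit k t1\<bar> \<le> measure lborel (ball y a) * ((S + \<nu>) / 2 + flux_const p \<alpha> k K1 K2 * \<nu>)"
proof -
  \<comment> \<open>An earlier starting time leaves room for the backward steps from \<tau> \<ge> t1
    to \<tau> - h.\<close>
  define t0 where "t0 = (s + t1) / 2"
  have t0: "s < t0" "t0 < t1" using t12 by (auto simp: t0_def)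
  have t02: "t0 < t2" using t0 t12 by simp
  obtain U V G where sl: "slab t0 t2 U V G" using slab_exists[OF t0(1) t02 t12(3)] by blast
  note SD = slabD[OF sl]
  have a0: "a > 0" and ab: "a < b" and b2: "b < 2 * r" and k0: "k > 0" using r k by auto
  have good: "AE \<tau> in lborel. \<tau> \<in> {t0..t2} \<longrightarrow> good U V \<tau>" by (rule slab_good[OF sl t0(1) t02 t12(3)])
  have times: "\<tau> \<in> I" if "\<tau> \<in> {t0..t2}" for \<tau>
    using that t0 t12 s0 by (auto simp: times_iff)
  have gS: "(LINT x|lborel. (\<mu> - U (x, \<tau>)) * bump y a x ^ k) \<le> measure lborel (ball y a) * S"
    if "\<tau> \<in> {t0..t2}" "good U V \<tau>" for \<tau>
    using S[OF times[OF that(1)]] good_deficit[OF sl that(2) k0] by simp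
  interpret FE: flux_estimate p \<alpha> K1 K2 k y a q \<mu> \<nu> S t1 t2 U V G
  proof
    show "AE z in lborel. fst z \<in> ball y a \<longrightarrow> snd z \<in> {t1..t2} \<longrightarrow>
       K1 * U z powr q * norm (V z) powr p \<le> G z \<bullet> V z \<and>
       norm (G z) \<le> K2 * U z powr q * norm (V z) powr (p - 1)"
      using SD(12)[unfolded AE_completion_iff]
    proof eventually_elim
      case (elim z)
      show ?case
      proof (intro impI)
        assume "fst z \<in> ball y a" "snd z \<in> {t1..t2}"
        then have "z \<in> ball y a \<times> {t0..t2}" using t0 by (auto simp: mem_Times_iff)
        then show "K1 * U z powr q * norm (V z) powr p \<le> G z \<bullet> V z \<and>
          norm (G z) \<le> K2 * U z powr q * norm (V z) powr (p - 1)" by (rule mp[OF elim])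
      qed
    qed
    show "AE \<tau> in lborel. \<tau> \<in> {t1..t2} \<longrightarrow> (LINT x|lborel. (\<mu> - U (x, \<tau>)) * bump y a x ^ k) \<le> measure lborel (ball y a) * S"
      using good
    proof eventually_elim
      case (elim \<tau>)
      show ?case
      proof
        assume "\<tau> \<in> {t1..t2}"
        then have \<tau>: "\<tau> \<in> {t0..t2}" using t0 by auto
        show "(LINT x|lborel. (\<mu> - U (x, \<tau>)) * bump y a x ^ k) \<le> measure lborel (ball y a) * S"
          by (rule gS[OF \<tau> mp[OF elim \<tau>]])
      qed
    qed
    have "\<mu> powr q * (t2 - t1) \<le> \<mu> powr q * (t - s)" using t12 by (intro mult_left_mono) auto
    also have "\<dots> \<le> r powr p * \<nu> powr (2 - p)" by (rule small)
    also have "\<dots> \<le> a powr p * \<nu> powr (2 - p)" using r p by (intro mult_right_mono powr_mono2) auto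
    finally show "\<mu> powr q * (t2 - t1) \<le> a powr p * \<nu> powr (2 - p)" .
  qed (use p K \<alpha> k \<theta> a0 q_pos \<nu> S0 t12 SD(1-8) in auto)

  \<comment> \<open>The bound for the energy of a good slice, from
    \<open>weighted_power_integral\<close> with exponent 1 - \<alpha>.\<close>
  define C where "C = 3 / (1 - \<alpha>) * measure lborel (ball y a) * (S + \<nu>) powr (1 - \<alpha>)"
  have C0: "C \<ge> 0" using \<alpha> by (simp add: C_def)
  have tg: "FE.test_grad (x, \<tau>) = slice_grad k \<nu> \<alpha> U V \<tau> x" if "\<tau> \<in> {t1..t2}" for x \<tau>
  proof -
    have eq: "\<mu> - U (x, \<tau>) + \<nu> = \<mu> + \<nu> - U (x, \<tau>)" by simp
    show ?thesis unfolding FE.test_grad_def slice_grad_def fst_conv snd_conv eq using that by simp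
  qed
  have tz: "FE.test_grad z = 0" if "snd z \<notin> {t1..t2}" for z
    using that by (simp add: FE.test_grad_def)
  have tgm[measurable]: "FE.test_grad \<in> borel_measurable borel"
    using FE.meas unfolding FE.test_grad_def by measurable
  have tgp: "integrable lborel (\<lambda>z. norm (FE.test_grad z) powr p)"
  proof -
    define c1 where "c1 = \<alpha> * \<nu> powr (- \<alpha> - 1)"
    define c2 where "c2 = \<nu> powr (- \<alpha>) * (2 * real k / a)"
    let ?R = "\<lambda>z::'a \<times> real. 2 powr p * (c1 powr p * norm (V z) powr p + indicator {t1..t2} (snd z) *\<^sub>R (indicator (cball y a) (fst z) * c2 powr p))"
    have iR: "integrable lborel ?R"
      by (intro integrable_mult_right Bochner_Integration.integrable_add SD(8)
        integrable_time_const[OF integrable_cball_const _ emeasure_bounded_finite]) auto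
    show ?thesis
    proof (rule Bochner_Integration.integrable_bound[OF iR])
      have "norm (norm (FE.test_grad z) powr p) \<le> norm (?R z)" for z
      proof (cases "snd z \<in> {t1..t2}")
        case True
        have P: "\<nu> \<le> \<mu> - U z + \<nu>" using SD(5)[of z] by simp
        let ?A = "(\<alpha> * (\<mu> - U z + \<nu>) powr (- \<alpha> - 1) * bump y a (fst z) ^ k) *\<^sub>R V z"
        let ?B = "(\<mu> - U z + \<nu>) powr (- \<alpha>) *\<^sub>R grad_bump k y a (fst z)"
        have eq: "FE.test_grad z = ?A + ?B" using True by (simp add: FE.test_grad_def)
        have "\<alpha> * (\<mu> - U z + \<nu>) powr (- \<alpha> - 1) * bump y a (fst z) ^ k \<le> c1 * 1"
          unfolding c1_def using P \<nu> \<alpha>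
          by (intro mult_mono powr_mono2' power_le_one zero_le_power bump_bounds) auto
        then have "norm ?A \<le> c1 * norm (V z)"
          using \<alpha> bump_bounds(1)[of y a "fst z"] by (auto intro!: mult_right_mono)
        then have A: "norm ?A powr p \<le> c1 powr p * norm (V z) powr p"
          using p by (subst powr_mult[symmetric]) (intro powr_mono2, auto)
        have B: "norm ?B powr p \<le> indicator (cball y a) (fst z) * c2 powr p"
        proof (cases "fst z \<in> ball y a")
          case T2: True
          have "bump y a (fst z) ^ (k - 1) \<le> 1" by (intro power_le_one bump_bounds)
          then have "2 * real k / a * bump y a (fst z) ^ (k - 1) \<le> 2 * real k / a * 1"
            using a0 by (intro mult_left_mono) auto
          then have "norm (grad_bump k y a (fst z)) \<le> 2 * real k / a"
            using norm_grad_bump_le[OF a0 k, of y "fst z"] by linarith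
          then have "norm ?B \<le> c2" unfolding c2_def norm_scaleR using P \<nu> \<alpha>
            by (intro mult_mono) (auto intro!: powr_mono2')
          then have "norm ?B powr p \<le> c2 powr p" using p by (intro powr_mono2) auto
          then show ?thesis using T2 by simp
        next
          case False
          show ?thesis using p by (simp add: grad_bump_zero[OF a0 k False])
        qed
        have "norm (FE.test_grad z) powr p \<le> 2 powr p * (norm ?A powr p + norm ?B powr p)"
          unfolding eq using p by (intro norm_add_powr_le) auto
        also have "\<dots> \<le> ?R z" using A B True by (intro mult_left_mono add_mono) auto
        finally show ?thesis by simp
      next
        case False
        then show ?thesis using p by (simp add: tz)
      qed
      then show "AE z in lborel. norm (norm (FE.test_grad z) powr p) \<le> norm (?R z)" by (intro AE_I2)
    qed measurable
  qed

  \<comment> \<open>\<open>energy_limit\<close> wants a function bounded at all times, while the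
    energy is estimated only at good ones; there the truncation changes nothing, as
    \<open>Yg\<close> shows.\<close>
  define Y where "Y \<tau> = max 0 (min C (slice_energy k \<nu> \<alpha> U \<tau>))" for \<tau>
  have Y: "0 \<le> Y \<tau>" "Y \<tau> \<le> C" for \<tau> using C0 by (auto simp: Y_def)
  have Ym: "Y \<in> borel_measurable borel"
  proof -
    have "(\<lambda>w::real \<times> 'a. (snd w, fst w)) \<in> borel_measurable borel"
      by (intro borel_measurable_continuous_onI continuous_intros)
    from measurable_compose[OF this SD(1)] have [measurable]: "(\<lambda>w::real \<times> 'a. U (snd w, fst w)) \<in> borel_measurable borel" .
    have "(\<lambda>(\<tau>, x). (\<mu> + \<nu> - U (x, \<tau>)) powr (1 - \<alpha>) / (1 - \<alpha>) * bump y a x ^ k) \<in> borel_measurable (lborel \<Otimes>\<^sub>M lborel)"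
      unfolding lborel_prod case_prod_beta by measurable
    then have "slice_energy k \<nu> \<alpha> U \<in> borel_measurable lborel"
      unfolding slice_energy_def by (rule lborel.borel_measurable_lebesgue_integral)
    then show ?thesis unfolding Y_def by (intro borel_measurable_max borel_measurable_min borel_measurable_const) simp
  qed
  have Yg: "Y \<tau> = slice_energy k \<nu> \<alpha> U \<tau>" if \<tau>: "\<tau> \<in> {t0..t2}" "good U V \<tau>" for \<tau>
  proof -
    note [measurable] = measurable_slice[OF SD(1), of \<tau>]
    have P0: "0 \<le> \<mu> - U (x, \<tau>)" "\<mu> - U (x, \<tau>) \<le> \<mu>" for x using SD(4,5)[of "(x, \<tau>)"] by auto
    have th: "0 \<le> 1 - \<alpha>" "1 - \<alpha> \<le> 1" using \<alpha> by auto
    have pp: "p > 0" using p by simp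
    have fm: "(\<lambda>x. \<mu> - U (x, \<tau>)) \<in> borel_measurable borel" by measurable
    note wp = weighted_power_integral[OF fm P0 a0 th \<theta>(1) pp \<nu> S0 gS[OF \<tau>]]
    have iH: "integrable lborel (\<lambda>x. (\<mu> + \<nu> - U (x, \<tau>)) powr (1 - \<alpha>) / (1 - \<alpha>) * bump y a x ^ k)"
    proof (rule bounded_bump_integrable[OF _ _ a0 k0])
      show "(\<lambda>x. (\<mu> + \<nu> - U (x, \<tau>)) powr (1 - \<alpha>) / (1 - \<alpha>)) \<in> borel_measurable borel" by measurable
      show "\<bar>(\<mu> + \<nu> - U (x, \<tau>)) powr (1 - \<alpha>) / (1 - \<alpha>)\<bar> \<le> (\<mu> + \<nu>) powr (1 - \<alpha>) / (1 - \<alpha>)" for x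
        using SD(4,5)[of "(x, \<tau>)"] \<nu> \<alpha> by (auto intro!: divide_right_mono powr_mono2)
    qed
    have "slice_energy k \<nu> \<alpha> U \<tau> \<le> (LINT x|lborel. 1 / (1 - \<alpha>) * ((\<mu> - U (x, \<tau>) + \<nu>) powr (1 - \<alpha>) * bump y a x powr (real k - p)))"
      unfolding slice_energy_def
    proof (rule integral_mono[OF iH integrable_mult_right[OF wp(1)]])
      fix x
      have "bump y a x ^ k \<le> bump y a x powr (real k - p)"
      proof (cases "bump y a x = 0")
        case False
        then have b: "bump y a x > 0" using bump_bounds(1)[of y a x] by simp
        then have "bump y a x ^ k = bump y a x powr real k" by (simp add: powr_realpow)
        also have "\<dots> \<le> bump y a x powr (real k - p)" using b bump_bounds(2)[of y a x] pp by (intro powr_mono') auto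
        finally show ?thesis .
      next
        case True
        then show ?thesis using k0 by (simp add: power_0_left)
      qed
      then have le: "(\<mu> + \<nu> - U (x, \<tau>)) powr (1 - \<alpha>) / (1 - \<alpha>) * bump y a x ^ k
        \<le> (\<mu> + \<nu> - U (x, \<tau>)) powr (1 - \<alpha>) / (1 - \<alpha>) * bump y a x powr (real k - p)"
        using \<alpha> by (intro mult_left_mono) auto
      have eq: "\<mu> - U (x, \<tau>) + \<nu> = \<mu> + \<nu> - U (x, \<tau>)" by simp
      show "(\<mu> + \<nu> - U (x, \<tau>)) powr (1 - \<alpha>) / (1 - \<alpha>) * bump y a x ^ k
        \<le> 1 / (1 - \<alpha>) * ((\<mu> - U (x, \<tau>) + \<nu>) powr (1 - \<alpha>) * bump y a x powr (real k - p))"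
        unfolding eq using le by simp
    qed
    also have "\<dots> = 1 / (1 - \<alpha>) * (LINT x|lborel. (\<mu> - U (x, \<tau>) + \<nu>) powr (1 - \<alpha>) * bump y a x powr (real k - p))"
      by (rule integral_mult_right_zero)
    also have "\<dots> \<le> 1 / (1 - \<alpha>) * (3 * measure lborel (ball y a) * (S + \<nu>) powr (1 - \<alpha>))"
      using \<alpha> by (intro mult_left_mono wp(2)) auto
    finally have "slice_energy k \<nu> \<alpha> U \<tau> \<le> C" by (simp add: C_def)
    moreover have "0 \<le> slice_energy k \<nu> \<alpha> U \<tau>"
      unfolding slice_energy_def using \<alpha> by (intro Bochner_Integration.integral_nonneg mult_nonneg_nonneg zero_le_power bump_bounds) auto
    ultimately show ?thesis by (simp add: Y_def)
  qed
  \<comment> \<open>Both \<tau> and \<tau> - h must be good for the same \<tau>, hence the shifted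
    null set.\<close>
  have step: "AE \<tau> in lborel. \<tau> \<in> {t1..t2} \<longrightarrow>
      (LINT z|lborel. indicator {\<tau> - h..\<tau>} (snd z) * (G z \<bullet> FE.test_grad (fst z, \<tau>))) \<le> Y \<tau> - Y (\<tau> - h)"
    if h: "0 < h" "h < t1 - t0" for h
    using good AE_shift[OF good, of h]
  proof eventually_elim
    case (elim \<tau>)
    show ?case
    proof
      assume \<tau>: "\<tau> \<in> {t1..t2}"
      then have \<tau>1: "\<tau> \<in> {t0..t2}" "\<tau> - h \<in> {t0..t2}" using h t0 by auto
      note g = mp[OF elim(1) \<tau>1(1)] mp[OF elim(2) \<tau>1(2)]
      have "t0 \<le> \<tau> - h" "\<tau> \<le> t2" using \<tau>1 by auto
      note ES = energy_step[OF sl g k \<nu> \<alpha>(1,2) t0(1) t12(3) this(1) h(1) this(2)]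
      show "(LINT z|lborel. indicator {\<tau> - h..\<tau>} (snd z) * (G z \<bullet> FE.test_grad (fst z, \<tau>))) \<le> Y \<tau> - Y (\<tau> - h)"
        unfolding tg[OF \<tau>] Yg[OF \<tau>1(1) g(1)] Yg[OF \<tau>1(2) g(2)] by (rule ES)
    qed
  qed
  note EL = energy_limit[OF SD(3) tgm Ym p(1) SD(9) tgp t0(2) t12(2) tz Y step]
  have en: "integrable lborel (\<lambda>z. G z \<bullet> FE.test_grad z)"
    "(LINT z|lborel. G z \<bullet> FE.test_grad z) \<le> 3 / (1 - \<alpha>) * measure lborel (ball y a) * (S + \<nu>) powr (1 - \<alpha>)"
    using EL unfolding C_def by simp_all
  note FB = FE.flux_bound[OF en]

  have pp: "p > 1" "p \<ge> 1" using p by auto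
  have tt: "0 < t1" "t1 < t2" "t2 \<le> T" using t12 s0 tT by auto
  have wz: "bump y a x ^ k = 0" "grad_bump k y a x = 0" if "x \<notin> cball y b" for x
  proof -
    have x: "x \<notin> ball y a" using that ab by auto
    show "bump y a x ^ k = 0" by (rule bump_power_zero[OF a0 k0 x])
    show "grad_bump k y a x = 0" by (rule grad_bump_zero[OF a0 k x])
  qed
  have w01: "0 \<le> bump y a x ^ k" "bump y a x ^ k \<le> 1" for x
    by (intro zero_le_power power_le_one bump_bounds)+
  have "pairing k t2 - pairing k t1 = - (LINT z:cball y b \<times> {t1..t2}|lebesgue. flux z \<bullet> grad_bump k y a (fst z))"
    unfolding pairing_def
    by (rule weak_identity(4)[OF sol cball_sub[OF b2] bump_power_approx[OF a0 k ab pp(2)] mm pp(1) _ _ _ _ tt])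
      (use wz w01 in auto)
  also have "(LINT z:cball y b \<times> {t1..t2}|lebesgue. flux z \<bullet> grad_bump k y a (fst z))
     = (LINT z|lborel. indicator {t1..t2} (snd z) * (G z \<bullet> grad_bump k y a (fst z)))"
    by (rule flux_integral[OF sl less_imp_le[OF t0(2)] order_refl]) (measurable, rule grad_bump_zero[OF a0 k])
  finally have "\<bar>deficit k t2 - deficit k t1\<bar> = norm (LINT z|lborel. indicator {t1..t2} (snd z) * (G z \<bullet> grad_bump k y a (fst z)))"
    by (simp add: deficit_def)
  also have "\<dots> \<le> (LINT z|lborel. FE.J z * (norm (G z) * norm (grad_bump k y a (fst z))))"
  proof (rule Bochner_Integration.integral_norm_bound_integral[OF _ FB(1)])
    note [measurable] = SD(3)
    have le: "norm (indicator {t1..t2} (snd z) * (G z \<bullet> grad_bump k y a (fst z))) \<le> FE.J z * (norm (G z) * norm (grad_bump k y a (fst z)))" for z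
      using Cauchy_Schwarz_ineq2[of "G z" "grad_bump k y a (fst z)"] by (auto simp: abs_mult indicator_def)
    then show "norm (indicator {t1..t2} (snd z) * (G z \<bullet> grad_bump k y a (fst z))) \<le> FE.J z * (norm (G z) * norm (grad_bump k y a (fst z)))" for z .
    show "integrable lborel (\<lambda>z. indicator {t1..t2} (snd z) * (G z \<bullet> grad_bump k y a (fst z)))"
    proof (rule Bochner_Integration.integrable_bound[OF FB(1)])
      show "AE z in lborel. norm (indicator {t1..t2} (snd z) * (G z \<bullet> grad_bump k y a (fst z))) \<le> norm (FE.J z * (norm (G z) * norm (grad_bump k y a (fst z))))"
        by (intro AE_I2 order_trans[OF le]) simp
    qed measurable
  qed
  also have "\<dots> \<le> measure lborel (ball y a) * ((S + \<nu>) / 2 + flux_const p \<alpha> k K1 K2 * \<nu>)" by (rule FB(2))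
  finally show ?thesis .
qed

lemma deficit_continuous:
  assumes k: "k \<ge> 2" and \<sigma>: "\<And>n. \<sigma> n \<in> {s<..<t}" "\<tau> \<in> I" "\<sigma> \<longlonglongrightarrow> \<tau>"
  shows "(\<lambda>n. deficit k (\<sigma> n)) \<longlonglongrightarrow> deficit k \<tau>"
proof -
  have a0: "a > 0" and ab: "a < b" and b2: "b < 2 * r" and k0: "k > 0" using r k by auto
  have pp: "p > 1" "p \<ge> 1" using p by auto
  have wz: "bump y a x ^ k = 0" "grad_bump k y a x = 0" if "x \<notin> cball y b" for x
  proof -
    have x: "x \<notin> ball y a" using that ab by auto
    show "bump y a x ^ k = 0" by (rule bump_power_zero[OF a0 k0 x])
    show "grad_bump k y a x = 0" by (rule grad_bump_zero[OF a0 k x])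
  qed
  have w01: "0 \<le> bump y a x ^ k" "bump y a x ^ k \<le> 1" for x
    by (intro zero_le_power power_le_one bump_bounds)+
  have \<sigma>T: "\<sigma> n \<in> {0<..T}" for n using \<sigma>(1)[of n] s0 tT by auto
  have \<tau>T: "\<tau> \<in> {0<..T}" using \<sigma>(2) by (simp add: solution_times_def)
  have "(\<lambda>n. pairing k (\<sigma> n)) \<longlonglongrightarrow> pairing k \<tau>"
    unfolding pairing_def
    by (rule weak_identity_continuous[OF sol cball_sub[OF b2] bump_power_approx[OF a0 k ab pp(2)] mm pp(1) _ _ _ _ \<sigma>T \<tau>T \<sigma>(3)])
      (use wz w01 in auto)
  then show ?thesis unfolding deficit_def by (intro tendsto_diff tendsto_const)
qed

lemma average_slice:
  assumes c: "0 < c" "c \<le> 2 * r" and f: "f \<in> borel_measurable borel"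
    and ae: "AE x in lebesgue. x \<in> ball y (2 * r) \<longrightarrow> u (x, \<tau>) = f x"
  shows "average (ball y c) (\<lambda>x. \<mu> - u (x, \<tau>)) = (LINT x|lborel. indicator (ball y c) x * (\<mu> - f x)) / measure lborel (ball y c)"
proof -
  have "(LINT x:ball y c|lebesgue. \<mu> - u (x, \<tau>)) = (LINT x|lborel. indicator (ball y c) x * (\<mu> - f x))"
    unfolding set_lebesgue_integral_def
  proof (rule lebesgue_integral_AE(1))
    show "(\<lambda>x. indicator (ball y c) x * (\<mu> - f x)) \<in> borel_measurable borel"
      by (intro borel_measurable_times borel_measurable_indicator borel_measurable_diff borel_measurable_const f) simp
    show "AE x in lebesgue. indicator (ball y c) x *\<^sub>R (\<mu> - u (x, \<tau>)) = indicator (ball y c) x * (\<mu> - f x)"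
      using ae
    proof eventually_elim
      case (elim x)
      show ?case
      proof (cases "x \<in> ball y c")
        case True
        then have "x \<in> ball y (2 * r)" using c by simp
        then show ?thesis using elim by simp
      qed simp
    qed
  qed
  then show ?thesis by (simp add: average_def)
qed

text \<open>The k-th power of the cutoff is at most the indicator of the ball of radius 2r and at
  least (5/9)^k on the ball of radius r, which places the deficit between the two averages of the
  theorem. The bound by \<mu> makes its supremum over the times finite.\<close>

lemma deficit_average:
  assumes \<tau>: "\<tau> \<in> I" and k: "k \<ge> 2"
  shows "0 \<le> deficit k \<tau>" "deficit k \<tau> \<le> measure lborel (ball y a) * \<mu>"
    and "deficit k \<tau> \<le> measure lborel (ball y (2 * r)) * average (ball y (2 * r)) (\<lambda>x. \<mu> - u (x, \<tau>))"
    and "measure lborel (ball y r) * average (ball y r) (\<lambda>x. \<mu> - u (x, \<tau>)) \<le> (9 / 5) ^ k * deficit k \<tau>"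
proof -
  have a0: "a > 0" and a2: "a < 2 * r" and k0: "k > 0" using r k by auto
  obtain f where f: "f \<in> borel_measurable borel" "\<And>x. 0 \<le> f x" "\<And>x. f x \<le> \<mu>"
    and ae: "AE x in lebesgue. x \<in> ball y (2 * r) \<longrightarrow> u (x, \<tau>) = f x" using slice_bounds[OF \<tau>] by blast
  note [measurable] = f(1)
  have d: "deficit k \<tau> = (LINT x|lborel. (\<mu> - f x) * bump y a x ^ k)"
    by (rule deficit_eq[OF k0 f pairing_slice[OF k0 f(1) ae]])
  have v: "0 \<le> \<mu> - f x" "\<bar>\<mu> - f x\<bar> \<le> \<mu>" for x using f(2,3)[of x] by auto
  have i: "integrable lborel (\<lambda>x. (\<mu> - f x) * bump y a x ^ k)"
    by (intro bounded_bump_integrable[OF _ v(2) a0 k0]) measurable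
  have ib: "integrable lborel (\<lambda>x. indicator (ball y c) x * \<mu>)" for c
    using emeasure_bounded_finite[of "ball y c"] by (intro integrable_mult_left integrable_real_indicator) auto
  have iv: "integrable lborel (\<lambda>x. indicator (ball y c) x * (\<mu> - f x))" for c
  proof (rule Bochner_Integration.integrable_bound[OF ib[of c]])
    have "norm (indicator (ball y c) x * (\<mu> - f x)) \<le> norm (indicator (ball y c) x * \<mu>)" for x
      using v[of x] by (auto simp: indicator_def)
    then show "AE x in lborel. norm (indicator (ball y c) x * (\<mu> - f x)) \<le> norm (indicator (ball y c) x * \<mu>)" by (intro AE_I2)
    have "(\<lambda>x. indicator (ball y c) x * (\<mu> - f x)) \<in> borel_measurable borel"
      by (intro borel_measurable_times borel_measurable_indicator borel_measurable_diff borel_measurable_const f(1)) simp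
    then show "(\<lambda>x. indicator (ball y c) x * (\<mu> - f x)) \<in> borel_measurable lborel" by simp
  qed
  have le: "(\<mu> - f x) * bump y a x ^ k \<le> indicator (ball y c) x * (\<mu> - f x)" if c: "a \<le> c" for x c
  proof (cases "x \<in> ball y a")
    case True
    then have "x \<in> ball y c" using c by simp
    moreover have "(\<mu> - f x) * bump y a x ^ k \<le> (\<mu> - f x) * 1"
      by (intro mult_left_mono power_le_one bump_bounds v)
    ultimately show ?thesis by simp
  next
    case False
    show ?thesis using v(1)[of x] by (simp add: bump_power_zero[OF a0 k0 False])
  qed
  show "0 \<le> deficit k \<tau>" unfolding d
    by (intro Bochner_Integration.integral_nonneg mult_nonneg_nonneg v zero_le_power bump_bounds)
  have "deficit k \<tau> \<le> (LINT x|lborel. indicator (ball y a) x * \<mu>)" unfolding d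
  proof (rule integral_mono[OF i ib])
    fix x
    have "indicator (ball y a) x * (\<mu> - f x) \<le> indicator (ball y a) x * \<mu>" using f(2)[of x] by (intro mult_left_mono) auto
    then show "(\<mu> - f x) * bump y a x ^ k \<le> indicator (ball y a) x * \<mu>" using le[OF order_refl, of x] by linarith
  qed
  then show "deficit k \<tau> \<le> measure lborel (ball y a) * \<mu>" by simp
  have "deficit k \<tau> \<le> (LINT x|lborel. indicator (ball y (2 * r)) x * (\<mu> - f x))" unfolding d
    by (rule integral_mono[OF i iv le]) (use a2 in simp)
  also have "\<dots> = measure lborel (ball y (2 * r)) * average (ball y (2 * r)) (\<lambda>x. \<mu> - u (x, \<tau>))"
  proof -
    have "0 < 2 * r" using r by simp
    then show ?thesis unfolding average_slice[OF \<open>0 < 2 * r\<close> order_refl f(1) ae] using measure_ball_pos[of "2 * r" y] by simp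
  qed
  finally show "deficit k \<tau> \<le> measure lborel (ball y (2 * r)) * average (ball y (2 * r)) (\<lambda>x. \<mu> - u (x, \<tau>))" .
  have "measure lborel (ball y r) * average (ball y r) (\<lambda>x. \<mu> - u (x, \<tau>)) = (LINT x|lborel. indicator (ball y r) x * (\<mu> - f x))"
  proof -
    have "r \<le> 2 * r" using r by simp
    show ?thesis unfolding average_slice[OF r \<open>r \<le> 2 * r\<close> f(1) ae] using measure_ball_pos[OF r, of y] by simp
  qed
  also have "\<dots> \<le> (LINT x|lborel. (9 / 5) ^ k * ((\<mu> - f x) * bump y a x ^ k))"
  proof (rule integral_mono[OF iv integrable_mult_right[OF i]])
    fix x
    show "indicator (ball y r) x * (\<mu> - f x) \<le> (9 / 5) ^ k * ((\<mu> - f x) * bump y a x ^ k)"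
    proof (cases "x \<in> ball y r")
      case True
      then have "x \<in> ball y (2 * a / 3)" by simp
      then have "5 / 9 \<le> bump y a x" by (rule bump_lower[OF a0])
      then have "1 \<le> 9 / 5 * bump y a x" by simp
      then have "1 \<le> (9 / 5 * bump y a x) ^ k" by (rule one_le_power)
      then have "1 * (\<mu> - f x) \<le> (9 / 5 * bump y a x) ^ k * (\<mu> - f x)" by (intro mult_right_mono v)
      also have "\<dots> = (9 / 5) ^ k * ((\<mu> - f x) * bump y a x ^ k)" by (simp only: power_mult_distrib mult_ac)
      finally show ?thesis using True by simp
    next
      case False
      then show ?thesis using v(1)[of x] by (simp add: bump_bounds)
    qed
  qed
  also have "\<dots> = (9 / 5) ^ k * deficit k \<tau>" unfolding d by (rule integral_mult_right_zero)
  finally show "measure lborel (ball y r) * average (ball y r) (\<lambda>x. \<mu> - u (x, \<tau>)) \<le> (9 / 5) ^ k * deficit k \<tau>" .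
qed

section \<open>Absorption of the supremum and the Harnack inequality\<close>

lemma times_nonempty: "t \<in> I"
  using st s0 by (simp add: times_iff)

text \<open>In the supremum over \<tau>' of deficit \<tau>' \<le> deficit \<tau>2 + Q, the half of S
  hidden in Q is absorbed on the left, S being finite; this doubles the remaining terms.\<close>

lemma deficit_harnack:
  fixes \<alpha> \<nu> :: real
  assumes \<alpha>: "0 < \<alpha>" "\<alpha> < 1" "\<alpha> \<le> p - 1" and k: "k \<ge> 2"
    and \<theta>: "real k * (1 - \<alpha>) + p \<le> real k" "real k * ((\<alpha> + 1) * (p - 1)) + p \<le> real k"
    and \<nu>: "\<nu> > 0" and small: "\<mu> powr q * (t - s) \<le> r powr p * \<nu> powr (2 - p)"
    and \<tau>: "\<tau>1 \<in> I" "\<tau>2 \<in> I"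
  shows "deficit k \<tau>1 \<le> 2 * deficit k \<tau>2 + measure lborel (ball y a) * ((2 * flux_const p \<alpha> k K1 K2 + 1) * \<nu>)"
proof -
  let ?\<Lambda> = "measure lborel (ball y a)" and ?C = "flux_const p \<alpha> k K1 K2"
  have a0: "a > 0" using r by simp
  have L: "?\<Lambda> > 0" by (rule measure_ball_pos[OF a0])
  define S where "S = (SUP \<tau>\<in>I. deficit k \<tau> / ?\<Lambda>)"
  have bdd: "bdd_above ((\<lambda>\<tau>. deficit k \<tau> / ?\<Lambda>) ` I)"
  proof (rule bdd_aboveI2)
    fix \<tau> assume "\<tau> \<in> I"
    from deficit_average(2)[OF this k] show "deficit k \<tau> / ?\<Lambda> \<le> \<mu>" using L by (simp add: divide_le_eq mult.commute)
  qed
  have Sub: "deficit k \<tau> / ?\<Lambda> \<le> S" if "\<tau> \<in> I" for \<tau>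
    unfolding S_def by (rule cSUP_upper[OF that bdd])
  have S0: "S \<ge> 0"
  proof -
    have "0 \<le> deficit k t / ?\<Lambda>" using deficit_average(1)[OF times_nonempty k] L by simp
    then show ?thesis using Sub[OF times_nonempty] by linarith
  qed
  have Sd: "deficit k \<tau> \<le> ?\<Lambda> * S" if "\<tau> \<in> I" for \<tau>
    using Sub[OF that] L by (simp add: divide_le_eq mult.commute)
  define Q where "Q = ?\<Lambda> * ((S + \<nu>) / 2 + ?C * \<nu>)"
  have FS: "\<bar>deficit k t2 - deficit k t1\<bar> \<le> Q" if "s < t1" "t1 < t2" "t2 < t" for t1 t2
    unfolding Q_def by (rule flux_small[OF \<alpha> k \<theta> \<nu> S0 _ small that]) (rule Sd)
  have Q: "\<bar>deficit k \<sigma>2 - deficit k \<sigma>1\<bar> \<le> Q" if "\<sigma>1 \<in> {s<..<t}" "\<sigma>2 \<in> {s<..<t}" for \<sigma>1 \<sigma>2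
  proof -
    consider "\<sigma>1 < \<sigma>2" | "\<sigma>2 < \<sigma>1" | "\<sigma>1 = \<sigma>2" by linarith
    then show ?thesis
    proof cases
      case 1
      then show ?thesis using FS[of \<sigma>1 \<sigma>2] that by simp
    next
      case 2
      then show ?thesis using FS[of \<sigma>2 \<sigma>1] that by (simp add: abs_minus_commute)
    next
      case 3
      \<comment> \<open>Any two interior times show that Q dominates an absolute value, so Q is
        nonnegative.\<close>
      have "\<exists>x1 x2. s < x1 \<and> x1 < x2 \<and> x2 < t" using st dense by meson
      then obtain x1 x2 where "s < x1" "x1 < x2" "x2 < t" by blast
      from FS[OF this] have "0 \<le> Q" by linarith
      then show ?thesis using 3 by simp
    qed
  qed
  \<comment> \<open>\<open>flux_small\<close> concerns interior times; continuity of the deficit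
    extends its bound to all of I.\<close>
  have lim: "deficit k \<tau>' - deficit k \<tau>2 \<le> Q" if \<tau>': "\<tau>' \<in> I" for \<tau>'
  proof -
    have tr: "AE \<sigma> in (lborel :: real measure). True" by simp
    obtain \<sigma>1 where \<sigma>1: "\<And>n. \<sigma>1 n \<in> {s<..<t}" "\<sigma>1 \<longlonglongrightarrow> \<tau>'" using times_approx[OF \<tau>' tr] by blast
    obtain \<sigma>2 where \<sigma>2: "\<And>n. \<sigma>2 n \<in> {s<..<t}" "\<sigma>2 \<longlonglongrightarrow> \<tau>2" using times_approx[OF \<tau>(2) tr] by blast
    have l: "(\<lambda>n. deficit k (\<sigma>1 n) - deficit k (\<sigma>2 n)) \<longlonglongrightarrow> deficit k \<tau>' - deficit k \<tau>2"
      by (intro tendsto_diff deficit_continuous k \<sigma>1 \<sigma>2 \<tau>' \<tau>)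
    have "deficit k (\<sigma>1 n) - deficit k (\<sigma>2 n) \<le> Q" for n
      using Q[OF \<sigma>2(1) \<sigma>1(1), of n n] by linarith
    then show ?thesis by (intro LIMSEQ_le_const2[OF l]) blast
  qed
  have "S \<le> (deficit k \<tau>2 + Q) / ?\<Lambda>"
    unfolding S_def
  proof (rule cSUP_least)
    show "I \<noteq> {}" using times_nonempty by blast
    fix \<tau>' assume "\<tau>' \<in> I"
    from lim[OF this] show "deficit k \<tau>' / ?\<Lambda> \<le> (deficit k \<tau>2 + Q) / ?\<Lambda>" using L by (intro divide_right_mono) auto
  qed
  then have "S * ?\<Lambda> \<le> deficit k \<tau>2 + Q" using L by (simp add: pos_le_divide_eq)
  moreover have "2 * Q = ?\<Lambda> * S + ?\<Lambda> * ((2 * ?C + 1) * \<nu>)" unfolding Q_def by (simp add: field_simps)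
  ultimately have "?\<Lambda> * S \<le> 2 * deficit k \<tau>2 + ?\<Lambda> * ((2 * ?C + 1) * \<nu>)" by (simp add: mult.commute[of S])
  then show ?thesis using Sd[OF \<tau>(1)] by linarith
qed

text \<open>The factors 2^N and (3/2)^N, with N the dimension, are the volumes of the balls of
  radius 2r and a relative to that of radius r.\<close>

lemma average_harnack:
  fixes \<alpha> \<nu> :: real
  assumes \<alpha>: "0 < \<alpha>" "\<alpha> < 1" "\<alpha> \<le> p - 1" and k: "k \<ge> 2"
    and \<theta>: "real k * (1 - \<alpha>) + p \<le> real k" "real k * ((\<alpha> + 1) * (p - 1)) + p \<le> real k"
    and \<nu>: "\<nu> > 0" and small: "\<mu> powr q * (t - s) \<le> r powr p * \<nu> powr (2 - p)"
    and \<tau>: "\<tau>1 \<in> I" "\<tau>2 \<in> I"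
  shows "average (ball y r) (\<lambda>x. \<mu> - u (x, \<tau>1))
    \<le> (9 / 5) ^ k * (2 * 2 ^ DIM('a) * average (ball y (2 * r)) (\<lambda>x. \<mu> - u (x, \<tau>2))
        + (3 / 2) ^ DIM('a) * ((2 * flux_const p \<alpha> k K1 K2 + 1) * \<nu>))"
proof -
  let ?C = "2 * flux_const p \<alpha> k K1 K2 + 1"
  let ?A = "average (ball y r) (\<lambda>x. \<mu> - u (x, \<tau>1))" and ?B = "average (ball y (2 * r)) (\<lambda>x. \<mu> - u (x, \<tau>2))"
  let ?M = "measure lborel (ball y r)"
  have M: "?M > 0" by (rule measure_ball_pos[OF r])
  have m2: "measure lborel (ball y (2 * r)) = 2 ^ DIM('a) * ?M"
    using measure_ball_ratio[of "2 * r" r y] r by simp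
  have ma: "measure lborel (ball y a) = (3 / 2) ^ DIM('a) * ?M"
    using measure_ball_ratio[of a r y] r by simp
  have "?M * ?A \<le> (9 / 5) ^ k * deficit k \<tau>1" by (rule deficit_average(4)[OF \<tau>(1) k])
  also have "\<dots> \<le> (9 / 5) ^ k * (2 * (measure lborel (ball y (2 * r)) * ?B) + measure lborel (ball y a) * (?C * \<nu>))"
    using deficit_harnack[OF \<alpha> k \<theta> \<nu> small \<tau>] deficit_average(3)[OF \<tau>(2) k] by (intro mult_left_mono) auto
  also have "\<dots> = ?M * ((9 / 5) ^ k * (2 * 2 ^ DIM('a) * ?B + (3 / 2) ^ DIM('a) * (?C * \<nu>)))"
    unfolding m2 ma by (simp add: algebra_simps)
  finally show ?thesis using M by simp
qed

end

text \<open>The conditions on k read k \<alpha> \<ge> p and k (1 - (\<alpha> + 1)(p - 1)) \<ge> p.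
  The second bracket is 2 - p - \<alpha> (p - 1), positive for \<alpha> < 2 - p. So \<alpha> is
  taken below p - 1 and 2 - p, and then k large.\<close>

lemma exponents_exist:
  fixes p :: real
  assumes p: "1 < p" "p < 2"
  shows "\<exists>\<alpha> (k::nat). 0 < \<alpha> \<and> \<alpha> < 1 \<and> \<alpha> \<le> p - 1 \<and> k \<ge> 2 \<and>
    real k * (1 - \<alpha>) + p \<le> real k \<and> real k * ((\<alpha> + 1) * (p - 1)) + p \<le> real k"
proof -
  define P where "P = (p - 1) * (2 - p)"
  define \<alpha> where "\<alpha> = P / 2"
  have 1: "0 < \<alpha>" using p by (simp add: \<alpha>_def P_def)
  have "P \<le> (p - 1) * 1" unfolding P_def using p by (intro mult_left_mono) auto
  then have 2: "\<alpha> \<le> p - 1" "\<alpha> < 1" using p by (simp_all add: \<alpha>_def)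
  have "P \<le> 1 * (2 - p)" unfolding P_def using p by (intro mult_right_mono) auto
  then have "\<alpha> < 2 - p" using p by (simp add: \<alpha>_def)
  moreover have "\<alpha> * (p - 1) \<le> \<alpha> * 1" using 1 p by (intro mult_left_mono) auto
  ultimately have 3: "0 < 1 - (\<alpha> + 1) * (p - 1)" by (simp add: algebra_simps)
  define d where "d = min \<alpha> (1 - (\<alpha> + 1) * (p - 1))"
  have d: "d > 0" "d \<le> \<alpha>" "d \<le> 1 - (\<alpha> + 1) * (p - 1)" using 1 3 by (auto simp: d_def)
  define k where "k = nat \<lceil>p / d\<rceil> + 2"
  have k2: "k \<ge> 2" by (simp add: k_def)
  have "p / d \<le> real k" unfolding k_def by linarith
  then have kd: "p \<le> real k * d" using d by (simp add: divide_le_eq)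
  have "p \<le> real k * \<alpha>" using kd mult_left_mono[OF d(2), of "real k"] by simp
  moreover have "p \<le> real k * (1 - (\<alpha> + 1) * (p - 1))" using kd mult_left_mono[OF d(3), of "real k"] by simp
  ultimately have "real k * (1 - \<alpha>) + p \<le> real k" "real k * ((\<alpha> + 1) * (p - 1)) + p \<le> real k"
    unfolding right_diff_distrib[of "real k" 1] by linarith+
  then show ?thesis using 1 2 k2 by blast
qed

theorem theorem3p2:
  fixes m p lam K1 K2 :: real
  assumes "m > 0" and "p > 1" and "K1 > 0" and "K2 > 0"
    and "lam = m * (p - 1)" and "lam > 1" and "p < 2"
  shows "\<exists>\<gamma>>0. \<forall>(\<Omega> :: (real ^ 'n) set) (T :: real)
      (A :: (real ^ 'n) \<times> real \<Rightarrow> real \<Rightarrow> real ^ 'n \<Rightarrow> real ^ 'n) (u :: (real ^ 'n) \<times> real \<Rightarrow> real)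
      (y :: real ^ 'n) (r :: real) (s :: real) (t :: real) (\<mu> :: real).
    domain \<Omega> \<and> T > 0 \<and>
    caratheodory \<Omega> T A \<and> structure_conditions \<Omega> T m p K1 K2 A u \<and> weak_solution \<Omega> T m p A u \<and>
    r > 0 \<and> s < t \<and> ball y (2 * r) \<times> {s<..<t} \<subseteq> cylinder \<Omega> T \<and>
    (AE z in lebesgue. z \<in> ball y (2 * r) \<times> {s<..<t} \<longrightarrow> u z \<le> \<mu>)
    \<longrightarrow>
    (SUP \<tau>\<in>solution_times T s t. average (ball y r) (\<lambda>x. \<mu> - u (x, \<tau>)))
      \<le> \<gamma> * (INF \<tau>\<in>solution_times T s t. average (ball y (2 * r)) (\<lambda>x. \<mu> - u (x, \<tau>)))
        + \<gamma> * \<mu> powr ((m - 1) * (p - 1) / (2 - p)) * ((t - s) / r powr p) powr (1 / (2 - p))"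
proof -
  have m1: "m > 1"
  proof (rule ccontr)
    assume "\<not> m > 1"
    then have "m * (p - 1) \<le> 1 * (p - 1)" using assms by (intro mult_right_mono) auto
    also have "\<dots> < 1" using assms(7) by simp
    finally show False using assms(5,6) by simp
  qed
  obtain \<alpha> and k :: nat where \<alpha>: "0 < \<alpha>" "\<alpha> < 1" "\<alpha> \<le> p - 1" and k: "k \<ge> 2"
    and \<theta>: "real k * (1 - \<alpha>) + p \<le> real k" "real k * ((\<alpha> + 1) * (p - 1)) + p \<le> real k"
    using exponents_exist[OF assms(2,7)] by blast
  define N where "N = DIM(real ^ 'n)"
  define c1 where "c1 = (9 / 5) ^ k * (2 * 2 ^ N :: real)"
  define c2 where "c2 = (9 / 5) ^ k * ((3 / 2) ^ N * (2 * flux_const p \<alpha> k K1 K2 + 1))"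
  \<comment> \<open>All choices so far depend only on the dimension, p, K1 and K2; the solution and
    the cylinder are fixed afterwards.\<close>
  define \<gamma> where "\<gamma> = max c1 c2"
  have c1: "c1 > 0" by (simp add: c1_def)
  have \<gamma>: "\<gamma> > 0" using c1 by (simp add: \<gamma>_def)
  show ?thesis
  proof (intro exI[of _ \<gamma>] conjI allI impI \<gamma>)
    fix \<Omega> :: "(real ^ 'n) set" and T :: real
      and A :: "(real ^ 'n) \<times> real \<Rightarrow> real \<Rightarrow> real ^ 'n \<Rightarrow> real ^ 'n" and u :: "(real ^ 'n) \<times> real \<Rightarrow> real"
      and y :: "real ^ 'n" and r s t \<mu> :: real
    assume h: "domain \<Omega> \<and> T > 0 \<and>
      caratheodory \<Omega> T A \<and> structure_conditions \<Omega> T m p K1 K2 A u \<and> weak_solution \<Omega> T m p A u \<and>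
      r > 0 \<and> s < t \<and> ball y (2 * r) \<times> {s<..<t} \<subseteq> cylinder \<Omega> T \<and>
      (AE z in lebesgue. z \<in> ball y (2 * r) \<times> {s<..<t} \<longrightarrow> u z \<le> \<mu>)"
    interpret L: local_solution \<Omega> T m p K1 K2 A u y r s t \<mu>
      using h m1 assms by unfold_locales auto
    let ?I = "solution_times T s t"
    let ?A = "\<lambda>\<tau>. average (ball y r) (\<lambda>x. \<mu> - u (x, \<tau>))"
    let ?B = "\<lambda>\<tau>. average (ball y (2 * r)) (\<lambda>x. \<mu> - u (x, \<tau>))"
    define \<nu> where "\<nu> = \<mu> powr ((m - 1) * (p - 1) / (2 - p)) * ((t - s) / r powr p) powr (1 / (2 - p))"
    have \<nu>0: "\<nu> \<ge> 0" by (simp add: \<nu>_def)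
    have rp: "r powr p > 0" using L.r by simp
    have \<nu>p: "\<nu> powr (2 - p) = \<mu> powr ((m - 1) * (p - 1)) * ((t - s) / r powr p)"
      using assms(7) L.st rp by (simp add: \<nu>_def powr_mult powr_powr)
    have B0: "0 \<le> ?B \<tau>" if "\<tau> \<in> ?I" for \<tau>
    proof -
      have "0 \<le> measure lborel (ball y (2 * r)) * ?B \<tau>"
        using L.deficit_average(1,3)[OF that k] by linarith
      then show ?thesis using measure_ball_pos[of "2 * r" y] L.r by (metis mult_pos_pos not_le zero_less_numeral zero_le_mult_iff)
    qed
    have main: "?A \<tau>1 \<le> \<gamma> * ?B \<tau>2 + \<gamma> * \<nu>" if \<tau>: "\<tau>1 \<in> ?I" "\<tau>2 \<in> ?I" for \<tau>1 \<tau>2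
    proof (rule field_le_epsilon)
      fix e :: real assume e: "e > 0"
      \<comment> \<open>\<nu> vanishes when \<mu> = 0, whereas the estimates divide by powers of it;
        the increment e / \<gamma> makes it positive and costs exactly e.\<close>
      define \<nu>' where "\<nu>' = \<nu> + e / \<gamma>"
      have \<nu>': "\<nu>' > 0" using \<nu>0 e \<gamma> by (simp add: \<nu>'_def add_nonneg_pos)
      have "\<nu> powr (2 - p) \<le> \<nu>' powr (2 - p)" using \<nu>0 e \<gamma> assms(7) by (intro powr_mono2) (auto simp: \<nu>'_def)
      then have "r powr p * \<nu> powr (2 - p) \<le> r powr p * \<nu>' powr (2 - p)" using rp by (intro mult_left_mono) auto
      then have small: "\<mu> powr ((m - 1) * (p - 1)) * (t - s) \<le> r powr p * \<nu>' powr (2 - p)"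
        unfolding \<nu>p using rp by simp
      have "?A \<tau>1 \<le> c1 * ?B \<tau>2 + c2 * \<nu>'"
        using L.average_harnack[OF \<alpha> k \<theta> \<nu>' small \<tau>] by (simp add: c1_def c2_def N_def algebra_simps)
      also have "\<dots> \<le> \<gamma> * ?B \<tau>2 + \<gamma> * \<nu>'"
        using B0[OF \<tau>(2)] \<nu>' by (intro add_mono mult_right_mono) (auto simp: \<gamma>_def)
      also have "\<dots> = \<gamma> * ?B \<tau>2 + \<gamma> * \<nu> + e" using \<gamma> by (simp add: \<nu>'_def distrib_left)
      finally show "?A \<tau>1 \<le> \<gamma> * ?B \<tau>2 + \<gamma> * \<nu> + e" .
    qed
    have ne: "?I \<noteq> {}" using L.times_nonempty by blast
    \<comment> \<open>As \<open>main\<close> holds for every pair of times, the supremum and then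
      the infimum can be taken over the nonempty set of times, one after the other.\<close>
    have "(SUP \<tau>\<in>?I. ?A \<tau>) \<le> \<gamma> * (INF \<tau>\<in>?I. ?B \<tau>) + \<gamma> * \<nu>"
    proof (rule cSUP_least[OF ne])
      fix \<tau>1 assume \<tau>1: "\<tau>1 \<in> ?I"
      have "(?A \<tau>1 - \<gamma> * \<nu>) / \<gamma> \<le> (INF \<tau>\<in>?I. ?B \<tau>)"
      proof (rule cINF_greatest[OF ne])
        fix \<tau>2 assume "\<tau>2 \<in> ?I"
        from main[OF \<tau>1 this] show "(?A \<tau>1 - \<gamma> * \<nu>) / \<gamma> \<le> ?B \<tau>2" using \<gamma> by (simp add: divide_le_eq mult.commute)
      qed
      then show "?A \<tau>1 \<le> \<gamma> * (INF \<tau>\<in>?I. ?B \<tau>) + \<gamma> * \<nu>" using \<gamma> by (simp add: divide_le_eq mult.commute)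
    qed
    then show "(SUP \<tau>\<in>?I. ?A \<tau>) \<le> \<gamma> * (INF \<tau>\<in>?I. ?B \<tau>)
        + \<gamma> * \<mu> powr ((m - 1) * (p - 1) / (2 - p)) * ((t - s) / r powr p) powr (1 / (2 - p))"
      by (simp add: \<nu>_def mult.assoc)
  qed
qed

end
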